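(* Let $r\geq 1$ be an integer and let $\delta\in\mathbb{C}$. Let $L_1,\dots,L_{r+1}$ be the Jucys-Murphy elements of the walled Brauer algebra $B_{r,1}(\delta)$ over $\mathbb{C}$, and let $\mathcal{S}_{r,1}[x;y]\subseteq\mathbb{C}[x_1,\dots,x_r,y_1]$ be the set of supersymmetric polynomials. Then the centre of $B_{r,1}(\delta)$ is $$Z(B_{r,1}(\delta))=\{p(L_1,\dots,L_r,L_{r+1})\mid p\in\mathcal{S}_{r,1}[x;y]\},$$ and moreover $\dim_{\mathbb{C}} Z(B_{r,1}(\delta))=|\Lambda_{r,1}|$.
   Context: Walled Brauer algebra. An $(r,s)$-walled Brauer diagram is a graph with $r+s$ top vertices and $r+s$ bottom vertices, each row numbered $1,\dots,r+s$ from left to right, in which each vertex is joined by a strand to exactly one other vertex. A vertical wall separates the vertices $1,\dots,r$ from the vertices $r+1,\dots,r+s$ (in both rows). A strand joining a top vertex to a bottom vertex (a propagating line) must not cross the wall; a strand joining two top vertices (northern arc) or two bottom vertices (southern arc) must cross the wall. For $\delta\in\mathbb{C}$, $B_{r,s}(\delta)$ is the $\mathbb{C}$-algebra with basis the $(r,s)$-walled Brauer diagrams and product $d_1d_2=\delta^n d$, where $d_1$ is placed above $d_2$, the bottom vertices of $d_1$ are identified with the top vertices of $d_2$, $n$ is the number of closed loops so formed in the middle, and $d$ is the resulting diagram with the loops omitted. Here $s=1$. Jucys-Murphy elements for $s=1$. For $1\leq a<b\leq r$, $(a,b)$ is the diagram joining top $a$ to bottom $b$, top $b$ to bottom $a$,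 and top $k$ to bottom $k$ for every other $k$. For $1\leq j\leq r$, $e_{j,r+1}$ is the diagram with a northern arc joining top vertices $j$ and $r+1$, a southern arc joining bottom vertices $j$ and $r+1$, and vertical lines joining top $k$ to bottom $k$ for every other $k$. Define $L_1=0$; $L_k=\sum_{j=1}^{k-1}(j,k)$ for $1<k\leq r$; and $L_{r+1}=-\sum_{j=1}^{r}e_{j,r+1}+\delta$. These elements commute pairwise, so polynomials can be evaluated at them. Supersymmetric polynomials. A polynomial $p\in\mathbb{C}[x_1,\dots,x_m,y_1,\dots,y_n]$ is supersymmetric if it is symmetric in $x_1,\dots,x_m$ and in $y_1,\dots,y_n$ separately, and the substitution $x_m=t$, $y_1=-t$ yields a polynomial in $x_1,\dots,x_{m-1},y_2,\dots,y_n$ that is independent of $t$. The set of these is denoted $\mathcal{S}_{m,n}[x;y]$. In $p(L_1,\dots,L_r,L_{r+1})$ one substitutes $x_i=L_i$ and $y_1=L_{r+1}$. Index set. $\Lambda_{r,s}=\coprod_{k=0}^{\min(r,s)}\{(\lambda,\mu)\mid \lambda,\mu\text{ partitions},\ |\lambda|=r-k,\ |\mu|=s-k\}$. *)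

theory Defs
  imports
    Complex_Main
    "HOL-Library.Poly_Mapping"
    "HOL-Combinatorics.Permutations"
    "HOL-Algebra.Module"
begin

section \<open>Walled Brauer diagrams\<close>

text \<open>A diagram is its set of strands, a strand being the two-element set of its end points.
  \<open>Mid\<close> vertices do not occur in diagrams; they form the middle row when two diagrams are stacked.\<close>

datatype vertex = Top (col: nat) | Mid (col: nat) | Bot (col: nat)

definition outer_vertices :: "nat \<Rightarrow> vertex set" where
  "outer_vertices n = Top ` {1..n} \<union> Bot ` {1..n}"

definition crosses_wall :: "nat \<Rightarrow> vertex \<Rightarrow> vertex \<Rightarrow> bool" where
  "crosses_wall r u v \<longleftrightarrow> (col u \<le> r) \<noteq> (col v \<le> r)"

definition wb_diagrams :: "nat \<Rightarrow> nat \<Rightarrow> vertex set set set" where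
  "wb_diagrams r s =
    {d. (\<forall>e\<in>d. \<exists>u\<in>outer_vertices (r + s). \<exists>v\<in>outer_vertices (r + s).
            u \<noteq> v \<and> e = {u, v} \<and> (crosses_wall r u v \<longleftrightarrow> is_Top u = is_Top v)) \<and>
        (\<forall>v\<in>outer_vertices (r + s). \<exists>!e. e \<in> d \<and> v \<in> e)}"

text \<open>The stacked graph puts \<open>d1\<close> above \<open>d2\<close>. A southern arc of \<open>d1\<close> and a northern arc of \<open>d2\<close>
  with the same end points become one edge of this simple graph. This changes no connected
  component, and only components are used below: closed loops are the components that lie
  entirely in the middle row.\<close>

definition bot_to_mid :: "vertex \<Rightarrow> vertex" where
  "bot_to_mid v = (case v of Bot i \<Rightarrow> Mid i | _ \<Rightarrow> v)"

definition top_to_mid :: "vertex \<Rightarrow> vertex" where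
  "top_to_mid v = (case v of Top i \<Rightarrow> Mid i | _ \<Rightarrow> v)"

definition stack :: "vertex set set \<Rightarrow> vertex set set \<Rightarrow> vertex set set" where
  "stack d1 d2 = (\<lambda>e. bot_to_mid ` e) ` d1 \<union> (\<lambda>e. top_to_mid ` e) ` d2"

definition connected_in_stack :: "vertex set set \<Rightarrow> vertex set set \<Rightarrow> (vertex \<times> vertex) set" where
  "connected_in_stack d1 d2 = {(u, v). {u, v} \<in> stack d1 d2}\<^sup>*"

definition diagram_comp :: "nat \<Rightarrow> vertex set set \<Rightarrow> vertex set set \<Rightarrow> vertex set set" where
  "diagram_comp n d1 d2 =
    {{u, v} | u v. u \<in> outer_vertices n \<and> v \<in> outer_vertices n \<and> u \<noteq> v \<and>
                   (u, v) \<in> connected_in_stack d1 d2}"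

definition loops :: "nat \<Rightarrow> vertex set set \<Rightarrow> vertex set set \<Rightarrow> nat" where
  "loops n d1 d2 =
    card {C. (\<exists>i\<in>{1..n}. C = connected_in_stack d1 d2 `` {Mid i}) \<and> C \<subseteq> range Mid}"

definition id_diagram :: "nat \<Rightarrow> vertex set set" where
  "id_diagram n = {{Top k, Bot k} | k. k \<in> {1..n}}"

definition transposition_diagram :: "nat \<Rightarrow> nat \<Rightarrow> nat \<Rightarrow> vertex set set" where
  "transposition_diagram n a b =
    {{Top a, Bot b}, {Top b, Bot a}} \<union> {{Top k, Bot k} | k. k \<in> {1..n} - {a, b}}"

definition arc_diagram :: "nat \<Rightarrow> nat \<Rightarrow> nat \<Rightarrow> vertex set set" where
  "arc_diagram n a b =
    {{Top a, Top b}, {Bot a, Bot b}} \<union> {{Top k, Bot k} | k. k \<in> {1..n} - {a, b}}"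

section \<open>The walled Brauer algebra\<close>

text \<open>Elements are finitely supported functions from diagrams to the complex numbers, so the
  additive structure of the algebra is the one of the type \<open>_ \<Rightarrow>\<^sub>0 complex\<close>.\<close>

type_synonym wb_elem = "vertex set set \<Rightarrow>\<^sub>0 complex"

definition scale :: "complex \<Rightarrow> wb_elem \<Rightarrow> wb_elem" where
  "scale c f = Poly_Mapping.map ((*) c) f"

lemma lookup_scale: "Poly_Mapping.lookup (scale c f) d = c * Poly_Mapping.lookup f d"
  by (simp add: scale_def map.rep_eq when_def)

lemma vector_space_scale: "vector_space scale"
  by unfold_locales (auto simp: poly_mapping_eq_iff fun_eq_iff lookup_scale lookup_add algebra_simps)

definition basis_elem :: "vertex set set \<Rightarrow> wb_elem" where
  "basis_elem d = Poly_Mapping.single d 1"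

definition wb_mult :: "nat \<Rightarrow> complex \<Rightarrow> wb_elem \<Rightarrow> wb_elem \<Rightarrow> wb_elem" where
  "wb_mult n \<delta> f g =
    (\<Sum>d1\<in>Poly_Mapping.keys f. \<Sum>d2\<in>Poly_Mapping.keys g.
      scale (Poly_Mapping.lookup f d1 * Poly_Mapping.lookup g d2 * \<delta> ^ loops n d1 d2)
        (basis_elem (diagram_comp n d1 d2)))"

definition walled_brauer :: "nat \<Rightarrow> nat \<Rightarrow> complex \<Rightarrow> (complex, wb_elem) module" where
  "walled_brauer r s \<delta> =
    \<lparr>carrier = {f. Poly_Mapping.keys f \<subseteq> wb_diagrams r s},
     monoid.mult = wb_mult (r + s) \<delta>, one = basis_elem (id_diagram (r + s)),
     zero = 0, add = (+), smult = scale\<rparr>"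

definition centre :: "('a, 'm) monoid_scheme \<Rightarrow> 'a set" where
  "centre R = {z \<in> carrier R. \<forall>x \<in> carrier R. z \<otimes>\<^bsub>R\<^esub> x = x \<otimes>\<^bsub>R\<^esub> z}"

text \<open>The Jucys-Murphy elements of \<open>walled_brauer r 1 \<delta>\<close>, for indices from \<open>1\<close> to \<open>r + 1\<close>.
  The sum for index \<open>1\<close> is empty.\<close>

definition jucys_murphy :: "nat \<Rightarrow> complex \<Rightarrow> nat \<Rightarrow> wb_elem" where
  "jucys_murphy r \<delta> k =
    (if k \<le> r then (\<Sum>j\<in>{1..<k}. basis_elem (transposition_diagram (r + 1) j k))
     else - (\<Sum>j\<in>{1..r}. basis_elem (arc_diagram (r + 1) j (r + 1)))
          + scale \<delta> (basis_elem (id_diagram (r + 1))))"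

section \<open>Supersymmetric polynomials\<close>

text \<open>Multivariate polynomials are finitely supported maps from monomials to coefficients;
  their ring structure is the convolution product of \<open>Poly_Mapping\<close>. \<open>T\<close> is an additional
  variable needed to state the cancellation property.\<close>

datatype var = X nat | Y nat | T

type_synonym cpoly = "(var \<Rightarrow>\<^sub>0 nat) \<Rightarrow>\<^sub>0 complex"

definition Var :: "var \<Rightarrow> cpoly" where
  "Var v = Poly_Mapping.single (Poly_Mapping.single v 1) 1"

definition vars :: "cpoly \<Rightarrow> var set" where
  "vars p = (\<Union>m\<in>Poly_Mapping.keys p. Poly_Mapping.keys m)"

definition subst :: "(var \<Rightarrow> cpoly) \<Rightarrow> cpoly \<Rightarrow> cpoly" where
  "subst \<sigma> p =
    (\<Sum>m\<in>Poly_Mapping.keys p. Poly_Mapping.single 0 (Poly_Mapping.lookup p m) *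
      (\<Prod>v\<in>Poly_Mapping.keys m. \<sigma> v ^ Poly_Mapping.lookup m v))"

text \<open>For \<open>m = 0\<close> or \<open>n = 0\<close> there is nothing to substitute for, and the cancellation condition
  is void.\<close>

definition supersymmetric :: "nat \<Rightarrow> nat \<Rightarrow> cpoly set" where
  "supersymmetric m n =
    {p. vars p \<subseteq> X ` {1..m} \<union> Y ` {1..n} \<and>
        (\<forall>\<pi>. \<pi> permutes {1..m} \<longrightarrow>
           subst (\<lambda>v. case v of X i \<Rightarrow> Var (X (\<pi> i)) | _ \<Rightarrow> Var v) p = p) \<and>
        (\<forall>\<pi>. \<pi> permutes {1..n} \<longrightarrow>
           subst (\<lambda>v. case v of Y j \<Rightarrow> Var (Y (\<pi> j)) | _ \<Rightarrow> Var v) p = p) \<and>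
        (1 \<le> m \<and> 1 \<le> n \<longrightarrow> T \<notin> vars (subst (Var(X m := Var T, Y 1 := - Var T)) p))}"

text \<open>The value \<open>p(L_1, ..., L_r, L_{r+1})\<close> of a polynomial in \<open>X 1, ..., X r, Y 1\<close>. The
  Jucys-Murphy elements commute pairwise, so the order of the factors in a monomial is immaterial;
  the factors are multiplied in order of increasing index.\<close>

definition jm_monomial :: "nat \<Rightarrow> complex \<Rightarrow> (var \<Rightarrow>\<^sub>0 nat) \<Rightarrow> wb_elem" where
  "jm_monomial r \<delta> m = (let B = walled_brauer r 1 \<delta> in
    foldr (\<lambda>i a. (jucys_murphy r \<delta> i
        [^]\<^bsub>B\<^esub> Poly_Mapping.lookup m (if i \<le> r then X i else Y 1)) \<otimes>\<^bsub>B\<^esub> a)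
      [1..<r + 2] \<one>\<^bsub>B\<^esub>)"

definition jm_eval :: "nat \<Rightarrow> complex \<Rightarrow> cpoly \<Rightarrow> wb_elem" where
  "jm_eval r \<delta> p =
    (\<Sum>m\<in>Poly_Mapping.keys p. scale (Poly_Mapping.lookup p m) (jm_monomial r \<delta> m))"

section \<open>The index set\<close>

text \<open>Partitions are weakly decreasing lists of positive integers.\<close>

definition partitions :: "nat \<Rightarrow> nat list set" where
  "partitions n = {xs. sorted_wrt (\<ge>) xs \<and> (\<forall>x\<in>set xs. 0 < x) \<and> sum_list xs = n}"

definition wb_index :: "nat \<Rightarrow> nat \<Rightarrow> (nat \<times> nat list \<times> nat list) set" where
  "wb_index r s = (SIGMA k:{0..min r s}. partitions (r - k) \<times> partitions (s - k))"

end

theory Submission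
  imports Defs
    "HOL-Combinatorics.Perm"
    "HOL-Computational_Algebra.Fundamental_Theorem_Algebra"
    "HOL-Library.Product_Plus"
begin

text \<open>Reflecting the last column turns walled Brauer diagrams with \<open>s = 1\<close> into permutations of
  \<open>r + 1\<close> points, and the algebra into the sum of the group algebra of \<open>S_r\<close> and the two-sided
  ideal generated by the arc diagram. Elements commuting with \<open>S_r\<close> are given by pairs \<open>(z, u)\<close>, where
  \<open>z\<close> is central in the group algebra of \<open>S_r\<close> and \<open>u\<close> lies in the centraliser of \<open>S_{r-1}\<close>; such
  an element is central iff \<open>z + u x\<close>, with \<open>x = \<delta> + L_r\<close>, lies in the group algebra of \<open>S_{r-1}\<close>.
  The specialisations \<open>z\<close> and \<open>z + u x\<close> map the values of supersymmetric power sums to shifted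
  power sums of the Jucys-Murphy elements of \<open>S_r\<close> and \<open>S_{r-1}\<close>, which generate the two centres.
  Hence the values of supersymmetric polynomials surject on both centres.

  It remains to reach the pairs with \<open>z + u x = 0\<close>. These are cut into pieces of dimension one by the
  minimal idempotents \<open>i\<close> of the centre of the group algebra of \<open>S_r\<close>. If \<open>L_r\<close> has eigenvalue \<open>-\<delta>\<close>
  on \<open>i j\<close> for a minimal idempotent \<open>j\<close> for \<open>S_{r-1}\<close>, a generator comes from the first power sum.
  Otherwise \<open>i\<close> can be separated from every \<open>j\<close> by supersymmetric power sums: if their values agree,
  the contents of \<open>i\<close> are those of \<open>j\<close> together with \<open>-\<delta>\<close>, and then \<open>i j \<noteq> 0\<close>. The last
  implication follows from the transition measures: their Stieltjes transforms are determined by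
  the contents, and such a transform has no double zero on the real line.\<close>

text \<open>The element \<open>x\<close> is what remains between two arcs: a transposition
  \<open>(i, r)\<close> placed between them either closes a loop, for \<open>i = r\<close>, and
  costs \<open>\<delta>\<close>, or survives; summing over \<open>i\<close> gives
  \<open>\<delta> + L_r\<close>. The last Jucys-Murphy element is \<open>\<delta>\<close> minus the
  sum of the arcs, so it becomes \<open>\<delta>\<close> in one specialisation and
  \<open>- L_r\<close> in the other; in the latter, supersymmetric cancellation removes
  \<open>L_r\<close> from the value of the polynomial. Neither Young diagrams nor representations
  are constructed. Everything takes place in the commutative algebra of the Jucys-Murphy elements,
  which a positive trace form makes semisimple. The price is that contents are known only as
  eigenvalues: it is no longer visible that contents which extend those of \<open>j\<close> by one
  value come from a representation whose restriction contains \<open>j\<close>. This is the obstacle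
  that forces the analytic argument. The number of idempotents is found by squeezing it between a
  spanning set of products of power sums and an independent set of class sums, both indexed by
  partitions.\<close>

unbundle permutation_syntax

abbreviation lookup :: "('a \<Rightarrow>\<^sub>0 'b::zero) \<Rightarrow> 'a \<Rightarrow> 'b" where "lookup \<equiv> Poly_Mapping.lookup"
abbreviation keys :: "('a \<Rightarrow>\<^sub>0 'b::zero) \<Rightarrow> 'a set" where "keys \<equiv> Poly_Mapping.keys"

section \<open>The group algebra of the finitary symmetric group\<close>

text \<open>The convolution product of \<open>Poly_Mapping\<close> is based on an additive monoid of keys.\<close>

instantiation perm :: (type) monoid_add
begin
definition zero_perm :: "'a perm" where "zero_perm = 1"
definition plus_perm :: "'a perm \<Rightarrow> 'a perm \<Rightarrow> 'a perm" where "plus_perm f g = f * g"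
instance by standard (auto simp: zero_perm_def plus_perm_def mult.assoc)
end

type_synonym galg = "nat perm \<Rightarrow>\<^sub>0 complex"

definition gel :: "nat perm \<Rightarrow> galg" where "gel \<pi> = Poly_Mapping.single \<pi> 1"
text \<open>Scalars are ring elements, multiples of the identity, so that linearity can be handled
  by the ring laws of \<open>galg\<close>.\<close>

definition gsc :: "complex \<Rightarrow> galg" where "gsc c = Poly_Mapping.single 1 c"

lemma lookup_gel: "lookup (gel \<pi>) \<sigma> = (if \<pi> = \<sigma> then 1 else 0)"
  by (simp add: gel_def lookup_single when_def)

lemma keys_gel [simp]: "keys (gel \<pi>) = {\<pi>}"
  by (simp add: gel_def)

lemma gel_one [simp]: "gel 1 = 1"
  by (simp add: gel_def zero_perm_def[symmetric])

lemma gel_mult: "gel (\<pi> * \<sigma>) = gel \<pi> * gel \<sigma>"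
  by (simp add: gel_def mult_single plus_perm_def)

lemma gsc_0 [simp]: "gsc 0 = 0" by (simp add: gsc_def)
lemma gsc_1 [simp]: "gsc 1 = 1" by (simp add: gsc_def zero_perm_def[symmetric])
lemma gsc_add: "gsc (a + b) = gsc a + gsc b" by (simp add: gsc_def single_add)
lemma gsc_minus: "gsc (- a) = - gsc a" by (simp add: gsc_def single_uminus)
lemma gsc_diff: "gsc (a - b) = gsc a - gsc b" by (simp add: gsc_def single_diff)
lemma gsc_mult: "gsc (a * b) = gsc a * gsc b"
  by (simp add: gsc_def mult_single plus_perm_def)

lemma gsc_mult_conv_map: "gsc c * x = Poly_Mapping.map ((*) c) x"
  by (simp add: gsc_def mult_map_scale_conv_mult zero_perm_def)

lemma lookup_gsc_mult [simp]: "lookup (gsc c * x) \<pi> = c * lookup x \<pi>"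
  by (simp add: gsc_mult_conv_map map.rep_eq when_def)

lemma galg_expand_superset:
  assumes "finite A" "keys x \<subseteq> A"
  shows "x = (\<Sum>\<pi>\<in>A. gsc (lookup x \<pi>) * gel \<pi>)"
proof (rule poly_mapping_eqI)
  fix \<sigma>
  have "(\<Sum>\<pi>\<in>A. lookup x \<pi> * (if \<pi> = \<sigma> then 1 else 0)) = lookup x \<sigma>"
    using assms by (auto simp: sum.delta if_distrib in_keys_iff cong: if_cong)
  then show "lookup x \<sigma> = lookup (\<Sum>\<pi>\<in>A. gsc (lookup x \<pi>) * gel \<pi>) \<sigma>"
    by (simp add: lookup_sum lookup_gel)
qed

lemma galg_expand: "x = (\<Sum>\<pi>\<in>keys x. gsc (lookup x \<pi>) * gel \<pi>)"
  by (rule galg_expand_superset) auto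

text \<open>Both sides are linear, so the expansion in group elements reduces the claim to single
  products; later identities for \<open>flip\<close>, \<open>cj\<close>, \<open>prj\<close> and
  \<open>star\<close> are extended from group elements in the same way.\<close>

lemma gsc_commute: "gsc c * x = x * gsc c"
proof -
  have "gsc c * gel \<pi> = gel \<pi> * gsc c" for \<pi>
    by (simp add: gsc_def gel_def mult_single plus_perm_def)
  moreover have "gsc c * gsc d = gsc d * gsc c" for d
    by (simp add: gsc_mult[symmetric] mult.commute)
  ultimately have "gsc c * (gsc d * gel \<pi>) = (gsc d * gel \<pi>) * gsc c" for d \<pi>
    by (metis (no_types) mult.assoc[of "gsc c" "gsc d" "gel \<pi>"] mult.assoc[of "gsc d" "gsc c" "gel \<pi>"]
        mult.assoc[of "gsc d" "gel \<pi>" "gsc c"])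
  then have "gsc c * (\<Sum>\<pi>\<in>keys x. gsc (lookup x \<pi>) * gel \<pi>) = (\<Sum>\<pi>\<in>keys x. gsc (lookup x \<pi>) * gel \<pi>) * gsc c"
    by (simp add: sum_distrib_left sum_distrib_right)
  then show ?thesis using galg_expand[of x] by metis
qed

lemma gsc_left_commute: "x * (gsc c * y) = gsc c * (x * y)"
  by (metis gsc_commute mult.assoc)

lemma lookup_gel_mult [simp]: "lookup (gel \<sigma> * x) \<pi> = lookup x (inverse \<sigma> * \<pi>)"
proof -
  have "lookup (gel \<sigma> * gel \<rho>) \<pi> = lookup (gel \<rho>) (inverse \<sigma> * \<pi>)" for \<rho>
    unfolding gel_mult[symmetric] lookup_gel
    by (metis (no_types, lifting) mult.assoc mult_1 perm.left_inverse perm.right_inverse)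
  then have "lookup (gel \<sigma> * (\<Sum>\<rho>\<in>keys x. gsc (lookup x \<rho>) * gel \<rho>)) \<pi>
      = lookup (\<Sum>\<rho>\<in>keys x. gsc (lookup x \<rho>) * gel \<rho>) (inverse \<sigma> * \<pi>)"
    by (simp add: sum_distrib_left lookup_sum gsc_left_commute)
  then show ?thesis using galg_expand[of x] by metis
qed

lemma lookup_mult_gel [simp]: "lookup (x * gel \<sigma>) \<pi> = lookup x (\<pi> * inverse \<sigma>)"
proof -
  have "lookup (gel \<rho> * gel \<sigma>) \<pi> = lookup (gel \<rho>) (\<pi> * inverse \<sigma>)" for \<rho>
    unfolding gel_mult[symmetric] lookup_gel
    by (metis (no_types, lifting) mult.assoc mult_1_right perm.left_inverse perm.right_inverse)
  then have "lookup ((\<Sum>\<rho>\<in>keys x. gsc (lookup x \<rho>) * gel \<rho>) * gel \<sigma>) \<pi>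
      = lookup (\<Sum>\<rho>\<in>keys x. gsc (lookup x \<rho>) * gel \<rho>) (\<pi> * inverse \<sigma>)"
    by (simp add: sum_distrib_right lookup_sum mult.assoc)
  then show ?thesis using galg_expand[of x] by metis
qed

section \<open>The symmetric groups as subgroups of one permutation type\<close>

definition Sym :: "nat \<Rightarrow> nat perm set" where "Sym n = {\<pi>. affected \<pi> \<subseteq> {1..n}}"

lemma Sym_one [simp]: "1 \<in> Sym n" by (simp add: Sym_def)
lemma Sym_mult: "\<pi> \<in> Sym n \<Longrightarrow> \<sigma> \<in> Sym n \<Longrightarrow> \<pi> * \<sigma> \<in> Sym n"
  using affected_times[of \<pi> \<sigma>] unfolding Sym_def by blast
lemma Sym_inverse [simp]: "inverse \<pi> \<in> Sym n \<longleftrightarrow> \<pi> \<in> Sym n"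
  by (simp add: Sym_def)
lemma Sym_mono: "m \<le> n \<Longrightarrow> Sym m \<subseteq> Sym n"
  by (auto simp: Sym_def)
lemma Sym_swap: "a \<in> {1..n} \<Longrightarrow> b \<in> {1..n} \<Longrightarrow> swap a b \<in> Sym n"
  by (cases "a = b") (auto simp: Sym_def affected_swap)
lemma Sym_fix: "\<pi> \<in> Sym n \<Longrightarrow> a \<notin> {1..n} \<Longrightarrow> \<pi> \<langle>$\<rangle> a = a"
  by (auto simp: Sym_def in_affected)
lemma Sym_in: "\<pi> \<in> Sym n \<Longrightarrow> a \<in> {1..n} \<Longrightarrow> \<pi> \<langle>$\<rangle> a \<in> {1..n}"
proof (rule ccontr)
  assume *: "\<pi> \<in> Sym n" "a \<in> {1..n}" "\<pi> \<langle>$\<rangle> a \<notin> {1..n}"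
  then have "\<pi> \<langle>$\<rangle> a = a" using Sym_fix[of \<pi> n "\<pi> \<langle>$\<rangle> a"] by (simp add: apply_inj)
  then show False using * by simp
qed
lemma Sym_permutes: "\<pi> \<in> Sym n \<Longrightarrow> (\<langle>$\<rangle>) \<pi> permutes {1..n}"
  unfolding permutes_def using bij_apply[of \<pi>] by (simp add: Sym_fix bij_iff)
lemma Sym_Suc_fix: "\<pi> \<in> Sym (Suc n) \<Longrightarrow> \<pi> \<langle>$\<rangle> (Suc n) = Suc n \<Longrightarrow> \<pi> \<in> Sym n"
  using in_affected[of "Suc n" \<pi>] by (auto simp: Sym_def subset_eq atLeastAtMostSuc_conv)
lemma Sym_0 [simp]: "Sym 0 = {1}" by (auto simp: Sym_def)
lemma Sym_1 [simp]: "Sym (Suc 0) = {1}"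
proof -
  have "affected \<pi> \<noteq> {Suc 0}" for \<pi> :: "nat perm"
    using card_affected_not_one[of \<pi>] by force
  then show ?thesis by (auto simp: Sym_def subset_singleton_iff)
qed

lemma finite_Sym [simp]: "finite (Sym n)"
proof (rule finite_imageD)
  show "finite ((\<langle>$\<rangle>) ` Sym n)"
    by (rule finite_subset[of _ "{f. f permutes {1..n}}"]) (use Sym_permutes finite_permutations in blast)+
  show "inj_on (\<langle>$\<rangle>) (Sym n)"
    by (auto simp: inj_on_def intro: perm_eqI)
qed

lemma perm_inverse_apply [simp]: "inverse \<pi> \<langle>$\<rangle> (\<pi> \<langle>$\<rangle> a) = a" "\<pi> \<langle>$\<rangle> (inverse \<pi> \<langle>$\<rangle> a) = a"
  by (simp_all add: apply_sequence)

lemma perm_inverse_eq_iff: "inverse \<pi> \<langle>$\<rangle> a = b \<longleftrightarrow> a = \<pi> \<langle>$\<rangle> b"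
  by (metis perm_inverse_apply)

lemma swap_conj: "\<pi> * swap a b * inverse \<pi> = swap (\<pi> \<langle>$\<rangle> a) (\<pi> \<langle>$\<rangle> b)"
proof (rule perm_eqI)
  fix c
  show "(\<pi> * swap a b * inverse \<pi>) \<langle>$\<rangle> c = swap (\<pi> \<langle>$\<rangle> a) (\<pi> \<langle>$\<rangle> b) \<langle>$\<rangle> c"
    using apply_swap_same[of "inverse \<pi> \<langle>$\<rangle> c" a b]
    by (cases "c = \<pi> \<langle>$\<rangle> a"; cases "c = \<pi> \<langle>$\<rangle> b") (auto simp: apply_times perm_inverse_eq_iff)
qed

lemma affected_conj: "affected (\<sigma> * \<pi> * inverse \<sigma>) = (\<langle>$\<rangle>) \<sigma> ` affected \<pi>"
proof (intro equalityI subsetI)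
  fix a assume "a \<in> affected (\<sigma> * \<pi> * inverse \<sigma>)"
  then have "inverse \<sigma> \<langle>$\<rangle> a \<in> affected \<pi>" by (auto simp: in_affected apply_times)
  then show "a \<in> (\<langle>$\<rangle>) \<sigma> ` affected \<pi>" using imageI[of _ "affected \<pi>" "(\<langle>$\<rangle>) \<sigma>"] by fastforce
qed (auto simp: in_affected apply_times apply_inj)

section \<open>Group algebras of the symmetric groups and their centralisers\<close>

definition GA :: "nat \<Rightarrow> galg set" where "GA n = {x. keys x \<subseteq> Sym n}"

lemma GA_0 [simp]: "0 \<in> GA n" by (simp add: GA_def)
lemma GA_gel: "\<pi> \<in> Sym n \<Longrightarrow> gel \<pi> \<in> GA n" by (simp add: GA_def)
lemma GA_gsc [simp]: "gsc c \<in> GA n" by (simp add: GA_def gsc_def)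
lemma GA_1 [simp]: "1 \<in> GA n" using GA_gsc[of 1 n] by simp
lemma GA_add: "x \<in> GA n \<Longrightarrow> y \<in> GA n \<Longrightarrow> x + y \<in> GA n"
  using keys_add[of x y] by (auto simp: GA_def)
lemma GA_mult: "x \<in> GA n \<Longrightarrow> y \<in> GA n \<Longrightarrow> x * y \<in> GA n"
  using keys_mult[of x y] Sym_mult by (fastforce simp: GA_def plus_perm_def)
lemma GA_power: "x \<in> GA n \<Longrightarrow> x ^ k \<in> GA n"
  by (induction k) (auto intro: GA_mult)
lemma GA_sum: "(\<And>i. i \<in> I \<Longrightarrow> f i \<in> GA n) \<Longrightarrow> sum f I \<in> GA n"
  by (induction I rule: infinite_finite_induct) (auto intro: GA_add)
lemma GA_mono: "m \<le> n \<Longrightarrow> x \<in> GA m \<Longrightarrow> x \<in> GA n"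
  using Sym_mono by (auto simp: GA_def)

lemma GA_expand: "x \<in> GA n \<Longrightarrow> x = (\<Sum>\<pi>\<in>Sym n. gsc (lookup x \<pi>) * gel \<pi>)"
  by (rule galg_expand_superset) (auto simp: GA_def)

text \<open>The support of \<open>x\<close> is left free: together with \<open>x \<in> GA n\<close>
  the predicate describes the centre for \<open>m = n\<close> and the centraliser of a smaller
  symmetric group for \<open>m < n\<close>.\<close>

definition cent :: "nat \<Rightarrow> galg \<Rightarrow> bool" where
  "cent m x \<longleftrightarrow> (\<forall>\<pi>\<in>Sym m. gel \<pi> * x = x * gel \<pi>)"

lemma centD: "cent m x \<Longrightarrow> \<pi> \<in> Sym m \<Longrightarrow> gel \<pi> * x = x * gel \<pi>"
  by (simp add: cent_def)
lemma cent_0 [simp]: "cent m 0" by (simp add: cent_def)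
lemma cent_1 [simp]: "cent m 1" by (simp add: cent_def)
lemma cent_gsc [simp]: "cent m (gsc c)" by (simp add: cent_def gsc_commute)
lemma cent_add: "cent m x \<Longrightarrow> cent m y \<Longrightarrow> cent m (x + y)" by (simp add: cent_def algebra_simps)
lemma cent_mult: "cent m x \<Longrightarrow> cent m y \<Longrightarrow> cent m (x * y)"
  unfolding cent_def by (metis mult.assoc)
lemma cent_power: "cent m x \<Longrightarrow> cent m (x ^ k)"
  by (induction k) (auto intro: cent_mult)
lemma cent_sum: "(\<And>i. i \<in> I \<Longrightarrow> cent m (f i)) \<Longrightarrow> cent m (sum f I)"
  by (induction I rule: infinite_finite_induct) (auto intro: cent_add)
lemma cent_mono: "m \<le> n \<Longrightarrow> cent n x \<Longrightarrow> cent m x"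
  using Sym_mono by (auto simp: cent_def)

lemma cent_GA_commute:
  assumes "cent m x" "y \<in> GA m"
  shows "y * x = x * y"
proof -
  have "(\<Sum>\<pi>\<in>Sym m. gsc (lookup y \<pi>) * gel \<pi>) * x = x * (\<Sum>\<pi>\<in>Sym m. gsc (lookup y \<pi>) * gel \<pi>)"
    using assms(1) by (simp add: sum_distrib_left sum_distrib_right gsc_left_commute mult.assoc centD)
  then show ?thesis using GA_expand[OF assms(2)] by metis
qed

text \<open>Commuting with a group element means that the coefficients are invariant under
  conjugation by it; \<open>centI_lookup\<close> is the converse.\<close>

lemma cent_lookup: "cent m x \<Longrightarrow> \<sigma> \<in> Sym m \<Longrightarrow> lookup x (\<sigma> * \<pi> * inverse \<sigma>) = lookup x \<pi>"
  using centD[of m x \<sigma>] lookup_gel_mult[of \<sigma> x "\<sigma> * \<pi>"] lookup_mult_gel[of x \<sigma> "\<sigma> * \<pi>"]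
  by (simp add: mult.assoc[symmetric])

lemma centI_lookup:
  assumes "\<And>\<sigma> \<pi>. \<sigma> \<in> Sym m \<Longrightarrow> lookup x (\<sigma> * \<pi> * inverse \<sigma>) = lookup x \<pi>"
  shows "cent m x"
  unfolding cent_def
proof (intro ballI poly_mapping_eqI)
  fix \<sigma> \<pi> assume "\<sigma> \<in> Sym m"
  from assms[OF this, of "inverse \<sigma> * \<pi>"]
  show "lookup (gel \<sigma> * x) \<pi> = lookup (x * gel \<sigma>) \<pi>"
    by (simp add: mult.assoc[symmetric])
qed

lemma gel_inverse_mult [simp]: "gel (inverse \<pi>) * gel \<pi> = 1" "gel \<pi> * gel (inverse \<pi>) = 1"
  by (simp_all flip: gel_mult)

lemma gel_commute_inverse:
  "gel \<pi> * x = x * gel \<pi> \<longleftrightarrow> gel \<pi> * x * gel (inverse \<pi>) = x"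
proof
  assume "gel \<pi> * x = x * gel \<pi>"
  then show "gel \<pi> * x * gel (inverse \<pi>) = x" by (simp add: mult.assoc)
next
  assume "gel \<pi> * x * gel (inverse \<pi>) = x"
  then have "gel \<pi> * x * (gel (inverse \<pi>) * gel \<pi>) = x * gel \<pi>" by (simp add: mult.assoc[symmetric] del: gel_inverse_mult)
  then show "gel \<pi> * x = x * gel \<pi>" by simp
qed

lemma commute_mult:
  fixes a b x :: "'a::semigroup_mult"
  assumes "a * x = x * a" "b * x = x * b" shows "(a * b) * x = x * (a * b)"
  using assms by (metis mult.assoc)

text \<open>\<open>Sym (Suc n)\<close> is generated by \<open>Sym n\<close> and one adjacent
  transposition: conjugating the latter inside \<open>Sym n\<close> yields every
  \<open>swap i (Suc n)\<close>, and one of these carries the image of \<open>Suc n\<close> under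
  \<open>\<pi>\<close> back to \<open>Suc n\<close>.\<close>

lemma cent_step:
  assumes "cent n x" "n \<ge> 1" "gel (swap n (Suc n)) * x = x * gel (swap n (Suc n))"
  shows "cent (Suc n) x"
  unfolding cent_def
proof
  fix \<pi> assume pi: "\<pi> \<in> Sym (Suc n)"
  have sw: "gel (swap i (Suc n)) * x = x * gel (swap i (Suc n))" if "i \<in> {1..n}" for i
  proof (cases "i = n")
    case False
    then have "swap i (Suc n) = swap i n * swap n (Suc n) * inverse (swap i n)"
      using that by (subst swap_conj) auto
    moreover have "swap i n \<in> Sym n" using that by (intro Sym_swap) auto
    ultimately show ?thesis using assms(3) centD[OF assms(1), of "swap i n"]
      by (simp only: gel_mult inverse_swap) (intro commute_mult; simp)
  qed (use assms in auto)
  show "gel \<pi> * x = x * gel \<pi>"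
  proof (cases "\<pi> \<langle>$\<rangle> (Suc n) = Suc n")
    case True
    then show ?thesis using pi assms(1) Sym_Suc_fix centD by blast
  next
    case False
    define i where "i = \<pi> \<langle>$\<rangle> (Suc n)"
    have i: "i \<in> {1..n}" using False Sym_in[OF pi, of "Suc n"] by (auto simp: i_def)
    define \<rho> where "\<rho> = swap i (Suc n) * \<pi>"
    have "\<rho> \<in> Sym (Suc n)" unfolding \<rho>_def using pi i by (intro Sym_mult Sym_swap) auto
    moreover have "\<rho> \<langle>$\<rangle> (Suc n) = Suc n" by (simp add: \<rho>_def apply_times i_def)
    ultimately have "\<rho> \<in> Sym n" using Sym_Suc_fix by blast
    then have "gel \<rho> * x = x * gel \<rho>" using assms(1) centD by blast
    moreover have "\<pi> = swap i (Suc n) * \<rho>" by (simp add: \<rho>_def mult.assoc[symmetric])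
    ultimately show ?thesis using sw[OF i] by (simp only: gel_mult) (intro commute_mult; simp)
  qed
qed

lemma cent_generators:
  assumes "\<And>i. 1 \<le> i \<Longrightarrow> i < n \<Longrightarrow> gel (swap i (Suc i)) * x = x * gel (swap i (Suc i))"
  shows "cent n x"
  using assms
proof (induction n)
  case 0 then show ?case by (simp add: cent_def)
next
  case (Suc n)
  show ?case
  proof (cases "n = 0")
    case True then show ?thesis by (simp add: cent_def)
  next
    case False
    then show ?thesis using Suc by (intro cent_step) auto
  qed
qed

section \<open>Jucys-Murphy elements of the symmetric groups\<close>

definition L :: "nat \<Rightarrow> galg" where "L n = (\<Sum>j\<in>{1..<n}. gel (swap j n))"

lemma L_GA: "L n \<in> GA n"
  unfolding L_def by (intro GA_sum GA_gel Sym_swap) auto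

lemma L_0 [simp]: "L 0 = 0" "L (Suc 0) = 0" by (simp_all add: L_def)

text \<open>Conjugation by an element of \<open>Sym n\<close> fixes \<open>Suc n\<close> and
  therefore only permutes the summands.\<close>

lemma L_cent: "cent n (L (Suc n))"
  unfolding cent_def
proof
  fix \<pi> assume pi: "\<pi> \<in> Sym n"
  have b: "bij_betw ((\<langle>$\<rangle>) \<pi>) {1..<Suc n} {1..<Suc n}"
    using permutes_imp_bij[OF Sym_permutes[OF pi]] by (simp add: atLeastLessThanSuc_atLeastAtMost)
  have "gel \<pi> * gel (swap j (Suc n)) = gel (swap (\<pi> \<langle>$\<rangle> j) (Suc n)) * gel \<pi>" for j
    using swap_conj[of \<pi> j "Suc n"] Sym_fix[OF pi, of "Suc n"]
    by (simp flip: gel_mult) (metis mult.assoc mult.right_neutral perm.left_inverse)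
  then have "gel \<pi> * L (Suc n) = (\<Sum>j\<in>{1..<Suc n}. gel (swap (\<pi> \<langle>$\<rangle> j) (Suc n))) * gel \<pi>"
    unfolding L_def sum_distrib_left sum_distrib_right by (intro sum.cong refl) blast
  also have "(\<Sum>j\<in>{1..<Suc n}. gel (swap (\<pi> \<langle>$\<rangle> j) (Suc n))) = L (Suc n)"
    unfolding L_def by (rule sum.reindex_bij_betw[OF b])
  finally show "gel \<pi> * L (Suc n) = L (Suc n) * gel \<pi>" .
qed

text \<open>The element with the smaller index lies in a group algebra that is centralised by the
  other one.\<close>

lemma L_commute: "L i * L j = L j * L i"
proof -
  have "L i * L j = L j * L i" if "i < j" for i j
  proof -
    obtain k where j: "j = Suc k" using \<open>i < j\<close> by (cases j) auto
    have "L i \<in> GA k" using that j L_GA GA_mono by (metis less_Suc_eq_le)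
    then show ?thesis using L_cent[of k] cent_GA_commute j by blast
  qed
  then show ?thesis by (metis linorder_neqE_nat)
qed

text \<open>The defining relation of the degenerate affine Hecke algebra. Conjugation turns
  \<open>swap j n\<close> into \<open>swap j (Suc n)\<close>; the one summand of
  \<open>L (Suc n)\<close> not reached is the adjacent transposition itself.\<close>

lemma L_braid:
  assumes "n \<ge> 1"
  shows "gel (swap n (Suc n)) * L n * gel (swap n (Suc n)) + gel (swap n (Suc n)) = L (Suc n)"
proof -
  have "gel (swap n (Suc n)) * gel (swap j n) * gel (swap n (Suc n)) = gel (swap j (Suc n))"
    if "j \<in> {1..<n}" for j
  proof -
    have "swap n (Suc n) * swap j n * inverse (swap n (Suc n)) = swap j (Suc n)"
      using that by (subst swap_conj) auto
    then show ?thesis by (simp flip: gel_mult)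
  qed
  then have "gel (swap n (Suc n)) * L n * gel (swap n (Suc n)) = (\<Sum>j\<in>{1..<n}. gel (swap j (Suc n)))"
    by (simp add: L_def sum_distrib_left sum_distrib_right)
  moreover have "{1..<Suc n} = insert n {1..<n}" using assms by auto
  ultimately show ?thesis by (simp add: L_def add.commute)
qed

lemma gel_swap_square [simp]: "gel (swap a b) * gel (swap a b) = 1"
  by (simp flip: gel_mult)

lemma gel_swap_left [simp]: "gel (swap a b) * (gel (swap a b) * x) = x"
  by (simp flip: mult.assoc)

lemma s_L: assumes "n \<ge> 1"
  shows "gel (swap n (Suc n)) * L n = L (Suc n) * gel (swap n (Suc n)) - 1"
  using arg_cong[OF L_braid[OF assms], of "\<lambda>y. y * gel (swap n (Suc n))"]
  by (simp add: algebra_simps)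

lemma L_s: assumes "n \<ge> 1"
  shows "L n * gel (swap n (Suc n)) = gel (swap n (Suc n)) * L (Suc n) - 1"
  using arg_cong[OF L_braid[OF assms], of "\<lambda>y. gel (swap n (Suc n)) * y"]
  by (simp add: algebra_simps)

text \<open>For \<open>j < i\<close> the supports are disjoint; for \<open>j > Suc i\<close> the
  transposition lies in a symmetric group centralised by \<open>L j\<close>.\<close>

lemma s_L_far:
  assumes "1 \<le> i" "j \<noteq> i" "j \<noteq> Suc i"
  shows "gel (swap i (Suc i)) * L j = L j * gel (swap i (Suc i))"
proof (cases "j < i")
  case True
  have "swap i (Suc i) * swap k j = swap k j * swap i (Suc i)" if "k \<in> {1..<j}" for k
    using that True by (intro perm_mult_commute) (auto simp: affected_swap)
  then show ?thesis by (simp add: L_def sum_distrib_left sum_distrib_right flip: gel_mult)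
next
  case False
  then obtain k where k: "j = Suc k" "Suc i \<le> k" using assms by (cases j) auto
  then have "swap i (Suc i) \<in> Sym k" using assms by (intro Sym_swap) auto
  then show ?thesis using L_cent[of k] centD k by blast
qed

text \<open>With s the adjacent transposition, s a = b s - 1 and s b = a s + 1 for
  commuting a, b; the correction terms of the two summands cancel.\<close>

lemma s_commute_sym:
  fixes s a b :: "'a::ring_1"
  assumes "s * a = b * s - 1" "s * b = a * s + 1" "a * b = b * a"
  shows "s * (a ^ m * b ^ k + a ^ k * b ^ m) = (a ^ m * b ^ k + a ^ k * b ^ m) * s"
proof -
  have ab: "s * (a * b) = (a * b) * s"
  proof -
    have "s * (a * b) = (b * s - 1) * b" using assms(1) by (simp add: mult.assoc[symmetric])
    also have "\<dots> = b * (a * s + 1) - b" using assms(2) by (simp add: algebra_simps)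
    also have "\<dots> = (a * b) * s" using assms(3) by (simp add: algebra_simps flip: mult.assoc)
    finally show ?thesis .
  qed
  have abk: "s * (a * b) ^ k = (a * b) ^ k * s" for k
    by (induction k) (simp_all add: ab mult.assoc[symmetric], metis ab mult.assoc)
  have pc: "a ^ i * b ^ j = b ^ j * a ^ i" for i j
    using assms(3) by (metis power_commuting_commutes)
  have 1: "s * a ^ k = b ^ k * s - (\<Sum>i<k. b ^ i * a ^ (k - 1 - i))" for k
  proof (induction k)
    case (Suc k)
    have "s * a ^ Suc k = s * a ^ k * a" by (simp add: mult.assoc power_commutes)
    also have "\<dots> = b ^ k * (s * a) - (\<Sum>i<k. b ^ i * a ^ (k - 1 - i)) * a"
      by (simp add: Suc algebra_simps)
    also have "(\<Sum>i<k. b ^ i * a ^ (k - 1 - i)) * a = (\<Sum>i<k. b ^ i * a ^ (k - i))"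
      by (simp add: sum_distrib_right mult.assoc power_Suc2[symmetric] Suc_diff_Suc del: power_Suc)
    also have "b ^ k * (s * a) = b ^ Suc k * s - b ^ k"
      by (simp add: assms(1) algebra_simps flip: power_commutes)
    finally show ?case by (simp add: algebra_simps)
  qed simp
  have 2: "s * b ^ k = a ^ k * s + (\<Sum>i<k. a ^ i * b ^ (k - 1 - i))" for k
  proof (induction k)
    case (Suc k)
    have "s * b ^ Suc k = s * b ^ k * b" by (simp add: mult.assoc power_commutes)
    also have "\<dots> = a ^ k * (s * b) + (\<Sum>i<k. a ^ i * b ^ (k - 1 - i)) * b"
      by (simp add: Suc algebra_simps)
    also have "(\<Sum>i<k. a ^ i * b ^ (k - 1 - i)) * b = (\<Sum>i<k. a ^ i * b ^ (k - i))"
      by (simp add: sum_distrib_right mult.assoc power_Suc2[symmetric] Suc_diff_Suc del: power_Suc)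
    also have "a ^ k * (s * b) = a ^ Suc k * s + a ^ k"
      by (simp add: assms(2) algebra_simps flip: power_commutes)
    finally show ?case by (simp add: algebra_simps)
  qed simp
  \<comment> \<open>Both correction sums are the complete homogeneous polynomial of degree
    \<open>k - 1\<close> in \<open>a\<close> and \<open>b\<close>.\<close>
  have 3: "(\<Sum>i<k. b ^ i * a ^ (k - 1 - i)) = (\<Sum>i<k. a ^ i * b ^ (k - 1 - i))" for k
    by (rule sum.reindex_bij_witness[of _ "\<lambda>i. k - 1 - i" "\<lambda>i. k - 1 - i"]) (auto simp: pc)
  have 4: "s * (a ^ k + b ^ k) = (a ^ k + b ^ k) * s" for k
    by (simp add: distrib_left distrib_right 1 2 3[simplified])
  have 5: "s * (a ^ m * b ^ k + a ^ k * b ^ m) = (a ^ m * b ^ k + a ^ k * b ^ m) * s" if mk: "m \<le> k" for m k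
  proof -
    have abp: "(a * b) ^ m = a ^ m * b ^ m"
    proof (induction m)
      case (Suc m)
      have "(a * b) ^ Suc m = a * (b * a ^ m) * b ^ m" using Suc by (simp add: mult.assoc)
      also have "b * a ^ m = a ^ m * b" using pc[of m 1] by simp
      finally show ?case by (simp add: mult.assoc power_commutes)
    qed simp
    obtain d where d: "k = m + d" using le_Suc_ex[OF mk] by blast
    \<comment> \<open>Since \<open>a * b\<close> commutes with \<open>s\<close>, splitting off its
      power \<open>m\<close> leaves the exponents \<open>0\<close> and \<open>d\<close>, where claim
      \<open>4\<close> applies.\<close>
    have "a ^ m * b ^ k + a ^ k * b ^ m = (a * b) ^ m * (a ^ d + b ^ d)"
    proof -
      have "(a * b) ^ m * (a ^ d + b ^ d) = a ^ m * (b ^ m * a ^ d) + a ^ m * (b ^ m * b ^ d)"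
        by (simp add: abp distrib_left mult.assoc)
      also have "b ^ m * a ^ d = a ^ d * b ^ m" by (rule pc[symmetric])
      finally show ?thesis by (simp add: d power_add mult.assoc)
    qed
    then show ?thesis by (metis 4 abk mult.assoc)
  qed
  show ?thesis
    using 5[of m k] 5[of k m] by (cases "m \<le> k") (auto simp: add.commute)
qed

definition psum :: "nat \<Rightarrow> nat \<Rightarrow> galg" where "psum n k = (\<Sum>i\<in>{1..n}. L i ^ k)"

lemma psum_GA: "psum n k \<in> GA n"
  unfolding psum_def by (intro GA_sum GA_power) (auto intro: GA_mono[OF _ L_GA])

lemma commute_power:
  fixes s a :: "'a::monoid_mult" assumes "s * a = a * s" shows "s * a ^ k = a ^ k * s"
  using assms by (metis power_commuting_commutes)

text \<open>An adjacent transposition commutes with the symmetric expression in the two neighbouring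
  elements that it involves, and with every other \<open>L j\<close>.\<close>

lemma psum_cent: "cent n (psum n k)"
proof (rule cent_generators)
  fix i assume i: "1 \<le> i" "i < n"
  let ?s = "gel (swap i (Suc i))"
  have split: "{1..n} = insert i (insert (Suc i) ({1..n} - {i, Suc i}))" using i by auto
  have "psum n k = (L i ^ k + L (Suc i) ^ k) + (\<Sum>j\<in>{1..n} - {i, Suc i}. L j ^ k)"
    unfolding psum_def by (subst split) (simp add: algebra_simps)
  moreover have "?s * (L i ^ k + L (Suc i) ^ k) = (L i ^ k + L (Suc i) ^ k) * ?s"
    using s_commute_sym[of ?s "L i" "L (Suc i)" k 0] s_L[OF i(1)] L_s[OF i(1)] L_commute
    by (simp add: add.commute)
  moreover have "?s * (\<Sum>j\<in>{1..n} - {i, Suc i}. L j ^ k) = (\<Sum>j\<in>{1..n} - {i, Suc i}. L j ^ k) * ?s"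
    unfolding sum_distrib_left sum_distrib_right
    using i by (intro sum.cong refl commute_power s_L_far) auto
  ultimately show "?s * psum n k = psum n k * ?s" by (simp add: algebra_simps)
qed

definition gscale :: "complex \<Rightarrow> galg \<Rightarrow> galg" where "gscale c x = gsc c * x"

global_interpretation G: vector_space gscale
  by unfold_locales (simp_all add: gscale_def gsc_add gsc_mult algebra_simps)

section \<open>Class sums\<close>

text \<open>The complements of \<open>A\<close> and of its image have equal size, so
  \<open>f\<close> can be completed by an arbitrary bijection between them.\<close>

lemma Sym_extend:
  assumes "A \<subseteq> {1..m}" "inj_on f A" "f ` A \<subseteq> {1..m}"
  obtains \<tau> where "\<tau> \<in> Sym m" "\<And>a. a \<in> A \<Longrightarrow> \<tau> \<langle>$\<rangle> a = f a"
proof -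
  have fin: "finite A" using assms(1) finite_subset by blast
  have "card ({1..m} - A) = card ({1..m} - f ` A)"
    using assms fin by (simp add: card_Diff_subset card_image)
  then obtain g where g: "bij_betw g ({1..m} - A) ({1..m} - f ` A)"
    using finite_same_card_bij by blast
  define h where "h a = (if a \<in> A then f a else if a \<in> {1..m} then g a else a)" for a
  have "bij_betw h A (f ` A)"
    using assms(2) by (auto simp: h_def bij_betw_def inj_on_def)
  moreover have "bij_betw h ({1..m} - A) ({1..m} - f ` A)"
    using g by (subst bij_betw_cong[where g = g]) (auto simp: h_def)
  ultimately have "bij_betw h (A \<union> ({1..m} - A)) (f ` A \<union> ({1..m} - f ` A))"
    by (rule bij_betw_combine) auto
  moreover have "A \<union> ({1..m} - A) = {1..m}" "f ` A \<union> ({1..m} - f ` A) = {1..m}" using assms by blast+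
  ultimately have "bij_betw h {1..m} {1..m}" by simp
  then have perm: "h permutes {1..m}"
    using assms(1) by (intro bij_imp_permutes) (auto simp: h_def)
  have "finite {a. h a \<noteq> a}"
    by (rule finite_subset[of _ "{1..m}"]) (use permutes_not_in[OF perm] in blast)+
  then have app: "(\<langle>$\<rangle>) (Perm h) = h"
    using permutes_bij[OF perm] by (intro Perm_inverse) auto
  show thesis
  proof (rule that[of "Perm h"])
    have "affected (Perm h) \<subseteq> {1..m}"
    proof
      fix a assume "a \<in> affected (Perm h)"
      then have "h a \<noteq> a" by (simp add: in_affected app)
      then show "a \<in> {1..m}" using permutes_not_in[OF perm, of a] by blast
    qed
    then show "Perm h \<in> Sym m" by (simp add: Sym_def)
  qed (simp add: app h_def)
qed

text \<open>Unnormalised averaging over conjugation. On a group element it is the sum over its orbit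
  under \<open>Sym m\<close>, each orbit element being counted as often as the stabiliser has
  elements; this spares a choice of orbit representatives.\<close>

definition Cl :: "nat \<Rightarrow> galg \<Rightarrow> galg" where
  "Cl m x = (\<Sum>\<sigma>\<in>Sym m. gel \<sigma> * x * gel (inverse \<sigma>))"

lemma Cl_gel: "Cl m (gel \<pi>) = (\<Sum>\<sigma>\<in>Sym m. gel (\<sigma> * \<pi> * inverse \<sigma>))"
  by (simp add: Cl_def gel_mult)

lemma Cl_sum: "Cl m (sum f I) = (\<Sum>i\<in>I. Cl m (f i))"
  unfolding Cl_def sum_distrib_left sum_distrib_right by (rule sum.swap)

lemma Cl_gsc: "Cl m (gsc c * x) = gsc c * Cl m x"
  by (simp add: Cl_def sum_distrib_left gsc_left_commute mult.assoc)

lemma Sym_mult_bij: "\<tau> \<in> Sym m \<Longrightarrow> bij_betw ((*) \<tau>) (Sym m) (Sym m)"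
  by (rule bij_betw_byWitness[where f' = "(*) (inverse \<tau>)"])
     (auto simp: Sym_mult simp flip: mult.assoc)

lemma Sym_mult_right_bij: "\<tau> \<in> Sym m \<Longrightarrow> bij_betw (\<lambda>\<sigma>. \<sigma> * \<tau>) (Sym m) (Sym m)"
  by (rule bij_betw_byWitness[where f' = "\<lambda>\<sigma>. \<sigma> * inverse \<tau>"])
     (auto simp: Sym_mult mult.assoc)

lemma Cl_conj: "\<tau> \<in> Sym m \<Longrightarrow> Cl m (gel (\<tau> * \<pi> * inverse \<tau>)) = Cl m (gel \<pi>)"
  using sum.reindex_bij_betw[OF Sym_mult_right_bij, of \<tau> m "\<lambda>\<sigma>. gel (\<sigma> * \<pi> * inverse \<sigma>)"]
  by (simp add: Cl_gel mult.assoc)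

lemma Cl_cent: "cent m (Cl m x)"
  unfolding cent_def gel_commute_inverse
proof
  fix \<tau> assume "\<tau> \<in> Sym m"
  from sum.reindex_bij_betw[OF Sym_mult_bij[OF this], of "\<lambda>\<sigma>. gel \<sigma> * x * gel (inverse \<sigma>)"]
  show "gel \<tau> * Cl m x * gel (inverse \<tau>) = Cl m x"
    by (simp add: Cl_def sum_distrib_left sum_distrib_right gel_mult mult.assoc)
qed

text \<open>Averaging acts as a non-zero scalar on the centraliser, so the averages of the group
  elements span it.\<close>

lemma Cl_of_cent: "cent m x \<Longrightarrow> Cl m x = gsc (of_nat (card (Sym m))) * x"
proof -
  assume "cent m x"
  then have "gel \<sigma> * x * gel (inverse \<sigma>) = x" if "\<sigma> \<in> Sym m" for \<sigma>
    using that centD gel_commute_inverse by blast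
  then have "Cl m x = of_nat (card (Sym m)) * x" by (simp add: Cl_def)
  also have "(of_nat (card (Sym m)) :: galg) = gsc (of_nat (card (Sym m)))"
    by (induction "card (Sym m)") (simp_all add: gsc_def zero_perm_def[symmetric])
  finally show ?thesis .
qed

lemma card_Sym_pos: "card (Sym m) > 0"
  using Sym_one[of m] finite_Sym[of m] by (metis card_gt_0_iff empty_iff)

lemma Cl_GA: "m \<le> n \<Longrightarrow> x \<in> GA n \<Longrightarrow> Cl m x \<in> GA n"
  unfolding Cl_def by (intro GA_sum GA_mult GA_gel) (use Sym_mono[of m n] in auto)

lemma Cl_mult:
  "Cl m (gel \<kappa>) * Cl m (gel \<pi>) = (\<Sum>\<sigma>\<in>Sym m. Cl m (gel (\<sigma> * \<kappa> * inverse \<sigma> * \<pi>)))"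
proof -
  have "Cl m (gel \<kappa>) * Cl m (gel \<pi>) =
      (\<Sum>\<tau>\<in>Sym m. \<Sum>\<sigma>\<in>Sym m. gel (\<sigma> * \<kappa> * inverse \<sigma>) * gel (\<tau> * \<pi> * inverse \<tau>))"
    unfolding Cl_gel sum_product by (rule sum.swap)
  also have "\<dots> = (\<Sum>\<tau>\<in>Sym m. \<Sum>\<sigma>\<in>Sym m. gel (\<tau> * (\<sigma> * \<kappa> * inverse \<sigma> * \<pi>) * inverse \<tau>))"
  proof (rule sum.cong[OF refl])
    fix \<tau> assume t: "\<tau> \<in> Sym m"
    show "(\<Sum>\<sigma>\<in>Sym m. gel (\<sigma> * \<kappa> * inverse \<sigma>) * gel (\<tau> * \<pi> * inverse \<tau>)) =
      (\<Sum>\<sigma>\<in>Sym m. gel (\<tau> * (\<sigma> * \<kappa> * inverse \<sigma> * \<pi>) * inverse \<tau>))"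
    \<comment> \<open>Replacing \<open>\<sigma>\<close> by \<open>\<tau> * \<sigma>\<close> turns
      the product of two separate conjugates into one conjugate by \<open>\<tau>\<close>.\<close>
    proof (subst sum.reindex_bij_betw[OF Sym_mult_bij[OF t], symmetric], rule sum.cong[OF refl])
      fix \<sigma>
      have "\<tau> * \<sigma> * \<kappa> * inverse (\<tau> * \<sigma>) * (\<tau> * \<pi> * inverse \<tau>)
          = \<tau> * (\<sigma> * \<kappa> * inverse \<sigma>) * (inverse \<tau> * \<tau>) * \<pi> * inverse \<tau>"
        by (simp only: mult.assoc perm.inverse_distrib_swap)
      then show "gel (\<tau> * \<sigma> * \<kappa> * inverse (\<tau> * \<sigma>)) * gel (\<tau> * \<pi> * inverse \<tau>)
          = gel (\<tau> * (\<sigma> * \<kappa> * inverse \<sigma> * \<pi>) * inverse \<tau>)"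
        by (simp add: mult.assoc flip: gel_mult)
    qed
  qed
  also have "\<dots> = (\<Sum>\<sigma>\<in>Sym m. Cl m (gel (\<sigma> * \<kappa> * inverse \<sigma> * \<pi>)))"
    unfolding Cl_gel by (rule sum.swap)
  finally show ?thesis .
qed

text \<open>The quotient \<open>inverse \<sigma> * \<tau>\<close> fixes every point moved by
  \<open>\<kappa>\<close> and hence commutes with it.\<close>

lemma conj_eq_if_agree:
  assumes "\<And>a. a \<in> affected \<kappa> \<Longrightarrow> \<tau> \<langle>$\<rangle> a = \<sigma> \<langle>$\<rangle> a"
  shows "\<tau> * \<kappa> * inverse \<tau> = \<sigma> * \<kappa> * inverse \<sigma>"
proof -
  have "affected (inverse \<sigma> * \<tau>) \<inter> affected \<kappa> = {}"
    using assms by (auto simp: in_affected apply_times)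
  then have "inverse \<sigma> * \<tau> * \<kappa> = \<kappa> * (inverse \<sigma> * \<tau>)" by (rule perm_mult_commute[symmetric])
  then have "\<sigma> * (inverse \<sigma> * \<tau> * \<kappa>) * inverse \<tau> = \<sigma> * (\<kappa> * (inverse \<sigma> * \<tau>)) * inverse \<tau>" by simp
  then show ?thesis by (simp add: mult.assoc) (simp flip: mult.assoc)
qed

text \<open>Conjugating the factor \<open>\<kappa>\<close> alone can be achieved by conjugating the
  whole product, with a permutation that acts like \<open>\<sigma>\<close> on the points moved by
  \<open>\<kappa>\<close> and fixes those moved by \<open>\<pi>\<close>; disjointness makes this
  prescription injective.\<close>

lemma Cl_disjoint:
  assumes "\<sigma> \<in> Sym m" "affected \<kappa> \<inter> affected \<pi> = {}" "(\<langle>$\<rangle>) \<sigma> ` affected \<kappa> \<inter> affected \<pi> = {}"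
  shows "Cl m (gel (\<sigma> * \<kappa> * inverse \<sigma> * \<pi>)) = Cl m (gel (\<kappa> * \<pi>))"
proof -
  define f where "f a = (if a \<in> affected \<kappa> then \<sigma> \<langle>$\<rangle> a else a)" for a
  \<comment> \<open>A point outside \<open>{1..m}\<close> is fixed by \<open>\<sigma>\<close>, so
    the prescription has to be realised on \<open>A\<close> only.\<close>
  define A where "A = (affected \<kappa> \<union> affected \<pi>) \<inter> {1..m}"
  obtain \<tau> where t: "\<tau> \<in> Sym m" "\<And>a. a \<in> A \<Longrightarrow> \<tau> \<langle>$\<rangle> a = f a"
  proof (rule Sym_extend[of A m f])
    show "A \<subseteq> {1..m}" by (simp add: A_def)
    have "\<sigma> \<langle>$\<rangle> a \<noteq> b" if "a \<in> affected \<kappa>" "b \<in> affected \<pi>" for a b using assms(3) that by blast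
    then show "inj_on f A" unfolding inj_on_def f_def A_def by (metis IntD1 UnE apply_inj)
    show "f ` A \<subseteq> {1..m}" using Sym_in[OF assms(1)] by (auto simp: f_def A_def)
  qed (rule that)
  have tf: "\<tau> \<langle>$\<rangle> a = f a" if "a \<in> affected \<kappa> \<union> affected \<pi>" for a
    using that t Sym_fix[OF t(1), of a] Sym_fix[OF assms(1), of a]
    by (cases "a \<in> {1..m}") (auto simp: A_def f_def)
  have "\<tau> * \<kappa> * inverse \<tau> = \<sigma> * \<kappa> * inverse \<sigma>"
    by (rule conj_eq_if_agree) (simp add: tf f_def)
  moreover have "\<tau> * \<pi> * inverse \<tau> = 1 * \<pi> * inverse 1"
    by (rule conj_eq_if_agree) (use assms(2) in \<open>auto simp: tf f_def\<close>)
  ultimately have "\<sigma> * \<kappa> * inverse \<sigma> * \<pi> = (\<tau> * \<kappa> * inverse \<tau>) * (\<tau> * \<pi> * inverse \<tau>)" by simp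
  also have "\<dots> = \<tau> * \<kappa> * (inverse \<tau> * \<tau>) * \<pi> * inverse \<tau>" by (simp only: mult.assoc)
  also have "\<dots> = \<tau> * (\<kappa> * \<pi>) * inverse \<tau>" by (simp add: mult.assoc)
  finally show ?thesis using Cl_conj[OF t(1)] by simp
qed

lemma G_subspace_cancel:
  assumes "G.subspace V" "gsc c * x \<in> V" "c \<noteq> 0" shows "x \<in> V"
  using G.subspace_scale[OF assms(1,2), of "1 / c"] assms(3)
  by (simp add: gscale_def mult.assoc[symmetric] flip: gsc_mult)

lemma of_nat_galg: "(of_nat k :: galg) = gsc (of_nat k)"
  by (induction k) (simp_all add: gsc_add)

text \<open>Conjugating \<kappa> either keeps it disjoint from \<pi>, which gives a conjugate of \<kappa>\<pi>, or
  yields a product moving fewer points.\<close>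

lemma Cl_product_in:
  assumes V: "G.subspace V" and "\<kappa> \<in> Sym n" "\<pi> \<in> Sym n" "m \<le> n" "affected \<kappa> \<inter> affected \<pi> = {}"
    and H: "\<And>\<rho>. \<rho> \<in> Sym n \<Longrightarrow> card (affected \<rho>) < card (affected \<kappa>) + card (affected \<pi>) \<Longrightarrow> Cl m (gel \<rho>) \<in> V"
    and prod: "Cl m (gel \<kappa>) * Cl m (gel \<pi>) \<in> V"
  shows "Cl m (gel (\<kappa> * \<pi>)) \<in> V"
proof -
  \<comment> \<open>The conjugations that keep the supports disjoint. They contain \<open>1\<close>,
    which makes it possible to divide by their number at the end.\<close>
  define good where "good = {\<sigma>\<in>Sym m. (\<langle>$\<rangle>) \<sigma> ` affected \<kappa> \<inter> affected \<pi> = {}}"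
  have g: "good \<subseteq> Sym m" "1 \<in> good" using assms(5) by (auto simp: good_def)
  have poles: "(\<Sum>\<sigma>\<in>Sym m - good. Cl m (gel (\<sigma> * \<kappa> * inverse \<sigma> * \<pi>))) \<in> V"
  proof (rule G.subspace_sum[OF V], rule H)
    fix \<sigma> assume s: "\<sigma> \<in> Sym m - good"
    then have "\<sigma> \<in> Sym n" using Sym_mono assms(4) by blast
    then show "\<sigma> * \<kappa> * inverse \<sigma> * \<pi> \<in> Sym n" using assms by (intro Sym_mult) simp_all
    have "affected (\<sigma> * \<kappa> * inverse \<sigma> * \<pi>) \<subseteq> (\<langle>$\<rangle>) \<sigma> ` affected \<kappa> \<union> affected \<pi>"
      using affected_times[of "\<sigma> * \<kappa> * inverse \<sigma>" \<pi>] by (simp add: affected_conj)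
    then have "card (affected (\<sigma> * \<kappa> * inverse \<sigma> * \<pi>)) \<le> card ((\<langle>$\<rangle>) \<sigma> ` affected \<kappa> \<union> affected \<pi>)"
      by (intro card_mono) auto
    also have "\<dots> < card ((\<langle>$\<rangle>) \<sigma> ` affected \<kappa>) + card (affected \<pi>)"
      using s card_Un_Int[of "(\<langle>$\<rangle>) \<sigma> ` affected \<kappa>" "affected \<pi>"] by (auto simp: good_def card_gt_0_iff)
    also have "card ((\<langle>$\<rangle>) \<sigma> ` affected \<kappa>) = card (affected \<kappa>)"
      by (rule card_image) (simp add: inj_on_def apply_inj)
    finally show "card (affected (\<sigma> * \<kappa> * inverse \<sigma> * \<pi>)) < card (affected \<kappa>) + card (affected \<pi>)" .
  qed
  have "(\<Sum>\<sigma>\<in>good. Cl m (gel (\<sigma> * \<kappa> * inverse \<sigma> * \<pi>))) = (\<Sum>\<sigma>\<in>good. Cl m (gel (\<kappa> * \<pi>)))"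
    by (rule sum.cong[OF refl], rule Cl_disjoint) (use assms(5) in \<open>auto simp: good_def\<close>)
  also have "\<dots> = gsc (of_nat (card good)) * Cl m (gel (\<kappa> * \<pi>))"
    by (simp add: of_nat_galg)
  finally have "gsc (of_nat (card good)) * Cl m (gel (\<kappa> * \<pi>)) =
      Cl m (gel \<kappa>) * Cl m (gel \<pi>) - (\<Sum>\<sigma>\<in>Sym m - good. Cl m (gel (\<sigma> * \<kappa> * inverse \<sigma> * \<pi>)))"
    using sum.subset_diff[OF g(1) finite_Sym, of "\<lambda>\<sigma>. Cl m (gel (\<sigma> * \<kappa> * inverse \<sigma> * \<pi>))"]
    by (simp add: Cl_mult)
  then have "gsc (of_nat (card good)) * Cl m (gel (\<kappa> * \<pi>)) \<in> V"
    using G.subspace_diff[OF V prod poles] by simp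
  moreover have "finite good" using g(1) finite_Sym finite_subset by blast
  then have "(of_nat (card good) :: complex) \<noteq> 0" using g(2) by auto
  ultimately show ?thesis using G_subspace_cancel[OF V] by blast
qed

text \<open>A word with distinct letters different from \<open>a\<close> is a cycle on
  \<open>length js + 1\<close> points. Such words are the terms of the powers of \<open>L a\<close>
  (\<open>L_power\<close>), which is why cycles are written in this form.\<close>

definition star_word :: "nat list \<Rightarrow> nat \<Rightarrow> nat perm" where
  "star_word js a = prod_list (map (\<lambda>j. swap j a) js)"

lemma star_word_simps [simp]:
  "star_word [] a = 1" "star_word (j # js) a = swap j a * star_word js a"
  "star_word (js @ ks) a = star_word js a * star_word ks a"
  by (simp_all add: star_word_def)

lemma affected_swap_subset: "affected (swap a b) \<subseteq> {a, b}"
  by (cases "a = b") (auto simp: affected_swap)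

lemma affected_star_word: "affected (star_word js a) \<subseteq> insert a (set js)"
proof (induction js)
  case (Cons j js)
  then show ?case using affected_times[of "swap j a" "star_word js a"] affected_swap_subset[of j a]
    unfolding star_word_simps by (simp add: subset_iff) blast
qed simp

lemma star_word_Sym: "a \<in> {1..n} \<Longrightarrow> set js \<subseteq> {1..n} \<Longrightarrow> star_word js a \<in> Sym n"
  using affected_star_word[of js a] unfolding Sym_def by blast

lemma conj_mult: "\<tau> * (\<pi> * \<rho>) * inverse \<tau> = (\<tau> * \<pi> * inverse \<tau>) * (\<tau> * \<rho> * inverse (\<tau> :: 'a perm))"
proof -
  have "(\<tau> * \<pi> * inverse \<tau>) * (\<tau> * \<rho> * inverse \<tau>) = \<tau> * \<pi> * (inverse \<tau> * \<tau>) * \<rho> * inverse \<tau>"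
    by (simp only: mult.assoc)
  then show ?thesis by (simp add: mult.assoc)
qed

lemma star_word_conj: "\<tau> * star_word js a * inverse \<tau> = star_word (map ((\<langle>$\<rangle>) \<tau>) js) (\<tau> \<langle>$\<rangle> a)"
  by (induction js) (simp_all add: conj_mult swap_conj)

lemma star_word_conjugate:
  assumes "distinct (a # js)" "distinct (b # ks)" "length js = length ks"
    "set (a # js) \<subseteq> {1..m}" "set (b # ks) \<subseteq> {1..m}"
  shows "Cl m (gel (star_word js a)) = Cl m (gel (star_word ks b))"
proof -
  define f where "f = the \<circ> map_of (zip (a # js) (b # ks))"
  have mf: "map f (a # js) = b # ks"
    unfolding f_def using assms by (intro nth_equalityI) (auto simp: map_of_zip_nth simp del: zip_Cons_Cons list.map)
  have "inj_on f (set (a # js))"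
    using assms(1,2) mf by (metis distinct_map)
  moreover have "f ` set (a # js) = set (b # ks)" using mf by (metis set_map)
  ultimately obtain \<tau> where t: "\<tau> \<in> Sym m" "\<And>c. c \<in> set (a # js) \<Longrightarrow> \<tau> \<langle>$\<rangle> c = f c"
    using Sym_extend[of "set (a # js)" m f] assms by metis
  then have "map ((\<langle>$\<rangle>) \<tau>) (a # js) = b # ks" using mf by (metis map_eq_conv)
  then have "star_word ks b = \<tau> * star_word js a * inverse \<tau>" by (simp add: star_word_conj)
  then show ?thesis using Cl_conj[OF t(1)] by simp
qed

text \<open>The centre \<open>Suc m\<close> lies outside the points permuted by
  \<open>Sym m\<close>, so only the other letters are relabelled: this is conjugacy under the
  smaller group.\<close>

lemma star_word_conjugate_fix:
  assumes "distinct js" "distinct ks" "length js = length ks"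
    "set js \<subseteq> {1..m}" "set ks \<subseteq> {1..m}"
  shows "Cl m (gel (star_word js (Suc m))) = Cl m (gel (star_word ks (Suc m)))"
proof -
  define f where "f = the \<circ> map_of (zip js ks)"
  have mf: "map f js = ks"
    unfolding f_def using assms by (intro nth_equalityI) (auto simp: map_of_zip_nth)
  have "inj_on f (set js)" using assms(1,2) mf by (metis distinct_map)
  moreover have "f ` set js = set ks" using mf by (metis set_map)
  ultimately obtain \<tau> where t: "\<tau> \<in> Sym m" "\<And>c. c \<in> set js \<Longrightarrow> \<tau> \<langle>$\<rangle> c = f c"
    using Sym_extend[of "set js" m f] assms by metis
  then have "map ((\<langle>$\<rangle>) \<tau>) js = ks" using mf by (metis map_eq_conv)
  then have "star_word ks (Suc m) = \<tau> * star_word js (Suc m) * inverse \<tau>"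
    using Sym_fix[OF t(1)] by (simp add: star_word_conj)
  then show ?thesis using Cl_conj[OF t(1)] by simp
qed

text \<open>Splits off the cycle through \<open>a\<close>. Multiplication by the transposition of
  \<open>a\<close> and its image \<open>b\<close> fixes \<open>a\<close>; if \<open>b\<close> is
  still moved, the cycle through \<open>b\<close> of the remaining permutation is extended by one
  letter.\<close>

lemma star_word_split:
  assumes "a \<in> affected \<pi>"
  obtains js \<rho> where "distinct (a # js)" "js \<noteq> []" "\<pi> = star_word js a * \<rho>"
    "set (a # js) \<inter> affected \<rho> = {}" "set (a # js) \<union> affected \<rho> = affected \<pi>"
proof -
  have "\<exists>js \<rho>. distinct (a # js) \<and> js \<noteq> [] \<and> \<pi> = star_word js a * \<rho> \<and>
    set (a # js) \<inter> affected \<rho> = {} \<and> set (a # js) \<union> affected \<rho> = affected \<pi>"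
    using assms
  proof (induction "card (affected \<pi>)" arbitrary: a \<pi> rule: less_induct)
    case less
    define b where "b = \<pi> \<langle>$\<rangle> a"
    define \<rho> where "\<rho> = swap a b * \<pi>"
    have ab: "a \<noteq> b" "b \<in> affected \<pi>" using less.prems by (auto simp: b_def in_affected apply_inj)
    have fa: "a \<notin> affected \<rho>" by (simp add: in_affected \<rho>_def apply_times b_def)
    have pi: "\<pi> = swap a b * \<rho>" by (simp add: \<rho>_def flip: mult.assoc)
    have sub: "affected \<rho> \<subseteq> affected \<pi>"
      using affected_times[of "swap a b" \<pi>] affected_swap_subset[of a b] less.prems ab
      unfolding \<rho>_def by blast
    have sub2: "affected \<pi> \<subseteq> {a, b} \<union> affected \<rho>"
      using affected_times[of "swap a b" \<rho>] affected_swap_subset[of a b]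
      unfolding pi[symmetric] by blast
    show ?case
    proof (cases "b \<in> affected \<rho>")
      case False
      then have "distinct (a # [b]) \<and> [b] \<noteq> [] \<and> \<pi> = star_word [b] a * \<rho> \<and>
        set (a # [b]) \<inter> affected \<rho> = {} \<and> set (a # [b]) \<union> affected \<rho> = affected \<pi>"
        using ab fa sub sub2 less.prems pi by (auto simp: swap_sym)
      then show ?thesis by blast
    next
      case True
      have "card (affected \<rho>) < card (affected \<pi>)"
        using sub fa less.prems by (intro psubset_card_mono) auto
      from less.hyps[OF this True] obtain js \<rho>' where js: "distinct (b # js)" "\<rho> = star_word js b * \<rho>'"
        "set (b # js) \<inter> affected \<rho>' = {}" "set (b # js) \<union> affected \<rho>' = affected \<rho>" by blast
      have anot: "a \<notin> set js" "a \<notin> affected \<rho>'" using fa js(4) by auto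
      \<comment> \<open>Conjugation by \<open>swap a b\<close> moves the centre of the word from
        \<open>b\<close> to \<open>a\<close>; commuting the transposition to the right then appends
        the letter \<open>b\<close>.\<close>
      have "map ((\<langle>$\<rangle>) (swap a b)) js = js" using anot js(1) by (intro map_idI apply_swap_same) auto
      then have "swap a b * star_word js b * inverse (swap a b) = star_word js a"
        by (simp add: star_word_conj del: inverse_swap)
      then have "swap a b * star_word js b = star_word js a * swap a b"
        by (metis (no_types) inverse_swap mult.assoc mult.right_neutral swap_self)
      then have "\<pi> = star_word (js @ [b]) a * \<rho>'"
        using pi js(2) by (simp add: mult.assoc[symmetric] swap_sym)
      moreover have "set (a # (js @ [b])) \<union> affected \<rho>' = affected \<pi>"
        using js(4) sub sub2 less.prems ab by auto
      ultimately show ?thesis using js anot ab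
        by (intro exI[of _ "js @ [b]"] exI[of _ \<rho>']) auto
    qed
  qed
  then show thesis using that by blast
qed

lemma L_power:
  "L a ^ k = (\<Sum>js\<in>{js. set js \<subseteq> {1..<a} \<and> length js = k}. gel (star_word js a))"
proof (induction k)
  case 0
  have "{js. set js \<subseteq> {1..<a} \<and> length js = 0} = {[]}" by auto
  then show ?case by simp
next
  case (Suc k)
  let ?A = "{js. set js \<subseteq> {1..<a} \<and> length js = k}"
  have "L a ^ Suc k = (\<Sum>j\<in>{1..<a}. gel (swap j a)) * (\<Sum>js\<in>?A. gel (star_word js a))"
    unfolding power_Suc Suc by (simp add: L_def)
  also have "\<dots> = (\<Sum>(j, js)\<in>{1..<a} \<times> ?A. gel (star_word (j # js) a))"
    by (simp add: sum_product sum.cartesian_product gel_mult)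
  also have "\<dots> = (\<Sum>js\<in>{js. set js \<subseteq> {1..<a} \<and> length js = Suc k}. gel (star_word js a))"
    by (rule sum.reindex_bij_witness[of _ "\<lambda>js. (hd js, tl js)" "\<lambda>(j, js). j # js"])
       (auto simp: length_Suc_conv)
  finally show ?case .
qed

lemma finite_words: "finite {js. set js \<subseteq> {1..<a::nat} \<and> length js = k}"
  by (rule finite_lists_length_eq) simp

lemma card_affected_star_word:
  assumes "\<not> distinct (a # js)" shows "card (affected (star_word js a)) < Suc (length js)"
proof -
  have "card (affected (star_word js a)) \<le> card (set (a # js))"
    using affected_star_word[of js a] by (intro card_mono) auto
  also have "\<dots> < length (a # js)" using assms by (meson card_distinct card_length le_neq_implies_less)
  finally show ?thesis by simp
qed

text \<open>Average the expansion of \<open>L (Suc m) ^ length js\<close>. All words with distinct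
  letters have the same average, and a word with a repetition moves fewer points, so that
  \<open>H\<close> applies; the average of one word is obtained by dividing by the number of
  distinct words.\<close>

lemma Cl_star_word_fix:
  assumes V: "G.subspace V"
    and js: "distinct js" "set js \<subseteq> {1..m}"
    and H: "\<And>\<rho>. \<rho> \<in> Sym (Suc m) \<Longrightarrow> card (affected \<rho>) < Suc (length js) \<Longrightarrow> Cl m (gel \<rho>) \<in> V"
    and L: "L (Suc m) ^ length js \<in> V"
  shows "Cl m (gel (star_word js (Suc m))) \<in> V"
proof -
  let ?A = "{ks. set ks \<subseteq> {1..<Suc m} \<and> length ks = length js}"
  let ?D = "{ks\<in>?A. distinct ks}"
  have fin: "finite ?A" by (rule finite_words)
  have eq: "gsc (of_nat (card (Sym m))) * L (Suc m) ^ length js = (\<Sum>ks\<in>?A. Cl m (gel (star_word ks (Suc m))))"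
    unfolding Cl_of_cent[OF cent_power[OF L_cent], symmetric] by (simp add: L_power Cl_sum)
  have poles: "(\<Sum>ks\<in>?A - ?D. Cl m (gel (star_word ks (Suc m)))) \<in> V"
  proof (rule G.subspace_sum[OF V], rule H)
    fix ks assume ks: "ks \<in> ?A - ?D"
    then show "star_word ks (Suc m) \<in> Sym (Suc m)" by (intro star_word_Sym) auto
    show "card (affected (star_word ks (Suc m))) < Suc (length js)"
      using card_affected_star_word[of "Suc m" ks] ks by auto
  qed
  have "(\<Sum>ks\<in>?D. Cl m (gel (star_word ks (Suc m)))) = (\<Sum>ks\<in>?D. Cl m (gel (star_word js (Suc m))))"
    by (rule sum.cong[OF refl], rule star_word_conjugate_fix) (use js in auto)
  also have "\<dots> = gsc (of_nat (card ?D)) * Cl m (gel (star_word js (Suc m)))" by (simp add: of_nat_galg)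
  finally have "gsc (of_nat (card ?D)) * Cl m (gel (star_word js (Suc m))) =
     gsc (of_nat (card (Sym m))) * L (Suc m) ^ length js - (\<Sum>ks\<in>?A - ?D. Cl m (gel (star_word ks (Suc m))))"
    unfolding eq by (subst sum_diff[OF fin]) auto
  also have "\<dots> \<in> V"
    using G.subspace_diff[OF V G.subspace_scale[OF V L] poles] by (simp add: gscale_def)
  finally have "gsc (of_nat (card ?D)) * Cl m (gel (star_word js (Suc m))) \<in> V" .
  moreover have "js \<in> ?D" using js by auto
  then have "(of_nat (card ?D) :: complex) \<noteq> 0" using fin by (auto simp del: mem_Collect_eq)
  ultimately show ?thesis using G_subspace_cancel[OF V] by blast
qed

text \<open>The same argument for the full group: in the power sum the centre varies as well, and
  all distinct words of the given length are conjugate under \<open>Sym n\<close>.\<close>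

lemma Cl_star_word:
  assumes V: "G.subspace V"
    and js: "distinct (a # js)" "set (a # js) \<subseteq> {1..n}"
    and H: "\<And>\<rho>. \<rho> \<in> Sym n \<Longrightarrow> card (affected \<rho>) < Suc (length js) \<Longrightarrow> Cl n (gel \<rho>) \<in> V"
    and L: "psum n (length js) \<in> V"
  shows "Cl n (gel (star_word js a)) \<in> V"
proof -
  let ?A = "SIGMA i:{1..n}. {ks. set ks \<subseteq> {1..<i} \<and> length ks = length js}"
  let ?f = "\<lambda>(i, ks). Cl n (gel (star_word ks i))"
  let ?D = "{p\<in>?A. distinct (snd p)}"
  have fin: "finite ?A" using finite_words by blast
  have eq: "gsc (of_nat (card (Sym n))) * psum n (length js) = sum ?f ?A"
    unfolding Cl_of_cent[OF psum_cent, symmetric]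
    by (simp add: psum_def L_power Cl_sum sum.Sigma finite_words[simplified] case_prod_unfold)
  have poles: "sum ?f (?A - ?D) \<in> V"
  proof (rule G.subspace_sum[OF V])
    fix p assume p: "p \<in> ?A - ?D"
    obtain i ks where ik: "p = (i, ks)" by (cases p)
    have ks: "(i, ks) \<notin> ?D" "i \<in> {1..n}" "set ks \<subseteq> {1..<i}" "length ks = length js"
      using p ik by auto
    show "?f p \<in> V" unfolding ik prod.case
    proof (rule H)
      show "star_word ks i \<in> Sym n" using ks by (intro star_word_Sym) auto
      show "card (affected (star_word ks i)) < Suc (length js)"
        using card_affected_star_word[of i ks] ks by auto
    qed
  qed
  have "sum ?f ?D = (\<Sum>p\<in>?D. Cl n (gel (star_word js a)))"
  proof (rule sum.cong[OF refl], clarify)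
    fix i ks assume "i \<in> {1..n}" "set ks \<subseteq> {1..<i}" "length ks = length js" "distinct (snd (i, ks))"
    then show "Cl n (gel (star_word ks i)) = Cl n (gel (star_word js a))"
      using js by (intro star_word_conjugate) auto
  qed
  also have "\<dots> = gsc (of_nat (card ?D)) * Cl n (gel (star_word js a))" by (simp add: of_nat_galg)
  finally have "gsc (of_nat (card ?D)) * Cl n (gel (star_word js a)) =
     gsc (of_nat (card (Sym n))) * psum n (length js) - sum ?f (?A - ?D)"
    unfolding eq by (subst sum_diff[OF fin]) auto
  also have "\<dots> \<in> V"
    using G.subspace_diff[OF V G.subspace_scale[OF V L] poles] by (simp add: gscale_def)
  finally have "gsc (of_nat (card ?D)) * Cl n (gel (star_word js a)) \<in> V" .
  moreover have "(of_nat (card ?D) :: complex) \<noteq> 0"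
  proof -
    have "length (a # js) \<le> n"
      using card_mono[OF _ js(2)] distinct_card[OF js(1)] by simp
    \<comment> \<open>A witness that there is something to divide by: the largest centre
      \<open>n\<close> has at least \<open>length js\<close> letters below it.\<close>
    then have "(n, [1..<Suc (length js)]) \<in> ?D" by (auto simp: Suc_le_eq)
    then have "?D \<noteq> {}" by blast
    moreover have "finite ?D" using fin by simp
    ultimately show ?thesis by (simp only: of_nat_eq_0_iff card_eq_0_iff) simp
  qed
  ultimately show ?thesis using G_subspace_cancel[OF V] by blast
qed

section \<open>Generation of the centre and of the centraliser\<close>

text \<open>The shift by one reflects that a cycle on \<open>x\<close> points arises from words of
  length \<open>x - 1\<close>. Parts \<open>1\<close> contribute the factor \<open>1\<close>, so
  that a partition of \<open>n\<close> describes a product of power sums.\<close>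

definition pfac :: "nat \<Rightarrow> nat \<Rightarrow> galg" where
  "pfac n x = (if x \<le> 1 then 1 else psum n (x - 1))"

text \<open>The weight is a filtration by the number of moved points. Bounding it keeps the spanning
  set as small as the set of partitions, as the later dimension count requires.\<close>

definition pprods :: "nat \<Rightarrow> nat \<Rightarrow> galg set" where
  "pprods n m = {prod_list (map (pfac n) xs) | xs. (\<forall>x\<in>set xs. 0 < x) \<and> sum_list xs \<le> m}"

lemma G_span_mult:
  assumes "x \<in> G.span A" "y \<in> G.span B" "\<And>a b. a \<in> A \<Longrightarrow> b \<in> B \<Longrightarrow> a * b \<in> G.span C"
  shows "x * y \<in> G.span C"
proof -
  have 1: "a * y \<in> G.span C" if "a \<in> A" for a
    using assms(2)
  proof (induction rule: G.span_induct_alt)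
    case (step c b y)
    have "a * (gscale c b + y) = gscale c (a * b) + a * y"
      by (simp add: gscale_def distrib_left gsc_left_commute)
    then show ?case using step assms(3)[OF that] by (simp add: G.span_add G.span_scale)
  qed (simp add: G.span_zero)
  show ?thesis using assms(1)
  proof (induction rule: G.span_induct_alt)
    case (step c b x)
    have "(gscale c b + x) * y = gscale c (b * y) + x * y"
      by (simp add: gscale_def distrib_right mult.assoc)
    then show ?case using step 1 by (simp add: G.span_add G.span_scale)
  qed (simp add: G.span_zero)
qed

lemma pprods_mult:
  assumes "x \<in> G.span (pprods n p)" "y \<in> G.span (pprods n q)"
  shows "x * y \<in> G.span (pprods n (p + q))"
  using assms
proof (rule G_span_mult)
  fix a b assume "a \<in> pprods n p" "b \<in> pprods n q"
  then obtain xs ys where "a = prod_list (map (pfac n) xs)" "b = prod_list (map (pfac n) ys)"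
    "\<forall>x\<in>set xs. 0 < x" "\<forall>x\<in>set ys. 0 < x" "sum_list xs \<le> p" "sum_list ys \<le> q"
    by (auto simp: pprods_def)
  then have "a * b \<in> pprods n (p + q)"
    unfolding pprods_def by (intro CollectI exI[of _ "xs @ ys"]) auto
  then show "a * b \<in> G.span (pprods n (p + q))" by (rule G.span_base)
qed

lemma pprods_mono: "p \<le> q \<Longrightarrow> G.span (pprods n p) \<subseteq> G.span (pprods n q)"
  by (rule G.span_mono) (auto simp: pprods_def)

text \<open>Induction on the number of moved points. One cycle is split off and expressed by a power
  sum, the remaining factor by the induction hypothesis, and \<open>Cl_product_in\<close> recombines
  them; the weights add up to the number of moved points.\<close>

lemma Cl_in_pprods:
  "\<pi> \<in> Sym n \<Longrightarrow> Cl n (gel \<pi>) \<in> G.span (pprods n (card (affected \<pi>)))"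
proof (induction "card (affected \<pi>)" arbitrary: \<pi> rule: less_induct)
  case less
  define c where "c = card (affected \<pi>)"
  have H: "Cl n (gel \<rho>) \<in> G.span (pprods n d)"
    if "\<rho> \<in> Sym n" "card (affected \<rho>) < d" "d \<le> c" for \<rho> d
    using less.hyps[of \<rho>] that pprods_mono[of "card (affected \<rho>)" d n] by (auto simp: c_def)
  show ?case
  proof (cases "\<pi> = 1")
    case True
    have "1 \<in> pprods n 0" unfolding pprods_def by (intro CollectI exI[of _ "[]"]) simp
    then have "gscale (of_nat (card (Sym n))) 1 \<in> G.span (pprods n 0)" by (intro G.span_scale G.span_base)
    then show ?thesis using True Cl_of_cent[of n 1] by (simp add: gscale_def)
  next
    case False
    then obtain a where "a \<in> affected \<pi>" by (metis affected_empty_iff equals0I)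
    then obtain js \<rho> where js: "distinct (a # js)" "js \<noteq> []" "\<pi> = star_word js a * \<rho>"
      "set (a # js) \<inter> affected \<rho> = {}" "set (a # js) \<union> affected \<rho> = affected \<pi>"
      by (rule star_word_split)
    have sub: "set (a # js) \<subseteq> {1..n}" "affected \<rho> \<subseteq> {1..n}"
      using less.prems js(5) by (auto simp: Sym_def)
    have cc: "Suc (length js) + card (affected \<rho>) = c"
      using card_Un_disjoint[of "set (a # js)" "affected \<rho>"] js distinct_card[OF js(1)] by (simp add: c_def)
    have swS: "star_word js a \<in> Sym n" using sub by (intro star_word_Sym) auto
    have cs: "card (affected (star_word js a)) \<le> Suc (length js)"
      using card_mono[OF _ affected_star_word[of js a]] distinct_card[OF js(1)] by simp
    have k: "Cl n (gel (star_word js a)) \<in> G.span (pprods n (Suc (length js)))"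
    proof (rule Cl_star_word[OF G.subspace_span js(1) sub(1)])
      show "psum n (length js) \<in> G.span (pprods n (Suc (length js)))"
        using js(2) unfolding pprods_def
        by (intro G.span_base CollectI exI[of _ "[Suc (length js)]"]) (auto simp: pfac_def)
    qed (use H cc in auto)
    have "Cl n (gel (star_word js a * \<rho>)) \<in> G.span (pprods n c)"
    proof (rule Cl_product_in[OF G.subspace_span])
      show "\<rho> \<in> Sym n" using sub by (simp add: Sym_def)
      show "affected (star_word js a) \<inter> affected \<rho> = {}"
        using affected_star_word[of js a] js(4) by auto
      have "Cl n (gel \<rho>) \<in> G.span (pprods n (card (affected \<rho>)))"
        using less.hyps[of \<rho>] cc \<open>\<rho> \<in> Sym n\<close> by (simp add: c_def)
      then show "Cl n (gel (star_word js a)) * Cl n (gel \<rho>) \<in> G.span (pprods n c)"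
        using pprods_mult[OF k, of "Cl n (gel \<rho>)" "card (affected \<rho>)"] cc by simp
      show "Cl n (gel \<sigma>) \<in> G.span (pprods n c)"
        if "\<sigma> \<in> Sym n" "card (affected \<sigma>) < card (affected (star_word js a)) + card (affected \<rho>)" for \<sigma>
        using H[of \<sigma> c] that cs cc by simp
    qed (use swS in auto)
    then show ?thesis by (simp only: c_def js(3)[symmetric])
  qed
qed

definition Zg :: "nat \<Rightarrow> galg set" where "Zg n = {x\<in>GA n. cent n x}"

lemma Zg_subspace: "G.subspace (Zg n)"
  by (rule G.subspaceI) (auto simp: Zg_def gscale_def GA_add cent_add intro: GA_mult cent_mult)

lemma Zg_mult: "x \<in> Zg n \<Longrightarrow> y \<in> Zg n \<Longrightarrow> x * y \<in> Zg n"
  by (auto simp: Zg_def intro: GA_mult cent_mult)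

lemma Zg_psum: "psum n k \<in> Zg n"
  by (simp add: Zg_def psum_GA psum_cent)

lemma Zg_1: "1 \<in> Zg n" by (simp add: Zg_def)

text \<open>The theorem of Jucys on the centre, with an explicit weight bound: no element of
  \<open>Sym n\<close> moves more than \<open>n\<close> points.\<close>

theorem Zg_generated: "Zg n = G.span (pprods n n)"
proof
  show "Zg n \<subseteq> G.span (pprods n n)"
  proof
    fix x assume x: "x \<in> Zg n"
    have "gsc (of_nat (card (Sym n))) * x = Cl n x" using x by (simp add: Zg_def Cl_of_cent)
    also have "\<dots> = Cl n (\<Sum>\<pi>\<in>Sym n. gsc (lookup x \<pi>) * gel \<pi>)"
      using x GA_expand[of x n] by (simp add: Zg_def)
    also have "\<dots> = (\<Sum>\<pi>\<in>Sym n. gscale (lookup x \<pi>) (Cl n (gel \<pi>)))"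
      by (simp add: Cl_sum Cl_gsc gscale_def)
    also have "\<dots> \<in> G.span (pprods n n)"
    proof (intro G.span_sum G.span_scale)
      fix \<pi> assume p: "\<pi> \<in> Sym n"
      then have "card (affected \<pi>) \<le> n" using card_mono[of "{1..n}" "affected \<pi>"] by (simp add: Sym_def)
      then show "Cl n (gel \<pi>) \<in> G.span (pprods n n)" using Cl_in_pprods[OF p] pprods_mono by blast
    qed
    finally show "x \<in> G.span (pprods n n)"
      using G_subspace_cancel[OF G.subspace_span] card_Sym_pos[of n] by fastforce
  qed
  have "prod_list (map (pfac n) xs) \<in> Zg n" for xs
    by (induction xs) (auto simp: pfac_def Zg_1 intro: Zg_mult Zg_psum)
  then show "G.span (pprods n n) \<subseteq> Zg n"
    by (intro G.span_minimal Zg_subspace) (auto simp: pprods_def)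
qed

section \<open>The centraliser of S_m in the group algebra of S_(m+1)\<close>

definition ZL :: "nat \<Rightarrow> galg set" where
  "ZL m = {z * L (Suc m) ^ k | z k. z \<in> Zg m}"

lemma ZL_span_mult:
  assumes "x \<in> G.span (ZL m)" "y \<in> G.span (ZL m)" shows "x * y \<in> G.span (ZL m)"
  using assms
proof (rule G_span_mult)
  fix a b assume "a \<in> ZL m" "b \<in> ZL m"
  then obtain z k z' k' where z: "a = z * L (Suc m) ^ k" "b = z' * L (Suc m) ^ k'" "z \<in> Zg m" "z' \<in> Zg m"
    by (auto simp: ZL_def)
  have "L (Suc m) ^ k * z' = z' * L (Suc m) ^ k"
    using cent_GA_commute[OF cent_power[OF L_cent]] z(4) by (simp add: Zg_def)
  then have "a * b = (z * z') * L (Suc m) ^ (k + k')"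
    unfolding z(1,2) by (metis (no_types) mult.assoc power_add)
  then show "a * b \<in> G.span (ZL m)" using z Zg_mult by (intro G.span_base) (auto simp: ZL_def)
qed

text \<open>A cycle through \<open>Suc m\<close> is produced by a power of \<open>L (Suc m)\<close>;
  the cycles that avoid \<open>Suc m\<close> already lie in the smaller group and average to a
  central element of its group algebra.\<close>

lemma Cl_in_ZL: "\<pi> \<in> Sym (Suc m) \<Longrightarrow> Cl m (gel \<pi>) \<in> G.span (ZL m)"
proof (induction "card (affected \<pi>)" arbitrary: \<pi> rule: less_induct)
  case less
  have ZZ: "z \<in> G.span (ZL m)" if "z \<in> Zg m" for z
    using that unfolding ZL_def by (intro G.span_base CollectI exI[of _ z] exI[of _ 0]) simp
  show ?case
  proof (cases "Suc m \<in> affected \<pi>")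
    case False
    then have "\<pi> \<in> Sym m" using less.prems Sym_Suc_fix by (simp add: in_affected)
    then show ?thesis by (intro ZZ) (auto simp: Zg_def Cl_cent intro: Cl_GA GA_gel)
  next
    case True
    then obtain js \<rho> where js: "distinct (Suc m # js)" "js \<noteq> []" "\<pi> = star_word js (Suc m) * \<rho>"
      "set (Suc m # js) \<inter> affected \<rho> = {}" "set (Suc m # js) \<union> affected \<rho> = affected \<pi>"
      by (rule star_word_split)
    have "affected \<pi> \<subseteq> {1..Suc m}" using less.prems by (simp add: Sym_def)
    then have sub: "set js \<subseteq> {1..m}" "affected \<rho> \<subseteq> {1..m}"
      using js(1,4,5) unfolding atLeastAtMostSuc_conv[OF le_add1[of 1 m, simplified plus_1_eq_Suc]] by auto
    have cc: "Suc (length js) + card (affected \<rho>) = card (affected \<pi>)"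
      using card_Un_disjoint[of "set (Suc m # js)" "affected \<rho>"] js distinct_card[OF js(1)] by simp
    have swS: "star_word js (Suc m) \<in> Sym (Suc m)" using sub by (intro star_word_Sym) auto
    have cs: "card (affected (star_word js (Suc m))) \<le> Suc (length js)"
      using card_mono[OF _ affected_star_word[of js "Suc m"]] distinct_card[OF js(1)] by simp
    have rS: "\<rho> \<in> Sym m" using sub by (simp add: Sym_def)
    have k: "Cl m (gel (star_word js (Suc m))) \<in> G.span (ZL m)"
    proof (rule Cl_star_word_fix[OF G.subspace_span])
      show "L (Suc m) ^ length js \<in> G.span (ZL m)"
        unfolding ZL_def using Zg_1
        by (intro G.span_base CollectI exI[of _ 1] exI[of _ "length js"]) auto
    qed (use js(1) sub cc less.hyps in auto)
    show ?thesis unfolding js(3)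
    proof (rule Cl_product_in[OF G.subspace_span])
      show "\<rho> \<in> Sym (Suc m)" using rS Sym_mono[of m "Suc m"] by auto
      show "affected (star_word js (Suc m)) \<inter> affected \<rho> = {}"
        using affected_star_word[of js "Suc m"] js(4) by auto
      have "Cl m (gel \<rho>) \<in> G.span (ZL m)"
        by (intro ZZ) (use rS in \<open>auto simp: Zg_def Cl_cent intro: Cl_GA GA_gel\<close>)
      then show "Cl m (gel (star_word js (Suc m))) * Cl m (gel \<rho>) \<in> G.span (ZL m)"
        using ZL_span_mult[OF k] by simp
    qed (use swS cs cc less.hyps in auto)
  qed
qed

text \<open>The algebraic form of multiplicity-free branching: the centraliser is generated by
  commuting elements.\<close>

theorem centraliser_generated:
  assumes "x \<in> GA (Suc m)" "cent m x" shows "x \<in> G.span (ZL m)"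
proof -
  have "gsc (of_nat (card (Sym m))) * x = Cl m x" using assms by (simp add: Cl_of_cent)
  also have "\<dots> = Cl m (\<Sum>\<pi>\<in>Sym (Suc m). gsc (lookup x \<pi>) * gel \<pi>)"
    using GA_expand[OF assms(1)] by simp
  also have "\<dots> = (\<Sum>\<pi>\<in>Sym (Suc m). gscale (lookup x \<pi>) (Cl m (gel \<pi>)))"
    by (simp add: Cl_sum Cl_gsc gscale_def)
  also have "\<dots> \<in> G.span (ZL m)"
    by (intro G.span_sum G.span_scale Cl_in_ZL)
  finally show ?thesis
    using G_subspace_cancel[OF G.subspace_span] card_Sym_pos[of m] by fastforce
qed

section \<open>The commutative algebra generated by the Jucys-Murphy elements\<close>

inductive_set JM :: "galg set" where
  JM_gsc: "gsc c \<in> JM"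
| JM_L: "L n \<in> JM"
| JM_add: "x \<in> JM \<Longrightarrow> y \<in> JM \<Longrightarrow> x + y \<in> JM"
| JM_mult: "x \<in> JM \<Longrightarrow> y \<in> JM \<Longrightarrow> x * y \<in> JM"

lemma JM_0: "0 \<in> JM" using JM_gsc[of 0] by simp
lemma JM_1: "1 \<in> JM" using JM_gsc[of 1] by simp
lemma JM_uminus: "x \<in> JM \<Longrightarrow> - x \<in> JM"
  using JM_mult[OF JM_gsc[of "-1"], of x] by (simp add: gsc_minus)
lemma JM_diff: "x \<in> JM \<Longrightarrow> y \<in> JM \<Longrightarrow> x - y \<in> JM"
  using JM_add[of x "- y"] JM_uminus[of y] by simp
lemma JM_power: "x \<in> JM \<Longrightarrow> x ^ k \<in> JM"
  by (induction k) (auto intro: JM_1 JM_mult)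
lemma JM_sum: "(\<And>i. i \<in> A \<Longrightarrow> f i \<in> JM) \<Longrightarrow> sum f A \<in> JM"
  by (induction A rule: infinite_finite_induct) (auto intro: JM_0 JM_add)
lemma JM_psum: "psum n k \<in> JM"
  unfolding psum_def by (intro JM_sum JM_power JM_L)

lemma JM_commute: assumes "x \<in> JM" "y \<in> JM" shows "x * y = y * x"
proof -
  have L: "L n * y = y * L n" for n
    using assms(2)
  proof induction
    case (JM_mult x y) then show ?case by (metis mult.assoc)
  qed (simp_all add: gsc_commute L_commute algebra_simps)
  show ?thesis using assms(1)
  proof induction
    case (JM_mult x z) then show ?case by (metis mult.assoc)
  qed (simp_all add: gsc_commute L algebra_simps)
qed

text \<open>Both the centres and the centralisers lie in \<open>JM\<close> (\<open>Zg_rep\<close>,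
  \<open>centraliser_rep\<close>). As a type of class \<open>comm_ring_1\<close> this algebra admits
  commutative simplification and the evaluation of polynomials.\<close>

typedef gz = JM
  using JM_0 by blast

setup_lifting type_definition_gz

instantiation gz :: comm_ring_1
begin
lift_definition zero_gz :: gz is 0 by (rule JM_0)
lift_definition one_gz :: gz is 1 by (rule JM_1)
lift_definition plus_gz :: "gz \<Rightarrow> gz \<Rightarrow> gz" is "(+)" by (rule JM_add)
lift_definition minus_gz :: "gz \<Rightarrow> gz \<Rightarrow> gz" is "(-)" by (rule JM_diff)
lift_definition uminus_gz :: "gz \<Rightarrow> gz" is "uminus" by (rule JM_uminus)
lift_definition times_gz :: "gz \<Rightarrow> gz \<Rightarrow> gz" is "(*)" by (rule JM_mult)
instance by standard (transfer; simp add: algebra_simps JM_commute)+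
end

abbreviation "rep \<equiv> Rep_gz"

lemmas rep_simps [simp] = zero_gz.rep_eq one_gz.rep_eq plus_gz.rep_eq minus_gz.rep_eq
  uminus_gz.rep_eq times_gz.rep_eq

lift_definition cz :: "complex \<Rightarrow> gz" is gsc by (rule JM_gsc)
lift_definition Lz :: "nat \<Rightarrow> gz" is L by (rule JM_L)

lemmas rep_cz [simp] = cz.rep_eq
lemmas rep_Lz [simp] = Lz.rep_eq

lemma rep_inject: "rep x = rep y \<longleftrightarrow> x = y" by (rule Rep_gz_inject)
lemma rep_power [simp]: "rep (x ^ k) = rep x ^ k" by (induction k) simp_all
lemma rep_sum [simp]: "rep (sum f A) = (\<Sum>i\<in>A. rep (f i))"
  by (induction A rule: infinite_finite_induct) simp_all

lemma cz_0 [simp]: "cz 0 = 0" by transfer simp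
lemma cz_1 [simp]: "cz 1 = 1" by transfer simp
lemma cz_add: "cz (a + b) = cz a + cz b" by transfer (rule gsc_add)
lemma cz_mult: "cz (a * b) = cz a * cz b" by transfer (rule gsc_mult)
lemma cz_minus: "cz (- a) = - cz a" by transfer (rule gsc_minus)
lemma cz_diff: "cz (a - b) = cz a - cz b" by transfer (rule gsc_diff)
lemma cz_power: "cz (a ^ k) = cz a ^ k" by (induction k) (simp_all add: cz_mult)
lemma cz_sum: "cz (sum f A) = (\<Sum>i\<in>A. cz (f i))"
  by (induction A rule: infinite_finite_induct) (simp_all add: cz_add)

definition zscale :: "complex \<Rightarrow> gz \<Rightarrow> gz" where "zscale c x = cz c * x"

global_interpretation Z: vector_space zscale
  by unfold_locales (simp_all add: zscale_def cz_add cz_mult algebra_simps)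

lemma cz_cancel: "cz c * x = 0 \<Longrightarrow> x \<noteq> 0 \<Longrightarrow> c = 0"
  using Z.scale_eq_0_iff[of c x] by (simp add: zscale_def)

global_interpretation rep: Vector_Spaces.linear zscale gscale rep
  by unfold_locales (simp_all add: zscale_def gscale_def)

lemma rep_span: "rep ` Z.span S = G.span (rep ` S)"
  by (rule rep.span_image[symmetric])

subsection \<open>Involutions and positivity\<close>

text \<open>\<open>flip\<close> is the antiautomorphism that inverts group elements,
  \<open>cj\<close> conjugates coefficients; their composition is the adjoint in the group
  algebra.\<close>

definition flip :: "galg \<Rightarrow> galg" where "flip x = Poly_Mapping.map_key inverse x"
definition cj :: "galg \<Rightarrow> galg" where "cj x = Poly_Mapping.map cnj x"

lemma inj_perm_inverse: "inj (inverse :: 'a perm \<Rightarrow> 'a perm)"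
  by (metis injI perm.inverse_inverse)

lemma lookup_flip [simp]: "lookup (flip x) \<pi> = lookup x (inverse \<pi>)"
  by (simp add: flip_def map_key.rep_eq inj_perm_inverse)

lemma lookup_cj [simp]: "lookup (cj x) \<pi> = cnj (lookup x \<pi>)"
  by (simp add: cj_def map.rep_eq when_def)

lemma flip_add: "flip (x + y) = flip x + flip y" by (rule poly_mapping_eqI) (simp add: lookup_add)
lemma cj_add: "cj (x + y) = cj x + cj y" by (rule poly_mapping_eqI) (simp add: lookup_add)
lemma flip_gel [simp]: "flip (gel \<pi>) = gel (inverse \<pi>)"
  by (rule poly_mapping_eqI) (auto simp: lookup_gel)
lemma cj_gel [simp]: "cj (gel \<pi>) = gel \<pi>"
  by (rule poly_mapping_eqI) (auto simp: lookup_gel)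
lemma flip_gsc_mult: "flip (gsc c * x) = gsc c * flip x"
  by (rule poly_mapping_eqI) simp
lemma cj_gsc_mult: "cj (gsc c * x) = gsc (cnj c) * cj x"
  by (rule poly_mapping_eqI) simp
lemma flip_0 [simp]: "flip 0 = 0" by (rule poly_mapping_eqI) simp
lemma cj_0 [simp]: "cj 0 = 0" by (rule poly_mapping_eqI) simp
lemma flip_sum: "flip (sum f A) = (\<Sum>i\<in>A. flip (f i))"
  by (induction A rule: infinite_finite_induct) (simp_all add: flip_add)
lemma cj_sum: "cj (sum f A) = (\<Sum>i\<in>A. cj (f i))"
  by (induction A rule: infinite_finite_induct) (simp_all add: cj_add)
lemma flip_gsc [simp]: "flip (gsc c) = gsc c"
  using flip_gsc_mult[of c 1] flip_gel[of 1] by simp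
lemma cj_gsc [simp]: "cj (gsc c) = gsc (cnj c)"
  using cj_gsc_mult[of c 1] cj_gel[of 1] by simp

lemma gsc_swap: "gsc a * (gsc b * x) = gsc b * (gsc a * x)"
  by (simp add: mult.commute[of a] flip: mult.assoc gsc_mult)

lemma flip_mult: "flip (x * y) = flip y * flip x"
proof -
  have "flip ((\<Sum>\<pi>\<in>keys x. gsc (lookup x \<pi>) * gel \<pi>) * (\<Sum>\<pi>\<in>keys y. gsc (lookup y \<pi>) * gel \<pi>)) =
    flip (\<Sum>\<pi>\<in>keys y. gsc (lookup y \<pi>) * gel \<pi>) * flip (\<Sum>\<pi>\<in>keys x. gsc (lookup x \<pi>) * gel \<pi>)"
    (is "?l = ?r")
  proof -
    have "?l = (\<Sum>\<pi>\<in>keys x. \<Sum>\<sigma>\<in>keys y. gsc (lookup x \<pi>) * (gsc (lookup y \<sigma>) * flip (gel (\<pi> * \<sigma>))))"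
      by (simp add: sum_product flip_sum gel_mult mult.assoc gsc_left_commute[of "gel _"] del: flip_gel)
         (simp add: flip_gsc_mult)
    also have "\<dots> = (\<Sum>\<sigma>\<in>keys y. \<Sum>\<pi>\<in>keys x. gsc (lookup x \<pi>) * (gsc (lookup y \<sigma>) * flip (gel (\<pi> * \<sigma>))))"
      by (rule sum.swap)
    also have "\<dots> = ?r"
      unfolding flip_sum sum_product flip_gsc_mult
      by (intro sum.cong refl) (simp add: mult.assoc gsc_swap gsc_left_commute[of "gel _"] gel_mult[symmetric])
    finally show ?thesis .
  qed
  then show ?thesis using galg_expand[of x] galg_expand[of y] by metis
qed

lemma cj_mult: "cj (x * y) = cj x * cj y"
proof -
  have "cj ((\<Sum>\<pi>\<in>keys x. gsc (lookup x \<pi>) * gel \<pi>) * (\<Sum>\<pi>\<in>keys y. gsc (lookup y \<pi>) * gel \<pi>)) =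
    cj (\<Sum>\<pi>\<in>keys x. gsc (lookup x \<pi>) * gel \<pi>) * cj (\<Sum>\<pi>\<in>keys y. gsc (lookup y \<pi>) * gel \<pi>)"
    (is "?l = ?r")
  proof -
    have "?l = (\<Sum>\<pi>\<in>keys x. \<Sum>\<sigma>\<in>keys y. gsc (cnj (lookup x \<pi>)) * (gsc (cnj (lookup y \<sigma>)) * gel (\<pi> * \<sigma>)))"
      by (simp add: sum_product cj_sum mult.assoc gsc_left_commute[of "gel _"])
         (simp add: cj_gsc_mult flip: gel_mult)
    also have "\<dots> = ?r"
      unfolding cj_sum sum_product cj_gsc_mult cj_gel gel_mult
      by (intro sum.cong refl) (simp add: mult.assoc gsc_swap gsc_left_commute[of "gel _"])
    finally show ?thesis .
  qed
  then show ?thesis using galg_expand[of x] galg_expand[of y] by metis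
qed

lemma flip_L [simp]: "flip (L n) = L n" by (simp add: L_def flip_sum)
lemma cj_L [simp]: "cj (L n) = L n" by (simp add: L_def cj_sum)

text \<open>The generators are scalars and sums of involutions, and on a commutative algebra an
  antiautomorphism respects products in either order.\<close>

lemma flip_JM: "x \<in> JM \<Longrightarrow> flip x = x"
  by (induction rule: JM.induct) (simp_all add: flip_add flip_mult JM_commute)

lemma cj_JM: "x \<in> JM \<Longrightarrow> cj x \<in> JM"
  by (induction rule: JM.induct) (simp_all add: cj_add cj_mult JM.intros)

lemma lookup_mult_1:
  fixes x y :: galg
  shows "lookup (y * x) 1 = (\<Sum>\<pi>\<in>keys x. lookup x \<pi> * lookup y (inverse \<pi>))"
proof -
  have "lookup (y * (\<Sum>\<pi>\<in>keys x. gsc (lookup x \<pi>) * gel \<pi>)) 1 =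
     (\<Sum>\<pi>\<in>keys x. lookup x \<pi> * lookup y (inverse \<pi>))"
    by (simp add: sum_distrib_left lookup_sum gsc_left_commute)
  then show ?thesis using galg_expand[of x] by metis
qed

lift_definition cjz :: "gz \<Rightarrow> gz" is cj by (rule cj_JM)

text \<open>The normalised trace of the regular representation.\<close>

definition tau :: "gz \<Rightarrow> complex" where "tau x = lookup (rep x) 1"

lemma tau_add: "tau (x + y) = tau x + tau y" by (simp add: tau_def lookup_add)
lemma tau_0 [simp]: "tau 0 = 0" by (simp add: tau_def)
lemma tau_cz: "tau (cz c * x) = c * tau x" by (simp add: tau_def)
lemma tau_sum: "tau (sum f A) = (\<Sum>i\<in>A. tau (f i))"
  by (induction A rule: infinite_finite_induct) (simp_all add: tau_add)

lemma cjz_mult: "cjz (x * y) = cjz x * cjz y" by transfer (rule cj_mult)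
lemma cjz_add: "cjz (x + y) = cjz x + cjz y" by transfer (rule cj_add)
lemma cjz_cz [simp]: "cjz (cz c) = cz (cnj c)" by transfer simp
lemma cjz_cjz [simp]: "cjz (cjz x) = x"
  by transfer (auto intro: poly_mapping_eqI)

text \<open>Because \<open>flip\<close> is trivial on \<open>JM\<close>, the coefficient of the
  identity in \<open>cjz x * x\<close> is the sum of the squared moduli of the coefficients of
  \<open>x\<close>.\<close>

lemma tau_pos: "\<exists>t\<ge>0. tau (cjz x * x) = of_real t \<and> (x \<noteq> 0 \<longrightarrow> t > 0)"
proof -
  define t where "t = (\<Sum>\<pi>\<in>keys (rep x). (norm (lookup (rep x) \<pi>))\<^sup>2)"
  have fl: "lookup (rep x) (inverse \<pi>) = lookup (rep x) \<pi>" for \<pi>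
    using flip_JM[OF Rep_gz[of x]] lookup_flip[of "rep x" \<pi>] by simp
  have "tau (cjz x * x) = (\<Sum>\<pi>\<in>keys (rep x). lookup (rep x) \<pi> * cnj (lookup (rep x) \<pi>))"
    by (simp add: tau_def lookup_mult_1 cjz.rep_eq fl)
  also have "\<dots> = of_real t"
    unfolding t_def of_real_sum complex_norm_square ..
  finally have 1: "tau (cjz x * x) = of_real t" .
  have "t > 0" if "x \<noteq> 0"
  proof -
    have "rep x \<noteq> 0" using that rep_inject[of x 0] by simp
    then show ?thesis unfolding t_def by (intro sum_pos) (auto simp: in_keys_iff)
  qed
  moreover have "t \<ge> 0" by (simp add: t_def sum_nonneg)
  ultimately show ?thesis using 1 by blast
qed

text \<open>Semisimplicity is drawn from positivity: if \<open>x * x = 0\<close>, then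
  \<open>cjz x * x\<close> is a self-adjoint element whose square vanishes, so it vanishes itself,
  and with it \<open>x\<close>.\<close>

lemma gz_reduced: fixes x :: gz assumes "x * x = 0" shows "x = 0"
proof (rule ccontr)
  assume "x \<noteq> 0"
  then have h: "cjz x * x \<noteq> 0" using tau_pos[of x] by auto
  have "cjz (cjz x * x) * (cjz x * x) = cjz x * cjz x * (x * x)"
    by (simp add: cjz_mult algebra_simps)
  also have "\<dots> = 0" using assms by simp
  finally show False using tau_pos[of "cjz x * x"] h by auto
qed

section \<open>Decomposition into orthogonal idempotents\<close>

definition evp :: "gz \<Rightarrow> complex poly \<Rightarrow> gz" where "evp z p = poly (map_poly cz p) z"

lemma evp_0 [simp]: "evp z 0 = 0" by (simp add: evp_def)
lemma evp_pCons [simp]: "evp z (pCons a p) = cz a + z * evp z p"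
  by (simp add: evp_def map_poly_pCons)
lemma evp_add: "evp z (p + q) = evp z p + evp z q"
proof -
  have "map_poly cz (p + q) = map_poly cz p + map_poly cz q"
    by (rule poly_eqI) (simp add: coeff_map_poly cz_add)
  then show ?thesis by (simp add: evp_def)
qed
lemma evp_smult: "evp z (smult c p) = cz c * evp z p"
  by (induction p) (simp_all add: cz_mult algebra_simps)
lemma evp_mult: "evp z (p * q) = evp z p * evp z q"
  by (induction p) (simp_all add: evp_add evp_smult algebra_simps)
lemma evp_sum: "evp z (sum f A) = (\<Sum>i\<in>A. evp z (f i))"
  by (induction A rule: infinite_finite_induct) (simp_all add: evp_add)
lemma evp_monom: "evp z (monom c k) = cz c * z ^ k"
  by (induction k) (simp_all add: monom_0 monom_Suc algebra_simps)

lemma evp_eigen: "z * w = cz a * w \<Longrightarrow> evp z p * w = cz (poly p a) * w"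
proof (induction p)
  case (pCons b p)
  have "evp z (pCons b p) * w = cz b * w + z * (evp z p * w)" by (simp add: algebra_simps)
  also have "evp z p * w = cz (poly p a) * w" using pCons by simp
  also have "z * (cz (poly p a) * w) = cz (poly p a) * (z * w)" by (rule mult.left_commute)
  also have "z * w = cz a * w" by (rule pCons.prems)
  also have "cz b * w + cz (poly p a) * (cz a * w) = cz (poly (pCons b p) a) * w"
    by (simp add: cz_add cz_mult algebra_simps)
  finally show ?case .
qed simp

lemma annihilating_poly:
  assumes fin: "finite B" and sp: "\<And>k. z ^ k * i \<in> Z.span B"
  shows "\<exists>q. q \<noteq> 0 \<and> evp z q * i = 0"
proof (cases "inj_on (\<lambda>k. z ^ k * i) {..card B}")
  \<comment> \<open>If two of the powers coincide, the set of powers is too small for a dimension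
    argument, but the difference of two monomials annihilates.\<close>
  case False
  then obtain j k where jk: "j \<noteq> k" "z ^ j * i = z ^ k * i" by (auto simp: inj_on_def)
  have "evp z (monom 1 j + monom (-1) k) * i = 0"
    using jk by (simp add: evp_add evp_monom cz_minus algebra_simps)
  moreover have "coeff (monom 1 j + monom (-1) k :: complex poly) j = 1" using jk by simp
  then have "monom 1 j + monom (-1) k \<noteq> (0 :: complex poly)" by force
  ultimately show ?thesis by blast
next
  case True
  let ?E = "(\<lambda>k. z ^ k * i) ` {..card B}"
  have "card ?E = Suc (card B)" using True by (simp add: card_image)
  then have "Z.dependent ?E"
    using Z.independent_span_bound[OF fin, of ?E] sp by fastforce
  then obtain u where u: "\<exists>v\<in>?E. u v \<noteq> 0" "(\<Sum>v\<in>?E. zscale (u v) v) = 0"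
    using Z.dependent_finite[of ?E] by auto
  define q where "q = (\<Sum>k\<le>card B. monom (u (z ^ k * i)) k)"
  have "coeff q k = u (z ^ k * i)" if "k \<le> card B" for k
    using that by (simp add: q_def coeff_sum)
  then have "q \<noteq> 0" using u(1) by auto
  moreover have "evp z q * i = (\<Sum>k\<le>card B. zscale (u (z ^ k * i)) (z ^ k * i))"
    by (simp add: q_def evp_sum evp_monom sum_distrib_right zscale_def mult.assoc)
  then have "evp z q * i = 0" using u(2) by (simp add: sum.reindex[OF True])
  ultimately show ?thesis by blast
qed

definition orth_idem :: "gz set \<Rightarrow> bool" where
  "orth_idem I \<longleftrightarrow> finite I \<and> 0 \<notin> I \<and> (\<forall>i\<in>I. i * i = i) \<and> (\<forall>i\<in>I. \<forall>j\<in>I. i \<noteq> j \<longrightarrow> i * j = 0)"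

lemma orth_idem_sum_mult:
  assumes "orth_idem I" "j \<in> I"
  shows "(\<Sum>i\<in>I. cz (c i) * i) * j = cz (c j) * j"
proof -
  have "(\<Sum>i\<in>I. cz (c i) * i) * j = (\<Sum>i\<in>I. if i = j then cz (c j) * j else 0)"
    unfolding sum_distrib_right using assms
    by (intro sum.cong refl) (auto simp: orth_idem_def mult.assoc)
  then show ?thesis using assms by (simp add: orth_idem_def)
qed

lemma orth_idem_independent: assumes "orth_idem I" shows "Z.independent I"
proof -
  have fin: "finite I" using assms by (simp add: orth_idem_def)
  show ?thesis
    unfolding Z.dependent_finite[OF fin]
  proof (rule notI, clarify)
    fix u j assume uj: "(\<Sum>v\<in>I. zscale (u v) v) = 0" "j \<in> I" "u j \<noteq> 0"
    then have "cz (u j) * j = 0" using orth_idem_sum_mult[OF assms uj(2), of u] by (simp add: zscale_def)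
    then show False using cz_cancel uj assms by (metis orth_idem_def)
  qed
qed

text \<open>The last clause makes every \<open>i\<close> a common eigenvector of all of
  \<open>S\<close>, so that \<open>i\<close> carries a character of \<open>S\<close>.\<close>

definition idem_basis :: "gz set \<Rightarrow> gz set \<Rightarrow> bool" where
  "idem_basis S I \<longleftrightarrow> orth_idem I \<and> I \<subseteq> S \<and> \<Sum>I = 1 \<and> (\<forall>z\<in>S. \<forall>i\<in>I. \<exists>c. z * i = cz c * i)"

text \<open>Take a decomposition of \<open>1\<close> into as many orthogonal idempotents as
  possible; independence bounds their number by \<open>card B\<close>. If some \<open>z\<close> were
  not scalar on \<open>i\<close>, a root of its minimal polynomial on \<open>i\<close> would give an
  eigenvector, reducedness would make a multiple of it idempotent, and \<open>i\<close> could be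
  split further.\<close>

theorem idem_basis_exists:
  assumes sub: "Z.subspace S" and mult: "\<And>x y. x \<in> S \<Longrightarrow> y \<in> S \<Longrightarrow> x * y \<in> S" and one: "1 \<in> S"
    and B: "finite B" "S \<subseteq> Z.span B"
  shows "\<exists>I. idem_basis S I"
proof -
  define P where "P I \<longleftrightarrow> orth_idem I \<and> I \<subseteq> S \<and> \<Sum>I = 1" for I
  have "orth_idem {1} \<and> \<Sum>{1::gz} = 1"
    using rep_inject[of 1 0] by (auto simp: orth_idem_def)
  then have "P {1}" using one by (simp add: P_def)
  moreover have "card I < Suc (card B)" if "P I" for I
  proof -
    have "I \<subseteq> Z.span B" using that B by (auto simp: P_def)
    then show ?thesis
      using Z.independent_span_bound[OF B(1), of I] orth_idem_independent[of I] that by (auto simp: P_def)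
  qed
  ultimately obtain I where I: "P I" "\<And>J. P J \<Longrightarrow> card J \<le> card I"
    using ex_has_greatest_nat[of P "{1}" card "Suc (card B)"] by (metis less_imp_le)
  have oI: "orth_idem I" "I \<subseteq> S" "\<Sum>I = 1" using I(1) by (auto simp: P_def)
  have finI: "finite I" using oI by (simp add: orth_idem_def)
  have "\<exists>c. z * i = cz c * i" if zi: "z \<in> S" "i \<in> I" for z i
  proof (rule ccontr)
    assume neg: "\<nexists>c. z * i = cz c * i"
    have ii: "i * i = i" "i \<noteq> 0" "i \<in> S" using oI zi by (auto simp: orth_idem_def)
    have zk: "z ^ k \<in> S" for k by (induction k) (auto simp: one mult zi)
    have cs: "cz c * x \<in> S" if "x \<in> S" for c x
      using Z.subspace_scale[OF sub that, of c] by (simp add: zscale_def)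
    have evS: "evp z p \<in> S" for p
    proof (induction p)
      case (pCons a p)
      have "cz a \<in> S" using cs[OF one, of a] by simp
      then show ?case using pCons mult zi Z.subspace_add[OF sub] by simp
    qed (simp add: Z.subspace_0[OF sub])
    have "\<exists>q. q \<noteq> 0 \<and> evp z q * i = 0"
      by (rule annihilating_poly[OF B(1)]) (use zk mult ii B in blast)
    then obtain q where q: "q \<noteq> 0" "evp z q * i = 0"
      "\<And>p. p \<noteq> 0 \<Longrightarrow> evp z p * i = 0 \<Longrightarrow> degree q \<le> degree p"
      using ex_has_least_nat[of "\<lambda>q. q \<noteq> 0 \<and> evp z q * i = 0" _ degree] by metis
    have "degree q \<noteq> 0"
    proof
      assume "degree q = 0"
      then obtain c where c: "q = [:c:]" using degree_eq_zeroE by blast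
      then have "cz c * i = 0" using q(2) by simp
      then show False using cz_cancel ii q(1) c by auto
    qed
    then obtain a where a: "poly q a = 0"
      using fundamental_theorem_of_algebra[of q] constant_degree[of q] by auto
    then obtain g where g: "q = [:- a, 1:] * g" by (auto simp: poly_eq_0_iff_dvd elim: dvdE)
    have g0: "g \<noteq> 0" using q(1) g by auto
    have "degree g < degree q" using g0 unfolding g by (subst degree_mult_eq) auto
    \<comment> \<open>The cofactor of a root of the minimal annihilating polynomial: non-zero by
      minimality, and an eigenvector for that root.\<close>
    define w where "w = evp z g * i"
    have w0: "w \<noteq> 0" using q(3)[OF g0] \<open>degree g < degree q\<close> by (auto simp: w_def)
    have "(z - cz a) * w = 0"
      using q(2) unfolding g evp_mult by (simp add: w_def cz_minus algebra_simps)
    then have zw: "z * w = cz a * w" by (simp add: algebra_simps)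
    have "i * w = evp z g * (i * i)" by (simp add: w_def algebra_simps)
    then have iw: "i * w = w" by (simp add: ii(1) w_def)
    define b where "b = poly g a"
    have ww: "w * w = cz b * w"
    proof -
      have "w * w = evp z g * (i * w)" by (simp add: w_def algebra_simps)
      then show ?thesis using evp_eigen[OF zw] iw by (simp add: b_def)
    qed
    \<comment> \<open>Here reducedness enters: for \<open>b = 0\<close> the square of
      \<open>w\<close> would vanish.\<close>
    have b0: "b \<noteq> 0" using ww gz_reduced[of w] w0 by auto
    define f where "f = cz (1 / b) * w"
    have "f * f = cz (1 / b) * cz (1 / b) * (w * w)" by (simp add: f_def algebra_simps)
    also have "\<dots> = cz (1 / b * (1 / b) * b) * w" by (simp only: ww cz_mult ac_simps)
    also have "1 / b * (1 / b) * b = 1 / b" using b0 by simp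
    also have "cz (1 / b) * w = f" by (simp only: f_def)
    finally have ff: "f * f = f" .
    have "i * f = cz (1 / b) * (i * w)" by (simp only: f_def ac_simps)
    then have fi: "f * i = f" "i * f = f" by (simp_all add: iw f_def mult.commute)
    have "w = cz b * f" using b0 by (simp add: f_def mult.assoc[symmetric] flip: cz_mult)
    then have f0: "f \<noteq> 0" using w0 by auto
    have "z * f = cz (1 / b) * (z * w)" by (simp only: f_def ac_simps)
    also have "\<dots> = cz a * f" unfolding zw f_def by (simp only: ac_simps)
    finally have zf: "z * f = cz a * f" .
    \<comment> \<open>\<open>f = i\<close> would make \<open>z\<close> scalar on
      \<open>i\<close>.\<close>
    have fni: "f \<noteq> i" using neg zf by auto
    have fS: "f \<in> S" unfolding f_def w_def by (intro cs mult evS ii)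
    have fo: "f * j = 0" "(i - f) * j = 0" if "j \<in> I" "j \<noteq> i" for j
    proof -
      have ij: "i * j = 0" using that zi oI by (auto simp: orth_idem_def)
      have "f * j = f * (i * j)" using fi by (simp add: mult.assoc[symmetric])
      then show "f * j = 0" using ij by simp
      then show "(i - f) * j = 0" using ij by (simp add: algebra_simps)
    qed
    define J where "J = insert f (insert (i - f) (I - {i}))"
    have nf: "f \<notin> I - {i}" using fo(1)[of f] ff f0 by auto
    have nif: "i - f \<notin> I - {i}"
    proof
      assume "i - f \<in> I - {i}"
      then have "(i - f) * (i - f) = 0" using fo(2) by blast
      then show False using gz_reduced[of "i - f"] fni by auto
    qed
    have fif: "f * (i - f) = 0" using ff fi by (simp add: algebra_simps)
    then have nff: "f \<noteq> i - f" using ff f0 by auto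
    have idif: "(i - f) * (i - f) = i - f" using ff fi ii by (simp add: algebra_simps)
    have "orth_idem J"
      unfolding orth_idem_def
    proof (intro conjI ballI impI)
      show "finite J" using finI by (simp add: J_def)
      show "0 \<notin> J" using oI f0 fni by (auto simp: J_def orth_idem_def)
      show "x * x = x" if "x \<in> J" for x using that ff idif oI by (auto simp: J_def orth_idem_def)
      show "x * y = 0" if "x \<in> J" "y \<in> J" "x \<noteq> y" for x y
      proof -
        have "(i - f) * f = 0" using fif by (simp add: mult.commute)
        moreover have "j * f = 0" "j * (i - f) = 0" if "j \<in> I" "j \<noteq> i" for j
          using fo[OF that] by (simp_all only: mult.commute[of j])
        moreover have "j * k = 0" if "j \<in> I" "k \<in> I" "j \<noteq> k" for j k
          using oI(1) that by (auto simp: orth_idem_def)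
        ultimately show ?thesis using that fif fo unfolding J_def by blast
      qed
    qed
    moreover have "J \<subseteq> S" using fS ii oI Z.subspace_diff[OF sub ii(3) fS] by (auto simp: J_def)
    moreover have "\<Sum>J = 1"
    proof -
      have "\<Sum>J = f + (i - f) + \<Sum>(I - {i})" using nf nif nff finI by (simp add: J_def algebra_simps)
      also have "\<dots> = \<Sum>I" using sum.remove[OF finI zi(2), of "\<lambda>x. x"] by simp
      finally show ?thesis using oI by simp
    qed
    ultimately have "card J \<le> card I" using I(2) by (simp add: P_def)
    moreover have "card J = Suc (card I)"
      using nf nif nff finI zi(2) card_Suc_Diff1[OF finI zi(2)] by (simp add: J_def)
    ultimately show False by simp
  qed
  then show ?thesis using oI unfolding idem_basis_def by blast
qed

section \<open>Characters of the centres\<close>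

definition Zc :: "nat \<Rightarrow> gz set" where "Zc n = {x. rep x \<in> Zg n}"

lemma Zc_subspace: "Z.subspace (Zc n)"
proof (rule Z.subspaceI)
  fix c x assume "x \<in> Zc n"
  then show "zscale c x \<in> Zc n"
    using G.subspace_scale[OF Zg_subspace, of "rep x" n c] by (simp add: Zc_def zscale_def gscale_def)
qed (use G.subspace_0[OF Zg_subspace] G.subspace_add[OF Zg_subspace] in \<open>auto simp: Zc_def\<close>)

lemma Zc_mult: "x \<in> Zc n \<Longrightarrow> y \<in> Zc n \<Longrightarrow> x * y \<in> Zc n"
  by (simp add: Zc_def Zg_mult)
lemma Zc_1: "1 \<in> Zc n" by (simp add: Zc_def Zg_1)
lemma Zc_add: "x \<in> Zc n \<Longrightarrow> y \<in> Zc n \<Longrightarrow> x + y \<in> Zc n"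
  using Z.subspace_add[OF Zc_subspace] .
lemma Zc_cz_mult: "x \<in> Zc n \<Longrightarrow> cz c * x \<in> Zc n"
  using Z.subspace_scale[OF Zc_subspace] by (simp add: zscale_def)
lemma Zc_cz: "cz c \<in> Zc n" using Zc_cz_mult[OF Zc_1, of c] by simp
lemma Zc_sum: "(\<And>i. i \<in> A \<Longrightarrow> f i \<in> Zc n) \<Longrightarrow> sum f A \<in> Zc n"
  using Z.subspace_sum[OF Zc_subspace] .

definition psz :: "nat \<Rightarrow> nat \<Rightarrow> gz" where "psz n k = (\<Sum>i\<in>{1..n}. Lz i ^ k)"

lemma rep_psz [simp]: "rep (psz n k) = psum n k" by (simp add: psz_def psum_def)
lemma Zc_psz: "psz n k \<in> Zc n" by (simp add: Zc_def Zg_psum)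
lemma psz_Suc: "psz (Suc n) k = psz n k + Lz (Suc n) ^ k" by (simp add: psz_def)

definition pfz :: "nat \<Rightarrow> nat \<Rightarrow> gz" where "pfz n x = (if x \<le> 1 then 1 else psz n (x - 1))"

lemma rep_pfz_prod: "rep (prod_list (map (pfz n) xs)) = prod_list (map (pfac n) xs)"
  by (induction xs) (simp_all add: pfz_def pfac_def)

lemma finite_partitions: "finite (partitions n)"
proof (rule finite_subset)
  show "partitions n \<subseteq> {xs. set xs \<subseteq> {..n} \<and> length xs \<le> n}"
  proof
    fix xs assume xs: "xs \<in> partitions n"
    have "length xs \<le> sum_list xs" if "\<forall>x\<in>set xs. 0 < x" for xs :: "nat list"
      using that by (induction xs) auto
    then show "xs \<in> {xs. set xs \<subseteq> {..n} \<and> length xs \<le> n}"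
      using xs member_le_sum_list[of _ xs] by (auto simp: partitions_def)
  qed
qed (simp add: finite_lists_length_le)

lemma Zc_eq_span: "Zc n = Z.span ((\<lambda>xs. prod_list (map (pfz n) xs)) ` partitions n)"
proof -
  have 1: "rep ` (\<lambda>xs. prod_list (map (pfz n) xs)) ` partitions n = pprods n n" (is "?l = _")
  proof
    show "?l \<subseteq> pprods n n"
      by (auto simp: image_image rep_pfz_prod pprods_def partitions_def)
    show "pprods n n \<subseteq> ?l"
    proof
      fix y assume "y \<in> pprods n n"
      then obtain xs where xs: "y = prod_list (map (pfac n) xs)" "\<forall>x\<in>set xs. 0 < x" "sum_list xs \<le> n"
        by (auto simp: pprods_def)
      \<comment> \<open>Parts \<open>1\<close> have the factor \<open>1\<close>, so they pad the
        weight up to \<open>n\<close>; sorting changes nothing in a commutative ring.\<close>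
      define ys where "ys = rev (sort (xs @ replicate (n - sum_list xs) 1))"
      have ms: "mset ys = mset (xs @ replicate (n - sum_list xs) 1)" by (simp add: ys_def)
      have "ys \<in> partitions n"
      proof -
        have "sum_list ys = sum_list (xs @ replicate (n - sum_list xs) 1)"
          using ms by (metis sum_mset_sum_list)
        moreover have "set ys = set (xs @ replicate (n - sum_list xs) 1)" using ms by (metis set_mset_mset)
        moreover have "sorted_wrt (\<ge>) ys" by (simp add: ys_def sorted_wrt_rev)
        ultimately show ?thesis using xs by (auto simp: partitions_def sum_list_replicate)
      qed
      moreover have "prod_list (map (pfz n) ys) = prod_list (map (pfz n) (xs @ replicate (n - sum_list xs) 1))"
        by (metis ms mset_map prod_mset_prod_list)
      then have "prod_list (map (pfz n) ys) = prod_list (map (pfz n) xs)"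
        by (simp add: pfz_def)
      then have "y = rep (prod_list (map (pfz n) ys))" by (simp add: xs(1) rep_pfz_prod)
      ultimately show "y \<in> ?l" by blast
    qed
  qed
  show ?thesis
  proof (intro equalityI subsetI)
    fix x assume "x \<in> Zc n"
    then have "rep x \<in> rep ` Z.span ((\<lambda>xs. prod_list (map (pfz n) xs)) ` partitions n)"
      by (simp only: rep_span 1) (simp add: Zc_def Zg_generated)
    then show "x \<in> Z.span ((\<lambda>xs. prod_list (map (pfz n) xs)) ` partitions n)" using rep_inject by auto
  next
    fix x assume "x \<in> Z.span ((\<lambda>xs. prod_list (map (pfz n) xs)) ` partitions n)"
    then have "rep x \<in> rep ` Z.span ((\<lambda>xs. prod_list (map (pfz n) xs)) ` partitions n)" by (rule imageI)
    then have "rep x \<in> Zg n" by (simp only: rep_span 1 Zg_generated)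
    then show "x \<in> Zc n" by (simp add: Zc_def)
  qed
qed

lemma Zg_rep: "x \<in> Zg n \<Longrightarrow> \<exists>z\<in>Zc n. x = rep z"
proof -
  assume "x \<in> Zg n"
  moreover have "G.span (pprods n n) \<subseteq> JM"
  proof (rule G.span_minimal)
    have "prod_list (map (pfac n) xs) \<in> JM" for xs
      by (induction xs) (auto simp: pfac_def JM_1 intro: JM_mult JM_psum)
    then show "pprods n n \<subseteq> JM" by (auto simp: pprods_def)
    show "G.subspace JM"
      by (rule G.subspaceI) (auto simp: gscale_def intro: JM_0 JM_add JM_mult JM_gsc)
  qed
  ultimately have "x \<in> JM" using Zg_generated by blast
  then have "x = rep (Abs_gz x)" by (simp add: Abs_gz_inverse)
  then show ?thesis using \<open>x \<in> Zg n\<close> unfolding Zc_def by (metis mem_Collect_eq)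
qed

lemma centraliser_rep:
  assumes "x \<in> GA (Suc m)" "cent m x"
  shows "\<exists>z. z \<in> Z.span {z * Lz (Suc m) ^ k | z k. z \<in> Zc m} \<and> x = rep z"
proof -
  have "rep ` {z * Lz (Suc m) ^ k | z k. z \<in> Zc m} = ZL m"
  proof (intro equalityI subsetI)
    fix y assume "y \<in> ZL m"
    then obtain z k where zk: "y = z * L (Suc m) ^ k" "z \<in> Zg m" by (auto simp: ZL_def)
    then obtain z' where z': "z' \<in> Zc m" "z = rep z'" using Zg_rep by blast
    then have "y = rep (z' * Lz (Suc m) ^ k)" using zk by simp
    then show "y \<in> rep ` {z * Lz (Suc m) ^ k | z k. z \<in> Zc m}" using z' by blast
  next
    fix y assume "y \<in> rep ` {z * Lz (Suc m) ^ k | z k. z \<in> Zc m}"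
    then obtain z k where "y = rep (z * Lz (Suc m) ^ k)" "z \<in> Zc m" by blast
    then show "y \<in> ZL m" unfolding ZL_def Zc_def by auto
  qed
  then have "x \<in> rep ` Z.span {z * Lz (Suc m) ^ k | z k. z \<in> Zc m}"
    using centraliser_generated[OF assms] by (simp only: rep_span)
  then show ?thesis by blast
qed

section \<open>Primitive central idempotents and central characters\<close>

definition Iz :: "nat \<Rightarrow> gz set" where "Iz n = (SOME I. idem_basis (Zc n) I)"

lemma Iz_basis: "idem_basis (Zc n) (Iz n)"
  unfolding Iz_def
proof (rule someI_ex, rule idem_basis_exists[OF Zc_subspace Zc_mult Zc_1])
  show "finite ((\<lambda>xs. prod_list (map (pfz n) xs)) ` partitions n)" by (simp add: finite_partitions)
  show "Zc n \<subseteq> Z.span ((\<lambda>xs. prod_list (map (pfz n) xs)) ` partitions n)" by (simp add: Zc_eq_span)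
qed

lemma Iz_orth: "orth_idem (Iz n)" and Iz_sub: "Iz n \<subseteq> Zc n" and Iz_sum: "\<Sum>(Iz n) = 1"
  using Iz_basis[of n] by (auto simp: idem_basis_def)
lemma finite_Iz [simp]: "finite (Iz n)" using Iz_orth by (simp add: orth_idem_def)
lemma Iz_nz: "i \<in> Iz n \<Longrightarrow> i \<noteq> 0" using Iz_orth[of n] by (auto simp: orth_idem_def)
lemma Iz_idem: "i \<in> Iz n \<Longrightarrow> i * i = i" using Iz_orth[of n] by (auto simp: orth_idem_def)
lemma Iz_orthD: "i \<in> Iz n \<Longrightarrow> j \<in> Iz n \<Longrightarrow> i \<noteq> j \<Longrightarrow> i * j = 0"
  using Iz_orth[of n] by (auto simp: orth_idem_def)

definition chr :: "gz \<Rightarrow> gz \<Rightarrow> complex" where "chr i z = (SOME c. z * i = cz c * i)"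

lemma chr: "i \<in> Iz n \<Longrightarrow> z \<in> Zc n \<Longrightarrow> z * i = cz (chr i z) * i"
  unfolding chr_def by (rule someI_ex) (use Iz_basis[of n] in \<open>auto simp: idem_basis_def\<close>)

text \<open>The factor \<open>x\<close> allows the eigenvalue to be read off from any non-zero
  multiple of \<open>i\<close>, for instance from \<open>i * j\<close> with an idempotent
  \<open>j\<close> of the smaller group.\<close>

lemma chr_unique: "i \<in> Iz n \<Longrightarrow> z \<in> Zc n \<Longrightarrow> x * i \<noteq> 0 \<Longrightarrow> z * (x * i) = cz c * (x * i) \<Longrightarrow> chr i z = c"
proof -
  assume a: "i \<in> Iz n" "z \<in> Zc n" "x * i \<noteq> 0" "z * (x * i) = cz c * (x * i)"
  have "z * (x * i) = cz (chr i z) * (x * i)"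
    using chr[OF a(1,2)] by (metis mult.left_commute)
  then have "cz (chr i z - c) * (x * i) = 0" using a(4) by (simp add: cz_diff algebra_simps)
  then have "chr i z - c = 0" using cz_cancel a(3) by blast
  then show ?thesis by simp
qed

lemma Zc_expand: "z \<in> Zc n \<Longrightarrow> z = (\<Sum>i\<in>Iz n. cz (chr i z) * i)"
proof -
  assume z: "z \<in> Zc n"
  have "z = z * (\<Sum>i\<in>Iz n. i)" by (simp add: Iz_sum)
  also have "\<dots> = (\<Sum>i\<in>Iz n. z * i)" by (rule sum_distrib_left)
  also have "\<dots> = (\<Sum>i\<in>Iz n. cz (chr i z) * i)" using chr z by (intro sum.cong) auto
  finally show ?thesis .
qed

section \<open>The number of conjugacy classes\<close>

text \<open>Points are counted instead of cycles, so a cycle of length \<open>j\<close> contributes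
  \<open>j\<close>. Fixed points are left out, as every element of \<open>nat perm\<close> has
  infinitely many of them.\<close>

definition cyc_count :: "nat perm \<Rightarrow> nat \<Rightarrow> nat" where
  "cyc_count \<pi> j = card {a \<in> affected \<pi>. Perm.order \<pi> a = j}"

lemma conj_power: "(\<sigma> * \<pi> * inverse \<sigma>) ^ k = \<sigma> * \<pi> ^ k * inverse (\<sigma> :: 'a perm)"
  by (induction k) (simp_all add: conj_mult)

lemma order_conj: "Perm.order (\<sigma> * \<pi> * inverse \<sigma>) (\<sigma> \<langle>$\<rangle> a) = Perm.order \<pi> a"
proof -
  have "Perm.orbit (\<sigma> * \<pi> * inverse \<sigma>) (\<sigma> \<langle>$\<rangle> a) = (\<langle>$\<rangle>) \<sigma> ` Perm.orbit \<pi> a"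
    by (auto simp: Perm.orbit_def conj_power apply_times)
  then show ?thesis
    by (simp add: card_image inj_on_def apply_inj flip: card_orbit_eq)
qed

lemma cyc_count_conj: "cyc_count (\<sigma> * \<pi> * inverse \<sigma>) j = cyc_count \<pi> j"
proof -
  have "{a \<in> affected (\<sigma> * \<pi> * inverse \<sigma>). Perm.order (\<sigma> * \<pi> * inverse \<sigma>) a = j}
      = (\<langle>$\<rangle>) \<sigma> ` {a \<in> affected \<pi>. Perm.order \<pi> a = j}"
    unfolding affected_conj by (auto simp: order_conj)
  then show ?thesis by (simp add: cyc_count_def card_image inj_on_def apply_inj)
qed

lemma order_disjoint_mult:
  assumes "affected \<kappa> \<inter> affected \<pi> = {}" "a \<in> affected \<kappa>"
  shows "Perm.order (\<kappa> * \<pi>) a = Perm.order \<kappa> a"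
proof -
  have "(\<kappa> ^ k) \<langle>$\<rangle> a \<in> affected \<kappa> \<and> ((\<kappa> * \<pi>) ^ k) \<langle>$\<rangle> a = (\<kappa> ^ k) \<langle>$\<rangle> a" for k
  proof (induction k)
    case (Suc k)
    then have "(\<kappa> ^ k) \<langle>$\<rangle> a \<notin> affected \<pi>" using assms(1) by blast
    with Suc show ?case by (simp add: apply_times in_affected apply_inj)
  qed (use assms in simp)
  then have "Perm.orbit (\<kappa> * \<pi>) a = Perm.orbit \<kappa> a" by (simp add: Perm.orbit_def)
  then show ?thesis by (simp flip: card_orbit_eq)
qed

lemma affected_disjoint_mult:
  assumes "affected \<kappa> \<inter> affected \<pi> = {}"
  shows "affected (\<kappa> * \<pi>) = affected \<kappa> \<union> affected \<pi>"
proof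
  show "affected (\<kappa> * \<pi>) \<subseteq> affected \<kappa> \<union> affected \<pi>" by (rule affected_times)
  show "affected \<kappa> \<union> affected \<pi> \<subseteq> affected (\<kappa> * \<pi>)"
  proof
    fix a assume "a \<in> affected \<kappa> \<union> affected \<pi>"
    moreover have "a \<in> affected (\<kappa> * \<pi>)" if "a \<in> affected \<kappa>"
    proof -
      have "\<pi> \<langle>$\<rangle> a = a" using that assms by (auto simp: in_affected)
      then show ?thesis using that by (simp add: in_affected apply_times)
    qed
    moreover have "a \<in> affected (\<kappa> * \<pi>)" if "a \<in> affected \<pi>"
    proof -
      have "\<pi> \<langle>$\<rangle> a \<in> affected \<pi>" "\<pi> \<langle>$\<rangle> a \<noteq> a" using that by (auto simp: in_affected apply_inj)
      moreover have "\<pi> \<langle>$\<rangle> a \<notin> affected \<kappa>" using calculation assms by blast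
      ultimately show ?thesis by (simp add: in_affected apply_times)
    qed
    ultimately show "a \<in> affected (\<kappa> * \<pi>)" by blast
  qed
qed

lemma cyc_count_disjoint:
  assumes "affected \<kappa> \<inter> affected \<pi> = {}"
  shows "cyc_count (\<kappa> * \<pi>) j = cyc_count \<kappa> j + cyc_count \<pi> j"
proof -
  have comm: "\<kappa> * \<pi> = \<pi> * \<kappa>" using perm_mult_commute[OF assms] by simp
  have "{a \<in> affected (\<kappa> * \<pi>). Perm.order (\<kappa> * \<pi>) a = j} =
      {a \<in> affected \<kappa>. Perm.order \<kappa> a = j} \<union> {a \<in> affected \<pi>. Perm.order \<pi> a = j}"
    using order_disjoint_mult[OF assms] order_disjoint_mult[of \<pi> \<kappa>] assms
    unfolding affected_disjoint_mult[OF assms] by (auto simp: comm Int_commute)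
  then show ?thesis
    unfolding cyc_count_def using assms by (simp add: card_Un_disjoint disjoint_iff)
qed

lemma star_word_center: "distinct (a # js) \<Longrightarrow> js \<noteq> [] \<Longrightarrow> star_word js a \<langle>$\<rangle> a = last js"
proof (induction js)
  case (Cons j js)
  then show ?case
  proof (cases "js = []")
    case False
    then have "last js \<in> set js" by simp
    then have "last js \<noteq> j" "last js \<noteq> a" using Cons.prems by auto
    then show ?thesis using Cons False by (simp add: apply_times)
  qed (simp add: apply_times)
qed simp

lemma star_word_nth:
  "distinct (a # js) \<Longrightarrow> k < length js \<Longrightarrow>
    star_word js a \<langle>$\<rangle> (js ! k) = (if k = 0 then a else js ! (k - 1))"
proof (induction js arbitrary: k)
  case (Cons j js)
  have fix_: "star_word js a \<langle>$\<rangle> j = j"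
    using affected_star_word[of js a] Cons.prems(1) in_affected[of j "star_word js a"] by auto
  show ?case
  proof (cases k)
    case (Suc i)
    then have i: "i < length js" using Cons.prems by simp
    have "js ! i' \<noteq> j" "js ! i' \<noteq> a" if "i' < length js" for i'
      using Cons.prems(1) nth_mem[OF that] by auto
    then show ?thesis using Suc Cons.IH[OF _ i] Cons.prems(1) i by (cases i) (auto simp: apply_times)
  qed (simp add: apply_times fix_)
qed simp

lemma order_star_word:
  assumes "distinct (a # js)" "js \<noteq> []" "c \<in> set (a # js)"
  shows "Perm.order (star_word js a) c = Suc (length js)"
proof -
  let ?f = "star_word js a"
  let ?n = "length js"
  \<comment> \<open>Starting at the centre, the word runs through its letters from the last one to
    the first.\<close>
  have p: "(?f ^ Suc k) \<langle>$\<rangle> a = js ! (?n - 1 - k)" if "k < ?n" for k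
    using that
  proof (induction k)
    case 0
    then show ?case using star_word_center[OF assms(1,2)] assms(2) by (simp add: last_conv_nth)
  next
    case (Suc k)
    have "(?f ^ Suc (Suc k)) \<langle>$\<rangle> a = ?f \<langle>$\<rangle> ((?f ^ Suc k) \<langle>$\<rangle> a)" by (simp add: apply_times)
    also have "\<dots> = ?f \<langle>$\<rangle> (js ! (?n - 1 - k))" using Suc by simp
    also have "\<dots> = js ! (?n - 1 - Suc k)" using Suc.prems by (subst star_word_nth[OF assms(1)]) auto
    finally show ?case .
  qed
  have sub: "set (a # js) \<subseteq> Perm.orbit ?f a"
  proof
    fix d assume "d \<in> set (a # js)"
    moreover have "d \<in> Perm.orbit ?f a" if dj: "d \<in> set js"
    proof -
      obtain i where i: "i < ?n" "d = js ! i" using dj by (auto simp: in_set_conv_nth)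
      then have "d = (?f ^ Suc (?n - 1 - i)) \<langle>$\<rangle> a" by (subst p) auto
      then show ?thesis unfolding Perm.orbit_def by blast
    qed
    ultimately show "d \<in> Perm.orbit ?f a" by auto
  qed
  have "a \<in> affected ?f" using star_word_center[OF assms(1,2)] assms(1,2) last_in_set[OF assms(2)]
    by (auto simp: in_affected)
  then have "Perm.orbit ?f a \<subseteq> set (a # js)"
    using orbit_subset_eq_affected[of a ?f] affected_star_word[of js a] by auto
  then have o: "Perm.orbit ?f a = set (a # js)" using sub by blast
  then have "Perm.orbit ?f c = Perm.orbit ?f a"
    using assms(3) orbit_equiv by metis
  then show ?thesis using o distinct_card[OF assms(1)] by (simp flip: card_orbit_eq)
qed

lemma cyc_count_star_word:
  assumes "distinct (a # js)" "js \<noteq> []"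
  shows "cyc_count (star_word js a) j = (if j = Suc (length js) then j else 0)"
proof -
  have "Perm.order (star_word js a) c = Suc (length js) \<and> c \<in> affected (star_word js a)" if "c \<in> set (a # js)" for c
  proof -
    have "Perm.order (star_word js a) c \<noteq> 1" using order_star_word[OF assms that] assms(2) by simp
    then show ?thesis using order_star_word[OF assms that] order_eq_one_iff by (metis One_nat_def)
  qed
  then have "affected (star_word js a) = set (a # js)"
    using affected_star_word[of js a] by auto
  then have "{c \<in> affected (star_word js a). Perm.order (star_word js a) c = j} =
      (if j = Suc (length js) then set (a # js) else {})"
    using order_star_word[OF assms] by auto
  then show ?thesis using distinct_card[OF assms(1)] by (simp add: cyc_count_def)
qed

text \<open>The cycles are placed side by side: a part \<open>x\<close> occupies the block of
  \<open>x\<close> points that follows the points used for the rest of the list.\<close>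

lemma cyc_count_realised:
  assumes "\<forall>x\<in>set xs. 0 < (x::nat)"
  shows "\<exists>\<pi>\<in>Sym (sum_list xs). \<forall>j\<ge>2. cyc_count \<pi> j = j * count_list xs j"
  using assms
proof (induction xs)
  case Nil
  then show ?case by (simp add: cyc_count_def)
next
  case (Cons x xs)
  then obtain \<pi> where p: "\<pi> \<in> Sym (sum_list xs)" "\<forall>j\<ge>2. cyc_count \<pi> j = j * count_list xs j" by auto
  let ?s = "sum_list xs"
  show ?case
  proof (cases "x = 1")
    case True
    then show ?thesis using p Sym_mono[of ?s "Suc ?s"] by (intro bexI[of _ \<pi>]) auto
  next
    case False
    define \<kappa> where "\<kappa> = star_word [Suc ?s..<?s + x] (?s + x)"
    have d: "distinct ((?s + x) # [Suc ?s..<?s + x])" "[Suc ?s..<?s + x] \<noteq> []"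
      using False Cons.prems by auto
    have ak: "affected \<kappa> \<subseteq> {Suc ?s..?s + x}"
      using affected_star_word[of "[Suc ?s..<?s + x]" "?s + x"] Cons.prems unfolding \<kappa>_def by fastforce
    have dis: "affected \<kappa> \<inter> affected \<pi> = {}" using ak p(1) by (fastforce simp: Sym_def)
    have "\<kappa> * \<pi> \<in> Sym (sum_list (x # xs))"
      using affected_disjoint_mult[OF dis] ak p(1) by (fastforce simp: Sym_def)
    moreover have "cyc_count (\<kappa> * \<pi>) j = j * count_list (x # xs) j" if "j \<ge> 2" for j
    proof -
      have "cyc_count \<kappa> j = (if x = j then j else 0)"
        using cyc_count_star_word[OF d, of j] False Cons.prems unfolding \<kappa>_def by auto
      then show ?thesis using that p(2) by (simp add: cyc_count_disjoint[OF dis])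
    qed
    ultimately show ?thesis by blast
  qed
qed

lemma sum_list_count_list: "sum_list xs = (\<Sum>x\<in>set xs. x * count_list xs x)" for xs :: "nat list"
  using sum_list_map_eq_sum_count[of "\<lambda>x. x" xs] by (simp add: mult.commute)

text \<open>Cycle counts do not see fixed points; the number of parts \<open>1\<close> is recovered
  from the common sum.\<close>

lemma partitions_eqI:
  assumes "xs \<in> partitions n" "ys \<in> partitions n" "\<And>j. j \<ge> 2 \<Longrightarrow> count_list xs j = count_list ys j"
  shows "xs = ys"
proof -
  let ?A = "set xs \<union> set ys \<union> {1}"
  have s: "sum_list zs = (\<Sum>x\<in>?A. x * count_list zs x)" if "set zs \<subseteq> ?A" for zs
    unfolding sum_list_count_list using that by (intro sum.mono_neutral_left) (auto simp: count_list_0_iff)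
  have s': "sum_list zs = count_list zs 1 + (\<Sum>x\<in>?A - {1}. x * count_list zs x)" if "set zs \<subseteq> ?A" for zs
    using s[OF that] sum.remove[of ?A 1 "\<lambda>x. x * count_list zs x"] by simp
  have pos: "0 \<notin> set xs" "0 \<notin> set ys" using assms(1,2) by (auto simp: partitions_def)
  have "(\<Sum>x\<in>?A - {1}. x * count_list xs x) = (\<Sum>x\<in>?A - {1}. x * count_list ys x)"
  proof (rule sum.cong[OF refl])
    fix x assume "x \<in> ?A - {1}"
    then have "x \<ge> 2" using pos by (cases "x = 0") auto
    then show "x * count_list xs x = x * count_list ys x" using assms(3) by simp
  qed
  then have 1: "count_list xs 1 = count_list ys 1"
  proof -
    have "sum_list xs = sum_list ys" using assms(1,2) by (simp add: partitions_def)
    moreover have "set xs \<subseteq> ?A" "set ys \<subseteq> ?A" by auto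
    ultimately show ?thesis
      using s'[of xs] s'[of ys] \<open>(\<Sum>x\<in>?A - {1}. x * count_list xs x) = (\<Sum>x\<in>?A - {1}. x * count_list ys x)\<close>
      by linarith
  qed
  have "count_list xs j = count_list ys j" for j
  proof -
    consider "j = 0" | "j = 1" | "j \<ge> 2" by linarith
    then show ?thesis using 1 assms(3) pos by cases (auto simp: count_list_0_iff)
  qed
  then have "mset xs = mset ys" by (intro multiset_eqI) (simp add: count_mset)
  then have "mset (rev xs) = mset (rev ys)" by simp
  moreover have "sorted (rev xs)" "sorted (rev ys)"
    using assms(1,2) by (auto simp: partitions_def sorted_wrt_rev)
  ultimately have "rev xs = rev ys" by (metis properties_for_sort)
  then show ?thesis by simp
qed

text \<open>The idempotents are independent elements of a space spanned by one product of power sums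
  for each partition.\<close>

lemma card_Iz_le: "card (Iz n) \<le> card (partitions n)"
proof -
  have "Iz n \<subseteq> Z.span ((\<lambda>xs. prod_list (map (pfz n) xs)) ` partitions n)"
    using Iz_sub[of n] Zc_eq_span by simp
  then have "card (Iz n) \<le> card ((\<lambda>xs. prod_list (map (pfz n) xs)) ` partitions n)"
    using Z.independent_span_bound[OF _ orth_idem_independent[OF Iz_orth]] finite_partitions by blast
  also have "\<dots> \<le> card (partitions n)" by (rule card_image_le[OF finite_partitions])
  finally show ?thesis .
qed

lemma Zg_span_Iz: "Zg n \<subseteq> G.span (rep ` Iz n)"
proof
  fix x assume "x \<in> Zg n"
  then obtain z where z: "z \<in> Zc n" "x = rep z" using Zg_rep by blast
  have "x = (\<Sum>i\<in>Iz n. gscale (chr i z) (rep i))"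
    using arg_cong[OF Zc_expand[OF z(1)], of rep] z(2) by (simp add: gscale_def)
  also have "\<dots> \<in> G.span (rep ` Iz n)" by (intro G.span_sum G.span_scale G.span_base) auto
  finally show "x \<in> G.span (rep ` Iz n)" .
qed

lemma Sym_conj: assumes "\<sigma> \<in> Sym n" shows "\<sigma> * \<pi> * inverse \<sigma> \<in> Sym n \<longleftrightarrow> \<pi> \<in> Sym n"
proof -
  have "inverse \<sigma> * (\<sigma> * \<pi> * inverse \<sigma>) * \<sigma> = \<pi>" by (rule perm_eqI) (simp add: apply_times)
  then show ?thesis using assms by (metis Sym_inverse Sym_mult)
qed

text \<open>The sums over all permutations with the same cycle counts are central, hence in the span
  of the idempotents, and their coefficients at chosen representatives show that they are
  independent.\<close>

lemma card_Iz_ge: "card (partitions n) \<le> card (Iz n)"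
proof -
  have "\<exists>\<pi>\<in>Sym n. \<forall>j\<ge>2. cyc_count \<pi> j = j * count_list xs j" if "xs \<in> partitions n" for xs
    using cyc_count_realised[of xs] that by (auto simp: partitions_def)
  then obtain p where p: "\<And>xs. xs \<in> partitions n \<Longrightarrow> p xs \<in> Sym n"
    "\<And>xs j. xs \<in> partitions n \<Longrightarrow> j \<ge> 2 \<Longrightarrow> cyc_count (p xs) j = j * count_list xs j" by metis
  define K where "K xs = (\<Sum>\<pi>\<in>{\<pi>\<in>Sym n. cyc_count \<pi> = cyc_count (p xs)}. gel \<pi>)" for xs
  have lK: "lookup (K xs) \<pi> = (if \<pi> \<in> Sym n \<and> cyc_count \<pi> = cyc_count (p xs) then 1 else 0)" for xs \<pi>
    by (simp add: K_def lookup_sum lookup_gel sum.delta)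
  have inj: "xs = ys" if "xs \<in> partitions n" "ys \<in> partitions n" "cyc_count (p xs) = cyc_count (p ys)" for xs ys
  proof (rule partitions_eqI[OF that(1,2)])
    fix j :: nat assume "j \<ge> 2"
    then show "count_list xs j = count_list ys j"
      using p(2)[OF that(1), of j] p(2)[OF that(2), of j] that(3) by simp
  qed
  have lKp: "lookup (K xs) (p ys) = (if xs = ys then 1 else 0)" if "xs \<in> partitions n" "ys \<in> partitions n" for xs ys
    using inj[of xs ys] p(1) that by (auto simp: lK)
  have injK: "inj_on K (partitions n)"
    by (rule inj_onI) (metis lKp zero_neq_one)
  have "G.independent (K ` partitions n)"
  proof -
    have fin: "finite (K ` partitions n)" by (simp add: finite_partitions)
    show ?thesis
      unfolding G.dependent_finite[OF fin]
    proof (rule notI, clarify)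
      fix u ys assume u: "(\<Sum>v\<in>K ` partitions n. gscale (u v) v) = 0" "ys \<in> partitions n" "u (K ys) \<noteq> 0"
      have "0 = lookup (\<Sum>v\<in>K ` partitions n. gscale (u v) v) (p ys)" using u(1) by simp
      also have "\<dots> = (\<Sum>xs\<in>partitions n. u (K xs) * lookup (K xs) (p ys))"
        by (simp add: sum.reindex[OF injK] lookup_sum gscale_def)
      also have "\<dots> = (\<Sum>xs\<in>partitions n. if xs = ys then u (K ys) else 0)"
        using u(2) by (intro sum.cong) (auto simp: lKp)
      also have "\<dots> = u (K ys)" using u(2) finite_partitions by simp
      finally show False using u(3) by simp
    qed
  qed
  moreover have "K ` partitions n \<subseteq> G.span (rep ` Iz n)"
  proof -
    have "K xs \<in> Zg n" for xs
    proof -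
      have "K xs \<in> GA n" unfolding K_def by (intro GA_sum GA_gel) auto
      moreover have "cent n (K xs)"
      proof (rule centI_lookup)
        fix \<sigma> \<pi> assume s: "\<sigma> \<in> Sym n"
        have "\<sigma> * \<pi> * inverse \<sigma> \<in> Sym n \<longleftrightarrow> \<pi> \<in> Sym n" by (rule Sym_conj[OF s])
        moreover have "cyc_count (\<sigma> * \<pi> * inverse \<sigma>) = cyc_count \<pi>" by (rule ext) (rule cyc_count_conj)
        ultimately show "lookup (K xs) (\<sigma> * \<pi> * inverse \<sigma>) = lookup (K xs) \<pi>" by (simp add: lK)
      qed
      ultimately show ?thesis by (simp add: Zg_def)
    qed
    then show ?thesis using Zg_span_Iz by blast
  qed
  ultimately have "card (K ` partitions n) \<le> card (rep ` Iz n)"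
    using G.independent_span_bound[of "rep ` Iz n" "K ` partitions n"] by simp
  also have "\<dots> \<le> card (Iz n)" by (rule card_image_le) simp
  finally show ?thesis by (simp add: card_image[OF injK])
qed

theorem card_Iz: "card (Iz n) = card (partitions n)"
  using card_Iz_le card_Iz_ge by (rule antisym)

section \<open>Transition measures\<close>

lemma chr_cz_mult:
  assumes "i \<in> Iz n" "z \<in> Zc n" shows "chr i (cz c * z) = c * chr i z"
proof (rule chr_unique[OF assms(1) Zc_cz_mult[OF assms(2)], of 1])
  show "1 * i \<noteq> 0" using Iz_nz assms(1) by simp
  show "cz c * z * (1 * i) = cz (c * chr i z) * (1 * i)"
    using chr[OF assms] by (simp add: cz_mult mult.assoc)
qed

lemma chr_mult:
  assumes "i \<in> Iz n" "x \<in> Zc n" "y \<in> Zc n" shows "chr i (x * y) = chr i x * chr i y"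
proof (rule chr_unique[OF assms(1) Zc_mult[OF assms(2,3)], of 1])
  show "1 * i \<noteq> 0" using Iz_nz assms(1) by simp
  have "x * y * i = x * (y * i)" by (rule mult.assoc)
  also have "\<dots> = cz (chr i y) * (x * i)" unfolding chr[OF assms(1,3)] by (rule mult.left_commute)
  finally show "x * y * (1 * i) = cz (chr i x * chr i y) * (1 * i)"
    unfolding chr[OF assms(1,2)] by (simp add: cz_mult algebra_simps)
qed

lemma chr_add:
  assumes "i \<in> Iz n" "x \<in> Zc n" "y \<in> Zc n" shows "chr i (x + y) = chr i x + chr i y"
proof (rule chr_unique[OF assms(1) Zc_add[OF assms(2,3)], of 1])
  show "1 * i \<noteq> 0" using Iz_nz assms(1) by simp
  show "(x + y) * (1 * i) = cz (chr i x + chr i y) * (1 * i)"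
    using chr[OF assms(1,2)] chr[OF assms(1,3)] by (simp add: cz_add distrib_right)
qed

lemma chr_cz: "i \<in> Iz n \<Longrightarrow> chr i (cz c) = c"
  using chr_unique[of i n "cz c" 1 c] Zc_cz Iz_nz by simp

lemma chr_1: "i \<in> Iz n \<Longrightarrow> chr i 1 = 1"
  using chr_cz[of i n 1] by simp

lemma chr_idem:
  assumes "i \<in> Iz n" "j \<in> Iz n" shows "chr i j = (if i = j then 1 else 0)"
proof (rule chr_unique[OF assms(1), of _ 1])
  show "j \<in> Zc n" using Iz_sub assms by blast
  show "j * (1 * i) = cz (if i = j then 1 else 0) * (1 * i)"
    using Iz_idem[OF assms(1)] Iz_orthD[OF assms(2,1)] by auto
qed (use Iz_nz assms in simp)

text \<open>Power sums generate the centre, so the two characters agree on all of it, in particular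
  on \<open>i\<close>, where the values are \<open>1\<close> and, for \<open>j \<noteq> i\<close>,
  \<open>0\<close>.\<close>

lemma chr_eqI:
  assumes "i \<in> Iz n" "j \<in> Iz n" "\<And>k. chr i (psz n k) = chr j (psz n k)"
  shows "i = j"
proof -
  have p: "prod_list (map (pfz n) xs) \<in> Zc n \<and>
      chr i (prod_list (map (pfz n) xs)) = chr j (prod_list (map (pfz n) xs))" for xs
  proof (induction xs)
    case Nil
    then show ?case using assms by (simp add: Zc_1 chr_1)
  next
    case (Cons x xs)
    have "pfz n x \<in> Zc n" "chr i (pfz n x) = chr j (pfz n x)"
      using assms by (auto simp: pfz_def Zc_1 Zc_psz chr_1)
    then show ?case using Cons assms(1,2) by (simp add: Zc_mult chr_mult)
  qed
  have "x \<in> Zc n \<and> chr i x = chr j x" if "x \<in> Z.span ((\<lambda>xs. prod_list (map (pfz n) xs)) ` partitions n)" for x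
    using that
  proof (induction rule: Z.span_induct_alt)
    case base
    then show ?case using Zc_cz[of 0 n] chr_cz[OF assms(1), of 0] chr_cz[OF assms(2), of 0] by simp
  next
    case (step c x y)
    then have x: "x \<in> Zc n" "chr i x = chr j x" using p by auto
    then show ?case using step assms(1,2)
      by (simp add: zscale_def Zc_add Zc_cz_mult chr_add chr_cz_mult)
  qed
  then have "chr i i = chr j i" using Iz_sub[of n] assms(1) Zc_eq_span by blast
  then show ?thesis using chr_idem assms by (metis zero_neq_one)
qed

lemma cjz_sum: "cjz (sum f A) = (\<Sum>i\<in>A. cjz (f i))"
  by (induction A rule: infinite_finite_induct) (use cjz_add cjz_cz[of 0] in auto)

lemma cjz_power: "cjz (x ^ k) = cjz x ^ k"
  by (induction k) (use cjz_cz[of 1] cjz_mult in auto)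

lemma cjz_Lz [simp]: "cjz (Lz n) = Lz n" by transfer simp

lemma cjz_psz [simp]: "cjz (psz n k) = psz n k" by (simp add: psz_def cjz_sum cjz_power)

lemma cjz_Zc: "x \<in> Zc n \<Longrightarrow> cjz x \<in> Zc n"
proof -
  assume x: "x \<in> Zc n"
  have "cj (rep x) \<in> GA n" using x by (auto simp: Zc_def Zg_def GA_def in_keys_iff subset_iff)
  moreover have "cent n (cj (rep x))"
    unfolding cent_def
  proof
    fix \<pi> assume "\<pi> \<in> Sym n"
    then have "cj (gel \<pi> * rep x) = cj (rep x * gel \<pi>)" using x centD[of n "rep x" \<pi>] by (simp add: Zc_def Zg_def)
    then show "gel \<pi> * cj (rep x) = cj (rep x) * gel \<pi>" by (simp add: cj_mult)
  qed
  ultimately show "cjz x \<in> Zc n" by (simp add: Zc_def Zg_def cjz.rep_eq)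
qed

text \<open>Positivity excludes \<open>cjz i * i = 0\<close>; as the character value of an
  idempotent, \<open>chr i (cjz i)\<close> is then \<open>1\<close>, so \<open>cjz i * i\<close>
  equals \<open>i\<close> and, on applying \<open>cjz\<close>, also \<open>cjz i\<close>.\<close>

lemma cjz_Iz: assumes "i \<in> Iz n" shows "cjz i = i"
proof -
  have i: "i \<in> Zc n" using assms Iz_sub by blast
  have ci: "cjz i \<in> Zc n" by (rule cjz_Zc[OF i])
  have "cjz i * cjz i = cjz i" using Iz_idem[OF assms] by (simp flip: cjz_mult)
  then have "chr i (cjz i) * chr i (cjz i) = chr i (cjz i)" using chr_mult[OF assms ci ci] by simp
  moreover have "chr i (cjz i) \<noteq> 0"
  proof
    assume "chr i (cjz i) = 0"
    then have "cjz i * i = 0" using chr[OF assms ci] by simp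
    then show False using tau_pos[of i] Iz_nz[OF assms] by auto
  qed
  ultimately have "chr i (cjz i) = 1" by simp
  then have 1: "cjz i * i = i" using chr[OF assms ci] by simp
  then have "cjz (cjz i * i) = cjz i" by simp
  then have "i * cjz i = cjz i" by (simp add: cjz_mult)
  then show ?thesis using 1 by (simp add: mult.commute)
qed

text \<open>The power sum and \<open>i\<close> are both invariant under \<open>cjz\<close>. Reality
  of the eigenvalues places the transition measure on the real line.\<close>

lemma chr_psz_real: assumes "i \<in> Iz n" shows "chr i (psz n k) \<in> \<real>"
proof -
  have "cjz (psz n k * i) = cjz (cz (chr i (psz n k)) * i)" using chr[OF assms Zc_psz] by simp
  then have "psz n k * i = cz (cnj (chr i (psz n k))) * i" by (simp add: cjz_mult cjz_Iz[OF assms])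
  then have "chr i (psz n k) = cnj (chr i (psz n k))"
    by (intro chr_unique[OF assms Zc_psz, of 1]) (simp_all add: Iz_nz[OF assms])
  then show ?thesis by (metis Reals_cnj_iff)
qed

text \<open>The eigenvalue of \<open>L (Suc m)\<close> on \<open>i * j\<close>, in the language of
  Young diagrams the content of the added box. The difference of first power sums gives it a value
  also for \<open>i * j = 0\<close>, which \<open>virtual_restriction\<close> relies on.\<close>

definition ct :: "nat \<Rightarrow> gz \<Rightarrow> gz \<Rightarrow> real" where
  "ct m i j = Re (chr i (psz (Suc m) 1) - chr j (psz m 1))"

lemma ct: "i \<in> Iz (Suc m) \<Longrightarrow> j \<in> Iz m \<Longrightarrow>
    of_real (ct m i j) = chr i (psz (Suc m) 1) - chr j (psz m 1)"
  using chr_psz_real by (simp add: ct_def of_real_Re)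

lemma Lz_ct:
  assumes "i \<in> Iz (Suc m)" "j \<in> Iz m"
  shows "Lz (Suc m) * (i * j) = cz (of_real (ct m i j)) * (i * j)"
proof -
  have "Lz (Suc m) = psz (Suc m) 1 - psz m 1" by (simp add: psz_Suc)
  then have "Lz (Suc m) * (i * j) = (psz (Suc m) 1 * i) * j - i * (psz m 1 * j)"
    by (simp only: left_diff_distrib right_diff_distrib ac_simps)
  also have "\<dots> = (cz (chr i (psz (Suc m) 1)) * i) * j - i * (cz (chr j (psz m 1)) * j)"
    by (simp only: chr[OF assms(1) Zc_psz] chr[OF assms(2) Zc_psz])
  finally show ?thesis by (simp add: ct[OF assms] cz_diff algebra_simps)
qed

text \<open>\<open>i * j\<close> is a self-adjoint idempotent, so its trace is a value of the
  positive form; up to the factor \<open>tau j\<close> these traces are the weights of the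
  transition measure.\<close>

lemma tau_idem_mult:
  assumes "i \<in> Iz (Suc m)" "j \<in> Iz m"
  shows "tau (i * j) = of_real (Re (tau (i * j)))" "Re (tau (i * j)) \<ge> 0"
    "Re (tau (i * j)) = 0 \<Longrightarrow> i * j = 0"
proof -
  have "cjz (i * j) * (i * j) = (i * i) * (j * j)" by (simp add: cjz_mult cjz_Iz[OF assms(1)] cjz_Iz[OF assms(2)])
  then have "cjz (i * j) * (i * j) = i * j" by (simp only: Iz_idem[OF assms(1)] Iz_idem[OF assms(2)])
  then show "tau (i * j) = of_real (Re (tau (i * j)))" "Re (tau (i * j)) \<ge> 0"
    "Re (tau (i * j)) = 0 \<Longrightarrow> i * j = 0"
    using tau_pos[of "i * j"] by auto
qed

lemma tau_idem_pos: assumes "j \<in> Iz m" shows "tau j = of_real (Re (tau j))" "Re (tau j) > 0"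
proof -
  have "cjz j * j = j" using Iz_idem[OF assms] by (simp add: cjz_Iz[OF assms])
  then show "tau j = of_real (Re (tau j))" "Re (tau j) > 0"
    using tau_pos[of j] Iz_nz[OF assms] by auto
qed

section \<open>Conditional expectation and resolvent\<close>

definition prj :: "nat \<Rightarrow> galg \<Rightarrow> galg" where
  "prj n x = (\<Sum>\<pi>\<in>Sym n. gsc (lookup x \<pi>) * gel \<pi>)"

lemma lookup_prj: "lookup (prj n x) \<pi> = (if \<pi> \<in> Sym n then lookup x \<pi> else 0)"
proof -
  have "(\<Sum>\<sigma>\<in>Sym n. lookup x \<sigma> * (if \<sigma> = \<pi> then 1 else 0)) = (if \<pi> \<in> Sym n then lookup x \<pi> else 0)"
    by (simp add: if_distrib sum.delta cong: if_cong)
  then show ?thesis by (simp add: prj_def lookup_sum lookup_gel del: lookup_mult_gel)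
qed

lemma prj_GA: "prj n x \<in> GA n"
  by (auto simp: GA_def in_keys_iff lookup_prj split: if_splits)

lemma prj_id: "x \<in> GA n \<Longrightarrow> prj n x = x"
  unfolding prj_def by (rule GA_expand[symmetric])

lemma prj_add: "prj n (x + y) = prj n x + prj n y"
  by (rule poly_mapping_eqI) (simp add: lookup_prj lookup_add)
lemma prj_0 [simp]: "prj n 0 = 0" by (rule poly_mapping_eqI) (simp add: lookup_prj)
lemma prj_sum: "prj n (sum f A) = (\<Sum>i\<in>A. prj n (f i))"
  by (induction A rule: infinite_finite_induct) (simp_all add: prj_add)
lemma prj_gsc: "prj n (gsc c * x) = gsc c * prj n x"
  by (rule poly_mapping_eqI) (simp add: lookup_prj)

lemma Sym_mult_iff: "\<sigma> \<in> Sym n \<Longrightarrow> \<sigma> * \<pi> \<in> Sym n \<longleftrightarrow> \<pi> \<in> Sym n"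
  and Sym_mult_iff2: "\<sigma> \<in> Sym n \<Longrightarrow> \<pi> * \<sigma> \<in> Sym n \<longleftrightarrow> \<pi> \<in> Sym n"
proof -
  assume s: "\<sigma> \<in> Sym n"
  have "inverse \<sigma> * (\<sigma> * \<pi>) = \<pi>" "\<pi> * \<sigma> * inverse \<sigma> = \<pi>" by (simp_all add: mult.assoc) (simp flip: mult.assoc)
  then show "\<sigma> * \<pi> \<in> Sym n \<longleftrightarrow> \<pi> \<in> Sym n" "\<pi> * \<sigma> \<in> Sym n \<longleftrightarrow> \<pi> \<in> Sym n"
    using s by (metis Sym_inverse Sym_mult)+
qed

lemma prj_gel_mult: "\<sigma> \<in> Sym n \<Longrightarrow> prj n (gel \<sigma> * x) = gel \<sigma> * prj n x"
  and prj_mult_gel: "\<sigma> \<in> Sym n \<Longrightarrow> prj n (x * gel \<sigma>) = prj n x * gel \<sigma>"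
  by (rule poly_mapping_eqI, simp add: lookup_prj Sym_mult_iff Sym_mult_iff2)+

lemma prj_mult_left: assumes "y \<in> GA n" shows "prj n (y * x) = y * prj n x"
proof -
  have "prj n ((\<Sum>\<pi>\<in>Sym n. gsc (lookup y \<pi>) * gel \<pi>) * x) = (\<Sum>\<pi>\<in>Sym n. gsc (lookup y \<pi>) * gel \<pi>) * prj n x"
    by (simp add: sum_distrib_right prj_sum mult.assoc prj_gsc prj_gel_mult)
  then show ?thesis using GA_expand[OF assms] by metis
qed

lemma prj_mult_right: assumes "y \<in> GA n" shows "prj n (x * y) = prj n x * y"
proof -
  have "prj n (x * (\<Sum>\<pi>\<in>Sym n. gsc (lookup y \<pi>) * gel \<pi>)) = prj n x * (\<Sum>\<pi>\<in>Sym n. gsc (lookup y \<pi>) * gel \<pi>)"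
    by (simp add: sum_distrib_left prj_sum mult.assoc prj_gsc prj_mult_gel gsc_left_commute)
  then show ?thesis using GA_expand[OF assms] by metis
qed

lemma prj_cent: "cent n x \<Longrightarrow> cent n (prj n x)"
  unfolding cent_def by (metis prj_gel_mult prj_mult_gel)

text \<open>The conjugating transposition exchanges \<open>Suc m\<close> with a point outside
  \<open>{1..Suc m}\<close>: it fixes the permutations in \<open>Sym m\<close> and carries the
  others of \<open>Sym (Suc m)\<close> out of that group.\<close>

lemma prj_conj:
  assumes "x \<in> GA (Suc m)"
  defines "s \<equiv> gel (swap (Suc m) (Suc (Suc m)))"
  shows "prj (Suc m) (s * x * s) = prj m x"
proof (rule poly_mapping_eqI)
  fix \<pi>
  let ?s = "swap (Suc m) (Suc (Suc m))"
  have l: "lookup (s * x * s) \<pi> = lookup x (?s * \<pi> * ?s)" by (simp add: s_def mult.assoc)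
  show "lookup (prj (Suc m) (s * x * s)) \<pi> = lookup (prj m x) \<pi>"
  proof (cases "\<pi> \<in> Sym m")
    case True
    then have "affected \<pi> \<inter> affected ?s = {}" by (auto simp: Sym_def affected_swap)
    then have "?s * \<pi> = \<pi> * ?s" by (rule perm_mult_commute)
    then have "?s * \<pi> * ?s = \<pi>" by (simp add: mult.assoc)
    then show ?thesis using True l Sym_mono[of m "Suc m"] by (auto simp: lookup_prj)
  next
    case False
    have "lookup x (?s * \<pi> * ?s) = 0" if p: "\<pi> \<in> Sym (Suc m)"
    proof (rule ccontr)
      assume "lookup x (?s * \<pi> * ?s) \<noteq> 0"
      then have "?s * \<pi> * ?s \<in> Sym (Suc m)" using assms(1) by (auto simp: GA_def in_keys_iff)
      then have "(?s * \<pi> * ?s) \<langle>$\<rangle> (Suc (Suc m)) = Suc (Suc m)" by (rule Sym_fix) simp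
      then have "\<pi> \<langle>$\<rangle> (Suc m) = Suc m" by (simp add: apply_times)
      then show False using False Sym_Suc_fix[OF p] by simp
    qed
    then show ?thesis using False l by (simp add: lookup_prj)
  qed
qed

lemma prj_swap: "prj (Suc m) (gel (swap (Suc m) (Suc (Suc m)))) = 0"
proof (rule poly_mapping_eqI)
  fix \<pi>
  have "swap (Suc m) (Suc (Suc m)) \<notin> Sym (Suc m)" by (auto simp: Sym_def affected_swap)
  then show "lookup (prj (Suc m) (gel (swap (Suc m) (Suc (Suc m))))) \<pi> = lookup 0 \<pi>"
    by (auto simp: lookup_prj lookup_gel)
qed

definition poles :: "nat \<Rightarrow> complex set" where
  "poles m = (\<lambda>(i, j). of_real (ct m i j)) ` (Iz (Suc m) \<times> Iz m)"

text \<open>The inverse of \<open>z - L (Suc m)\<close>, written through the joint eigenspaces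
  \<open>i * j\<close>. \<open>poles\<close> takes in the pairs with \<open>i * j = 0\<close> as
  well, so that no denominator vanishes outside of it.\<close>

definition resolv :: "nat \<Rightarrow> complex \<Rightarrow> gz" where
  "resolv m z = (\<Sum>i\<in>Iz (Suc m). \<Sum>j\<in>Iz m. cz (1 / (z - of_real (ct m i j))) * (i * j))"

lemma finite_poles [simp]: "finite (poles m)" by (simp add: poles_def)

lemma resolv_inverse:
  assumes "z \<notin> poles m" shows "(cz z - Lz (Suc m)) * resolv m z = 1"
proof -
  have "(cz z - Lz (Suc m)) * (cz (1 / (z - of_real (ct m i j))) * (i * j)) = i * j"
    if ij: "i \<in> Iz (Suc m)" "j \<in> Iz m" for i j
  proof -
    let ?c = "complex_of_real (ct m i j)"
    have nz: "z - ?c \<noteq> 0" using assms ij by (auto simp: poles_def)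
    have "(cz z - Lz (Suc m)) * (cz (1 / (z - ?c)) * (i * j)) =
        cz (1 / (z - ?c)) * (cz z * (i * j) - Lz (Suc m) * (i * j))" by (simp add: algebra_simps)
    also have "\<dots> = cz (1 / (z - ?c) * (z - ?c)) * (i * j)"
      unfolding Lz_ct[OF ij] cz_mult cz_diff by (simp add: algebra_simps)
    finally show ?thesis using nz by simp
  qed
  then have "(cz z - Lz (Suc m)) * resolv m z = (\<Sum>i\<in>Iz (Suc m). \<Sum>j\<in>Iz m. i * j)"
    unfolding resolv_def sum_distrib_left by (intro sum.cong refl)
  also have "\<dots> = (\<Sum>i\<in>Iz (Suc m). i) * (\<Sum>j\<in>Iz m. j)" by (simp add: sum_product)
  finally show ?thesis by (simp add: Iz_sum)
qed

lemma Iz_GA: "i \<in> Iz n \<Longrightarrow> rep i \<in> GA n" and Iz_cent: "i \<in> Iz n \<Longrightarrow> cent n (rep i)"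
  using Iz_sub[of n] by (auto simp: Zc_def Zg_def)

lemma resolv_GA: "rep (resolv m z) \<in> GA (Suc m)"
  unfolding resolv_def rep_sum rep_simps rep_cz
  by (intro GA_sum GA_mult GA_gsc) (auto intro: Iz_GA GA_mono[OF _ Iz_GA, of m "Suc m"])

lemma resolv_cent: "cent m (rep (resolv m z))"
  unfolding resolv_def rep_sum rep_simps rep_cz
  by (intro cent_sum cent_mult cent_gsc) (auto intro: Iz_cent cent_mono[OF _ Iz_cent, of m "Suc m"])

text \<open>\<open>prj n\<close> is the conditional expectation of \<open>GA (Suc n)\<close> onto \<open>GA n\<close>. For \<open>j \<in> Iz n\<close> the function
  \<open>\<lambda>z. chr j (Gf n z)\<close> is the Stieltjes transform of the transition measure of \<open>j\<close>.\<close>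

definition Gf :: "nat \<Rightarrow> complex \<Rightarrow> gz" where
  "Gf n z = (SOME g. g \<in> Zc n \<and> rep g = prj n (rep (resolv n z)))"

lemma Gf: "Gf n z \<in> Zc n" "rep (Gf n z) = prj n (rep (resolv n z))"
proof -
  have "prj n (rep (resolv n z)) \<in> Zg n"
    by (simp add: Zg_def prj_GA prj_cent resolv_cent)
  then have "\<exists>g. g \<in> Zc n \<and> rep g = prj n (rep (resolv n z))" using Zg_rep by metis
  from someI_ex[OF this] show "Gf n z \<in> Zc n" "rep (Gf n z) = prj n (rep (resolv n z))"
    unfolding Gf_def by auto
qed

text \<open>Inverting the relation \<open>s * a = b * s + 1\<close> gives
  \<open>b' * s = s * a' + b' * a'\<close>. Multiplied by \<open>s\<close> once more and projected,
  the term \<open>s * a' * s\<close> descends one level by \<open>prj_conj\<close>, while a bare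
  \<open>s\<close> projects to \<open>0\<close>.\<close>

lemma Gf_recursion:
  assumes "z \<notin> poles m" "z \<notin> poles (Suc m)"
  shows "Gf (Suc m) z = Gf m z + resolv m z * resolv m z * Gf (Suc m) z"
proof -
  define s where "s = gel (swap (Suc m) (Suc (Suc m)))"
  define a where "a = gsc z - L (Suc m)"
  define b where "b = gsc z - L (Suc (Suc m))"
  define a' where "a' = rep (resolv m z)"
  define b' where "b' = rep (resolv (Suc m) z)"
  let ?P = "prj (Suc m)"
  have inv: "a * a' = 1" "b * b' = 1"
    using arg_cong[OF resolv_inverse[OF assms(1)], of rep] arg_cong[OF resolv_inverse[OF assms(2)], of rep]
    by (simp_all add: a_def a'_def b_def b'_def)
  have bJ: "b \<in> JM" "b' \<in> JM" "a' \<in> JM"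
    by (auto simp: b_def b'_def a'_def Rep_gz intro: JM.intros JM_diff)
  have b'b: "b' * b = 1" using inv(2) JM_commute bJ by simp
  have ab': "a' * b' = b' * a'" using JM_commute bJ by blast
  have ss: "s * s = 1" by (simp add: s_def)
  have a'GA: "a' \<in> GA (Suc m)" unfolding a'_def by (rule resolv_GA)
  have sa: "s * a = b * s + 1"
    using s_L[of "Suc m"] by (simp add: s_def a_def b_def algebra_simps gsc_commute)
  have 1: "b' * s = s * a' + b' * a'"
  proof -
    have "b' * (s * a) * a' = b' * (b * s + 1) * a'" by (simp add: sa)
    then have "b' * s * (a * a') = (b' * b) * s * a' + b' * a'" by (simp add: algebra_simps)
    then show ?thesis by (simp add: inv b'b)
  qed
  have P1: "?P (b' * s) = ?P b' * a'"
    unfolding 1 prj_add by (simp add: prj_mult_right[OF a'GA] prj_swap s_def)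
  have "b' = b' * s * s" by (simp add: mult.assoc ss)
  also have "b' * s * s = (s * a' + b' * a') * s" by (simp only: 1)
  also have "\<dots> = s * a' * s + a' * (b' * s)" by (simp only: distrib_right mult.assoc ab'[symmetric])
  finally have "?P b' = ?P (s * a' * s) + ?P (a' * (b' * s))" by (metis prj_add)
  also have "?P (s * a' * s) = prj m a'" unfolding s_def by (rule prj_conj[OF a'GA])
  also have "?P (a' * (b' * s)) = a' * (?P b' * a')" by (simp add: prj_mult_left[OF a'GA] P1)
  finally have "rep (Gf (Suc m) z) = rep (Gf m z + resolv m z * (Gf (Suc m) z * resolv m z))"
    by (simp add: Gf(2) a'_def b'_def)
  then have "Gf (Suc m) z = Gf m z + resolv m z * (Gf (Suc m) z * resolv m z)" by (simp only: rep_inject)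
  then show ?thesis by (simp only: mult_ac)
qed

text \<open>\<open>L 1 = 0\<close>, so the resolvent at level \<open>0\<close> is
  \<open>1 / z\<close>.\<close>

lemma Gf_0: assumes "z \<notin> poles 0" shows "Gf 0 z * cz z = 1"
proof -
  have 1: "cz z * resolv 0 z = 1"
  proof -
    have "Lz (Suc 0) = 0" by transfer simp
    then show ?thesis using resolv_inverse[OF assms] by simp
  qed
  have "rep (Gf 0 z * cz z) = prj 0 (rep (resolv 0 z)) * gsc z" by (simp add: Gf(2))
  also have "\<dots> = prj 0 (rep (cz z * resolv 0 z))" by (simp add: prj_gsc gsc_commute[symmetric])
  also have "\<dots> = 1" using prj_id[of 1 0] by (simp only: 1) simp
  finally show ?thesis by (metis rep_inject one_gz.rep_eq)
qed

text \<open>The solved recursion, cleared of denominators since it is an identity in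
  \<open>gz\<close>: the transform is \<open>1 / z\<close> times the product of
  \<open>(z - c)\<^sup>2 / ((z - c)\<^sup>2 - 1)\<close> over the contents \<open>c\<close>. In this
  way the contents determine the transition measure.\<close>

lemma Gf_product:
  assumes "\<And>j. j \<le> n \<Longrightarrow> z \<notin> poles j"
  shows "Gf n z * cz z * (\<Prod>i\<in>{1..n}. (cz z - Lz i)\<^sup>2 - 1) = (\<Prod>i\<in>{1..n}. (cz z - Lz i)\<^sup>2)"
  using assms
proof (induction n)
  case 0
  then show ?case using Gf_0 by simp
next
  case (Suc m)
  let ?a = "cz z - Lz (Suc m)"
  let ?r = "resolv m z"
  have ar: "?a * ?r = 1" using Suc.prems by (intro resolv_inverse) simp
  have rec: "Gf (Suc m) z = Gf m z + ?r * ?r * Gf (Suc m) z"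
    using Suc.prems by (intro Gf_recursion) auto
  have "?a\<^sup>2 * Gf (Suc m) z = ?a\<^sup>2 * (Gf m z + ?r * ?r * Gf (Suc m) z)" using rec by simp
  also have "\<dots> = ?a\<^sup>2 * Gf m z + (?a * ?r) * (?a * ?r) * Gf (Suc m) z"
    by (simp only: distrib_left power2_eq_square mult_ac)
  finally have "?a\<^sup>2 * Gf (Suc m) z = ?a\<^sup>2 * Gf m z + Gf (Suc m) z" unfolding ar by simp
  then have 1: "(?a\<^sup>2 - 1) * Gf (Suc m) z = ?a\<^sup>2 * Gf m z" by (simp add: left_diff_distrib)
  have "Gf (Suc m) z * cz z * (\<Prod>i\<in>{1..Suc m}. (cz z - Lz i)\<^sup>2 - 1) =
     ((?a\<^sup>2 - 1) * Gf (Suc m) z) * (cz z * (\<Prod>i\<in>{1..m}. (cz z - Lz i)\<^sup>2 - 1))"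
    by (simp add: mult_ac)
  also have "\<dots> = ?a\<^sup>2 * (Gf m z * cz z * (\<Prod>i\<in>{1..m}. (cz z - Lz i)\<^sup>2 - 1))"
    unfolding 1 by (simp add: mult_ac)
  also have "\<dots> = (\<Prod>i\<in>{1..Suc m}. (cz z - Lz i)\<^sup>2)"
    using Suc by (simp add: mult_ac)
  finally show ?case .
qed

lemma tau_prj: "rep g = prj n (rep x) \<Longrightarrow> tau g = tau x"
  by (simp add: tau_def lookup_prj)

text \<open>Pairing the resolvent with \<open>j\<close> yields partial fractions with the weights
  \<open>tau (i * j)\<close>.\<close>

lemma chr_Gf:
  assumes "j \<in> Iz m" "z \<notin> poles m"
  shows "chr j (Gf m z) * tau j = (\<Sum>i\<in>Iz (Suc m). tau (i * j) / (z - of_real (ct m i j)))"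
proof -
  have "chr j (Gf m z) * tau j = tau (Gf m z * j)" using chr[OF assms(1) Gf(1)] by (simp add: tau_cz)
  also have "\<dots> = tau (resolv m z * j)"
    by (rule tau_prj[of _ m]) (simp add: Gf(2) prj_mult_right[OF Iz_GA[OF assms(1)]])
  also have "resolv m z * j = (\<Sum>i\<in>Iz (Suc m). cz (1 / (z - of_real (ct m i j))) * (i * j))"
  proof -
    have "(\<Sum>k\<in>Iz m. cz (1 / (z - of_real (ct m i k))) * (i * k)) * j
      = cz (1 / (z - of_real (ct m i j))) * (i * j)" if "i \<in> Iz (Suc m)" for i
      using arg_cong[OF orth_idem_sum_mult[OF Iz_orth assms(1), of "\<lambda>k. 1 / (z - of_real (ct m i k))"], of "(*) i"]
      by (simp add: sum_distrib_left sum_distrib_right mult_ac)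
    then show ?thesis unfolding resolv_def sum_distrib_right[of _ _ j] by (intro sum.cong refl) simp
  qed
  finally show ?thesis by (simp add: tau_sum tau_cz)
qed

text \<open>At each level idempotents of two consecutive groups are multiplied on without making the
  product zero, which is possible because they sum to \<open>1\<close>; on \<open>i * j\<close> the
  next \<open>L\<close> is scalar. The result takes the place of a Gelfand-Tsetlin vector.\<close>

lemma joint_eigenvector:
  assumes "x \<noteq> 0"
  shows "\<exists>y c. x * y \<noteq> 0 \<and> (\<forall>i\<in>{1..n}. Lz i * (x * y) = cz (c i) * (x * y))"
proof -
  have ex: "\<exists>i\<in>Iz k. x * i \<noteq> 0" if "x \<noteq> 0" for x k
  proof (rule ccontr)
    assume "\<not> (\<exists>i\<in>Iz k. x * i \<noteq> 0)"
    then have "x * (\<Sum>i\<in>Iz k. i) = 0" unfolding sum_distrib_left by (intro sum.neutral) blast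
    then show False using that by (simp add: Iz_sum)
  qed
  show ?thesis
  proof (induction n)
    case 0
    then show ?case using assms by (intro exI[of _ 1]) simp
  next
    case (Suc n)
    then obtain y c where y: "x * y \<noteq> 0" "\<forall>i\<in>{1..n}. Lz i * (x * y) = cz (c i) * (x * y)" by blast
    from ex[OF y(1)] obtain j where j: "j \<in> Iz n" "x * y * j \<noteq> 0" by blast
    from ex[OF j(2)] obtain i where i: "i \<in> Iz (Suc n)" "x * y * j * i \<noteq> 0" by blast
    let ?y = "y * j * i"
    have e: "x * ?y = x * y * (i * j)" by (simp add: mult_ac)
    have "Lz k * (x * ?y) = cz ((c(Suc n := of_real (ct n i j))) k) * (x * ?y)" if "k \<in> {1..Suc n}" for k
    proof (cases "k = Suc n")
      case True
      have "Lz k * (x * ?y) = x * y * (Lz (Suc n) * (i * j))" unfolding e True by (simp add: mult_ac)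
      then show ?thesis unfolding Lz_ct[OF i(1) j(1)] e True by (simp add: mult_ac)
    next
      case False
      have "Lz k * (x * ?y) = (Lz k * (x * y)) * (i * j)" unfolding e by (simp add: mult_ac)
      then show ?thesis using y(2) that False unfolding e by (simp add: mult_ac)
    qed
    moreover have "x * ?y \<noteq> 0" using i(2) by (simp add: mult_ac)
    ultimately show ?case by blast
  qed
qed

lemma eigen_prod:
  fixes y :: gz
  assumes "\<And>i. i \<in> A \<Longrightarrow> f i * y = cz (g i) * y"
  shows "prod f A * y = cz (prod g A) * y"
  using assms
proof (induction A rule: infinite_finite_induct)
  case (insert i A)
  have "prod f (insert i A) * y = f i * (prod f A * y)" using insert by (simp add: mult.assoc)
  also have "prod f A * y = cz (prod g A) * y" using insert by simp
  also have "f i * (cz (prod g A) * y) = cz (prod g A) * (f i * y)" by (rule mult.left_commute)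
  also have "f i * y = cz (g i) * y" using insert by simp
  also have "cz (prod g A) * (cz (g i) * y) = cz (prod g (insert i A)) * y"
    using insert by (simp add: cz_mult mult_ac)
  finally show ?case .
qed simp_all

text \<open>By linearity the sums of every polynomial agree; a polynomial that vanishes at all
  elements other than \<open>a\<close> then isolates the multiplicity of \<open>a\<close>.\<close>

lemma multiset_eq_if_power_sums_eq:
  fixes M N :: "complex multiset"
  assumes "\<And>k. (\<Sum>a\<in>#M. a ^ k) = (\<Sum>a\<in>#N. a ^ k)"
  shows "M = N"
proof (rule multiset_eqI)
  fix a
  have p: "(\<Sum>x\<in>#M. poly f x) = (\<Sum>x\<in>#N. poly f x)" for f :: "complex poly"
  proof -
    have "(\<Sum>x\<in>#K. poly f x) = (\<Sum>i\<le>degree f. coeff f i * (\<Sum>x\<in>#K. x ^ i))" for K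
      by (induction K) (simp_all add: poly_altdef sum.distrib distrib_left)
    then show ?thesis using assms by simp
  qed
  define f :: "complex poly" where "f = (\<Prod>x\<in>set_mset M \<union> set_mset N - {a}. [:- x, 1:])"
  have fa: "poly f a \<noteq> 0" by (auto simp: f_def poly_prod)
  have fx: "poly f x = 0" if "x \<in> set_mset M \<union> set_mset N" "x \<noteq> a" for x
    using that by (auto simp: f_def poly_prod intro!: prod_zero)
  have "(\<Sum>x\<in>#K. poly f x) = of_nat (count K a) * poly f a" if "set_mset K \<subseteq> set_mset M \<union> set_mset N" for K
    using that by (induction K) (auto simp: fx distrib_right)
  from this[of M] this[of N] p[of f] fa show "count M a = count N a" by simp
qed

lemma power_sum_spectrum:
  fixes y :: gz
  assumes "i \<in> Iz n" "\<forall>k\<in>{1..n}. Lz k * (i * y) = cz (c k) * (i * y)" "i * y \<noteq> 0"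
  shows "chr i (psz n k) = (\<Sum>l\<in>{1..n}. c l ^ k)"
proof (rule chr_unique[OF assms(1) Zc_psz, of y])
  have "Lz l ^ k * (i * y) = cz (c l ^ k) * (i * y)" if l: "l \<in> {1..n}" for l
  proof (induction k)
    case (Suc k)
    have "Lz l ^ Suc k * (i * y) = Lz l * (Lz l ^ k * (i * y))" by (simp add: mult_ac)
    also have "\<dots> = cz (c l ^ k) * (Lz l * (i * y))" unfolding Suc by (rule mult.left_commute)
    also have "\<dots> = cz (c l ^ Suc k) * (i * y)" using assms(2) l by (simp add: cz_mult mult_ac)
    finally show ?case .
  qed simp
  then show "psz n k * (y * i) = cz (\<Sum>l\<in>{1..n}. c l ^ k) * (y * i)"
    unfolding psz_def cz_sum sum_distrib_right mult.commute[of y i] by (intro sum.cong refl)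
  show "y * i \<noteq> 0" using assms(3) by (simp add: mult.commute)
qed

lemma chr_Gf_product:
  assumes "i \<in> Iz n" "\<forall>k\<in>{1..n}. Lz k * (i * y) = cz (c k) * (i * y)" "i * y \<noteq> 0"
    and good: "\<And>j. j \<le> n \<Longrightarrow> z \<notin> poles j"
  shows "chr i (Gf n z) * z * (\<Prod>k\<in>{1..n}. (z - c k)\<^sup>2 - 1) = (\<Prod>k\<in>{1..n}. (z - c k)\<^sup>2)"
proof -
  have a: "(cz z - Lz k)\<^sup>2 * (i * y) = cz ((z - c k)\<^sup>2) * (i * y)" if "k \<in> {1..n}" for k
  proof -
    have 1: "(cz z - Lz k) * (i * y) = cz (z - c k) * (i * y)"
      using assms(2) that by (simp add: left_diff_distrib cz_diff)
    have "(cz z - Lz k)\<^sup>2 * (i * y) = (cz z - Lz k) * ((cz z - Lz k) * (i * y))"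
      by (simp only: power2_eq_square mult.assoc)
    also have "\<dots> = (cz z - Lz k) * (cz (z - c k) * (i * y))" by (simp only: 1)
    also have "\<dots> = cz (z - c k) * ((cz z - Lz k) * (i * y))" by (rule mult.left_commute)
    also have "\<dots> = cz ((z - c k)\<^sup>2) * (i * y)" unfolding 1 by (simp add: power2_eq_square cz_mult mult_ac)
    finally show ?thesis .
  qed
  have 1: "(\<Prod>k\<in>{1..n}. (cz z - Lz k)\<^sup>2) * (i * y) = cz (\<Prod>k\<in>{1..n}. (z - c k)\<^sup>2) * (i * y)"
    by (rule eigen_prod[OF a])
  have 2: "(\<Prod>k\<in>{1..n}. (cz z - Lz k)\<^sup>2 - 1) * (i * y) = cz (\<Prod>k\<in>{1..n}. (z - c k)\<^sup>2 - 1) * (i * y)"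
    by (rule eigen_prod) (use a in \<open>simp add: left_diff_distrib cz_diff\<close>)
  have g: "Gf n z * (i * y) = cz (chr i (Gf n z)) * (i * y)"
    using chr[OF assms(1) Gf(1)] by (metis mult.assoc)
  have "cz (\<Prod>k\<in>{1..n}. (z - c k)\<^sup>2) * (i * y) =
      Gf n z * cz z * (\<Prod>k\<in>{1..n}. (cz z - Lz k)\<^sup>2 - 1) * (i * y)"
    unfolding 1[symmetric] using Gf_product[of n z] good by simp
  also have "\<dots> = cz z * (Gf n z * ((\<Prod>k\<in>{1..n}. (cz z - Lz k)\<^sup>2 - 1) * (i * y)))" by (simp add: mult_ac)
  also have "\<dots> = cz z * (cz (\<Prod>k\<in>{1..n}. (z - c k)\<^sup>2 - 1) * (Gf n z * (i * y)))"
    unfolding 2 by (simp add: mult_ac)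
  also have "\<dots> = cz (chr i (Gf n z) * z * (\<Prod>k\<in>{1..n}. (z - c k)\<^sup>2 - 1)) * (i * y)"
    unfolding g by (simp add: cz_mult mult_ac)
  finally have "cz ((\<Prod>k\<in>{1..n}. (z - c k)\<^sup>2) - chr i (Gf n z) * z * (\<Prod>k\<in>{1..n}. (z - c k)\<^sup>2 - 1)) * (i * y) = 0"
    by (simp add: cz_diff left_diff_distrib)
  then show ?thesis using cz_cancel[OF _ assms(3)] by fastforce
qed

lemma tendsto_at_unique:
  fixes f g :: "real \<Rightarrow> real"
  assumes "(f \<longlongrightarrow> l) (at c)" "(g \<longlongrightarrow> l') (at c)" "\<forall>\<^sub>F x in at c. f x = g x"
  shows "l = l'"
  using assms tendsto_cong[OF assms(3)] tendsto_unique[OF at_neq_bot] by metis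

text \<open>The equation makes the Stieltjes transform of the positive measure \<open>w\<close> vanish to second order
  at \<open>c\<close>, where its derivative is negative.\<close>

lemma no_double_zero:
  fixes a w :: "'i \<Rightarrow> real" and b v :: "'j \<Rightarrow> real"
  assumes fin: "finite I" "finite J" and w: "\<And>i. i \<in> I \<Longrightarrow> w i \<ge> 0" "sum w I > 0"
    and b: "\<And>j. j \<in> J \<Longrightarrow> v j \<noteq> 0 \<Longrightarrow> b j \<noteq> c"
    and eq: "\<forall>\<^sub>F x in at c. (\<Sum>i\<in>I. w i / (x - a i)) * ((x - c)\<^sup>2 - 1) = (\<Sum>j\<in>J. v j / (x - b j)) * (x - c)\<^sup>2"
  shows False
proof -
  define I1 where "I1 = {i\<in>I. a i \<noteq> c}"
  define A where "A = (\<Sum>i\<in>I - I1. w i)"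
  define F where "F x = (\<Sum>i\<in>I1. w i / (x - a i))" for x
  define H where "H x = (\<Sum>j\<in>J. v j / (x - b j))" for x
  have I1: "I1 \<subseteq> I" by (auto simp: I1_def)
  have x0: "((\<lambda>x. x - c) \<longlongrightarrow> 0) (at c)" by (auto intro!: tendsto_eq_intros)
  have limF: "(F \<longlongrightarrow> F c) (at c)"
    unfolding F_def by (intro tendsto_intros) (auto simp: I1_def)
  have limH: "(H \<longlongrightarrow> H c) (at c)"
    unfolding H_def
  proof (intro tendsto_sum)
    fix j assume j: "j \<in> J"
    show "((\<lambda>x. v j / (x - b j)) \<longlongrightarrow> v j / (c - b j)) (at c)"
      using b[OF j] by (cases "v j = 0") (auto intro!: tendsto_intros)
  qed
  have ne: "\<forall>\<^sub>F x in at c. x \<noteq> c" by (simp add: eventually_at_filter)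
  have split: "(\<Sum>i\<in>I. w i / (x - a i)) = A / (x - c) + F x" for x
  proof -
    have "(\<Sum>i\<in>I. w i / (x - a i)) = (\<Sum>i\<in>I - I1. w i / (x - a i)) + F x"
      unfolding F_def by (rule sum.subset_diff[OF I1 fin(1)])
    also have "(\<Sum>i\<in>I - I1. w i / (x - a i)) = A / (x - c)"
      unfolding A_def sum_divide_distrib by (rule sum.cong) (auto simp: I1_def)
    finally show ?thesis .
  qed
  have eq': "\<forall>\<^sub>F x in at c. (A / (x - c) + F x) * ((x - c)\<^sup>2 - 1) = H x * (x - c)\<^sup>2"
    using eq unfolding split H_def .
  \<comment> \<open>The residue at \<open>c\<close>: multiplication by \<open>x - c\<close> and
    passage to the limit exclude a mass at \<open>c\<close>.\<close>
  have A0: "A = 0"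
  proof -
    have "((\<lambda>x. (A + (x - c) * F x) * ((x - c)\<^sup>2 - 1)) \<longlongrightarrow> (A + 0 * F c) * (0\<^sup>2 - 1)) (at c)"
      by (intro tendsto_intros x0 limF)
    moreover have "((\<lambda>x. H x * (x - c)\<^sup>2 * (x - c)) \<longlongrightarrow> H c * 0\<^sup>2 * 0) (at c)"
      by (intro tendsto_intros x0 limH)
    moreover have "\<forall>\<^sub>F x in at c. (A + (x - c) * F x) * ((x - c)\<^sup>2 - 1) = H x * (x - c)\<^sup>2 * (x - c)"
      using eq' ne
    proof eventually_elim
      case (elim x)
      have "(A + (x - c) * F x) * ((x - c)\<^sup>2 - 1) = (x - c) * ((A / (x - c) + F x) * ((x - c)\<^sup>2 - 1))"
        using elim(2) by (simp add: field_simps)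
      then show ?case using elim(1) by simp
    qed
    ultimately have "(A + 0 * F c) * (0\<^sup>2 - 1) = H c * 0\<^sup>2 * 0"
      by (rule tendsto_at_unique)
    then show ?thesis by simp
  qed
  \<comment> \<open>With the pole gone, the limit gives the value of the transform at
    \<open>c\<close>.\<close>
  have F0: "F c = 0"
  proof -
    have "((\<lambda>x. F x * ((x - c)\<^sup>2 - 1)) \<longlongrightarrow> F c * (0\<^sup>2 - 1)) (at c)"
      by (intro tendsto_intros x0 limF)
    moreover have "((\<lambda>x. H x * (x - c)\<^sup>2) \<longlongrightarrow> H c * 0\<^sup>2) (at c)"
      by (intro tendsto_intros x0 limH)
    moreover have "\<forall>\<^sub>F x in at c. F x * ((x - c)\<^sup>2 - 1) = H x * (x - c)\<^sup>2"
      using eq' by (simp add: A0)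
    ultimately have "F c * (0\<^sup>2 - 1) = H c * 0\<^sup>2"
      by (rule tendsto_at_unique)
    then show ?thesis by simp
  qed
  \<comment> \<open>\<open>B\<close> is minus the derivative of \<open>F\<close> at
    \<open>c\<close>, a sum of non-negative terms that vanishes only if all the weights in
    \<open>I1\<close> do.\<close>
  define B where "B = (\<Sum>i\<in>I1. w i / ((c - a i) * (c - a i)))"
  have "B = 0"
  proof -
    have "((\<lambda>x. - (\<Sum>i\<in>I1. w i / ((x - a i) * (c - a i))) * ((x - c)\<^sup>2 - 1)) \<longlongrightarrow> - B * (0\<^sup>2 - 1)) (at c)"
      unfolding B_def by (intro tendsto_intros x0) (auto simp: I1_def)
    moreover have "((\<lambda>x. H x * (x - c)) \<longlongrightarrow> H c * 0) (at c)"
      by (intro tendsto_intros x0 limH)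
    moreover have "\<forall>\<^sub>F x in at c. x \<noteq> a i" if "i \<in> I1" for i
      using that by (intro tendsto_imp_eventually_ne[OF tendsto_ident_at]) (auto simp: I1_def)
    then have "\<forall>\<^sub>F x in at c. \<forall>i\<in>I1. x \<noteq> a i"
      using finite_subset[OF I1 fin(1)] by (simp add: eventually_ball_finite_distrib)
    then have "\<forall>\<^sub>F x in at c. - (\<Sum>i\<in>I1. w i / ((x - a i) * (c - a i))) * ((x - c)\<^sup>2 - 1) = H x * (x - c)"
      using eq' ne
    proof eventually_elim
      case (elim x)
      have "F x = F x - F c" by (simp add: F0)
      also have "\<dots> = (\<Sum>i\<in>I1. w i / (x - a i) - w i / (c - a i))" by (simp add: F_def sum_subtractf)
      also have "\<dots> = (\<Sum>i\<in>I1. (x - c) * - (w i / ((x - a i) * (c - a i))))"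
      proof (rule sum.cong[OF refl])
        fix i assume "i \<in> I1"
        then have nz: "x - a i \<noteq> 0" "c - a i \<noteq> 0" using elim(1) by (auto simp: I1_def)
        have "w i / (x - a i) - w i / (c - a i) = (w i * (c - a i) - w i * (x - a i)) / ((x - a i) * (c - a i))"
          by (rule diff_frac_eq[OF nz])
        also have "w i * (c - a i) - w i * (x - a i) = (x - c) * - w i" by (simp add: algebra_simps)
        finally show "w i / (x - a i) - w i / (c - a i) = (x - c) * - (w i / ((x - a i) * (c - a i)))"
          by simp
      qed
      finally have F: "F x = (x - c) * - (\<Sum>i\<in>I1. w i / ((x - a i) * (c - a i)))"
        by (simp add: sum_distrib_left sum_negf)
      have "(x - c) * (- (\<Sum>i\<in>I1. w i / ((x - a i) * (c - a i))) * ((x - c)\<^sup>2 - 1)) = F x * ((x - c)\<^sup>2 - 1)"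
        unfolding F by (simp only: mult.assoc)
      also have "\<dots> = (x - c) * (H x * (x - c))" using elim(2) by (simp add: A0 power2_eq_square mult_ac)
      finally show ?case using elim(3) mult_left_cancel[of "x - c"] by (metis right_minus_eq)
    qed
    ultimately have "- B * (0\<^sup>2 - 1) = H c * 0"
      by (rule tendsto_at_unique)
    then show ?thesis by simp
  qed
  have "w i = 0" if "i \<in> I" for i
  proof (cases "i \<in> I1")
    case True
    have "\<forall>i\<in>I1. w i / ((c - a i) * (c - a i)) = 0"
      using \<open>B = 0\<close> finite_subset[OF I1 fin(1)] w(1) I1 unfolding B_def
      by (subst (asm) sum_nonneg_eq_0_iff) (auto intro!: divide_nonneg_nonneg)
    then show ?thesis using True by (auto simp: I1_def)
  next
    case False
    have "\<forall>i\<in>I - I1. w i = 0" using A0 fin w(1) unfolding A_def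
      by (subst (asm) sum_nonneg_eq_0_iff) auto
    then show ?thesis using False that by blast
  qed
  then show False using w(2) by simp
qed

text \<open>The power sums determine the contents and these determine \<open>Gf\<close>. If \<open>c\<close> were not a pole of the
  transform of \<open>j\<close>, the transform of \<open>i\<close> would have a double zero at \<open>c\<close>.\<close>

lemma virtual_restriction:
  assumes i: "i \<in> Iz (Suc m)" and j: "j \<in> Iz m"
    and pk: "\<And>k. chr i (psz (Suc m) k) = chr j (psz m k) + c ^ k"
  shows "i * j \<noteq> 0"
proof
  assume ij0: "i * j = 0"
  define x0 where "x0 = ct m i j"
  have c: "c = of_real x0" using ct[OF i j] pk[of 1] by (simp add: x0_def)
  \<comment> \<open>Such an \<open>i'\<close> would have the contents of \<open>j\<close> together
    with \<open>c\<close>, just as \<open>i\<close> has; so \<open>i' = i\<close>, contradicting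
    \<open>i * j = 0\<close>.\<close>
  have nopole: "ct m i' j \<noteq> x0" if i': "i' \<in> Iz (Suc m)" "i' * j \<noteq> 0" for i'
  proof
    assume e: "ct m i' j = x0"
    have "chr i' (psz (Suc m) k) = chr i (psz (Suc m) k)" for k
    proof (rule chr_unique[OF i'(1) Zc_psz, of j])
      have L: "Lz (Suc m) ^ k * (i' * j) = cz (c ^ k) * (i' * j)" for k
      proof (induction k)
        case (Suc k)
        have "Lz (Suc m) ^ Suc k * (i' * j) = Lz (Suc m) * (Lz (Suc m) ^ k * (i' * j))" by (simp add: mult_ac)
        also have "\<dots> = cz (c ^ k) * (Lz (Suc m) * (i' * j))" unfolding Suc by (rule mult.left_commute)
        also have "\<dots> = cz (c ^ Suc k) * (i' * j)" unfolding Lz_ct[OF i'(1) j] e c by (simp add: cz_mult mult_ac)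
        finally show ?case .
      qed simp
      have p: "psz m k * (i' * j) = cz (chr j (psz m k)) * (i' * j)"
        using chr[OF j Zc_psz] by (metis mult.left_commute)
      show "psz (Suc m) k * (j * i') = cz (chr i (psz (Suc m) k)) * (j * i')"
        unfolding pk cz_add mult.commute[of j i'] unfolding psz_Suc distrib_right L p ..
      show "j * i' \<noteq> 0" using i'(2) by (simp add: mult.commute)
    qed
    then have "i' = i" by (rule chr_eqI[OF i'(1) i])
    then show False using i'(2) ij0 by simp
  qed
  obtain y d where y: "i * y \<noteq> 0" "\<forall>k\<in>{1..Suc m}. Lz k * (i * y) = cz (d k) * (i * y)"
    using joint_eigenvector[OF Iz_nz[OF i]] by blast
  obtain y' e where y': "j * y' \<noteq> 0" "\<forall>k\<in>{1..m}. Lz k * (j * y') = cz (e k) * (j * y')"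
    using joint_eigenvector[OF Iz_nz[OF j]] by blast
  \<comment> \<open>The contents of \<open>i\<close> are those of \<open>j\<close> and
    \<open>c\<close>, since their power sums agree.\<close>
  have ms: "image_mset d (mset_set {1..Suc m}) = add_mset c (image_mset e (mset_set {1..m}))"
  proof (rule multiset_eq_if_power_sums_eq)
    fix k
    show "(\<Sum>a\<in>#image_mset d (mset_set {1..Suc m}). a ^ k) =
        (\<Sum>a\<in>#add_mset c (image_mset e (mset_set {1..m})). a ^ k)"
      using pk[of k] power_sum_spectrum[OF i y(2,1), of k] power_sum_spectrum[OF j y'(2,1), of k]
      by (simp add: image_mset.compositionality comp_def sum_unfold_sum_mset del: sum.cl_ivl_Suc)
  qed
  have pr: "(\<Prod>k\<in>{1..Suc m}. f (d k)) = f c * (\<Prod>k\<in>{1..m}. f (e k))" for f :: "complex \<Rightarrow> complex"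
    using arg_cong[OF ms, of "\<lambda>M. prod_mset (image_mset f M)"]
    by (simp add: image_mset.compositionality comp_def prod_unfold_prod_mset del: prod.cl_ivl_Suc)
  \<comment> \<open>The arguments at which a resolvent is undefined or a factor vanishes that has to
    be cancelled: \<open>(z - e)\<^sup>2 = 1\<close> gives the values \<open>e + 1\<close> and
    \<open>e - 1\<close>.\<close>
  define S where "S = (\<Union>l\<le>Suc m. poles l) \<union> {0} \<union> (\<lambda>k. e k + 1) ` {1..m} \<union> (\<lambda>k. e k - 1) ` {1..m}"
  have finS: "finite S" by (simp add: S_def)
  \<comment> \<open>In the quotient of the two product formulas every factor cancels except the one
    for \<open>c\<close>.\<close>
  have key: "chr i (Gf (Suc m) z) * ((z - c)\<^sup>2 - 1) = chr j (Gf m z) * (z - c)\<^sup>2" if z: "z \<notin> S" for z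
  proof -
    let ?E = "\<Prod>k\<in>{1..m}. (z - e k)\<^sup>2 - 1"
    have good: "z \<notin> poles l" if "l \<le> Suc m" for l using z that by (auto simp: S_def)
    have "(z - e k)\<^sup>2 - 1 \<noteq> 0" if "k \<in> {1..m}" for k
    proof
      assume "(z - e k)\<^sup>2 - 1 = 0"
      then have "(z - e k)\<^sup>2 = 1\<^sup>2" by simp
      then have "z - e k = 1 \<or> z - e k = - 1" using power2_eq_iff by blast
      then have "z = e k + 1 \<or> z = e k - 1" by (auto simp: algebra_simps)
      then show False using z that by (auto simp: S_def)
    qed
    then have E0: "?E \<noteq> 0" by simp
    have z0: "z \<noteq> 0" using z by (simp add: S_def)
    have 1: "chr i (Gf (Suc m) z) * z * (((z - c)\<^sup>2 - 1) * ?E) = (z - c)\<^sup>2 * (\<Prod>k\<in>{1..m}. (z - e k)\<^sup>2)"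
      using chr_Gf_product[OF i y(2,1) good] pr[of "\<lambda>d. (z - d)\<^sup>2 - 1"] pr[of "\<lambda>d. (z - d)\<^sup>2"]
      by (simp del: prod.cl_ivl_Suc)
    have 2: "chr j (Gf m z) * z * ?E = (\<Prod>k\<in>{1..m}. (z - e k)\<^sup>2)"
      using chr_Gf_product[OF j y'(2,1) good] by simp
    have "(chr i (Gf (Suc m) z) * ((z - c)\<^sup>2 - 1)) * (z * ?E) = (chr j (Gf m z) * (z - c)\<^sup>2) * (z * ?E)"
      using 1 2 by (simp add: mult_ac)
    then show ?thesis using z0 E0 by simp
  qed
  show False
  proof (rule no_double_zero[where I = "Iz (Suc (Suc m))" and J = "Iz (Suc m)" and c = x0
        and w = "\<lambda>\<nu>. Re (tau (\<nu> * i)) / Re (tau i)" and a = "\<lambda>\<nu>. ct (Suc m) \<nu> i"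
        and v = "\<lambda>\<nu>. Re (tau (\<nu> * j)) / Re (tau j)" and b = "\<lambda>\<nu>. ct m \<nu> j"])
    show "Re (tau (\<nu> * i)) / Re (tau i) \<ge> 0" if "\<nu> \<in> Iz (Suc (Suc m))" for \<nu>
      using tau_idem_mult(2)[OF that i] tau_idem_pos(2)[OF i] by simp
    have "(\<Sum>\<nu>\<in>Iz (Suc (Suc m)). tau (\<nu> * i)) = tau ((\<Sum>\<nu>\<in>Iz (Suc (Suc m)). \<nu>) * i)"
      by (simp add: sum_distrib_right tau_sum)
    then have "(\<Sum>\<nu>\<in>Iz (Suc (Suc m)). Re (tau (\<nu> * i))) = Re (tau i)"
      by (simp add: Iz_sum flip: Re_sum)
    then show "(\<Sum>\<nu>\<in>Iz (Suc (Suc m)). Re (tau (\<nu> * i)) / Re (tau i)) > 0"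
      using tau_idem_pos(2)[OF i] by (simp flip: sum_divide_distrib)
    show "ct m \<nu> j \<noteq> x0" if "\<nu> \<in> Iz (Suc m)" "Re (tau (\<nu> * j)) / Re (tau j) \<noteq> 0" for \<nu>
      using nopole[OF that(1)] that(2) by (cases "\<nu> * j = 0") auto
    have "\<forall>\<^sub>F x in at x0. x \<noteq> a" for a :: real
    proof (cases "a = x0")
      case True
      then show ?thesis by (simp add: eventually_at_filter)
    next
      case False
      then have "x0 \<noteq> a" by simp
      then show ?thesis by (rule tendsto_imp_eventually_ne[OF tendsto_ident_at])
    qed
    then have "\<forall>\<^sub>F x in at x0. \<forall>a\<in>Re ` S. x \<noteq> a"
      using finS by (simp add: eventually_ball_finite_distrib)
    then have "\<forall>\<^sub>F x in at x0. complex_of_real x \<notin> S"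
      by eventually_elim force
    then show "\<forall>\<^sub>F x in at x0. (\<Sum>\<nu>\<in>Iz (Suc (Suc m)). Re (tau (\<nu> * i)) / Re (tau i) / (x - ct (Suc m) \<nu> i)) * ((x - x0)\<^sup>2 - 1)
        = (\<Sum>\<nu>\<in>Iz (Suc m). Re (tau (\<nu> * j)) / Re (tau j) / (x - ct m \<nu> j)) * (x - x0)\<^sup>2"
    proof eventually_elim
      case (elim x)
      have g: "chr k (Gf n (of_real x)) = of_real (\<Sum>\<nu>\<in>Iz (Suc n). Re (tau (\<nu> * k)) / Re (tau k) / (x - ct n \<nu> k))"
        if k: "k \<in> Iz n" "of_real x \<notin> poles n" for k n
      proof -
        have t: "tau (\<nu> * k) = of_real (Re (tau (\<nu> * k)))" if "\<nu> \<in> Iz (Suc n)" for \<nu>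
          by (rule tau_idem_mult(1)[OF that k(1)])
        have "chr k (Gf n (of_real x)) * tau k = of_real (\<Sum>\<nu>\<in>Iz (Suc n). Re (tau (\<nu> * k)) / (x - ct n \<nu> k))"
          unfolding chr_Gf[OF k] of_real_sum by (intro sum.cong refl) (subst t, auto)
        then have "chr k (Gf n (of_real x)) = of_real (\<Sum>\<nu>\<in>Iz (Suc n). Re (tau (\<nu> * k)) / (x - ct n \<nu> k)) / of_real (Re (tau k))"
          using tau_idem_pos[OF k(1)] by (metis less_irrefl nonzero_eq_divide_eq of_real_eq_0_iff)
        also have "\<dots> = of_real (\<Sum>\<nu>\<in>Iz (Suc n). Re (tau (\<nu> * k)) / Re (tau k) / (x - ct n \<nu> k))"
          by (simp add: sum_divide_distrib mult.commute flip: of_real_divide)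
        finally show ?thesis .
      qed
      have nb: "of_real x \<notin> poles m" "of_real x \<notin> poles (Suc m)" using elim by (auto simp: S_def)
      from key[OF elim] show ?case
        unfolding g[OF i nb(2)] g[OF j nb(1)] c
        by (metis (no_types, lifting) of_real_1 of_real_diff of_real_eq_iff of_real_mult of_real_power)
    qed
  qed simp_all
qed

section \<open>The commutative model of the centre\<close>

lemma Zc_minimal:
  assumes "Z.subspace S" "\<And>x y. x \<in> S \<Longrightarrow> y \<in> S \<Longrightarrow> x * y \<in> S" "1 \<in> S"
    "\<And>k. k \<ge> 1 \<Longrightarrow> psz n k \<in> S"
  shows "Zc n \<subseteq> S"
proof -
  have "pfz n x \<in> S" for x
    using assms(3) assms(4)[of "x - 1"] by (auto simp: pfz_def)
  then have "prod_list (map (pfz n) xs) \<in> S" for xs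
    by (induction xs) (auto intro: assms)
  then show ?thesis unfolding Zc_eq_span by (intro Z.span_minimal assms(1)) auto
qed

definition Cc :: "nat \<Rightarrow> gz set" where
  "Cc m = {u. rep u \<in> GA (Suc m) \<and> cent m (rep u)}"

lemma Cc_subspace: "Z.subspace (Cc m)"
  by (rule Z.subspaceI) (auto simp: Cc_def zscale_def GA_add cent_add GA_mult cent_mult)
lemma Cc_mult: "x \<in> Cc m \<Longrightarrow> y \<in> Cc m \<Longrightarrow> x * y \<in> Cc m"
  by (auto simp: Cc_def GA_mult cent_mult)
lemma Zc_Cc: "z \<in> Zc m \<Longrightarrow> z \<in> Cc m"
  by (auto simp: Cc_def Zc_def Zg_def intro: GA_mono[of m "Suc m"])
lemma Zc_Suc_Cc: "z \<in> Zc (Suc m) \<Longrightarrow> z \<in> Cc m"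
  by (auto simp: Cc_def Zc_def Zg_def intro: cent_mono[of m "Suc m"])
lemma Lz_Cc: "Lz (Suc m) \<in> Cc m"
  by (simp add: Cc_def L_GA L_cent)

lemma Lz_power_ct:
  assumes "i \<in> Iz (Suc m)" "j \<in> Iz m"
  shows "Lz (Suc m) ^ k * (i * j) = cz (of_real (ct m i j) ^ k) * (i * j)"
proof (induction k)
  case (Suc k)
  have "Lz (Suc m) ^ Suc k * (i * j) = Lz (Suc m) ^ k * (Lz (Suc m) * (i * j))" by (simp only: power_Suc mult_ac)
  also have "\<dots> = cz (of_real (ct m i j)) * (Lz (Suc m) ^ k * (i * j))"
    unfolding Lz_ct[OF assms] by (rule mult.left_commute)
  also have "\<dots> = cz (of_real (ct m i j) ^ Suc k) * (i * j)" unfolding Suc by (simp add: cz_mult mult_ac)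
  finally show ?case .
qed simp

lemma chr_psz_ct:
  assumes "i \<in> Iz (Suc m)" "j \<in> Iz m" "i * j \<noteq> 0"
  shows "chr i (psz (Suc m) k) = chr j (psz m k) + of_real (ct m i j) ^ k"
proof (rule chr_unique[OF assms(1) Zc_psz, of j])
  have p: "psz m k * (i * j) = cz (chr j (psz m k)) * (i * j)"
    using chr[OF assms(2) Zc_psz] by (metis mult.left_commute)
  show "psz (Suc m) k * (j * i) = cz (chr j (psz m k) + of_real (ct m i j) ^ k) * (j * i)"
    unfolding mult.commute[of j i] psz_Suc distrib_right cz_add p Lz_power_ct[OF assms(1,2)] ..
  show "j * i \<noteq> 0" using assms(3) by (simp add: mult.commute)
qed

text \<open>Multiplicity-free branching: the centraliser is spanned by products of central elements
  of the smaller group algebra with powers of \<open>L (Suc m)\<close>, and both act on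
  \<open>i * j\<close> by scalars.\<close>

lemma Cc_scalar:
  assumes "i \<in> Iz (Suc m)" "j \<in> Iz m" "u \<in> Cc m"
  shows "\<exists>a. u * (i * j) = cz a * (i * j)"
proof -
  obtain u' where u': "u' \<in> Z.span {z * Lz (Suc m) ^ k | z k. z \<in> Zc m}" "rep u = rep u'"
    using centraliser_rep[of "rep u" m] assms(3) by (auto simp: Cc_def)
  have "\<exists>a. u' * (i * j) = cz a * (i * j)"
    using u'(1)
  proof (induction rule: Z.span_induct_alt)
    case base
    show ?case by (rule exI[of _ 0]) simp
  next
    case (step c x y)
    then obtain z k a where z: "x = z * Lz (Suc m) ^ k" "z \<in> Zc m" "y * (i * j) = cz a * (i * j)" by auto
    have "x * (i * j) = z * (cz (of_real (ct m i j) ^ k) * (i * j))"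
      unfolding z(1) mult.assoc Lz_power_ct[OF assms(1,2)] ..
    also have "\<dots> = cz (of_real (ct m i j) ^ k) * i * (z * j)" by (simp only: mult_ac)
    also have "\<dots> = cz (of_real (ct m i j) ^ k * chr j z) * (i * j)"
      unfolding chr[OF assms(2) z(2)] cz_mult by (simp only: mult_ac)
    finally have x: "x * (i * j) = cz (of_real (ct m i j) ^ k * chr j z) * (i * j)" .
    have "(zscale c x + y) * (i * j) = cz c * (x * (i * j)) + y * (i * j)"
      by (simp only: zscale_def distrib_right mult.assoc)
    also have "\<dots> = cz (c * (of_real (ct m i j) ^ k * chr j z) + a) * (i * j)"
      unfolding x z(3) by (simp only: cz_add cz_mult distrib_right mult.assoc)
    finally show ?case by blast
  qed
  then show ?thesis using u'(2) by (simp add: rep_inject)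
qed

section \<open>Pairs and their two specialisations\<close>

type_synonym pair = "gz \<times> gz"

definition pscale :: "complex \<Rightarrow> pair \<Rightarrow> pair" where
  "pscale c f = (cz c * fst f, cz c * snd f)"

global_interpretation P: vector_space pscale
  by unfold_locales (auto simp: pscale_def cz_add cz_mult algebra_simps prod_eq_iff)

lemma P_independent_family:
  assumes "finite A" "\<And>c. (\<Sum>a\<in>A. pscale (c a) (e a)) = 0 \<Longrightarrow> \<forall>a\<in>A. c a = 0"
  shows "inj_on e A" "P.independent (e ` A)"
proof -
  show inj: "inj_on e A"
  proof (rule inj_onI, rule ccontr)
    fix a b assume ab: "a \<in> A" "b \<in> A" "e a = e b" "a \<noteq> b"
    have "(\<Sum>x\<in>A. pscale (if x = a then 1 else if x = b then - 1 else 0) (e x)) =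
      (\<Sum>x\<in>A. if x = a then e a else 0) + (\<Sum>x\<in>A. if x = b then - e b else 0)"
      unfolding sum.distrib[symmetric] using ab(4)
      by (intro sum.cong refl) (auto simp: pscale_def cz_minus prod_eq_iff)
    also have "\<dots> = 0" using ab assms(1) by simp
    finally show False using assms(2)[of "\<lambda>x. if x = a then 1 else if x = b then - 1 else 0"] ab by auto
  qed
  have fin: "finite (e ` A)" using assms(1) by simp
  show "P.independent (e ` A)"
    unfolding P.dependent_finite[OF fin]
  proof
    assume "\<exists>u. (\<exists>v\<in>e ` A. u v \<noteq> 0) \<and> (\<Sum>v\<in>e ` A. pscale (u v) v) = 0"
    then obtain u a where "(\<Sum>v\<in>e ` A. pscale (u v) v) = 0" "a \<in> A" "u (e a) \<noteq> 0" by blast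
    then show False using assms(2)[of "u \<circ> e"] by (simp add: sum.reindex[OF inj])
  qed
qed

locale shifted =
  fixes m :: nat and \<delta> :: complex
begin

text \<open>Pairs \<open>(z, u)\<close> stand for \<open>z + u * \<eta>\<close> where \<open>\<eta> * \<eta> = x * \<eta>\<close>. The two
  specialisations \<open>\<eta> = 0\<close> and \<open>\<eta> = x\<close> are \<open>fst\<close> and \<open>low\<close>.\<close>

definition x :: gz where "x = cz \<delta> + Lz (Suc m)"

definition pm :: "pair \<Rightarrow> pair \<Rightarrow> pair" where
  "pm f g = (fst f * fst g, fst f * snd g + snd f * fst g + x * snd f * snd g)"

definition low :: "pair \<Rightarrow> gz" where "low f = fst f + snd f * x"

lemma fst_pm [simp]: "fst (pm f g) = fst f * fst g" by (simp add: pm_def)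
lemma snd_pm: "snd (pm f g) = fst f * snd g + snd f * low g"
  by (simp add: pm_def low_def algebra_simps)
lemma low_pm: "low (pm f g) = low f * low g"
  by (simp add: pm_def low_def algebra_simps)
lemma low_add: "low (f + g) = low f + low g" by (simp add: low_def algebra_simps)
lemma low_diff: "low (f - g) = low f - low g" by (simp add: low_def algebra_simps)
lemma low_pscale: "low (pscale c f) = cz c * low f" by (simp add: low_def pscale_def algebra_simps)
lemma low_0 [simp]: "low 0 = 0" by (simp add: low_def)
lemma low_sum: "low (sum f A) = (\<Sum>a\<in>A. low (f a))"
  by (induction A rule: infinite_finite_induct) (simp_all add: low_add)

text \<open>The third condition is what commuting with the arc diagrams amounts to; see
  \<open>centre_eq\<close>.\<close>

definition centre_pairs :: "pair set" where
  "centre_pairs = {f. fst f \<in> Zc (Suc m) \<and> snd f \<in> Cc m \<and> low f \<in> Zc m}"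

lemma x_Cc: "x \<in> Cc m"
  unfolding x_def by (intro Z.subspace_add[OF Cc_subspace] Zc_Cc Zc_cz Lz_Cc)

lemma centre_pairs_subspace: "P.subspace centre_pairs"
proof (rule P.subspaceI)
  show "0 \<in> centre_pairs"
    by (simp add: centre_pairs_def Z.subspace_0[OF Zc_subspace] Z.subspace_0[OF Cc_subspace])
  show "f + g \<in> centre_pairs" if "f \<in> centre_pairs" "g \<in> centre_pairs" for f g
    using that by (auto simp: centre_pairs_def low_add Zc_add Z.subspace_add[OF Cc_subspace])
  show "pscale c f \<in> centre_pairs" if "f \<in> centre_pairs" for c f
  proof -
    have "low (pscale c f) \<in> Zc m" using that by (auto simp: centre_pairs_def low_pscale Zc_cz_mult)
    moreover have "cz c * snd f \<in> Cc m" using that by (auto simp: centre_pairs_def intro: Cc_mult Zc_Cc Zc_cz)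
    ultimately show ?thesis using that by (auto simp: centre_pairs_def pscale_def Zc_cz_mult)
  qed
qed

text \<open>The second component is minus the divided difference of the \<open>k\<close>-th power at
  \<open>L (Suc m)\<close> and \<open>- \<delta>\<close>. Multiplied by their difference
  \<open>x\<close> it cancels the last summand and the constant of the first component, which leaves
  \<open>psz m k\<close> in \<open>low_super_psum\<close>.\<close>

definition super_psum :: "nat \<Rightarrow> pair" where
  "super_psum k = (psz (Suc m) k - cz ((- \<delta>) ^ k), - (\<Sum>i<k. Lz (Suc m) ^ i * cz ((- \<delta>) ^ (k - Suc i))))"

lemma low_super_psum: "low (super_psum k) = psz m k"
proof -
  have "Lz (Suc m) ^ k - cz (- \<delta>) ^ k = (Lz (Suc m) - cz (- \<delta>)) * (\<Sum>i<k. cz (- \<delta>) ^ (k - Suc i) * Lz (Suc m) ^ i)"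
    by (rule power_diff_sumr2)
  then have "(\<Sum>i<k. Lz (Suc m) ^ i * cz ((- \<delta>) ^ (k - Suc i))) * x = Lz (Suc m) ^ k - cz ((- \<delta>) ^ k)"
    by (simp add: x_def cz_power cz_minus mult.commute add.commute)
  then show ?thesis by (simp add: low_def super_psum_def psz_Suc)
qed

lemma x_ct: assumes "i \<in> Iz (Suc m)" "j \<in> Iz m"
  shows "x * (i * j) = cz (of_real (ct m i j) + \<delta>) * (i * j)"
  by (simp only: x_def distrib_right Lz_ct[OF assms] cz_add add.commute)

end

text \<open>Collects what the surjectivity argument uses of the set of values of supersymmetric
  polynomials; \<open>V\<close> is specialised to that set further below.\<close>

locale supersym_algebra = shifted +
  fixes V :: "pair set"
  assumes V_sub: "V \<subseteq> centre_pairs" and V_subspace: "P.subspace V"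
    and V_mult: "\<And>f g. f \<in> V \<Longrightarrow> g \<in> V \<Longrightarrow> pm f g \<in> V"
    and V_1: "(1, 0) \<in> V"
    and V_psum: "\<And>k. k \<ge> 1 \<Longrightarrow> super_psum k \<in> V"
begin

text \<open>The constants in \<open>V\<close> remove the shift \<open>(- \<delta>) ^ k\<close>, and
  power sums generate the centre.\<close>

lemma fst_V: "Zc (Suc m) \<subseteq> fst ` V"
proof (rule Zc_minimal)
  show "Z.subspace (fst ` V)"
  proof (rule Z.subspaceI)
    show "0 \<in> fst ` V" using P.subspace_0[OF V_subspace] by force
    show "a + b \<in> fst ` V" if ab: "a \<in> fst ` V" "b \<in> fst ` V" for a b
    proof -
      from ab obtain f g where "f \<in> V" "g \<in> V" "a = fst f" "b = fst g" by blast
      then show ?thesis using P.subspace_add[OF V_subspace, of f g] by (metis fst_add image_eqI)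
    qed
    show "zscale c a \<in> fst ` V" if a: "a \<in> fst ` V" for c a
    proof -
      from a obtain f where "f \<in> V" "a = fst f" by blast
      then show ?thesis using P.subspace_scale[OF V_subspace, of f c]
        by (metis fst_conv image_eqI pscale_def zscale_def)
    qed
  qed
  show "a * b \<in> fst ` V" if ab: "a \<in> fst ` V" "b \<in> fst ` V" for a b
  proof -
    from ab obtain f g where "f \<in> V" "g \<in> V" "a = fst f" "b = fst g" by blast
    then show ?thesis using V_mult[of f g] by (metis fst_pm image_eqI)
  qed
  show "1 \<in> fst ` V" using V_1 by force
  show "psz (Suc m) k \<in> fst ` V" if "k \<ge> 1" for k
  proof -
    have "super_psum k + pscale ((- \<delta>) ^ k) (1, 0) \<in> V"
      by (intro P.subspace_add[OF V_subspace] P.subspace_scale[OF V_subspace] V_psum V_1 that)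
    moreover have "fst (super_psum k + pscale ((- \<delta>) ^ k) (1, 0)) = psz (Suc m) k"
      by (simp add: super_psum_def pscale_def)
    ultimately show ?thesis by (metis image_eqI)
  qed
qed

lemma low_V: "Zc m \<subseteq> low ` V"
proof (rule Zc_minimal)
  show "Z.subspace (low ` V)"
  proof (rule Z.subspaceI)
    show "0 \<in> low ` V" using P.subspace_0[OF V_subspace] low_0 by (metis image_eqI)
    show "a + b \<in> low ` V" if ab: "a \<in> low ` V" "b \<in> low ` V" for a b
    proof -
      from ab obtain f g where "f \<in> V" "g \<in> V" "a = low f" "b = low g" by blast
      then show ?thesis using P.subspace_add[OF V_subspace, of f g] by (metis low_add image_eqI)
    qed
    show "zscale c a \<in> low ` V" if a: "a \<in> low ` V" for c a
    proof -
      from a obtain f where "f \<in> V" "a = low f" by blast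
      then show ?thesis using P.subspace_scale[OF V_subspace, of f c]
        by (metis low_pscale image_eqI zscale_def)
    qed
  qed
  show "a * b \<in> low ` V" if ab: "a \<in> low ` V" "b \<in> low ` V" for a b
  proof -
    from ab obtain f g where "f \<in> V" "g \<in> V" "a = low f" "b = low g" by blast
    then show ?thesis using V_mult[of f g] by (metis low_pm image_eqI)
  qed
  show "1 \<in> low ` V" using V_1 by (intro image_eqI[of _ _ "(1, 0)"]) (simp_all add: low_def)
  show "psz m k \<in> low ` V" if "k \<ge> 1" for k
    using V_psum[OF that] low_super_psum by (metis image_eqI)
qed

definition cut :: "gz \<Rightarrow> pair \<Rightarrow> pair" where "cut i f = (i * fst f, i * snd f)"

lemma sum_Iz: "y = (\<Sum>i\<in>Iz n. y * i)"
  by (simp add: Iz_sum flip: sum_distrib_left)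

text \<open>If \<open>ct m i j = - \<delta>\<close> for some \<open>j\<close> with \<open>i * j \<noteq> 0\<close>, the element \<open>(0, i * j)\<close> arises from
  \<open>super_psum 1\<close>. Otherwise \<open>virtual_restriction\<close> separates \<open>i\<close> from every \<open>j\<close>.\<close>

lemma cut_generator:
  assumes i: "i \<in> Iz (Suc m)"
  shows "\<exists>k\<in>V. k \<noteq> 0 \<and> low k = 0 \<and> cut i k = k \<and>
    (\<forall>f\<in>centre_pairs. low f = 0 \<longrightarrow> (\<exists>a. cut i f = pscale a k))"
proof -
  have iZ: "i \<in> Zc (Suc m)" using i Iz_sub by blast
  obtain v0 where v0: "v0 \<in> V" "fst v0 = i" using fst_V iZ by force
  have ii: "i * i = i" "i \<noteq> 0" using i Iz_idem Iz_nz by auto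
  have iy: "i * (i * y) = i * y" "i * (y * i) = y * i" for y
    by (simp add: ii(1) flip: mult.assoc) (simp add: ii(1) mult.left_commute[of i])
  show ?thesis
  proof (cases "\<exists>j\<in>Iz m. i * j \<noteq> 0 \<and> of_real (ct m i j) = - \<delta>")
    case True
    then obtain j where j: "j \<in> Iz m" "i * j \<noteq> 0" "of_real (ct m i j) = - \<delta>" by blast
    have jj: "j * j = j" using j Iz_idem by auto
    obtain v1 where v1: "v1 \<in> V" "low v1 = j" using low_V j(1) Iz_sub by force
    \<comment> \<open>\<open>s\<close> is arranged so that \<open>i\<close> kills its first
      component and \<open>j\<close> its lower specialisation, while the second component is
      \<open>- 1\<close>.\<close>
    define s where "s = super_psum 1 - pscale (chr j (psz m 1)) (1, 0)"
    have sV: "s \<in> V" unfolding s_def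
      by (intro P.subspace_diff[OF V_subspace] P.subspace_scale[OF V_subspace] V_psum V_1) simp
    have s1: "fst s = psz (Suc m) 1 - cz (chr i (psz (Suc m) 1))"
    proof -
      have "cz (chr i (psz (Suc m) 1)) = cz (chr j (psz m 1)) + cz (- \<delta>)"
        by (simp only: chr_psz_ct[OF i j(1,2)] j(3) power_one_right cz_add)
      then show ?thesis by (simp add: s_def super_psum_def pscale_def)
    qed
    have s2: "snd s = - 1" by (simp add: s_def super_psum_def pscale_def)
    have s3: "low s * j = 0"
    proof -
      have "low s * j = psz m 1 * j - cz (chr j (psz m 1)) * j"
        by (simp add: s_def low_diff low_super_psum low_pscale low_def[of "(1,0)"] left_diff_distrib)
      then show ?thesis by (simp only: chr[OF j(1) Zc_psz] diff_self)
    qed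
    have is0: "i * fst s = 0"
    proof -
      have "i * fst s = psz (Suc m) 1 * i - cz (chr i (psz (Suc m) 1)) * i"
        unfolding s1 by (simp only: right_diff_distrib mult.commute[of i])
      then show ?thesis by (simp only: chr[OF i Zc_psz] diff_self)
    qed
    \<comment> \<open>In the product rule for the second component every term but the one with
      \<open>- 1\<close> is killed.\<close>
    have "pm (pm v0 s) v1 = pscale (- 1) (0, i * j)"
    proof -
      have "snd (pm (pm v0 s) v1) = (fst v0 * snd s + snd v0 * low s) * j + i * fst s * snd v1"
        by (simp add: snd_pm v1(2) v0(2))
      also have "\<dots> = - (i * j) + snd v0 * (low s * j)" by (simp only: is0 v0(2) s2) (simp add: algebra_simps)
      also have "\<dots> = - (i * j)" by (simp add: s3)
      finally show ?thesis using is0 by (simp add: prod_eq_iff v0(2) pscale_def cz_minus)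
    qed
    then have "pscale (- 1) (pscale (- 1) (0, i * j)) \<in> V"
      using V_mult[OF V_mult[OF v0(1) sV] v1(1)] P.subspace_scale[OF V_subspace] by metis
    then have kV: "(0, i * j) \<in> V" by (simp add: pscale_def cz_minus)
    have lk: "low (0, i * j) = 0"
      using x_ct[OF i j(1)] j(3) by (simp add: low_def mult.commute)
    have "\<exists>a. cut i f = pscale a (0, i * j)" if f: "f \<in> centre_pairs" "low f = 0" for f
    proof -
      have f': "fst f \<in> Zc (Suc m)" "snd f \<in> Cc m" using f by (auto simp: centre_pairs_def)
      obtain a where a: "\<And>j'. j' \<in> Iz m \<Longrightarrow> snd f * (i * j') = cz (a j') * (i * j')"
        using Cc_scalar[OF i _ f'(2)] by metis
      have rel: "chr i (fst f) + a j' * (of_real (ct m i j') + \<delta>) = 0"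
        if j': "j' \<in> Iz m" "i * j' \<noteq> 0" for j'
      proof -
        have "0 = low f * (i * j')" using f(2) by simp
        also have "\<dots> = (fst f * i) * j' + snd f * (x * (i * j'))"
          by (simp only: low_def distrib_right mult.assoc)
        also have "\<dots> = cz (chr i (fst f)) * (i * j') + cz (of_real (ct m i j') + \<delta>) * (snd f * (i * j'))"
          unfolding chr[OF i f'(1)] x_ct[OF i j'(1)] by (simp only: mult_ac)
        also have "\<dots> = cz (chr i (fst f) + a j' * (of_real (ct m i j') + \<delta>)) * (i * j')"
          unfolding a[OF j'(1)] cz_add cz_mult by (simp only: distrib_right distrib_left mult_ac)
        finally show ?thesis using cz_cancel j'(2) by metis
      qed
      \<comment> \<open>At \<open>j\<close> the factor of the unknown \<open>a j\<close> is
        \<open>0\<close>.\<close>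
      have z0: "chr i (fst f) = 0" using rel[OF j(1,2)] j(3) by simp
      have other: "i * snd f * j' = 0" if j': "j' \<in> Iz m" "j' \<noteq> j" for j'
      proof (cases "i * j' = 0")
        case True
        have "i * snd f * j' = snd f * (i * j')" by (simp only: mult_ac)
        then show ?thesis using True by simp
      next
        case False
        have "of_real (ct m i j') + \<delta> \<noteq> 0"
        proof
          assume "of_real (ct m i j') + \<delta> = 0"
          then have e: "complex_of_real (ct m i j') = of_real (ct m i j)" using j(3) by (simp add: add_eq_0_iff2)
          have "chr j' (psz m k) = chr j (psz m k)" for k
            using chr_psz_ct[OF i j'(1) False, of k] chr_psz_ct[OF i j(1,2), of k] unfolding e by simp
          then have "j' = j" by (rule chr_eqI[OF j'(1) j(1)])
          then show False using j'(2) by simp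
        qed
        then have "a j' = 0" using rel[OF j'(1) False] z0 by simp
        then have "snd f * (i * j') = 0" using a[OF j'(1)] by simp
        then show ?thesis by (simp only: mult_ac)
      qed
      have "i * snd f = (\<Sum>j'\<in>Iz m. i * snd f * j')" by (rule sum_Iz)
      also have "\<dots> = i * snd f * j" using other j(1)
        by (subst sum.remove[OF finite_Iz j(1)]) (simp add: sum.neutral)
      also have "\<dots> = snd f * (i * j)" by (simp only: mult_ac)
      also have "\<dots> = cz (a j) * (i * j)" by (rule a[OF j(1)])
      finally have "i * snd f = cz (a j) * (i * j)" .
      moreover have "i * fst f = 0" using chr[OF i f'(1)] z0 by (simp add: mult.commute)
      ultimately show ?thesis by (auto simp: cut_def pscale_def)
    qed
    moreover have "cut i (0, i * j) = (0, i * j)" by (simp add: cut_def mult.assoc[symmetric] ii)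
    ultimately show ?thesis using kV lk j(2) by (intro bexI[of _ "(0, i * j)"]) (auto simp: prod_eq_iff)
  next
    case False
    \<comment> \<open>Multiply on, for one \<open>j\<close> after another, a factor whose lower
      specialisation is killed by \<open>j\<close> but whose first component acts on
      \<open>i\<close> by a non-zero scalar.\<close>
    have "\<exists>v\<in>V. \<exists>a. a \<noteq> 0 \<and> fst v = cz a * i \<and> (\<forall>j\<in>J. low v * j = 0)" if "J \<subseteq> Iz m" for J
      using finite_subset[OF that finite_Iz] that
    proof (induction J rule: finite_induct)
      case empty
      then show ?case using v0 by (intro bexI[of _ v0] exI[of _ 1]) auto
    next
      case (insert j J)
      then obtain v a where v: "v \<in> V" "a \<noteq> 0" "fst v = cz a * i" "\<forall>j\<in>J. low v * j = 0" by auto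
      have j: "j \<in> Iz m" using insert.prems by simp
      have "\<exists>k. chr i (psz (Suc m) k) \<noteq> chr j (psz m k) + (- \<delta>) ^ k"
      proof (rule ccontr)
        assume "\<not> ?thesis"
        then have all: "chr i (psz (Suc m) k) = chr j (psz m k) + (- \<delta>) ^ k" for k by blast
        then have "i * j \<noteq> 0" by (rule virtual_restriction[OF i j])
        moreover have "of_real (ct m i j) = - \<delta>" using ct[OF i j] all[of 1] by simp
        ultimately show False using False j by blast
      qed
      then obtain k where k: "chr i (psz (Suc m) k) - (- \<delta>) ^ k - chr j (psz m k) \<noteq> 0"
        by (metis add.commute diff_diff_eq diff_eq_eq add_0)
      \<comment> \<open>Exponent \<open>0\<close> separates nothing: there the comparison reads
        \<open>Suc m = m + 1\<close>. This matters since \<open>V_psum\<close> starts at exponent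
        \<open>1\<close>.\<close>
      have k1: "k \<ge> 1"
      proof (rule ccontr)
        assume "\<not> k \<ge> 1"
        then have "k = 0" by simp
        moreover have "psz n 0 = cz (of_nat n)" for n
          by (induction n) (simp_all add: psz_def cz_add)
        ultimately show False using k chr_cz[OF i] chr_cz[OF j] by simp
      qed
      define t where "t = super_psum k - pscale (chr j (psz m k)) (1, 0)"
      have tV: "t \<in> V" unfolding t_def
        by (intro P.subspace_diff[OF V_subspace] P.subspace_scale[OF V_subspace] V_psum V_1 k1)
      have t1: "fst t = psz (Suc m) k - cz ((- \<delta>) ^ k) - cz (chr j (psz m k))"
        by (simp add: t_def super_psum_def pscale_def)
      have t2: "low t * j = 0"
      proof -
        have "low t * j = psz m k * j - cz (chr j (psz m k)) * j"
          by (simp add: t_def low_diff low_super_psum low_pscale low_def[of "(1,0)"] left_diff_distrib)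
        then show ?thesis by (simp only: chr[OF j Zc_psz] diff_self)
      qed
      let ?b = "chr i (psz (Suc m) k) - (- \<delta>) ^ k - chr j (psz m k)"
      have "fst (pm v t) = cz a * (psz (Suc m) k * i - cz ((- \<delta>) ^ k) * i - cz (chr j (psz m k)) * i)"
        unfolding fst_pm v(3) t1 by (simp only: right_diff_distrib left_diff_distrib mult_ac)
      also have "\<dots> = cz (a * ?b) * i"
        unfolding chr[OF i Zc_psz] by (simp only: cz_mult cz_diff left_diff_distrib right_diff_distrib mult.assoc)
      finally have "fst (pm v t) = cz (a * ?b) * i" .
      moreover have "low (pm v t) * j' = 0" if "j' \<in> insert j J" for j'
      proof (cases "j' = j")
        case True
        have "low (pm v t) * j = low v * (low t * j)" by (simp add: low_pm mult.assoc)
        then show ?thesis using True t2 by simp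
      next
        case False
        have "low (pm v t) * j' = low t * (low v * j')" by (simp only: low_pm mult_ac)
        then show ?thesis using False that v(4) by simp
      qed
      moreover have "a * ?b \<noteq> 0" using v(2) k by simp
      ultimately show ?case using V_mult[OF v(1) tV] by blast
    qed
    from this[OF order.refl] obtain v a where v: "v \<in> V" "a \<noteq> 0" "fst v = cz a * i" "\<forall>j\<in>Iz m. low v * j = 0" by auto
    have lv: "low v = 0" using sum_Iz[of "low v" m] v(4) by simp
    \<comment> \<open>The factor \<open>v0\<close> makes the second component a multiple of
      \<open>i\<close> too.\<close>
    define k where "k = pm v0 v"
    have k: "fst k = cz a * i" "snd k = i * snd v"
      by (simp_all add: k_def v0(2) v(3) snd_pm lv iy)
    have kV: "k \<in> V" unfolding k_def by (rule V_mult[OF v0(1) v(1)])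
    have lk: "low k = 0" by (simp add: k_def low_pm lv)
    have ck: "cut i k = k"
      by (simp add: cut_def prod_eq_iff k iy)
    have k0: "k \<noteq> 0" using k(1) cz_cancel[of a i] v(2) ii(2) by (auto simp: prod_eq_iff)
    have "\<exists>b. cut i f = pscale b k" if f: "f \<in> centre_pairs" "low f = 0" for f
    proof -
      have f': "fst f \<in> Zc (Suc m)" "snd f \<in> Cc m" using f by (auto simp: centre_pairs_def)
      define b where "b = chr i (fst f) / a"
      \<comment> \<open>The error in the second component. It satisfies \<open>u * x = 0\<close>,
        and in this case \<open>x\<close> acts by a non-zero scalar on every non-zero
        \<open>i * j\<close>, so it has to vanish.\<close>
      define u where "u = i * snd f - cz b * snd k"
      have kC: "snd k \<in> Cc m" using kV V_sub by (auto simp: centre_pairs_def)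
      have uC: "u \<in> Cc m" unfolding u_def
        by (intro Z.subspace_diff[OF Cc_subspace] Cc_mult Zc_Suc_Cc iZ f' kC Zc_cz)
      have fsti: "i * fst f = cz b * fst k"
      proof -
        have "cz b * fst k = cz (b * a) * i" by (simp only: k(1) cz_mult mult.assoc)
        also have "b * a = chr i (fst f)" using v(2) by (simp add: b_def)
        also have "cz (chr i (fst f)) * i = i * fst f" using chr[OF i f'(1)] by (simp only: mult.commute)
        finally show ?thesis by simp
      qed
      have "u * x = i * low f - cz b * low k"
        using fsti by (simp add: u_def low_def algebra_simps)
      then have ux: "u * x = 0" using f(2) lk by simp
      have iu: "i * u = u"
        using ck by (simp add: u_def cut_def right_diff_distrib mult.assoc[symmetric] ii prod_eq_iff)
           (simp add: mult.commute[of i] mult.assoc)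
      have "u * j = 0" if j: "j \<in> Iz m" for j
      proof (cases "i * j = 0")
        case True
        have "u * j = u * (i * j)" using iu by (metis mult.assoc mult.commute)
        then show ?thesis using True by simp
      next
        case nz: False
        obtain c where c: "u * (i * j) = cz c * (i * j)" using Cc_scalar[OF i j uC] by blast
        have "0 = (u * x) * (i * j)" using ux by simp
        also have "\<dots> = u * (x * (i * j))" by (rule mult.assoc)
        also have "\<dots> = cz (of_real (ct m i j) + \<delta>) * (u * (i * j))" unfolding x_ct[OF i j] by (rule mult.left_commute)
        also have "\<dots> = cz ((of_real (ct m i j) + \<delta>) * c) * (i * j)" unfolding c by (simp only: cz_mult mult.assoc)
        finally have "(of_real (ct m i j) + \<delta>) * c = 0" using cz_cancel nz by metis
        moreover have "of_real (ct m i j) + \<delta> \<noteq> 0" using False j nz by (auto simp: add_eq_0_iff2)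
        ultimately have "u * (i * j) = 0" using c by simp
        moreover have "u * j = u * (i * j)" using iu by (metis mult.assoc mult.commute)
        ultimately show ?thesis by simp
      qed
      then have "u = 0" using sum_Iz[of u m] by simp
      then have "cut i f = pscale b k" using fsti by (simp add: cut_def pscale_def u_def)
      then show ?thesis by blast
    qed
    then show ?thesis using kV k0 lk ck by blast
  qed
qed

lemma sum_cut: "(\<Sum>i\<in>Iz (Suc m). cut i f) = f"
proof -
  have "fst (\<Sum>i\<in>Iz (Suc m). cut i f) = (\<Sum>i\<in>Iz (Suc m). fst f * i)"
    by (simp add: fst_sum cut_def mult.commute)
  moreover have "snd (\<Sum>i\<in>Iz (Suc m). cut i f) = (\<Sum>i\<in>Iz (Suc m). snd f * i)"
    by (simp add: snd_sum cut_def mult.commute)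
  ultimately show ?thesis using sum_Iz[of "fst f" "Suc m"] sum_Iz[of "snd f" "Suc m"] by (simp add: prod_eq_iff)
qed

text \<open>The kernel of \<open>low\<close> on the central pairs has one generator for each
  \<open>i\<close>, by \<open>cut_generator\<close>; the image is spanned by the idempotents
  \<open>j\<close>, which have preimages in \<open>V\<close>. Hence both the equality and the
  dimension.\<close>

theorem centre_pairs_structure:
  "V = centre_pairs" "\<exists>B. finite B \<and> B \<subseteq> centre_pairs \<and> P.independent B \<and> centre_pairs \<subseteq> P.span B \<and> card B = card (Iz (Suc m)) + card (Iz m)"
proof -
  obtain k where k: "\<And>i. i \<in> Iz (Suc m) \<Longrightarrow> k i \<in> V \<and> k i \<noteq> 0 \<and> low (k i) = 0 \<and> cut i (k i) = k i \<and>
    (\<forall>f\<in>centre_pairs. low f = 0 \<longrightarrow> (\<exists>a. cut i f = pscale a (k i)))"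
    using cut_generator by metis
  have "\<exists>v\<in>V. low v = j" if "j \<in> Iz m" for j using low_V that Iz_sub by force
  then obtain v where v: "\<And>j. j \<in> Iz m \<Longrightarrow> v j \<in> V \<and> low (v j) = j" by metis
  have dec0: "\<exists>a. f = (\<Sum>i\<in>Iz (Suc m). pscale (a i) (k i))" if f: "f \<in> centre_pairs" "low f = 0" for f
  proof -
    have "\<forall>i\<in>Iz (Suc m). \<exists>a. cut i f = pscale a (k i)" using k f by blast
    then obtain a where "\<forall>i\<in>Iz (Suc m). cut i f = pscale (a i) (k i)" by (rule bchoice[THEN exE])
    then show ?thesis using sum_cut[of f] by (intro exI[of _ a]) simp
  qed
  have dec: "\<exists>a b. f = (\<Sum>i\<in>Iz (Suc m). pscale (a i) (k i)) + (\<Sum>j\<in>Iz m. pscale (b j) (v j))"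
    if f: "f \<in> centre_pairs" for f
  proof -
    define g where "g = (\<Sum>j\<in>Iz m. pscale (chr j (low f)) (v j))"
    have gF: "g \<in> centre_pairs" unfolding g_def
      by (intro P.subspace_sum[OF centre_pairs_subspace] P.subspace_scale[OF centre_pairs_subspace]) (use v V_sub in auto)
    have "low f \<in> Zc m" using f by (simp add: centre_pairs_def)
    then have "low g = low f"
      using Zc_expand[of "low f" m] v by (simp add: g_def low_sum low_pscale)
    then have "low (f - g) = 0" by (simp add: low_diff)
    then obtain a where "f - g = (\<Sum>i\<in>Iz (Suc m). pscale (a i) (k i))"
      using dec0 P.subspace_diff[OF centre_pairs_subspace f gF] by blast
    then have "f = (\<Sum>i\<in>Iz (Suc m). pscale (a i) (k i)) + g" by (simp add: algebra_simps)
    then show ?thesis unfolding g_def by (intro exI[of _ a] exI[of _ "\<lambda>j. chr j (low f)"])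
  qed
  show "V = centre_pairs"
  proof (intro equalityI V_sub subsetI)
    fix f assume "f \<in> centre_pairs"
    then obtain a b where f: "f = (\<Sum>i\<in>Iz (Suc m). pscale (a i) (k i)) + (\<Sum>j\<in>Iz m. pscale (b j) (v j))"
      using dec by blast
    show "f \<in> V" unfolding f
      by (intro P.subspace_add[OF V_subspace] P.subspace_sum[OF V_subspace] P.subspace_scale[OF V_subspace])
         (use k v in auto)
  qed
  define e where "e = case_sum k v"
  let ?A = "Iz (Suc m) <+> Iz m"
  have finA: "finite ?A" by simp
  have es: "(\<Sum>a\<in>?A. pscale (c a) (e a)) =
      (\<Sum>i\<in>Iz (Suc m). pscale (c (Inl i)) (k i)) + (\<Sum>j\<in>Iz m. pscale (c (Inr j)) (v j))" for c
    by (simp add: sum.Plus e_def)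
  have ind: "\<forall>a\<in>?A. c a = 0" if c: "(\<Sum>a\<in>?A. pscale (c a) (e a)) = 0" for c
  proof -
    have "0 = low (\<Sum>a\<in>?A. pscale (c a) (e a))" using c by simp
    also have "\<dots> = (\<Sum>j\<in>Iz m. cz (c (Inr j)) * j)"
      unfolding es low_add low_sum low_pscale using k v by simp
    finally have l: "(\<Sum>j\<in>Iz m. cz (c (Inr j)) * j) = 0" by simp
    have cr: "c (Inr j) = 0" if "j \<in> Iz m" for j
      using orth_idem_sum_mult[OF Iz_orth that, of "\<lambda>j. c (Inr j)"] l cz_cancel Iz_nz[OF that] by simp
    then have s0: "(\<Sum>i\<in>Iz (Suc m). pscale (c (Inl i)) (k i)) = 0"
      using c unfolding es by simp
    have cl: "c (Inl i) = 0" if i: "i \<in> Iz (Suc m)" for i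
    proof -
      have ck: "cut i (k i') = (if i' = i then k i else 0)" if i': "i' \<in> Iz (Suc m)" for i'
      proof (cases "i' = i")
        case False
        have "cut i (k i') = cut i (cut i' (k i'))" using k[OF i'] by simp
        then show ?thesis using Iz_orthD[OF i i'] False by (simp add: cut_def mult.assoc[symmetric] prod_eq_iff)
      qed (use k i in simp)
      have "0 = cut i (\<Sum>i'\<in>Iz (Suc m). pscale (c (Inl i')) (k i'))" unfolding s0 by (simp add: cut_def prod_eq_iff)
      also have "\<dots> = (\<Sum>i'\<in>Iz (Suc m). pscale (c (Inl i')) (cut i (k i')))"
        by (simp add: cut_def prod_eq_iff fst_sum snd_sum sum_distrib_left pscale_def mult.left_commute)
      also have "\<dots> = (\<Sum>i'\<in>Iz (Suc m). if i' = i then pscale (c (Inl i)) (k i) else 0)"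
        by (intro sum.cong refl) (auto simp: ck)
      also have "\<dots> = pscale (c (Inl i)) (k i)" using i by simp
      finally show ?thesis using k[OF i] by (metis P.scale_eq_0_iff)
    qed
    show ?thesis using cl cr by auto
  qed
  have "centre_pairs \<subseteq> P.span (e ` ?A)"
  proof
    fix f assume "f \<in> centre_pairs"
    then obtain a b where f: "f = (\<Sum>i\<in>Iz (Suc m). pscale (a i) (k i)) + (\<Sum>j\<in>Iz m. pscale (b j) (v j))"
      using dec by blast
    have "f = (\<Sum>l\<in>?A. pscale (case_sum a b l) (e l))" unfolding es f by simp
    also have "\<dots> \<in> P.span (e ` ?A)" by (intro P.span_sum P.span_scale P.span_base) auto
    finally show "f \<in> P.span (e ` ?A)" .
  qed
  moreover have "e ` ?A \<subseteq> centre_pairs" using k v V_sub by (auto simp: e_def)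
  moreover have "card (e ` ?A) = card (Iz (Suc m)) + card (Iz m)"
    using card_image[OF P_independent_family(1)[OF finA ind]] by (simp add: card_Plus)
  ultimately show "\<exists>B. finite B \<and> B \<subseteq> centre_pairs \<and> P.independent B \<and> centre_pairs \<subseteq> P.span B \<and> card B = card (Iz (Suc m)) + card (Iz m)"
    using P_independent_family(2)[OF finA ind] finA by (intro exI[of _ "e ` ?A"]) simp
qed

end

section \<open>Walled Brauer diagrams as permutations\<close>

text \<open>Flipping the last column turns a walled Brauer diagram into the diagram of a permutation:
  \<open>btm\<close> and \<open>tp\<close> are the lower and upper vertices after the flip.\<close>

definition btm :: "nat \<Rightarrow> nat \<Rightarrow> vertex" where "btm r i = (if i \<le> r then Bot i else Top i)"
definition tp :: "nat \<Rightarrow> nat \<Rightarrow> vertex" where "tp r i = (if i \<le> r then Top i else Bot i)"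

definition diag :: "nat \<Rightarrow> nat perm \<Rightarrow> vertex set set" where
  "diag r \<pi> = (\<lambda>i. {btm r i, tp r (\<pi> \<langle>$\<rangle> i)}) ` {1..Suc r}"

lemma btm_eq_iff [simp]: "btm r i = btm r j \<longleftrightarrow> i = j" by (auto simp: btm_def)
lemma tp_eq_iff [simp]: "tp r i = tp r j \<longleftrightarrow> i = j" by (auto simp: tp_def)
lemma btm_neq_tp [simp]: "btm r i \<noteq> tp r j" "tp r j \<noteq> btm r i" by (auto simp: btm_def tp_def)

lemma outer_vertices_eq: "outer_vertices (Suc r) = btm r ` {1..Suc r} \<union> tp r ` {1..Suc r}"
proof
  show "outer_vertices (Suc r) \<subseteq> btm r ` {1..Suc r} \<union> tp r ` {1..Suc r}"
  proof
    fix v assume "v \<in> outer_vertices (Suc r)"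
    then obtain i where i: "i \<in> {1..Suc r}" "v = Top i \<or> v = Bot i" by (auto simp: outer_vertices_def)
    then have "v = btm r i \<or> v = tp r i" by (auto simp: btm_def tp_def)
    then show "v \<in> btm r ` {1..Suc r} \<union> tp r ` {1..Suc r}" using i(1) by blast
  qed
qed (auto simp: outer_vertices_def btm_def tp_def)

lemma strand_pair_iff:
  "{btm r i, tp r j} = {btm r i', tp r j'} \<longleftrightarrow> i = i' \<and> j = j'"
  by (auto simp: doubleton_eq_iff)

lemma diag_inj:
  assumes "\<pi> \<in> Sym (Suc r)" "\<sigma> \<in> Sym (Suc r)" "diag r \<pi> = diag r \<sigma>"
  shows "\<pi> = \<sigma>"
proof (rule perm_eqI)
  fix i
  show "\<pi> \<langle>$\<rangle> i = \<sigma> \<langle>$\<rangle> i"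
  proof (cases "i \<in> {1..Suc r}")
    case True
    then have "{btm r i, tp r (\<pi> \<langle>$\<rangle> i)} \<in> diag r \<pi>" unfolding diag_def by (rule imageI)
    then have "{btm r i, tp r (\<pi> \<langle>$\<rangle> i)} \<in> diag r \<sigma>" using assms(3) by simp
    then show ?thesis by (auto simp: diag_def strand_pair_iff)
  next
    case False
    then show ?thesis using Sym_fix[OF assms(1) False] Sym_fix[OF assms(2) False] by simp
  qed
qed

text \<open>After the flip the wall rule says that every strand joins a \<open>btm\<close> vertex to
  a \<open>tp\<close> vertex.\<close>

lemma wall_condition:
  "crosses_wall r (btm r i) (tp r j) \<longleftrightarrow> is_Top (btm r i) = is_Top (tp r j)"
  "crosses_wall r (tp r j) (btm r i) \<longleftrightarrow> is_Top (tp r j) = is_Top (btm r i)"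
  "\<not> (crosses_wall r (btm r i) (btm r j) \<longleftrightarrow> is_Top (btm r i) = is_Top (btm r j))"
  "\<not> (crosses_wall r (tp r i) (tp r j) \<longleftrightarrow> is_Top (tp r i) = is_Top (tp r j))"
  by (auto simp: crosses_wall_def btm_def tp_def)

lemma diag_in_wb: assumes "\<pi> \<in> Sym (Suc r)" shows "diag r \<pi> \<in> wb_diagrams r 1"
proof -
  have "\<exists>u\<in>outer_vertices (Suc r). \<exists>v\<in>outer_vertices (Suc r).
      u \<noteq> v \<and> e = {u, v} \<and> (crosses_wall r u v \<longleftrightarrow> is_Top u = is_Top v)" if "e \<in> diag r \<pi>" for e
  proof -
    obtain i where i: "i \<in> {1..Suc r}" "e = {btm r i, tp r (\<pi> \<langle>$\<rangle> i)}" using \<open>e \<in> diag r \<pi>\<close> by (auto simp: diag_def)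
    then show ?thesis using Sym_in[OF assms i(1)] wall_condition(1)[of r i "\<pi> \<langle>$\<rangle> i"]
      by (intro bexI[of _ "btm r i"] bexI[of _ "tp r (\<pi> \<langle>$\<rangle> i)"]) (auto simp: outer_vertices_eq)
  qed
  moreover have "\<exists>!e. e \<in> diag r \<pi> \<and> v \<in> e" if v: "v \<in> outer_vertices (Suc r)" for v
  proof -
    consider i where "i \<in> {1..Suc r}" "v = btm r i" | i where "i \<in> {1..Suc r}" "v = tp r i"
      using v by (auto simp: outer_vertices_eq)
    then show ?thesis
    proof cases
      case (1 i)
      then show ?thesis by (intro ex1I[of _ "{btm r i, tp r (\<pi> \<langle>$\<rangle> i)}"]) (auto simp: diag_def)
    next
      case (2 i)
      define j where "j = inverse \<pi> \<langle>$\<rangle> i"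
      have j: "j \<in> {1..Suc r}" "\<pi> \<langle>$\<rangle> j = i" using Sym_in[of "inverse \<pi>" "Suc r" i] assms 2 by (simp_all add: j_def)
      show ?thesis
      proof (rule ex1I[of _ "{btm r j, tp r i}"])
        show "{btm r j, tp r i} \<in> diag r \<pi> \<and> v \<in> {btm r j, tp r i}"
          unfolding diag_def using 2 j by (auto simp del: atLeastAtMost_iff)
        fix e assume "e \<in> diag r \<pi> \<and> v \<in> e"
        then obtain k where k: "e = {btm r k, tp r (\<pi> \<langle>$\<rangle> k)}" "tp r i \<in> e" using 2 by (auto simp: diag_def)
        then have "\<pi> \<langle>$\<rangle> k = \<pi> \<langle>$\<rangle> j" using j by auto
        then have "k = j" by (simp add: apply_inj)
        then show "e = {btm r j, tp r i}" using k(1) j by simp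
      qed
    qed
  qed
  ultimately show ?thesis by (simp add: wb_diagrams_def)
qed

text \<open>The strand at each \<open>btm\<close> vertex defines a map of columns, injective because
  a \<open>tp\<close> vertex lies on only one strand.\<close>

lemma wb_diagrams_eq: "wb_diagrams r 1 = diag r ` Sym (Suc r)"
proof
  show "diag r ` Sym (Suc r) \<subseteq> wb_diagrams r 1" using diag_in_wb by blast
  show "wb_diagrams r 1 \<subseteq> diag r ` Sym (Suc r)"
  proof
    fix d assume "d \<in> wb_diagrams r 1"
    then have d1: "\<And>e. e \<in> d \<Longrightarrow> \<exists>u\<in>outer_vertices (Suc r). \<exists>v\<in>outer_vertices (Suc r).
      u \<noteq> v \<and> e = {u, v} \<and> (crosses_wall r u v \<longleftrightarrow> is_Top u = is_Top v)"
      and d2: "\<And>v. v \<in> outer_vertices (Suc r) \<Longrightarrow> \<exists>!e. e \<in> d \<and> v \<in> e" by (auto simp: wb_diagrams_def)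
    have e: "\<exists>i\<in>{1..Suc r}. \<exists>j\<in>{1..Suc r}. e = {btm r i, tp r j}" if ed: "e \<in> d" for e
    proof -
      obtain u v where uv: "u \<in> outer_vertices (Suc r)" "v \<in> outer_vertices (Suc r)" "e = {u, v}"
        "crosses_wall r u v \<longleftrightarrow> is_Top u = is_Top v" using d1[OF ed] by blast
      then show ?thesis using wall_condition[of r]
        by (auto simp: outer_vertices_eq)
    qed
    have ex: "\<exists>j\<in>{1..Suc r}. {btm r i, tp r j} \<in> d" if i: "i \<in> {1..Suc r}" for i
    proof -
      have "btm r i \<in> outer_vertices (Suc r)" using i by (auto simp: outer_vertices_eq)
      then obtain s where s: "s \<in> d" "btm r i \<in> s" using d2 by blast
      then show ?thesis using e[OF s(1)] by auto
    qed
    then obtain f where f: "\<And>i. i \<in> {1..Suc r} \<Longrightarrow> f i \<in> {1..Suc r} \<and> {btm r i, tp r (f i)} \<in> d" by metis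
    have inj: "inj_on f {1..Suc r}"
    proof (rule inj_onI)
      fix i j assume ij: "i \<in> {1..Suc r}" "j \<in> {1..Suc r}" "f i = f j"
      have "tp r (f i) \<in> outer_vertices (Suc r)" using f[OF ij(1)] by (auto simp: outer_vertices_eq)
      then have "{btm r i, tp r (f i)} = {btm r j, tp r (f j)}"
        using d2 f[OF ij(1)] f[OF ij(2)] ij(3) by (metis insert_iff)
      then show "i = j" by (simp add: strand_pair_iff)
    qed
    have "f ` {1..Suc r} \<subseteq> {1..Suc r}" using f by blast
    then obtain \<tau> where t: "\<tau> \<in> Sym (Suc r)" "\<And>i. i \<in> {1..Suc r} \<Longrightarrow> \<tau> \<langle>$\<rangle> i = f i"
      using Sym_extend[OF order.refl inj] by blast
    have "d = diag r \<tau>"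
    proof (intro equalityI subsetI)
      fix s assume s: "s \<in> d"
      then obtain i j where ij: "i \<in> {1..Suc r}" "j \<in> {1..Suc r}" "s = {btm r i, tp r j}" using e by blast
      have "btm r i \<in> outer_vertices (Suc r)" using ij by (auto simp: outer_vertices_eq)
      then have "s = {btm r i, tp r (f i)}" using d2 f[OF ij(1)] s ij(3) by (metis insertI1)
      then show "s \<in> diag r \<tau>" using ij t(2) by (auto simp: diag_def)
    next
      fix s assume "s \<in> diag r \<tau>"
      then show "s \<in> d" using f t(2) by (auto simp: diag_def)
    qed
    then show "d \<in> diag r ` Sym (Suc r)" using t(1) by blast
  qed
qed

text \<open>The end points in the stack of two flipped diagrams: \<open>b1\<close> and \<open>t1\<close> for the upper diagram,
  \<open>b2\<close> and \<open>t2\<close> for the lower one.\<close>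

definition b1 :: "nat \<Rightarrow> nat \<Rightarrow> vertex" where "b1 r i = (if i \<le> r then Mid i else Top i)"
definition t1 :: "nat \<Rightarrow> nat \<Rightarrow> vertex" where "t1 r i = (if i \<le> r then Top i else Mid i)"
definition b2 :: "nat \<Rightarrow> nat \<Rightarrow> vertex" where "b2 r i = (if i \<le> r then Bot i else Mid i)"
definition t2 :: "nat \<Rightarrow> nat \<Rightarrow> vertex" where "t2 r i = (if i \<le> r then Mid i else Bot i)"

section \<open>Composition of stacked diagrams\<close>

lemma stack_diag:
  "stack (diag r \<pi>) (diag r \<rho>) = (\<lambda>i. {b1 r i, t1 r (\<pi> \<langle>$\<rangle> i)}) ` {1..Suc r} \<union> (\<lambda>i. {b2 r i, t2 r (\<rho> \<langle>$\<rangle> i)}) ` {1..Suc r}"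
proof -
  have "bot_to_mid (btm r i) = b1 r i" "bot_to_mid (tp r i) = t1 r i"
    "top_to_mid (btm r i) = b2 r i" "top_to_mid (tp r i) = t2 r i" for i
    by (simp_all add: bot_to_mid_def top_to_mid_def btm_def tp_def b1_def t1_def b2_def t2_def)
  then show ?thesis by (simp add: stack_def diag_def image_image)
qed

lemma connected_refl [simp]: "(v, v) \<in> connected_in_stack d1 d2"
  by (simp add: connected_in_stack_def)

lemma connected_sym: "(u, v) \<in> connected_in_stack d1 d2 \<Longrightarrow> (v, u) \<in> connected_in_stack d1 d2"
proof -
  have "sym {(u, v). {u, v} \<in> stack d1 d2}" by (auto simp: sym_def insert_commute)
  then show "(u, v) \<in> connected_in_stack d1 d2 \<Longrightarrow> (v, u) \<in> connected_in_stack d1 d2"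
    unfolding connected_in_stack_def using sym_rtrancl symD by metis
qed

lemma connected_trans:
  "(u, v) \<in> connected_in_stack d1 d2 \<Longrightarrow> (v, w) \<in> connected_in_stack d1 d2 \<Longrightarrow> (u, w) \<in> connected_in_stack d1 d2"
  unfolding connected_in_stack_def by (rule rtrancl_trans)

lemma connected_upper: "i \<in> {1..Suc r} \<Longrightarrow> (b1 r i, t1 r (\<pi> \<langle>$\<rangle> i)) \<in> connected_in_stack (diag r \<pi>) (diag r \<rho>)"
  unfolding connected_in_stack_def by (rule r_into_rtrancl) (auto simp: stack_diag)

lemma connected_lower: "i \<in> {1..Suc r} \<Longrightarrow> (b2 r i, t2 r (\<rho> \<langle>$\<rangle> i)) \<in> connected_in_stack (diag r \<pi>) (diag r \<rho>)"
  unfolding connected_in_stack_def by (rule r_into_rtrancl) (auto simp: stack_diag)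

text \<open>Components are separated by a vertex label that is constant along edges, so that no
  paths have to be analysed.\<close>

lemma connected_invariant:
  assumes "\<And>i. i \<in> {1..Suc r} \<Longrightarrow> h (b1 r i) = h (t1 r (\<pi> \<langle>$\<rangle> i))"
    "\<And>i. i \<in> {1..Suc r} \<Longrightarrow> h (b2 r i) = h (t2 r (\<rho> \<langle>$\<rangle> i))"
    "(u, v) \<in> connected_in_stack (diag r \<pi>) (diag r \<rho>)"
  shows "h u = h v"
  using assms(3) unfolding connected_in_stack_def
proof (induction rule: rtrancl_induct)
  case (step v w)
  then have "{v, w} \<in> stack (diag r \<pi>) (diag r \<rho>)" by simp
  then have "h v = h w" unfolding stack_diag using assms(1,2) by (auto simp: doubleton_eq_iff)
  then show ?case using step by simp
qed simp

text \<open>\<open>h\<close> labels a vertex with the column of the \<open>btm\<close> end of its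
  strand. \<open>E1\<close> and \<open>E2\<close> say that labels are constant on components,
  \<open>C\<close> supplies the connections, and by \<open>H\<close> equal labels single out the two
  ends of a strand.\<close>

lemma diagram_comp_eqI:
  assumes \<theta>: "\<theta> \<in> Sym (Suc r)"
    and E1: "\<And>i. i \<in> {1..Suc r} \<Longrightarrow> h (b1 r i) = h (t1 r (\<pi> \<langle>$\<rangle> i))"
    and E2: "\<And>i. i \<in> {1..Suc r} \<Longrightarrow> h (b2 r i) = h (t2 r (\<rho> \<langle>$\<rangle> i))"
    and H: "\<And>i. i \<in> {1..Suc r} \<Longrightarrow> h (btm r i) = (i :: nat)"
      "\<And>i. i \<in> {1..Suc r} \<Longrightarrow> h (tp r i) = inverse \<theta> \<langle>$\<rangle> i"
    and C: "\<And>i. i \<in> {1..Suc r} \<Longrightarrow> (btm r i, tp r (\<theta> \<langle>$\<rangle> i)) \<in> connected_in_stack (diag r \<pi>) (diag r \<rho>)"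
  shows "diagram_comp (Suc r) (diag r \<pi>) (diag r \<rho>) = diag r \<theta>"
proof (intro equalityI subsetI)
  fix e assume "e \<in> diagram_comp (Suc r) (diag r \<pi>) (diag r \<rho>)"
  then obtain u v where uv: "e = {u, v}" "u \<in> outer_vertices (Suc r)" "v \<in> outer_vertices (Suc r)" "u \<noteq> v"
    "(u, v) \<in> connected_in_stack (diag r \<pi>) (diag r \<rho>)"
    by (auto simp: diagram_comp_def)
  have huv: "h u = h v" by (rule connected_invariant[OF E1 E2 uv(5)])
  have out: "w = btm r (h w) \<and> h w \<in> {1..Suc r} \<or> w = tp r (\<theta> \<langle>$\<rangle> (h w)) \<and> h w \<in> {1..Suc r}"
    if "w \<in> outer_vertices (Suc r)" for w
    using that Sym_in[of "inverse \<theta>" "Suc r"] \<theta> unfolding outer_vertices_eq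
    by (auto simp: H simp del: atLeastAtMost_iff)
  from out[OF uv(2)] out[OF uv(3)] huv uv(4)
  have "(u = btm r (h u) \<and> v = tp r (\<theta> \<langle>$\<rangle> (h u)) \<or> v = btm r (h u) \<and> u = tp r (\<theta> \<langle>$\<rangle> (h u))) \<and> h u \<in> {1..Suc r}"
    by auto
  then have "e = {btm r (h u), tp r (\<theta> \<langle>$\<rangle> (h u))}" "h u \<in> {1..Suc r}"
    using uv(1) by (auto simp: insert_commute)
  then show "e \<in> diag r \<theta>" unfolding diag_def by blast
next
  fix e assume "e \<in> diag r \<theta>"
  then obtain i where i: "i \<in> {1..Suc r}" "e = {btm r i, tp r (\<theta> \<langle>$\<rangle> i)}" by (auto simp: diag_def)
  have "btm r i \<in> outer_vertices (Suc r)" "tp r (\<theta> \<langle>$\<rangle> i) \<in> outer_vertices (Suc r)"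
    using i(1) Sym_in[OF \<theta> i(1)] unfolding outer_vertices_eq by blast+
  then show "e \<in> diagram_comp (Suc r) (diag r \<pi>) (diag r \<rho>)"
    unfolding diagram_comp_def using C[OF i(1)] i(2) btm_neq_tp(1) by blast
qed

lemma loops_0I:
  assumes "\<And>i. i \<in> {1..n} \<Longrightarrow> \<exists>v. v \<notin> range Mid \<and> (Mid i, v) \<in> connected_in_stack d1 d2"
  shows "loops n d1 d2 = 0"
proof -
  have "{C. (\<exists>i\<in>{1..n}. C = connected_in_stack d1 d2 `` {Mid i}) \<and> C \<subseteq> range Mid} = {}"
    using assms by blast
  then show ?thesis by (simp add: loops_def)
qed

lemma Sym_inv_apply: "\<theta> \<langle>$\<rangle> a = b \<Longrightarrow> inverse \<theta> \<langle>$\<rangle> b = a"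
  by auto

lemma comp_fix_upper:
  assumes p: "\<pi> \<in> Sym r" and q: "\<rho> \<in> Sym (Suc r)"
  shows "diagram_comp (Suc r) (diag r \<pi>) (diag r \<rho>) = diag r (\<pi> * \<rho>)"
    "loops (Suc r) (diag r \<pi>) (diag r \<rho>) = 0"
proof -
  let ?n = "Suc r"
  let ?\<theta> = "\<pi> * \<rho>"
  let ?R = "connected_in_stack (diag r \<pi>) (diag r \<rho>)"
  have p': "\<pi> \<in> Sym ?n" using p Sym_mono[of r ?n] by auto
  have pn: "\<pi> \<langle>$\<rangle> ?n = ?n" "inverse \<pi> \<langle>$\<rangle> ?n = ?n" using p by (auto intro: Sym_fix)
  have pr: "\<pi> \<langle>$\<rangle> i \<le> r \<longleftrightarrow> i \<le> r" if "i \<in> {1..?n}" for i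
    using Sym_in[OF p, of i] that pn by (cases "i = ?n") auto
  \<comment> \<open>The last middle vertex is joined to the last top vertex, the \<open>btm\<close>
    vertex of that column; every other middle vertex belongs to the strand that enters it from the
    lower diagram.\<close>
  define h where "h v = (case v of Bot i \<Rightarrow> if i \<le> r then i else inverse ?\<theta> \<langle>$\<rangle> i
    | Top i \<Rightarrow> if i \<le> r then inverse ?\<theta> \<langle>$\<rangle> i else i
    | Mid i \<Rightarrow> if i \<le> r then inverse \<rho> \<langle>$\<rangle> i else ?n)" for v
  have n1: "i = ?n" if "i \<in> {1..?n}" "\<not> i \<le> r" for i using that by auto
  have up: "(Mid i, Top (\<pi> \<langle>$\<rangle> i)) \<in> ?R" if "i \<in> {1..?n}" "i \<le> r" for i
    using connected_upper[OF that(1), of \<pi> \<rho>] pr[OF that(1)] that(2) by (simp add: b1_def t1_def)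
  have upn: "(Mid ?n, Top ?n) \<in> ?R"
    using connected_upper[of ?n r \<pi> \<rho>] connected_sym by (simp add: b1_def t1_def pn)
  show "diagram_comp ?n (diag r \<pi>) (diag r \<rho>) = diag r ?\<theta>"
  proof (rule diagram_comp_eqI[where h = h])
    show "?\<theta> \<in> Sym ?n" by (rule Sym_mult[OF p' q])
    fix i assume i: "i \<in> {1..?n}"
    show "h (b1 r i) = h (t1 r (\<pi> \<langle>$\<rangle> i))"
      using pr[OF i] n1[OF i] by (cases "i \<le> r") (auto simp: h_def b1_def t1_def apply_times pn)
    show "h (b2 r i) = h (t2 r (\<rho> \<langle>$\<rangle> i))"
    proof (cases "\<rho> \<langle>$\<rangle> i \<le> r")
      case True
      then show ?thesis using n1[OF i] by (auto simp: h_def b2_def t2_def)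
    next
      case False
      then have "\<rho> \<langle>$\<rangle> i = ?n" using n1 Sym_in[OF q i] by blast
      then have "inverse ?\<theta> \<langle>$\<rangle> ?n = i" by (simp add: apply_times pn Sym_inv_apply)
      then show ?thesis using n1[OF i] \<open>\<rho> \<langle>$\<rangle> i = ?n\<close> by (auto simp: h_def b2_def t2_def)
    qed
    show "h (btm r i) = i" by (simp add: h_def btm_def)
    show "h (tp r i) = inverse ?\<theta> \<langle>$\<rangle> i" by (simp add: h_def tp_def)
    have "(btm r i, b2 r i) \<in> ?R"
      using n1[OF i] connected_sym[OF upn] by (auto simp: btm_def b2_def)
    moreover have "(t2 r (\<rho> \<langle>$\<rangle> i), tp r (?\<theta> \<langle>$\<rangle> i)) \<in> ?R"
      using up[OF Sym_in[OF q i]] n1[OF Sym_in[OF q i]] pr[OF Sym_in[OF q i]] pn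
      by (auto simp: t2_def tp_def apply_times)
    ultimately show "(btm r i, tp r (?\<theta> \<langle>$\<rangle> i)) \<in> ?R"
      using connected_lower[OF i, of \<rho> \<pi>] connected_trans by blast
  qed
  show "loops ?n (diag r \<pi>) (diag r \<rho>) = 0"
  proof (rule loops_0I)
    fix i assume i: "i \<in> {1..?n}"
    show "\<exists>v. v \<notin> range Mid \<and> (Mid i, v) \<in> ?R"
      using up[OF i] upn n1[OF i] by (cases "i \<le> r") blast+
  qed
qed

lemma comp_fix_lower:
  assumes p: "\<pi> \<in> Sym (Suc r)" and q: "\<rho> \<in> Sym r"
  shows "diagram_comp (Suc r) (diag r \<pi>) (diag r \<rho>) = diag r (\<pi> * \<rho>)"
    "loops (Suc r) (diag r \<pi>) (diag r \<rho>) = 0"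
proof -
  let ?n = "Suc r"
  let ?\<theta> = "\<pi> * \<rho>"
  let ?R = "connected_in_stack (diag r \<pi>) (diag r \<rho>)"
  have q': "\<rho> \<in> Sym ?n" using q Sym_mono[of r ?n] by auto
  have qn: "\<rho> \<langle>$\<rangle> ?n = ?n" "inverse \<rho> \<langle>$\<rangle> ?n = ?n" using q by (auto intro: Sym_fix)
  have qr: "\<rho> \<langle>$\<rangle> i \<le> r \<longleftrightarrow> i \<le> r" if "i \<in> {1..?n}" for i
    using Sym_in[OF q, of i] that qn by (cases "i = ?n") auto
  \<comment> \<open>Now the last middle vertex is joined to the last bottom vertex, a
    \<open>tp\<close> end, and takes its label.\<close>
  define h where "h v = (case v of Bot i \<Rightarrow> if i \<le> r then i else inverse ?\<theta> \<langle>$\<rangle> i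
    | Top i \<Rightarrow> if i \<le> r then inverse ?\<theta> \<langle>$\<rangle> i else i
    | Mid i \<Rightarrow> if i \<le> r then inverse \<rho> \<langle>$\<rangle> i else inverse ?\<theta> \<langle>$\<rangle> ?n)" for v
  have n1: "i = ?n" if "i \<in> {1..?n}" "\<not> i \<le> r" for i using that by auto
  have low: "(Mid i, Bot (inverse \<rho> \<langle>$\<rangle> i)) \<in> ?R" if i: "i \<in> {1..?n}" "i \<le> r" for i
  proof -
    let ?j = "inverse \<rho> \<langle>$\<rangle> i"
    have j: "?j \<in> {1..?n}" using Sym_in[of "inverse \<rho>" ?n i] q' i(1) by simp
    then have "?j \<le> r" using qr[OF j] i(2) by simp
    then show ?thesis using connected_sym[OF connected_lower[OF j, of \<rho> \<pi>]] i(2) by (simp add: b2_def t2_def)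
  qed
  have lown: "(Mid ?n, Bot ?n) \<in> ?R"
    using connected_lower[of ?n r \<rho> \<pi>] by (simp add: b2_def t2_def qn)
  show "diagram_comp ?n (diag r \<pi>) (diag r \<rho>) = diag r ?\<theta>"
  proof (rule diagram_comp_eqI[where h = h])
    show "?\<theta> \<in> Sym ?n" by (rule Sym_mult[OF p q'])
    fix i assume i: "i \<in> {1..?n}"
    show "h (b1 r i) = h (t1 r (\<pi> \<langle>$\<rangle> i))"
    proof (cases "\<pi> \<langle>$\<rangle> i \<le> r")
      case True
      then show ?thesis using n1[OF i] by (auto simp: h_def b1_def t1_def apply_times qn)
    next
      case False
      then have e: "\<pi> \<langle>$\<rangle> i = ?n" using n1 Sym_in[OF p i] by blast
      then have "inverse \<pi> \<langle>$\<rangle> ?n = i" by (rule Sym_inv_apply)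
      then show ?thesis using n1[OF i] e by (auto simp: h_def b1_def t1_def apply_times qn)
    qed
    show "h (b2 r i) = h (t2 r (\<rho> \<langle>$\<rangle> i))"
      using qr[OF i] n1[OF i] by (cases "i \<le> r") (auto simp: h_def b2_def t2_def qn)
    show "h (btm r i) = i" by (simp add: h_def btm_def)
    show "h (tp r i) = inverse ?\<theta> \<langle>$\<rangle> i" by (simp add: h_def tp_def)
    have "(btm r i, b1 r (\<rho> \<langle>$\<rangle> i)) \<in> ?R"
    proof (cases "i \<le> r")
      case True
      then show ?thesis using connected_lower[OF i, of \<rho> \<pi>] qr[OF i] by (simp add: btm_def b1_def b2_def t2_def)
    next
      case False
      then show ?thesis using n1[OF i] qn by (auto simp: btm_def b1_def)
    qed
    moreover have "(t1 r (?\<theta> \<langle>$\<rangle> i), tp r (?\<theta> \<langle>$\<rangle> i)) \<in> ?R"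
      using lown n1[OF Sym_in[OF Sym_mult[OF p q'] i]] by (auto simp: t1_def tp_def)
    moreover have "(b1 r (\<rho> \<langle>$\<rangle> i), t1 r (?\<theta> \<langle>$\<rangle> i)) \<in> ?R"
      using connected_upper[OF Sym_in[OF q' i], of \<pi> \<rho>] by (simp add: apply_times)
    ultimately show "(btm r i, tp r (?\<theta> \<langle>$\<rangle> i)) \<in> ?R"
      using connected_trans by metis
  qed
  show "loops ?n (diag r \<pi>) (diag r \<rho>) = 0"
  proof (rule loops_0I)
    fix i assume i: "i \<in> {1..?n}"
    show "\<exists>v. v \<notin> range Mid \<and> (Mid i, v) \<in> ?R"
      using low[OF i] lown n1[OF i] by (cases "i \<le> r") blast+
  qed
qed

text \<open>The northern arc of the upper and the southern arc of the lower diagram survive. The two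
  arcs in the middle row share the vertex \<open>Mid n\<close>: either they link the strand from
  column \<open>q\<close> to its upper end, or they have the same end points, for
  \<open>q = n\<close>, and form the loop.\<close>

lemma comp_arcs:
  fixes r :: nat
  defines "n \<equiv> Suc r"
  assumes \<pi>: "\<pi> \<in> Sym n" "\<pi> \<langle>$\<rangle> n \<noteq> n" and \<rho>: "\<rho> \<in> Sym n" "\<rho> \<langle>$\<rangle> n \<noteq> n"
  defines "p \<equiv> inverse \<rho> \<langle>$\<rangle> n" and "q \<equiv> inverse (\<pi> * \<rho>) \<langle>$\<rangle> n"
  defines "\<theta> \<equiv> \<pi> * \<rho> * swap q n * swap p n"
  shows "diagram_comp n (diag r \<pi>) (diag r \<rho>) = diag r \<theta>"
    "loops n (diag r \<pi>) (diag r \<rho>) = (if q = n then 1 else 0)"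
proof -
  let ?R = "connected_in_stack (diag r \<pi>) (diag r \<rho>)"
  have nn: "n \<in> {1..n}" by (simp add: n_def)
  have pq: "p \<in> {1..n}" "q \<in> {1..n}"
    using Sym_in[of "inverse \<rho>" n n] Sym_in[of "inverse (\<pi> * \<rho>)" n n] \<rho>(1) Sym_mult[OF \<pi>(1) \<rho>(1)] nn
    by (simp_all add: p_def q_def del: perm.inverse_distrib_swap)
  have rp: "\<rho> \<langle>$\<rangle> p = n" by (simp add: p_def)
  have rq: "\<pi> \<langle>$\<rangle> (\<rho> \<langle>$\<rangle> q) = n" by (simp add: q_def apply_times)
  have pn: "p \<noteq> n" using rp \<rho>(2) by auto
  have pnq: "p \<noteq> q" using rp rq \<pi>(2) by auto
  have thp: "\<theta> \<langle>$\<rangle> p = n" using rq by (simp add: \<theta>_def apply_times)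
  have thn: "\<theta> \<langle>$\<rangle> n = \<pi> \<langle>$\<rangle> n"
    using rp pn pnq by (simp add: \<theta>_def apply_times)
  have thq: "\<theta> \<langle>$\<rangle> q = \<pi> \<langle>$\<rangle> (\<rho> \<langle>$\<rangle> n)" if "q \<noteq> n"
    using that pnq by (simp add: \<theta>_def apply_times)
  have tho: "\<theta> \<langle>$\<rangle> i = \<pi> \<langle>$\<rangle> (\<rho> \<langle>$\<rangle> i)" if "i \<noteq> n" "i \<noteq> p" "i \<noteq> q" for i
    using that by (simp add: \<theta>_def apply_times)
  have thS: "\<theta> \<in> Sym n" unfolding \<theta>_def
    by (intro Sym_mult \<pi>(1) \<rho>(1) Sym_swap pq nn)
  note inv = thp[THEN Sym_inv_apply] thn[THEN Sym_inv_apply] thq[THEN Sym_inv_apply] tho[THEN Sym_inv_apply]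
  have n1: "i = n" if "i \<in> {1..n}" "\<not> i \<le> r" for i using that by (auto simp: n_def)
  have nr: "\<not> n \<le> r" by (simp add: n_def)
  have le: "i \<le> r \<longleftrightarrow> i \<noteq> n" if "i \<in> {1..n}" for i using that by (auto simp: n_def)
  \<comment> \<open>\<open>0\<close> is not a column; it marks the loop. Without a loop the vertices
    of the two middle arcs belong to the strand from \<open>q\<close>.\<close>
  define h where "h v = (case v of Bot i \<Rightarrow> if i \<le> r then i else inverse \<theta> \<langle>$\<rangle> i
    | Top i \<Rightarrow> if i \<le> r then inverse \<theta> \<langle>$\<rangle> i else i
    | Mid i \<Rightarrow> if i = n \<or> i = \<rho> \<langle>$\<rangle> n then (if q = n then 0 else q) else inverse \<rho> \<langle>$\<rangle> i)" for v
  have up: "(b1 r i, t1 r (\<pi> \<langle>$\<rangle> i)) \<in> ?R" if "i \<in> {1..n}" for i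
    using connected_upper[of i r \<pi> \<rho>] that by (simp add: n_def)
  have lo: "(b2 r i, t2 r (\<rho> \<langle>$\<rangle> i)) \<in> ?R" if "i \<in> {1..n}" for i
    using connected_lower[of i r \<rho> \<pi>] that by (simp add: n_def)
  have E1: "h (b1 r i) = h (t1 r (\<pi> \<langle>$\<rangle> i))" if i: "i \<in> {1..n}" for i
  proof (cases "i = n")
    case True
    have "\<pi> \<langle>$\<rangle> n \<le> r" using le[OF Sym_in[OF \<pi>(1) nn]] \<pi>(2) by simp
    then show ?thesis using nr True inv(2) by (simp add: h_def b1_def t1_def)
  next
    case False
    then have ir: "i \<le> r" using le[OF i] by simp
    show ?thesis
    proof (cases "\<pi> \<langle>$\<rangle> i = n")
      case True
      have "i = \<rho> \<langle>$\<rangle> q" using True rq by (metis apply_inj)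
      then have "i = \<rho> \<langle>$\<rangle> n \<longleftrightarrow> q = n" "inverse \<rho> \<langle>$\<rangle> i = q" by (auto simp: apply_inj)
      then show ?thesis using True ir nr False by (auto simp: h_def b1_def t1_def)
    next
      case nf: False
      then have pr: "\<pi> \<langle>$\<rangle> i \<le> r" using le[OF Sym_in[OF \<pi>(1) i]] by simp
      show ?thesis
      proof (cases "i = \<rho> \<langle>$\<rangle> n")
        case True
        have "q \<noteq> n"
        proof
          assume "q = n"
          then have "\<pi> \<langle>$\<rangle> i = n" using rq True by simp
          then show False using nf by simp
        qed
        then have "inverse \<theta> \<langle>$\<rangle> (\<pi> \<langle>$\<rangle> i) = q" using inv(3) True by simp
        then show ?thesis using True ir pr \<open>q \<noteq> n\<close> by (simp add: h_def b1_def t1_def)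
      next
        case False
        define k where "k = inverse \<rho> \<langle>$\<rangle> i"
        have k: "\<rho> \<langle>$\<rangle> k = i" by (simp add: k_def)
        have "k \<noteq> n" "k \<noteq> p" "k \<noteq> q" using k False \<open>i \<noteq> n\<close> rp rq nf by auto
        then have "inverse \<theta> \<langle>$\<rangle> (\<pi> \<langle>$\<rangle> i) = k" using inv(4)[of k] k by simp
        then show ?thesis using ir pr False \<open>i \<noteq> n\<close> by (simp add: h_def b1_def t1_def k_def)
      qed
    qed
  qed
  have E2: "h (b2 r i) = h (t2 r (\<rho> \<langle>$\<rangle> i))" if i: "i \<in> {1..n}" for i
  proof (cases "i = n")
    case True
    have "\<rho> \<langle>$\<rangle> n \<le> r" using le[OF Sym_in[OF \<rho>(1) nn]] \<rho>(2) by simp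
    then show ?thesis using nr True by (simp add: h_def b2_def t2_def)
  next
    case False
    then have ir: "i \<le> r" using le[OF i] by simp
    show ?thesis
    proof (cases "\<rho> \<langle>$\<rangle> i = n")
      case True
      then have "i = p" using rp by (metis apply_inj)
      then show ?thesis using True ir nr inv(1) by (simp add: h_def b2_def t2_def)
    next
      case nf: False
      then have "\<rho> \<langle>$\<rangle> i \<le> r" using le[OF Sym_in[OF \<rho>(1) i]] by simp
      then show ?thesis using ir nf False by (simp add: h_def b2_def t2_def apply_inj)
    qed
  qed
  show "diagram_comp n (diag r \<pi>) (diag r \<rho>) = diag r \<theta>"
    unfolding n_def
  proof (rule diagram_comp_eqI[where h = h])
    show "\<theta> \<in> Sym (Suc r)" using thS by (simp add: n_def)
    fix i assume "i \<in> {1..Suc r}"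
    then have i: "i \<in> {1..n}" by (simp add: n_def)
    show "h (b1 r i) = h (t1 r (\<pi> \<langle>$\<rangle> i))" by (rule E1[OF i])
    show "h (b2 r i) = h (t2 r (\<rho> \<langle>$\<rangle> i))" by (rule E2[OF i])
    show "h (btm r i) = i" by (simp add: h_def btm_def)
    show "h (tp r i) = inverse \<theta> \<langle>$\<rangle> i" by (simp add: h_def tp_def)
    consider "i = n" | "i = p" | "i = q" "i \<noteq> n" | "i \<noteq> n" "i \<noteq> p" "i \<noteq> q" by blast
    then show "(btm r i, tp r (\<theta> \<langle>$\<rangle> i)) \<in> ?R"
    proof cases
      case 1
      have "\<pi> \<langle>$\<rangle> n \<le> r" using le[OF Sym_in[OF \<pi>(1) nn]] \<pi>(2) by simp
      then show ?thesis using up[OF nn] 1 nr by (simp add: b1_def t1_def btm_def tp_def thn)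
    next
      case 2
      have "p \<le> r" using le[OF pq(1)] pn by simp
      then show ?thesis using lo[OF pq(1)] 2 nr by (simp add: b2_def t2_def btm_def tp_def thp rp)
    next
      case 3
      have qr: "q \<le> r" using le[OF pq(2)] 3 by simp
      have a: "\<rho> \<langle>$\<rangle> q \<in> {1..n}" "\<rho> \<langle>$\<rangle> n \<in> {1..n}" using Sym_in[OF \<rho>(1)] pq nn by blast+
      have b: "\<rho> \<langle>$\<rangle> q \<le> r" using le[OF a(1)] rq \<pi>(2) by auto
      have c: "\<rho> \<langle>$\<rangle> n \<le> r" using le[OF a(2)] \<rho>(2) by simp
      have "\<pi> \<langle>$\<rangle> (\<rho> \<langle>$\<rangle> n) \<noteq> n" using rq 3 by (metis apply_inj)
      then have d: "\<pi> \<langle>$\<rangle> (\<rho> \<langle>$\<rangle> n) \<le> r" using le[OF Sym_in[OF \<pi>(1) a(2)]] by simp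
      have 1: "(Bot q, Mid (\<rho> \<langle>$\<rangle> q)) \<in> ?R" using lo[OF pq(2)] qr b by (simp add: b2_def t2_def)
      have 2: "(Mid (\<rho> \<langle>$\<rangle> q), Mid n) \<in> ?R" using up[OF a(1)] b nr by (simp add: b1_def t1_def rq)
      have 4: "(Mid n, Mid (\<rho> \<langle>$\<rangle> n)) \<in> ?R" using lo[OF nn] nr c by (simp add: b2_def t2_def)
      have 5: "(Mid (\<rho> \<langle>$\<rangle> n), Top (\<pi> \<langle>$\<rangle> (\<rho> \<langle>$\<rangle> n))) \<in> ?R" using up[OF a(2)] c d by (simp add: b1_def t1_def)
      have "(Bot q, Top (\<pi> \<langle>$\<rangle> (\<rho> \<langle>$\<rangle> n))) \<in> ?R" using 1 2 4 5 connected_trans by blast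
      then show ?thesis using 3 qr d by (simp add: btm_def tp_def thq)
    next
      case 4
      have ir: "i \<le> r" using le[OF i] 4 by simp
      have a: "\<rho> \<langle>$\<rangle> i \<in> {1..n}" using Sym_in[OF \<rho>(1) i] .
      have "\<rho> \<langle>$\<rangle> i \<noteq> n" using rp 4 by (metis apply_inj)
      then have b: "\<rho> \<langle>$\<rangle> i \<le> r" using le[OF a] by simp
      have "\<pi> \<langle>$\<rangle> (\<rho> \<langle>$\<rangle> i) \<noteq> n" using rq 4 by (metis apply_inj)
      then have c: "\<pi> \<langle>$\<rangle> (\<rho> \<langle>$\<rangle> i) \<le> r" using le[OF Sym_in[OF \<pi>(1) a]] by simp
      have "(Bot i, Mid (\<rho> \<langle>$\<rangle> i)) \<in> ?R" using lo[OF i] ir b by (simp add: b2_def t2_def)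
      moreover have "(Mid (\<rho> \<langle>$\<rangle> i), Top (\<pi> \<langle>$\<rangle> (\<rho> \<langle>$\<rangle> i))) \<in> ?R" using up[OF a] b c by (simp add: b1_def t1_def)
      ultimately have "(Bot i, Top (\<pi> \<langle>$\<rangle> (\<rho> \<langle>$\<rangle> i))) \<in> ?R" by (rule connected_trans)
      then show ?thesis using ir c by (simp add: btm_def tp_def tho[OF 4])
    qed
  qed
  have an: "\<rho> \<langle>$\<rangle> n \<in> {1..n}" "\<rho> \<langle>$\<rangle> n \<le> r" using Sym_in[OF \<rho>(1) nn] le[OF Sym_in[OF \<rho>(1) nn]] \<rho>(2) by simp_all
  have mid: "(Mid n, Mid (\<rho> \<langle>$\<rangle> n)) \<in> ?R" using lo[OF nn] nr an by (simp add: b2_def t2_def)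
  have other: "(Mid i, Bot (inverse \<rho> \<langle>$\<rangle> i)) \<in> ?R" if i: "i \<in> {1..n}" "i \<noteq> n" "i \<noteq> \<rho> \<langle>$\<rangle> n" for i
  proof -
    let ?k = "inverse \<rho> \<langle>$\<rangle> i"
    have k: "?k \<in> {1..n}" using Sym_in[of "inverse \<rho>" n i] \<rho>(1) i by simp
    have "?k \<noteq> n" using i(3) by (auto simp: perm_inverse_eq_iff)
    then show ?thesis using connected_sym[OF lo[OF k]] le[OF k] le[OF i(1)] i(2) by (simp add: b2_def t2_def)
  qed
  show "loops n (diag r \<pi>) (diag r \<rho>) = (if q = n then 1 else 0)"
  proof (cases "q = n")
    case False
    have "\<pi> \<langle>$\<rangle> (\<rho> \<langle>$\<rangle> n) \<noteq> n" using rq False by (metis apply_inj)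
    then have d: "\<pi> \<langle>$\<rangle> (\<rho> \<langle>$\<rangle> n) \<le> r" using le[OF Sym_in[OF \<pi>(1) an(1)]] by simp
    have 5: "(Mid (\<rho> \<langle>$\<rangle> n), Top (\<pi> \<langle>$\<rangle> (\<rho> \<langle>$\<rangle> n))) \<in> ?R" using up[OF an(1)] an(2) d by (simp add: b1_def t1_def)
    have 6: "(Mid n, Top (\<pi> \<langle>$\<rangle> (\<rho> \<langle>$\<rangle> n))) \<in> ?R" by (rule connected_trans[OF mid 5])
    have "loops n (diag r \<pi>) (diag r \<rho>) = 0"
    proof (rule loops_0I)
      fix i assume i: "i \<in> {1..n}"
      show "\<exists>v. v \<notin> range Mid \<and> (Mid i, v) \<in> ?R"
        using 5 6 other[OF i] by (cases "i = n"; cases "i = \<rho> \<langle>$\<rangle> n") blast+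
    qed
    then show ?thesis using False by simp
  next
    case True
    let ?C = "{Mid n, Mid (\<rho> \<langle>$\<rangle> n)}"
    \<comment> \<open>Only the two vertices of the loop carry the label \<open>0\<close>.\<close>
    have h0: "w \<in> ?C" if w: "h w = 0" "w = b1 r i \<or> w = t1 r i \<or> w = b2 r i \<or> w = t2 r i" "i \<in> {1..n}" for w i
    proof -
      have "inverse \<theta> \<langle>$\<rangle> i \<in> {1..n}" "inverse \<rho> \<langle>$\<rangle> i \<in> {1..n}"
        using Sym_in[of "inverse \<theta>" n i] Sym_in[of "inverse \<rho>" n i] thS \<rho>(1) w(3) by simp_all
      then show ?thesis using w True by (auto simp: h_def b1_def t1_def b2_def t2_def split: if_splits)
    qed
    have closed: "v \<in> ?C" if "(Mid n, v) \<in> ?R" for v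
    proof -
      have "(Mid n, v) \<in> {(u, v). {u, v} \<in> stack (diag r \<pi>) (diag r \<rho>)}\<^sup>*"
        using that by (simp add: connected_in_stack_def)
      then show ?thesis
      proof (induction rule: rtrancl_induct)
        case (step v w)
        have "h v = 0" using step.IH True by (auto simp: h_def)
        moreover have "(v, w) \<in> ?R" unfolding connected_in_stack_def using step.hyps(2) by (rule r_into_rtrancl)
        then have "h v = h w" using connected_invariant[of r h \<pi> \<rho> v w] E1 E2 by (simp add: n_def)
        ultimately have hw: "h w = 0" by simp
        obtain i where i: "i \<in> {1..n}"
          and "{v, w} = {b1 r i, t1 r (\<pi> \<langle>$\<rangle> i)} \<or> {v, w} = {b2 r i, t2 r (\<rho> \<langle>$\<rangle> i)}"
          using step.hyps(2) unfolding stack_diag n_def by (auto simp del: atLeastAtMost_iff)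
        then have "w \<in> {b1 r i, t1 r (\<pi> \<langle>$\<rangle> i)} \<or> w \<in> {b2 r i, t2 r (\<rho> \<langle>$\<rangle> i)}" by blast
        then show ?case using h0[OF hw, of i] h0[OF hw, of "\<pi> \<langle>$\<rangle> i"] h0[OF hw, of "\<rho> \<langle>$\<rangle> i"]
          Sym_in[OF \<pi>(1) i] Sym_in[OF \<rho>(1) i] i by blast
      qed simp
    qed
    have Cn: "?R `` {Mid n} = ?C" using closed mid by auto
    have "?R `` {Mid (\<rho> \<langle>$\<rangle> n)} = ?R `` {Mid n}"
      using mid connected_trans connected_sym by blast
    then have Cn': "?R `` {Mid (\<rho> \<langle>$\<rangle> n)} = ?C" using Cn by simp
    have "{C. (\<exists>i\<in>{1..n}. C = ?R `` {Mid i}) \<and> C \<subseteq> range Mid} = {?C}"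
    proof (intro equalityI subsetI)
      fix C assume "C \<in> {C. (\<exists>i\<in>{1..n}. C = ?R `` {Mid i}) \<and> C \<subseteq> range Mid}"
      then obtain i where i: "i \<in> {1..n}" "C = ?R `` {Mid i}" "C \<subseteq> range Mid" by blast
      have "i = n \<or> i = \<rho> \<langle>$\<rangle> n" using other[OF i(1)] i(2,3) by blast
      then show "C \<in> {?C}" using Cn Cn' i(2) by auto
    next
      fix C assume "C \<in> {?C}"
      then show "C \<in> {C. (\<exists>i\<in>{1..n}. C = ?R `` {Mid i}) \<and> C \<subseteq> range Mid}" using Cn nn by auto
    qed
    then show ?thesis using True by (simp add: loops_def)
  qed
qed

section \<open>The walled Brauer algebra in terms of permutations\<close>

definition Psi :: "nat \<Rightarrow> galg \<Rightarrow> wb_elem" where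
  "Psi r x = (\<Sum>\<pi>\<in>Sym (Suc r). scale (lookup x \<pi>) (basis_elem (diag r \<pi>)))"

lemma lookup_basis_elem: "lookup (basis_elem d) e = (if d = e then 1 else 0)"
  by (simp add: basis_elem_def lookup_single when_def)

lemma lookup_Psi: "\<pi> \<in> Sym (Suc r) \<Longrightarrow> lookup (Psi r x) (diag r \<pi>) = lookup x \<pi>"
proof -
  assume p: "\<pi> \<in> Sym (Suc r)"
  have "lookup (Psi r x) (diag r \<pi>) = (\<Sum>\<sigma>\<in>Sym (Suc r). if \<sigma> = \<pi> then lookup x \<pi> else 0)"
    unfolding Psi_def lookup_sum lookup_scale lookup_basis_elem
    using diag_inj[OF _ p] by (intro sum.cong refl) auto
  then show ?thesis using p by simp
qed

lemma keys_Psi: "keys (Psi r x) \<subseteq> diag r ` Sym (Suc r)"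
proof
  fix d assume "d \<in> keys (Psi r x)"
  then have "(\<Sum>\<pi>\<in>Sym (Suc r). lookup x \<pi> * (if diag r \<pi> = d then 1 else 0)) \<noteq> 0"
    by (simp add: Psi_def in_keys_iff lookup_sum lookup_scale lookup_basis_elem)
  then obtain \<pi> where "\<pi> \<in> Sym (Suc r)" "lookup x \<pi> * (if diag r \<pi> = d then 1 else 0) \<noteq> 0"
    by (rule sum.not_neutral_contains_not_neutral)
  then show "d \<in> diag r ` Sym (Suc r)" by (auto split: if_splits)
qed

lemma scale_add_left: "scale (a + b) f = scale a f + scale b f"
  by (rule poly_mapping_eqI) (simp add: lookup_scale lookup_add distrib_right)
lemma scale_add_right: "scale a (f + g) = scale a f + scale a g"
  by (rule poly_mapping_eqI) (simp add: lookup_scale lookup_add distrib_left)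
lemma scale_scale: "scale a (scale b f) = scale (a * b) f"
  by (rule poly_mapping_eqI) (simp add: lookup_scale mult.assoc)
lemma scale_sum: "scale a (sum f A) = (\<Sum>i\<in>A. scale a (f i))"
  by (induction A rule: infinite_finite_induct)
     (simp_all add: scale_add_right, auto intro: poly_mapping_eqI simp: lookup_scale)
lemma scale_0 [simp]: "scale 0 f = 0" "scale a 0 = 0"
  by (auto intro: poly_mapping_eqI simp: lookup_scale)
lemma scale_1 [simp]: "scale 1 f = f"
  by (auto intro: poly_mapping_eqI simp: lookup_scale)

lemma Psi_add: "Psi r (x + y) = Psi r x + Psi r y"
  by (simp add: Psi_def lookup_add scale_add_left sum.distrib)
lemma Psi_gsc: "Psi r (gsc c * x) = scale c (Psi r x)"
  by (simp add: Psi_def scale_sum scale_scale)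
lemma Psi_0 [simp]: "Psi r 0 = 0" by (simp add: Psi_def)
lemma Psi_sum: "Psi r (sum f A) = (\<Sum>i\<in>A. Psi r (f i))"
  by (induction A rule: infinite_finite_induct) (simp_all add: Psi_add)
lemma Psi_uminus: "Psi r (- x) = - Psi r x"
  using Psi_add[of r x "- x"] by (simp add: eq_neg_iff_add_eq_0 add.commute)

lemma Psi_inj: "x \<in> GA (Suc r) \<Longrightarrow> y \<in> GA (Suc r) \<Longrightarrow> Psi r x = Psi r y \<Longrightarrow> x = y"
proof (rule poly_mapping_eqI)
  fix \<pi> assume xy: "x \<in> GA (Suc r)" "y \<in> GA (Suc r)" "Psi r x = Psi r y"
  show "lookup x \<pi> = lookup y \<pi>"
  proof (cases "\<pi> \<in> Sym (Suc r)")
    case True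
    then show ?thesis using lookup_Psi[OF True, of x] lookup_Psi[OF True, of y] xy(3) by simp
  next
    case False
    then have "\<pi> \<notin> keys x" "\<pi> \<notin> keys y" using xy by (auto simp: GA_def)
    then show ?thesis by (simp add: in_keys_iff)
  qed
qed

lemma Psi_surj: assumes "keys f \<subseteq> diag r ` Sym (Suc r)" shows "\<exists>x\<in>GA (Suc r). f = Psi r x"
proof
  define x where "x = (\<Sum>\<pi>\<in>Sym (Suc r). gsc (lookup f (diag r \<pi>)) * gel \<pi>)"
  show "x \<in> GA (Suc r)" unfolding x_def by (intro GA_sum GA_mult GA_gel GA_gsc)
  have lx: "lookup x \<pi> = lookup f (diag r \<pi>)" if "\<pi> \<in> Sym (Suc r)" for \<pi>
  proof -
    have "lookup x \<pi> = (\<Sum>\<sigma>\<in>Sym (Suc r). if \<sigma> = \<pi> then lookup f (diag r \<pi>) else 0)"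
      unfolding x_def lookup_sum lookup_gsc_mult lookup_gel by (intro sum.cong refl) auto
    then show ?thesis using that by simp
  qed
  show "f = Psi r x"
  proof (rule poly_mapping_eqI)
    fix d
    show "lookup f d = lookup (Psi r x) d"
    proof (cases "d \<in> diag r ` Sym (Suc r)")
      case True
      then show ?thesis by (auto simp: lookup_Psi lx)
    next
      case False
      then have "d \<notin> keys f" "d \<notin> keys (Psi r x)" using assms keys_Psi by blast+
      then show ?thesis by (simp add: in_keys_iff)
    qed
  qed
qed

lemma Psi_gel: "\<pi> \<in> Sym (Suc r) \<Longrightarrow> Psi r (gel \<pi>) = basis_elem (diag r \<pi>)"
proof -
  assume p: "\<pi> \<in> Sym (Suc r)"
  have "Psi r (gel \<pi>) = (\<Sum>\<sigma>\<in>Sym (Suc r). if \<sigma> = \<pi> then basis_elem (diag r \<pi>) else 0)"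
    unfolding Psi_def lookup_gel by (intro sum.cong refl) auto
  then show ?thesis using p by simp
qed

text \<open>If both diagrams have arcs, the southern arc of the first and the northern arc of the second one are
  cut out of the product of the permutations; they form a loop iff they end in the same column.\<close>

definition comp_perm :: "nat \<Rightarrow> nat perm \<Rightarrow> nat perm \<Rightarrow> nat perm" where
  "comp_perm n \<pi> \<rho> = (if \<pi> \<langle>$\<rangle> n = n \<or> \<rho> \<langle>$\<rangle> n = n then \<pi> * \<rho>
     else \<pi> * \<rho> * swap (inverse (\<pi> * \<rho>) \<langle>$\<rangle> n) n * swap (inverse \<rho> \<langle>$\<rangle> n) n)"

definition loop_count :: "nat \<Rightarrow> nat perm \<Rightarrow> nat perm \<Rightarrow> nat" where
  "loop_count n \<pi> \<rho> = (if \<pi> \<langle>$\<rangle> n = n \<or> \<rho> \<langle>$\<rangle> n = n \<or> inverse (\<pi> * \<rho>) \<langle>$\<rangle> n \<noteq> n then 0 else 1)"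

lemma comp_perm_loop_count:
  assumes "\<pi> \<in> Sym (Suc r)" "\<rho> \<in> Sym (Suc r)"
  shows "diagram_comp (Suc r) (diag r \<pi>) (diag r \<rho>) = diag r (comp_perm (Suc r) \<pi> \<rho>)"
    "loops (Suc r) (diag r \<pi>) (diag r \<rho>) = loop_count (Suc r) \<pi> \<rho>"
proof -
  consider "\<pi> \<in> Sym r" "\<pi> \<langle>$\<rangle> (Suc r) = Suc r" | "\<rho> \<in> Sym r" "\<rho> \<langle>$\<rangle> (Suc r) = Suc r"
    | "\<pi> \<langle>$\<rangle> (Suc r) \<noteq> Suc r" "\<rho> \<langle>$\<rangle> (Suc r) \<noteq> Suc r"
    using assms Sym_Suc_fix by blast
  then show "diagram_comp (Suc r) (diag r \<pi>) (diag r \<rho>) = diag r (comp_perm (Suc r) \<pi> \<rho>)"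
    "loops (Suc r) (diag r \<pi>) (diag r \<rho>) = loop_count (Suc r) \<pi> \<rho>"
  proof (atomize(full), cases)
    case 1
    then show "diagram_comp (Suc r) (diag r \<pi>) (diag r \<rho>) = diag r (comp_perm (Suc r) \<pi> \<rho>) \<and>
      loops (Suc r) (diag r \<pi>) (diag r \<rho>) = loop_count (Suc r) \<pi> \<rho>"
      using comp_fix_upper[OF 1(1) assms(2)] by (simp add: comp_perm_def loop_count_def)
  next
    case 2
    then show "diagram_comp (Suc r) (diag r \<pi>) (diag r \<rho>) = diag r (comp_perm (Suc r) \<pi> \<rho>) \<and>
      loops (Suc r) (diag r \<pi>) (diag r \<rho>) = loop_count (Suc r) \<pi> \<rho>"
      using comp_fix_lower[OF assms(1) 2(1)] by (simp add: comp_perm_def loop_count_def)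
  next
    case 3
    then show "diagram_comp (Suc r) (diag r \<pi>) (diag r \<rho>) = diag r (comp_perm (Suc r) \<pi> \<rho>) \<and>
      loops (Suc r) (diag r \<pi>) (diag r \<rho>) = loop_count (Suc r) \<pi> \<rho>"
      using comp_arcs[OF assms(1) 3(1) assms(2) 3(2)] by (simp add: comp_perm_def loop_count_def del: perm.inverse_distrib_swap)
  qed
qed

lemma comp_perm_Sym: assumes "\<pi> \<in> Sym n" "\<rho> \<in> Sym n" "n \<ge> 1" shows "comp_perm n \<pi> \<rho> \<in> Sym n"
proof -
  have "inverse (\<pi> * \<rho>) \<langle>$\<rangle> n \<in> {1..n}" "inverse \<rho> \<langle>$\<rangle> n \<in> {1..n}"
    using Sym_in[of "inverse (\<pi> * \<rho>)" n n] Sym_in[of "inverse \<rho>" n n] assms Sym_mult[OF assms(1,2)]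
    by (simp_all del: perm.inverse_distrib_swap)
  then show ?thesis using assms unfolding comp_perm_def
    by (simp add: Sym_mult Sym_swap del: perm.inverse_distrib_swap)
qed

text \<open>The product of the walled Brauer algebra transported along \<open>Psi\<close>. For
  \<open>n = Suc r\<close> it agrees with convolution when one factor lies in \<open>GA r\<close>
  and the other in \<open>GA n\<close> (\<open>star_upper\<close>, \<open>star_lower\<close>), so
  the new information is in products of two arcs.\<close>

definition star :: "nat \<Rightarrow> complex \<Rightarrow> galg \<Rightarrow> galg \<Rightarrow> galg" where
  "star n \<delta> x y = (\<Sum>\<pi>\<in>Sym n. \<Sum>\<rho>\<in>Sym n.
     gsc (lookup x \<pi> * lookup y \<rho> * \<delta> ^ loop_count n \<pi> \<rho>) * gel (comp_perm n \<pi> \<rho>))"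

lemma wb_mult_Psi: "wb_mult (Suc r) \<delta> (Psi r x) (Psi r y) = Psi r (star (Suc r) \<delta> x y)"
proof -
  let ?D = "diag r ` Sym (Suc r)"
  let ?F = "\<lambda>d1 d2. scale (lookup (Psi r x) d1 * lookup (Psi r y) d2 * \<delta> ^ loops (Suc r) d1 d2)
        (basis_elem (diagram_comp (Suc r) d1 d2))"
  have inj: "inj_on (diag r) (Sym (Suc r))" by (rule inj_onI) (rule diag_inj)
  have "wb_mult (Suc r) \<delta> (Psi r x) (Psi r y) = (\<Sum>d1\<in>?D. \<Sum>d2\<in>?D. ?F d1 d2)"
  proof -
    have "(\<Sum>d2\<in>keys (Psi r y). ?F d1 d2) = (\<Sum>d2\<in>?D. ?F d1 d2)" for d1
      by (rule sum.mono_neutral_left[OF _ keys_Psi]) (simp_all add: in_keys_iff)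
    moreover have "(\<Sum>d1\<in>keys (Psi r x). \<Sum>d2\<in>?D. ?F d1 d2) = (\<Sum>d1\<in>?D. \<Sum>d2\<in>?D. ?F d1 d2)"
      by (rule sum.mono_neutral_left[OF _ keys_Psi]) (simp_all add: in_keys_iff)
    ultimately show ?thesis by (simp add: wb_mult_def)
  qed
  also have "\<dots> = (\<Sum>\<pi>\<in>Sym (Suc r). \<Sum>\<rho>\<in>Sym (Suc r). ?F (diag r \<pi>) (diag r \<rho>))"
    by (simp add: sum.reindex[OF inj])
  also have "\<dots> = (\<Sum>\<pi>\<in>Sym (Suc r). \<Sum>\<rho>\<in>Sym (Suc r).
      Psi r (gsc (lookup x \<pi> * lookup y \<rho> * \<delta> ^ loop_count (Suc r) \<pi> \<rho>) * gel (comp_perm (Suc r) \<pi> \<rho>)))"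
    by (intro sum.cong refl) (simp add: lookup_Psi comp_perm_loop_count Psi_gsc Psi_gel comp_perm_Sym)
  also have "\<dots> = Psi r (star (Suc r) \<delta> x y)" by (simp add: star_def Psi_sum)
  finally show ?thesis .
qed

lemma star_GA: "n \<ge> 1 \<Longrightarrow> star n \<delta> x y \<in> GA n"
  unfolding star_def by (intro GA_sum GA_mult GA_gsc GA_gel comp_perm_Sym)

lemma star_add_left: "star n \<delta> (x + x') y = star n \<delta> x y + star n \<delta> x' y"
  by (simp add: star_def lookup_add distrib_right gsc_add sum.distrib)
lemma star_add_right: "star n \<delta> x (y + y') = star n \<delta> x y + star n \<delta> x y'"
  by (simp add: star_def lookup_add distrib_left distrib_right gsc_add sum.distrib)
lemma star_0 [simp]: "star n \<delta> 0 y = 0" "star n \<delta> x 0 = 0" by (simp_all add: star_def)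
lemma star_gsc_left: "star n \<delta> (gsc c * x) y = gsc c * star n \<delta> x y"
  by (simp add: star_def sum_distrib_left mult.assoc flip: gsc_mult) (simp add: gsc_mult mult.assoc)
lemma star_gsc_right: "star n \<delta> x (gsc c * y) = gsc c * star n \<delta> x y"
  by (simp add: star_def sum_distrib_left gsc_mult mult.assoc gsc_swap[of c])
lemma star_sum_left: "star n \<delta> (sum f A) y = (\<Sum>i\<in>A. star n \<delta> (f i) y)"
  by (induction A rule: infinite_finite_induct) (simp_all add: star_add_left)
lemma star_sum_right: "star n \<delta> x (sum f A) = (\<Sum>i\<in>A. star n \<delta> x (f i))"
  by (induction A rule: infinite_finite_induct) (simp_all add: star_add_right)

lemma star_gel:
  assumes "\<pi> \<in> Sym n" "\<rho> \<in> Sym n"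
  shows "star n \<delta> (gel \<pi>) (gel \<rho>) = gsc (\<delta> ^ loop_count n \<pi> \<rho>) * gel (comp_perm n \<pi> \<rho>)"
proof -
  have "star n \<delta> (gel \<pi>) (gel \<rho>) = (\<Sum>\<pi>'\<in>Sym n. if \<pi>' = \<pi> then
      (\<Sum>\<rho>'\<in>Sym n. if \<rho>' = \<rho> then gsc (\<delta> ^ loop_count n \<pi> \<rho>) * gel (comp_perm n \<pi> \<rho>) else 0) else 0)"
    unfolding star_def
  proof (intro sum.cong refl)
    fix \<pi>'
    show "(\<Sum>\<rho>'\<in>Sym n. gsc (lookup (gel \<pi>) \<pi>' * lookup (gel \<rho>) \<rho>' * \<delta> ^ loop_count n \<pi>' \<rho>') * gel (comp_perm n \<pi>' \<rho>')) =
      (if \<pi>' = \<pi> then (\<Sum>\<rho>'\<in>Sym n. if \<rho>' = \<rho> then gsc (\<delta> ^ loop_count n \<pi> \<rho>) * gel (comp_perm n \<pi> \<rho>) else 0) else 0)"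
    proof (cases "\<pi>' = \<pi>")
      case True
      then show ?thesis by (simp only: if_True refl, intro sum.cong refl) (auto simp: lookup_gel)
    next
      case False
      then show ?thesis by (auto simp: lookup_gel)
    qed
  qed
  then show ?thesis using assms by simp
qed

lemma star_expand_left: "x \<in> GA a \<Longrightarrow> star n \<delta> x y = (\<Sum>\<pi>\<in>Sym a. gsc (lookup x \<pi>) * star n \<delta> (gel \<pi>) y)"
  by (subst (1) GA_expand, assumption) (simp add: star_sum_left star_gsc_left)
lemma star_expand_right: "y \<in> GA a \<Longrightarrow> star n \<delta> x y = (\<Sum>\<pi>\<in>Sym a. gsc (lookup y \<pi>) * star n \<delta> x (gel \<pi>))"
  by (subst (1) GA_expand, assumption) (simp add: star_sum_right star_gsc_right)

lemma star_upper:
  assumes x: "x \<in> GA r" and y: "y \<in> GA (Suc r)" shows "star (Suc r) \<delta> x y = x * y"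
proof -
  have g: "star (Suc r) \<delta> (gel \<pi>) (gel \<rho>) = gel \<pi> * gel \<rho>" if "\<pi> \<in> Sym r" "\<rho> \<in> Sym (Suc r)" for \<pi> \<rho>
  proof -
    have "\<pi> \<langle>$\<rangle> (Suc r) = Suc r" using that(1) by (auto intro: Sym_fix)
    then show ?thesis using that Sym_mono[of r "Suc r"] by (subst star_gel) (auto simp: loop_count_def comp_perm_def gel_mult)
  qed
  have l: "star (Suc r) \<delta> (gel \<pi>) y = gel \<pi> * y" if p: "\<pi> \<in> Sym r" for \<pi>
  proof -
    have "star (Suc r) \<delta> (gel \<pi>) y = (\<Sum>\<rho>\<in>Sym (Suc r). gsc (lookup y \<rho>) * (gel \<pi> * gel \<rho>))"
      unfolding star_expand_right[OF y] by (intro sum.cong refl) (simp add: g p)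
    also have "\<dots> = gel \<pi> * (\<Sum>\<rho>\<in>Sym (Suc r). gsc (lookup y \<rho>) * gel \<rho>)"
      by (simp add: sum_distrib_left gsc_left_commute[of "gel _"])
    finally show ?thesis by (simp flip: GA_expand[OF y])
  qed
  have "star (Suc r) \<delta> x y = (\<Sum>\<pi>\<in>Sym r. gsc (lookup x \<pi>) * (gel \<pi> * y))"
    unfolding star_expand_left[OF x] by (intro sum.cong refl) (simp add: l)
  also have "\<dots> = (\<Sum>\<pi>\<in>Sym r. gsc (lookup x \<pi>) * gel \<pi>) * y"
    by (simp add: sum_distrib_right mult.assoc)
  finally show ?thesis by (simp flip: GA_expand[OF x])
qed

lemma star_lower:
  assumes x: "x \<in> GA r" and y: "y \<in> GA (Suc r)" shows "star (Suc r) \<delta> y x = y * x"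
proof -
  have g: "star (Suc r) \<delta> (gel \<rho>) (gel \<pi>) = gel \<rho> * gel \<pi>" if "\<pi> \<in> Sym r" "\<rho> \<in> Sym (Suc r)" for \<pi> \<rho>
  proof -
    have "\<pi> \<langle>$\<rangle> (Suc r) = Suc r" using that(1) by (auto intro: Sym_fix)
    then show ?thesis using that Sym_mono[of r "Suc r"] by (subst star_gel) (auto simp: loop_count_def comp_perm_def gel_mult)
  qed
  have l: "star (Suc r) \<delta> y (gel \<pi>) = y * gel \<pi>" if p: "\<pi> \<in> Sym r" for \<pi>
  proof -
    have "star (Suc r) \<delta> y (gel \<pi>) = (\<Sum>\<rho>\<in>Sym (Suc r). gsc (lookup y \<rho>) * (gel \<rho> * gel \<pi>))"
      unfolding star_expand_left[OF y] by (intro sum.cong refl) (simp add: g p)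
    also have "\<dots> = (\<Sum>\<rho>\<in>Sym (Suc r). gsc (lookup y \<rho>) * gel \<rho>) * gel \<pi>"
      by (simp add: sum_distrib_right mult.assoc)
    finally show ?thesis by (simp flip: GA_expand[OF y])
  qed
  have "star (Suc r) \<delta> y x = (\<Sum>\<pi>\<in>Sym r. gsc (lookup x \<pi>) * (y * gel \<pi>))"
    unfolding star_expand_right[OF x] by (intro sum.cong refl) (simp add: l)
  also have "\<dots> = y * (\<Sum>\<pi>\<in>Sym r. gsc (lookup x \<pi>) * gel \<pi>)"
    by (simp add: sum_distrib_left gsc_left_commute)
  finally show ?thesis by (simp flip: GA_expand[OF x])
qed

definition arc :: "nat \<Rightarrow> nat perm" where "arc r = swap r (Suc r)"

lemma arc_conj: "arc r * swap i r * arc r = swap (arc r \<langle>$\<rangle> i) (Suc r)"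
  using swap_conj[of "arc r" i r] by (simp add: arc_def)

lemma arc_arc [simp]: "arc r * arc r = 1" by (simp add: arc_def)
lemma arc_arc_apply [simp]: "arc r \<langle>$\<rangle> (arc r \<langle>$\<rangle> a) = a" by (simp add: apply_sequence)
lemma inverse_arc [simp]: "inverse (arc r) = arc r" by (simp add: arc_def)
lemma arc_r [simp]: "arc r \<langle>$\<rangle> r = Suc r" "arc r \<langle>$\<rangle> (Suc r) = r" by (simp_all add: arc_def)
lemma arc_Sym: "r \<ge> 1 \<Longrightarrow> arc r \<in> Sym (Suc r)" unfolding arc_def by (rule Sym_swap) auto

text \<open>Permutations in \<open>Sym (Suc r)\<close> that move \<open>Suc r\<close> form the
  double coset of \<open>arc r\<close>, so this rule covers all products of two arcs. The middle
  arcs end in the columns \<open>r\<close> and \<open>i\<close> up to relabelling by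
  \<open>\<tau>\<close>, and close to a loop only for \<open>i = r\<close>.\<close>

lemma star_arcs:
  assumes r: "r \<ge> 1" and S: "\<sigma> \<in> Sym r" "\<tau> \<in> Sym r" "\<beta> \<in> Sym r" and i: "i \<in> {1..r}"
  shows "star (Suc r) \<delta> (gel (\<sigma> * arc r * \<tau>)) (gel (inverse \<tau> * swap i r * arc r * \<beta>)) =
    gsc (if i = r then \<delta> else 1) * gel (\<sigma> * arc r * \<beta>)"
proof -
  let ?n = "Suc r" and ?\<pi> = "\<sigma> * arc r * \<tau>" and ?\<rho> = "inverse \<tau> * swap i r * arc r * \<beta>"
  have S': "\<sigma> \<in> Sym ?n" "\<tau> \<in> Sym ?n" "\<beta> \<in> Sym ?n" using S Sym_mono[of r ?n] by auto
  have fix1: "\<sigma> \<langle>$\<rangle> ?n = ?n" "\<tau> \<langle>$\<rangle> ?n = ?n" "\<beta> \<langle>$\<rangle> ?n = ?n"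
    "inverse \<sigma> \<langle>$\<rangle> ?n = ?n" "inverse \<tau> \<langle>$\<rangle> ?n = ?n" "inverse \<beta> \<langle>$\<rangle> ?n = ?n" using S by (auto intro: Sym_fix)
  have swn: "swap i r \<langle>$\<rangle> ?n = ?n" using i by simp
  have "\<sigma> \<langle>$\<rangle> r \<in> {1..r}" "inverse \<tau> \<langle>$\<rangle> i \<in> {1..r}"
    using Sym_in[OF S(1), of r] Sym_in[of "inverse \<tau>" r i] S r i by auto
  then have mv: "?\<pi> \<langle>$\<rangle> ?n \<noteq> ?n" "?\<rho> \<langle>$\<rangle> ?n \<noteq> ?n"
    by (auto simp: apply_times fix1)
  have pS: "?\<pi> \<in> Sym ?n" "?\<rho> \<in> Sym ?n"
    using S' i r by (auto intro!: Sym_mult Sym_swap arc_Sym)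
  have "?\<pi> * ?\<rho> = \<sigma> * arc r * (\<tau> * inverse \<tau>) * swap i r * arc r * \<beta>" by (simp only: mult.assoc)
  also have "\<dots> = \<sigma> * (arc r * swap i r * arc r) * \<beta>" by (simp add: mult.assoc)
  finally have pr: "?\<pi> * ?\<rho> = \<sigma> * swap (arc r \<langle>$\<rangle> i) ?n * \<beta>" unfolding arc_conj .
  let ?a = "inverse \<beta> \<langle>$\<rangle> (arc r \<langle>$\<rangle> i)" and ?b = "inverse \<beta> \<langle>$\<rangle> r"
  have q: "inverse (?\<pi> * ?\<rho>) \<langle>$\<rangle> ?n = ?a"
    unfolding pr by (simp add: apply_times fix1 mult.assoc)
  have p: "inverse ?\<rho> \<langle>$\<rangle> ?n = ?b" by (simp add: apply_times fix1 swn mult.assoc)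
  have bc: "\<beta> * swap (inverse \<beta> \<langle>$\<rangle> c) ?n = swap c ?n * \<beta>" for c
  proof -
    have "\<beta> * swap (inverse \<beta> \<langle>$\<rangle> c) ?n * inverse \<beta> = swap c ?n" by (simp add: swap_conj fix1)
    then have "\<beta> * swap (inverse \<beta> \<langle>$\<rangle> c) ?n * (inverse \<beta> * \<beta>) = swap c ?n * \<beta>" by (metis mult.assoc)
    then show ?thesis by simp
  qed
  have "comp_perm ?n ?\<pi> ?\<rho> = \<sigma> * swap (arc r \<langle>$\<rangle> i) ?n * \<beta> * swap ?a ?n * swap ?b ?n"
    unfolding comp_perm_def q p using mv pr by simp
  also have "\<dots> = \<sigma> * swap (arc r \<langle>$\<rangle> i) ?n * (\<beta> * swap ?a ?n) * swap ?b ?n" by (simp only: mult.assoc)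
  also have "\<dots> = \<sigma> * (swap (arc r \<langle>$\<rangle> i) ?n * swap (arc r \<langle>$\<rangle> i) ?n) * (\<beta> * swap ?b ?n)"
    unfolding bc[of "arc r \<langle>$\<rangle> i"] by (simp only: mult.assoc)
  also have "\<dots> = \<sigma> * (\<beta> * swap ?b ?n)" by simp
  also have "\<dots> = \<sigma> * arc r * \<beta>" unfolding bc by (simp add: arc_def mult.assoc)
  finally have c: "comp_perm ?n ?\<pi> ?\<rho> = \<sigma> * arc r * \<beta>" .
  have "?a = ?n \<longleftrightarrow> i = r"
  proof -
    have "?a = ?n \<longleftrightarrow> arc r \<langle>$\<rangle> i = ?n" using fix1(3) by (simp add: perm_inverse_eq_iff)
    also have "\<dots> \<longleftrightarrow> i = r" by (simp add: arc_def)
    finally show ?thesis .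
  qed
  then have "loop_count ?n ?\<pi> ?\<rho> = (if i = r then 1 else 0)" unfolding loop_count_def q using mv by simp
  then show ?thesis unfolding star_gel[OF pS] c by simp
qed

lemma star_arcs_left:
  assumes r: "r \<ge> 1" and S: "\<sigma> \<in> Sym r" "\<tau> \<in> Sym r" and i: "i \<in> {1..r}" and v: "v \<in> GA r"
  shows "star (Suc r) \<delta> (gel (\<sigma> * arc r * \<tau>)) (gel (inverse \<tau> * swap i r * arc r) * v) =
    gsc (if i = r then \<delta> else 1) * (gel (\<sigma> * arc r) * v)"
proof -
  have "star (Suc r) \<delta> (gel (\<sigma> * arc r * \<tau>)) (gel (inverse \<tau> * swap i r * arc r) * (\<Sum>\<beta>\<in>Sym r. gsc (lookup v \<beta>) * gel \<beta>)) =
    gsc (if i = r then \<delta> else 1) * (gel (\<sigma> * arc r) * (\<Sum>\<beta>\<in>Sym r. gsc (lookup v \<beta>) * gel \<beta>))"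
    unfolding sum_distrib_left star_sum_right
    by (intro sum.cong refl)
       (simp only: gsc_left_commute[of "gel _"] star_gsc_right gel_mult[symmetric] star_arcs[OF r S _ i] gsc_swap[of "if _ then _ else _"])
  then show ?thesis using GA_expand[OF v] by simp
qed

lemma star_arcs_right:
  assumes r: "r \<ge> 1" and S: "\<tau> \<in> Sym r" "\<beta> \<in> Sym r" and i: "i \<in> {1..r}" and v: "v \<in> GA r"
  shows "star (Suc r) \<delta> (v * gel (arc r * swap i r * inverse \<tau>)) (gel (\<tau> * arc r * \<beta>)) =
    gsc (if i = r then \<delta> else 1) * (v * gel (arc r * \<beta>))"
proof -
  let ?\<tau> = "swap i r * inverse \<tau>"
  have t: "?\<tau> \<in> Sym r" using S i r by (auto intro!: Sym_mult Sym_swap)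
  have "inverse ?\<tau> * swap i r * arc r * \<beta> = \<tau> * (swap i r * swap i r) * arc r * \<beta>" by (simp add: mult.assoc)
  then have e: "inverse ?\<tau> * swap i r * arc r * \<beta> = \<tau> * arc r * \<beta>" by simp
  have g: "star (Suc r) \<delta> (gel \<sigma> * gel (arc r * swap i r * inverse \<tau>)) (gel (\<tau> * arc r * \<beta>)) =
      gsc (if i = r then \<delta> else 1) * (gel \<sigma> * gel (arc r * \<beta>))" if "\<sigma> \<in> Sym r" for \<sigma>
    using star_arcs[OF r that t S(2) i, of \<delta>] unfolding e by (simp only: gel_mult mult.assoc)
  have "star (Suc r) \<delta> ((\<Sum>\<sigma>\<in>Sym r. gsc (lookup v \<sigma>) * gel \<sigma>) * gel (arc r * swap i r * inverse \<tau>)) (gel (\<tau> * arc r * \<beta>)) =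
    gsc (if i = r then \<delta> else 1) * ((\<Sum>\<sigma>\<in>Sym r. gsc (lookup v \<sigma>) * gel \<sigma>) * gel (arc r * \<beta>))"
    unfolding sum_distrib_left sum_distrib_right star_sum_left
    by (intro sum.cong refl)
       (simp only: mult.assoc[of "gsc _" "gel _"] star_gsc_left g gsc_swap[of "if _ then _ else _"])
  then show ?thesis using GA_expand[OF v] by simp
qed

section \<open>The centre\<close>

text \<open>The relative trace from \<open>S_(r-1)\<close> to \<open>S_r\<close>: the transpositions
  \<open>swap i r\<close> represent the cosets.\<close>

definition Tr :: "nat \<Rightarrow> galg \<Rightarrow> galg" where
  "Tr r y = (\<Sum>i\<in>{1..r}. gel (swap i r) * y * gel (swap i r))"

lemma Tr_add: "Tr r (x + y) = Tr r x + Tr r y" by (simp add: Tr_def algebra_simps sum.distrib)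
lemma Tr_gsc: "Tr r (gsc c * x) = gsc c * Tr r x"
  by (simp add: Tr_def sum_distrib_left mult.assoc gsc_left_commute[of "gel _"])
lemma Tr_uminus: "Tr r (- x) = - Tr r x" by (simp add: Tr_def sum_negf)
lemma Tr_0 [simp]: "Tr r 0 = 0" by (simp add: Tr_def)

lemma Tr_cent:
  assumes "cent m y" shows "cent (Suc m) (Tr (Suc m) y)"
  unfolding cent_def gel_commute_inverse
proof
  let ?r = "Suc m"
  fix \<tau> assume t: "\<tau> \<in> Sym ?r"
  have a: "gel \<tau> * (gel (swap i ?r) * y * gel (swap i ?r)) * gel (inverse \<tau>) =
      gel (swap (\<tau> \<langle>$\<rangle> i) ?r) * y * gel (swap (\<tau> \<langle>$\<rangle> i) ?r)" if i: "i \<in> {1..?r}" for i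
  proof -
    \<comment> \<open>\<open>\<tau>\<close> permutes the cosets, and \<open>\<rho>\<close> corrects
      the representative; it fixes \<open>?r\<close>, hence lies in \<open>Sym m\<close> and
      commutes with \<open>y\<close>.\<close>
    define \<rho> where "\<rho> = swap (\<tau> \<langle>$\<rangle> i) ?r * \<tau> * swap i ?r"
    have "\<rho> \<in> Sym ?r" unfolding \<rho>_def using t i Sym_in[OF t i] by (intro Sym_mult Sym_swap) auto
    moreover have "\<rho> \<langle>$\<rangle> ?r = ?r" by (simp add: \<rho>_def apply_times)
    ultimately have "\<rho> \<in> Sym m" using Sym_Suc_fix by blast
    then have c: "gel \<rho> * y * gel (inverse \<rho>) = y" using assms centD gel_commute_inverse by blast
    have "swap (\<tau> \<langle>$\<rangle> i) ?r * \<rho> = (swap (\<tau> \<langle>$\<rangle> i) ?r * swap (\<tau> \<langle>$\<rangle> i) ?r) * \<tau> * swap i ?r"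
      unfolding \<rho>_def by (simp only: mult.assoc)
    then have e: "\<tau> * swap i ?r = swap (\<tau> \<langle>$\<rangle> i) ?r * \<rho>" by simp
    have e': "swap i ?r * inverse \<tau> = inverse \<rho> * swap (\<tau> \<langle>$\<rangle> i) ?r"
      using arg_cong[OF e, of inverse] by simp
    have "gel \<tau> * (gel (swap i ?r) * y * gel (swap i ?r)) * gel (inverse \<tau>) =
        gel (\<tau> * swap i ?r) * y * gel (swap i ?r * inverse \<tau>)" by (simp only: gel_mult mult.assoc)
    also have "\<dots> = gel (swap (\<tau> \<langle>$\<rangle> i) ?r) * (gel \<rho> * y * gel (inverse \<rho>)) * gel (swap (\<tau> \<langle>$\<rangle> i) ?r)"
      unfolding e e' by (simp only: gel_mult mult.assoc)
    finally show ?thesis unfolding c .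
  qed
  have "gel \<tau> * Tr ?r y * gel (inverse \<tau>) = (\<Sum>i\<in>{1..?r}. gel (swap (\<tau> \<langle>$\<rangle> i) ?r) * y * gel (swap (\<tau> \<langle>$\<rangle> i) ?r))"
    unfolding Tr_def sum_distrib_left sum_distrib_right by (rule sum.cong[OF refl a])
  also have "\<dots> = Tr ?r y" unfolding Tr_def
    by (rule sum.reindex_bij_betw[OF permutes_imp_bij[OF Sym_permutes[OF t]], of "\<lambda>i. gel (swap i ?r) * y * gel (swap i ?r)"])
  finally show "gel \<tau> * Tr ?r y * gel (inverse \<tau>) = Tr ?r y" .
qed

lemma arc_commute: "v \<in> GA m \<Longrightarrow> gel (arc (Suc m)) * v = v * gel (arc (Suc m))"
proof -
  assume v: "v \<in> GA m"
  have "cent m (gel (arc (Suc m)))"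
    unfolding cent_def
  proof
    fix \<pi> assume "\<pi> \<in> Sym m"
    then have "affected \<pi> \<inter> affected (arc (Suc m)) = {}" by (auto simp: Sym_def arc_def affected_swap)
    then show "gel \<pi> * gel (arc (Suc m)) = gel (arc (Suc m)) * gel \<pi>"
      using perm_mult_commute by (metis gel_mult)
  qed
  then show ?thesis using cent_GA_commute[OF _ v] by simp
qed

context shifted
begin

abbreviation r where "r \<equiv> Suc m"
abbreviation n where "n \<equiv> Suc (Suc m)"
abbreviation arcg where "arcg \<equiv> gel (arc (Suc m))"

text \<open>\<open>Om (z, u)\<close> is the element denoted by \<open>z + u * \<eta>\<close>: here \<open>\<eta>\<close> is the sum of the arc diagrams.\<close>

definition Om :: "pair \<Rightarrow> galg" where
  "Om f = rep (fst f) + Tr r (arcg * rep (snd f))"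

lemma arcg_GA: "arcg \<in> GA n" by (intro GA_gel arc_Sym) simp

lemma swap_r_GA: "i \<in> {1..r} \<Longrightarrow> gel (swap i r) \<in> GA n" "i \<in> {1..r} \<Longrightarrow> gel (swap i r) \<in> GA r"
  by (auto intro!: GA_gel Sym_swap)

lemma Tr_GA: "y \<in> GA n \<Longrightarrow> Tr r y \<in> GA n"
  unfolding Tr_def by (intro GA_sum GA_mult swap_r_GA) auto

lemma arc_u_cent: "cent m u \<Longrightarrow> cent m (arcg * u)"
  using arc_commute[of _ m] by (intro cent_mult) (auto simp: cent_def GA_gel)

lemma Om_GA: "fst f \<in> Zc r \<Longrightarrow> snd f \<in> Cc m \<Longrightarrow> Om f \<in> GA n"
  unfolding Om_def
  by (intro GA_add Tr_GA GA_mult arcg_GA)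
     (auto simp: Zc_def Zg_def Cc_def intro: GA_mono[of r n])

text \<open>The element commutes with \<open>Sym r\<close> and so lies in \<open>JM\<close>, where
  \<open>flip\<close> is trivial; but \<open>flip\<close> reverses the order of the two
  factors.\<close>

lemma Tr_arc_JM: "u \<in> Cc m \<Longrightarrow> Tr r (arcg * rep u) = Tr r (rep u * arcg)"
proof -
  assume u: "u \<in> Cc m"
  have "cent r (Tr r (arcg * rep u))" using u by (intro Tr_cent arc_u_cent) (simp add: Cc_def)
  moreover have "Tr r (arcg * rep u) \<in> GA n"
    using u by (intro Tr_GA GA_mult arcg_GA) (auto simp: Cc_def intro: GA_mono[of r n])
  ultimately obtain z where "Tr r (arcg * rep u) = rep z" using centraliser_rep by blast
  then have "flip (Tr r (arcg * rep u)) = Tr r (arcg * rep u)" using flip_JM[OF Rep_gz] by simp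
  moreover have "flip (Tr r (arcg * rep u)) = Tr r (rep u * arcg)"
    using flip_JM[OF Rep_gz[of u]] by (simp add: Tr_def flip_sum flip_mult mult.assoc del: sum.cl_ivl_Suc)
  ultimately show ?thesis by simp
qed

text \<open>The coefficients are the loop factors of \<open>star_arcs\<close>.\<close>

lemma rep_x: "rep x = (\<Sum>i\<in>{1..r}. gsc (if i = r then \<delta> else 1) * gel (swap i r))"
proof -
  have s: "{1..r} = insert r {1..<r}" by auto
  have "(\<Sum>i\<in>{1..<r}. gsc (if i = r then \<delta> else 1) * gel (swap i r)) = L r"
    unfolding L_def by (rule sum.cong) auto
  then show ?thesis unfolding s by (simp add: x_def)
qed

lemma conj_cent: "cent k y \<Longrightarrow> \<tau> \<in> Sym k \<Longrightarrow> gel \<tau> * y * gel (inverse \<tau>) = y"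
  using centD gel_commute_inverse by blast

lemma star_Tr_right:
  assumes u: "u \<in> Cc m" and S: "\<sigma> \<in> Sym r" "\<tau> \<in> Sym r"
  shows "star n \<delta> (gel (\<sigma> * arc r * \<tau>)) (Tr r (arcg * rep u)) = gel \<sigma> * arcg * rep (u * x) * gel \<tau>"
proof -
  have uG: "rep u \<in> GA r" using u by (simp add: Cc_def)
  have "cent r (Tr r (arcg * rep u))" using u by (intro Tr_cent arc_u_cent) (simp add: Cc_def)
  \<comment> \<open>Conjugation by \<open>inverse \<tau>\<close> costs nothing and brings the
    summands into the form that \<open>star_arcs_left\<close> expects.\<close>
  from conj_cent[OF this, of "inverse \<tau>"] have "Tr r (arcg * rep u) = gel (inverse \<tau>) * Tr r (arcg * rep u) * gel \<tau>"
    using S by simp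
  also have "\<dots> = (\<Sum>i\<in>{1..r}. gel (inverse \<tau> * swap i r * arc r) * (rep u * gel (swap i r) * gel \<tau>))"
    by (simp only: Tr_def sum_distrib_left sum_distrib_right gel_mult mult.assoc)
  finally have e: "Tr r (arcg * rep u) = (\<Sum>i\<in>{1..r}. gel (inverse \<tau> * swap i r * arc r) * (rep u * gel (swap i r) * gel \<tau>))" .
  have "star n \<delta> (gel (\<sigma> * arc r * \<tau>)) (Tr r (arcg * rep u)) =
      (\<Sum>i\<in>{1..r}. gsc (if i = r then \<delta> else 1) * (gel (\<sigma> * arc r) * (rep u * gel (swap i r) * gel \<tau>)))"
    unfolding e star_sum_right
    by (intro sum.cong refl star_arcs_left S GA_mult uG swap_r_GA GA_gel) auto
  also have "\<dots> = gel (\<sigma> * arc r) * (rep u * (\<Sum>i\<in>{1..r}. gsc (if i = r then \<delta> else 1) * gel (swap i r)) * gel \<tau>)"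
    unfolding sum_distrib_left sum_distrib_right
    by (intro sum.cong refl) (simp only: mult.assoc gsc_left_commute[of "gel _"] gsc_left_commute[of "rep _"])
  finally show ?thesis unfolding rep_x[symmetric] by (simp add: gel_mult mult.assoc)
qed

lemma star_Tr_left:
  assumes u: "u \<in> Cc m" and S: "\<sigma> \<in> Sym r" "\<tau> \<in> Sym r"
  shows "star n \<delta> (Tr r (arcg * rep u)) (gel (\<sigma> * arc r * \<tau>)) = gel \<sigma> * rep (x * u) * arcg * gel \<tau>"
proof -
  have uG: "rep u \<in> GA r" using u by (simp add: Cc_def)
  have "cent r (Tr r (arcg * rep u))" using u by (intro Tr_cent arc_u_cent) (simp add: Cc_def)
  from conj_cent[OF this S(1)] have "Tr r (arcg * rep u) = gel \<sigma> * Tr r (rep u * arcg) * gel (inverse \<sigma>)"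
    using Tr_arc_JM[OF u] by simp
  also have "\<dots> = (\<Sum>i\<in>{1..r}. (gel \<sigma> * gel (swap i r) * rep u) * gel (arc r * swap i r * inverse \<sigma>))"
    by (simp only: Tr_def sum_distrib_left sum_distrib_right gel_mult mult.assoc)
  finally have e: "Tr r (arcg * rep u) = (\<Sum>i\<in>{1..r}. (gel \<sigma> * gel (swap i r) * rep u) * gel (arc r * swap i r * inverse \<sigma>))" .
  have "star n \<delta> (Tr r (arcg * rep u)) (gel (\<sigma> * arc r * \<tau>)) =
      (\<Sum>i\<in>{1..r}. gsc (if i = r then \<delta> else 1) * ((gel \<sigma> * gel (swap i r) * rep u) * gel (arc r * \<tau>)))"
    unfolding e star_sum_left
    by (intro sum.cong refl star_arcs_right S GA_mult uG swap_r_GA GA_gel) auto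
  also have "\<dots> = gel \<sigma> * ((\<Sum>i\<in>{1..r}. gsc (if i = r then \<delta> else 1) * gel (swap i r)) * rep u) * gel (arc r * \<tau>)"
    unfolding sum_distrib_left sum_distrib_right
    by (intro sum.cong refl) (simp only: mult.assoc gsc_left_commute[of "gel _"])
  finally show ?thesis unfolding rep_x[symmetric] by (simp add: gel_mult mult.assoc)
qed

text \<open>Invariance under \<open>Sym r\<close> determines \<open>y\<close> from its coefficients
  on \<open>Sym r\<close> and on the permutations that send \<open>n\<close> to \<open>r\<close>:
  any other permutation moving \<open>n\<close> is conjugate to such a one by a transposition
  \<open>swap i r\<close>. Removing the arc from the second part leaves an element of
  \<open>GA r\<close>.\<close>

lemma Om_decompose:
  assumes y: "y \<in> GA n" "cent r y"
  shows "\<exists>f. fst f \<in> Zc r \<and> snd f \<in> Cc m \<and> y = Om f"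
proof -
  have "prj r y \<in> Zg r" by (simp add: Zg_def prj_GA prj_cent y)
  then obtain z where z: "z \<in> Zc r" "prj r y = rep z" using Zg_rep by blast
  define w where "w = (\<Sum>\<pi>\<in>{\<pi>\<in>Sym n. \<pi> \<langle>$\<rangle> n = r}. gsc (lookup y \<pi>) * gel \<pi>)"
  have lw: "lookup w \<pi> = (if \<pi> \<in> Sym n \<and> \<pi> \<langle>$\<rangle> n = r then lookup y \<pi> else 0)" for \<pi>
  proof -
    have "lookup w \<pi> = (\<Sum>\<sigma>\<in>{\<pi>\<in>Sym n. \<pi> \<langle>$\<rangle> n = r}. if \<sigma> = \<pi> then lookup y \<pi> else 0)"
      unfolding w_def lookup_sum lookup_gsc_mult lookup_gel by (intro sum.cong refl) auto
    then show ?thesis by simp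
  qed
  define u where "u = arcg * w"
  have lu: "lookup u \<pi> = lookup w (arc r * \<pi>)" for \<pi> by (simp add: u_def)
  have uG: "u \<in> GA r"
    unfolding GA_def
  proof (clarify)
    fix \<pi> assume "\<pi> \<in> keys u"
    then have p: "arc r * \<pi> \<in> Sym n" "(arc r * \<pi>) \<langle>$\<rangle> n = r" by (auto simp: in_keys_iff lu lw split: if_splits)
    have "\<pi> \<in> Sym n" using p(1) Sym_mult_iff[OF arc_Sym[of r], of \<pi>] by simp
    moreover have "\<pi> \<langle>$\<rangle> n = n"
    proof -
      have "arc r \<langle>$\<rangle> (arc r \<langle>$\<rangle> (\<pi> \<langle>$\<rangle> n)) = arc r \<langle>$\<rangle> r" using p(2) by (simp only: apply_times comp_apply)
      then show ?thesis by simp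
    qed
    ultimately show "\<pi> \<in> Sym r" using Sym_Suc_fix by blast
  qed
  have "cent m w"
  proof (rule centI_lookup)
    fix \<sigma> \<pi> assume s: "\<sigma> \<in> Sym m"
    have s': "\<sigma> \<in> Sym r" "\<sigma> \<in> Sym n" using s Sym_mono[of m r] Sym_mono[of m n] by auto
    have f: "\<sigma> \<langle>$\<rangle> r = r" "inverse \<sigma> \<langle>$\<rangle> n = n" "inverse \<sigma> \<langle>$\<rangle> r = r"
      using Sym_fix[OF s, of r] Sym_fix[of "inverse \<sigma>" m n] Sym_fix[of "inverse \<sigma>" m r] s by auto
    have "(\<sigma> * \<pi> * inverse \<sigma>) \<langle>$\<rangle> n = r \<longleftrightarrow> \<pi> \<langle>$\<rangle> n = r"
      using f by (simp add: apply_times) (metis apply_inj)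
    then show "lookup w (\<sigma> * \<pi> * inverse \<sigma>) = lookup w \<pi>"
      unfolding lw using Sym_conj[OF s'(2)] cent_lookup[OF y(2) s'(1)] by simp
  qed
  then have uc: "cent m u" unfolding u_def by (rule arc_u_cent)
  obtain u' where u': "u = rep u'" using centraliser_rep[OF uG uc] by blast
  have wu: "arcg * u = w" by (simp add: u_def mult.assoc[symmetric] flip: gel_mult)
  have "y = prj r y + Tr r w"
  proof (rule poly_mapping_eqI)
    fix \<pi>
    have lT: "lookup (Tr r w) \<pi> = (\<Sum>i\<in>{1..r}. lookup w (swap i r * \<pi> * swap i r))"
      by (simp add: Tr_def lookup_sum mult.assoc del: sum.cl_ivl_Suc)
    show "lookup y \<pi> = lookup (prj r y + Tr r w) \<pi>"
    proof (cases "\<pi> \<in> Sym n")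
      case False
      have "lookup w (swap i r * \<pi> * swap i r) = 0" if "i \<in> {1..r}" for i
      proof -
        have "swap i r \<in> Sym n" using that by (intro Sym_swap) auto
        then have "swap i r * \<pi> * swap i r \<notin> Sym n" using False Sym_mult_iff Sym_mult_iff2 by blast
        then show ?thesis by (simp add: lw)
      qed
      moreover have "\<pi> \<notin> Sym r" using False Sym_mono[of r n] by auto
      moreover have "lookup y \<pi> = 0" using False y(1) by (auto simp: GA_def in_keys_iff)
      ultimately show ?thesis by (simp add: lookup_add lookup_prj lT)
    next
      case True
      have t: "lookup w (swap i r * \<pi> * swap i r) = (if i = \<pi> \<langle>$\<rangle> n then lookup y \<pi> else 0)" if i: "i \<in> {1..r}" for i
      proof -
        have si: "swap i r \<in> Sym n" "swap i r \<in> Sym r" using i by (auto intro: Sym_swap)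
        have "(swap i r * \<pi> * swap i r) \<langle>$\<rangle> n = r \<longleftrightarrow> \<pi> \<langle>$\<rangle> n = i"
          using i by (simp add: apply_times)
        moreover have "swap i r * \<pi> * swap i r \<in> Sym n" using si True by (intro Sym_mult)
        moreover have "lookup y (swap i r * \<pi> * swap i r) = lookup y \<pi>"
          using cent_lookup[OF y(2) si(2), of \<pi>] by simp
        ultimately show ?thesis by (auto simp: lw)
      qed
      have lT': "lookup (Tr r w) \<pi> = (\<Sum>i\<in>{1..r}. if i = \<pi> \<langle>$\<rangle> n then lookup y \<pi> else 0)"
        unfolding lT by (rule sum.cong[OF refl t])
      show ?thesis
      proof (cases "\<pi> \<in> Sym r")
        case True
        then have "\<pi> \<langle>$\<rangle> n = n" by (auto intro: Sym_fix)
        then show ?thesis using True by (simp add: lookup_add lookup_prj lT' del: sum.cl_ivl_Suc)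
      next
        case False
        then have "\<pi> \<langle>$\<rangle> n \<noteq> n" using True Sym_Suc_fix by blast
        then have "\<pi> \<langle>$\<rangle> n \<in> {1..r}" using Sym_in[OF True, of n] by auto
        then show ?thesis using False by (simp add: lookup_add lookup_prj lT' del: sum.cl_ivl_Suc)
      qed
    qed
  qed
  then have "y = Om (z, u')" using z(2) u' wu by (simp add: Om_def)
  then show ?thesis using z(1) u' uG uc by (intro exI[of _ "(z, u')"]) (simp add: Cc_def)
qed

text \<open>Permutations fixing \<open>n\<close> see only the first component. The second one is
  read off at \<open>arc r * \<rho>\<close> with \<open>\<rho>\<close> in \<open>Sym r\<close>,
  where the trace contributes its summand \<open>i = r\<close> alone.\<close>

lemma Om_zero:
  assumes f: "fst f \<in> Zc r" "snd f \<in> Cc m" "Om f = 0"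
  shows "f = 0"
proof -
  let ?u = "rep (snd f)"
  have uG: "?u \<in> GA r" and zG: "rep (fst f) \<in> GA r" using f by (auto simp: Cc_def Zc_def Zg_def)
  have lT: "lookup (Tr r (arcg * ?u)) \<pi> = (\<Sum>i\<in>{1..r}. lookup ?u (arc r * swap i r * \<pi> * swap i r))" for \<pi>
    by (simp add: Tr_def lookup_sum mult.assoc del: sum.cl_ivl_Suc)
  have u0: "lookup ?u \<pi> = 0" if "\<pi> \<langle>$\<rangle> n \<noteq> n" for \<pi>
  proof -
    have "\<pi> \<notin> Sym r" using that Sym_fix[of \<pi> r n] by auto
    then show ?thesis using uG by (auto simp: GA_def in_keys_iff)
  qed
  have swn: "swap i r \<langle>$\<rangle> n = n" if "i \<in> {1..r}" for i using that by simp
  have z0: "rep (fst f) = 0"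
  proof (rule poly_mapping_eqI)
    fix \<pi>
    show "lookup (rep (fst f)) \<pi> = lookup 0 \<pi>"
    proof (cases "\<pi> \<in> Sym r")
      case True
      have "lookup ?u (arc r * swap i r * \<pi> * swap i r) = 0" if i: "i \<in> {1..r}" for i
      proof (rule u0)
        have "\<pi> \<langle>$\<rangle> n = n" using True by (auto intro: Sym_fix)
        then show "(arc r * swap i r * \<pi> * swap i r) \<langle>$\<rangle> n \<noteq> n" using swn[OF i] by (simp add: apply_times)
      qed
      then have "lookup (Tr r (arcg * ?u)) \<pi> = 0" unfolding lT by (intro sum.neutral) blast
      moreover have "lookup (rep (fst f)) \<pi> + lookup (Tr r (arcg * ?u)) \<pi> = 0"
        using f(3) by (simp add: Om_def flip: lookup_add)
      ultimately show ?thesis by simp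
    next
      case False
      then show ?thesis using zG by (auto simp: GA_def in_keys_iff)
    qed
  qed
  have "?u = 0"
  proof (rule poly_mapping_eqI)
    fix \<rho>
    show "lookup ?u \<rho> = lookup 0 \<rho>"
    proof (cases "\<rho> \<in> Sym r")
      case True
      then have rn: "\<rho> \<langle>$\<rangle> n = n" by (auto intro: Sym_fix)
      have t: "lookup ?u (arc r * swap i r * (arc r * \<rho>) * swap i r) = (if i = r then lookup ?u \<rho> else 0)"
        if i: "i \<in> {1..r}" for i
      proof (cases "i = r")
        case True
        then show ?thesis by (simp add: mult.assoc[symmetric])
      next
        case False
        then have "swap i r \<langle>$\<rangle> (arc r \<langle>$\<rangle> n) = i" "arc r \<langle>$\<rangle> i = i" using i by (auto simp: arc_def)
        then have "(arc r * swap i r * (arc r * \<rho>) * swap i r) \<langle>$\<rangle> n \<noteq> n"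
          using swn[OF i] rn i by (simp add: apply_times)
        then show ?thesis using u0 False by simp
      qed
      have "0 = lookup (Tr r (arcg * ?u)) (arc r * \<rho>)" using f(3) z0 by (simp add: Om_def)
      also have "\<dots> = (\<Sum>i\<in>{1..r}. if i = r then lookup ?u \<rho> else 0)" unfolding lT by (rule sum.cong[OF refl t])
      finally show ?thesis by simp
    next
      case False
      then show ?thesis using uG by (auto simp: GA_def in_keys_iff)
    qed
  qed
  then show ?thesis using z0 rep_inject[of "fst f" 0] rep_inject[of "snd f" 0] by (simp add: prod_eq_iff)
qed

lemma Om_add: "Om (f + g) = Om f + Om g" by (simp add: Om_def Tr_add distrib_left)
lemma Om_pscale: "Om (pscale c f) = gsc c * Om f"
  by (simp add: Om_def pscale_def distrib_left gsc_left_commute[of arcg] Tr_gsc)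

lemma Sym_arc_cases:
  assumes "\<pi> \<in> Sym n" "\<pi> \<notin> Sym r"
  obtains \<sigma> \<tau> where "\<sigma> \<in> Sym r" "\<tau> \<in> Sym r" "\<pi> = \<sigma> * arc r * \<tau>"
proof -
  define i where "i = \<pi> \<langle>$\<rangle> n"
  have "\<pi> \<langle>$\<rangle> n \<noteq> n" using assms Sym_Suc_fix by blast
  then have "i \<noteq> n" by (simp add: i_def)
  then have i: "i \<in> {1..r}" using Sym_in[OF assms(1), of n] by (auto simp: i_def)
  define \<tau> where "\<tau> = arc r * swap i r * \<pi>"
  have "\<tau> \<in> Sym n" unfolding \<tau>_def using assms(1) i by (intro Sym_mult Sym_swap arc_Sym) auto
  moreover have "\<tau> \<langle>$\<rangle> n = n" by (simp add: \<tau>_def apply_times i_def[symmetric])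
  ultimately have "\<tau> \<in> Sym r" using Sym_Suc_fix by blast
  moreover have "swap i r \<in> Sym r" using i by (intro Sym_swap) auto
  moreover have "\<pi> = swap i r * arc r * \<tau>"
  proof -
    have "swap i r * arc r * \<tau> = swap i r * (arc r * arc r) * swap i r * \<pi>" by (simp only: \<tau>_def mult.assoc)
    then show ?thesis by simp
  qed
  ultimately show thesis using that by blast
qed

text \<open>Against permutations with arcs the pair acts through \<open>low f\<close> alone: this is
  the specialisation of the arc sum to \<open>x\<close>.\<close>

lemma star_Om:
  assumes f: "fst f \<in> Zc r" "snd f \<in> Cc m" and S: "\<sigma> \<in> Sym r" "\<tau> \<in> Sym r"
  shows "star n \<delta> (gel (\<sigma> * arc r * \<tau>)) (Om f) = gel \<sigma> * (arcg * rep (low f)) * gel \<tau>"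
    "star n \<delta> (Om f) (gel (\<sigma> * arc r * \<tau>)) = gel \<sigma> * (rep (low f) * arcg) * gel \<tau>"
proof -
  have zG: "rep (fst f) \<in> GA r" and zc: "cent r (rep (fst f))" using f by (auto simp: Zc_def Zg_def)
  have pG: "gel (\<sigma> * arc r * \<tau>) \<in> GA n"
    using S Sym_mono[of r n] by (intro GA_gel Sym_mult arc_Sym) auto
  have "star n \<delta> (gel (\<sigma> * arc r * \<tau>)) (Om f) = gel (\<sigma> * arc r * \<tau>) * rep (fst f) + gel \<sigma> * arcg * rep (snd f * x) * gel \<tau>"
    unfolding Om_def star_add_right star_lower[OF zG pG] star_Tr_right[OF f(2) S] ..
  also have "gel (\<sigma> * arc r * \<tau>) * rep (fst f) = gel \<sigma> * arcg * (rep (fst f) * gel \<tau>)"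
    using centD[OF zc S(2)] by (simp add: gel_mult mult.assoc)
  finally show "star n \<delta> (gel (\<sigma> * arc r * \<tau>)) (Om f) = gel \<sigma> * (arcg * rep (low f)) * gel \<tau>"
    by (simp add: low_def distrib_left distrib_right mult.assoc)
  have "star n \<delta> (Om f) (gel (\<sigma> * arc r * \<tau>)) = rep (fst f) * gel (\<sigma> * arc r * \<tau>) + gel \<sigma> * rep (x * snd f) * arcg * gel \<tau>"
    unfolding Om_def star_add_left star_upper[OF zG pG] star_Tr_left[OF f(2) S] ..
  also have "rep (fst f) * gel (\<sigma> * arc r * \<tau>) = (rep (fst f) * gel \<sigma>) * arcg * gel \<tau>" by (simp add: gel_mult mult.assoc)
  also have "rep (fst f) * gel \<sigma> = gel \<sigma> * rep (fst f)" using centD[OF zc S(1)] by simp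
  also have "x * snd f = snd f * x" by (rule mult.commute)
  finally show "star n \<delta> (Om f) (gel (\<sigma> * arc r * \<tau>)) = gel \<sigma> * (rep (low f) * arcg) * gel \<tau>"
    by (simp add: low_def distrib_left distrib_right mult.assoc)
qed

lemma Om_cent: "fst f \<in> Zc r \<Longrightarrow> snd f \<in> Cc m \<Longrightarrow> cent r (Om f)"
  unfolding Om_def by (intro cent_add Tr_cent arc_u_cent) (auto simp: Zc_def Zg_def Cc_def)

text \<open>Commuting with \<open>Sym r\<close> gives the form \<open>Om f\<close>. By
  \<open>star_Om\<close>, commuting with the arc diagram means that \<open>low f\<close> commutes
  with the transposition \<open>arc r\<close>, which for an element of \<open>GA r\<close> forces
  its support into \<open>Sym m\<close>.\<close>

theorem centre_eq: "centre (walled_brauer r 1 \<delta>) = (\<lambda>f. Psi r (Om f)) ` centre_pairs"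
proof -
  let ?A = "walled_brauer r 1 \<delta>"
  have car: "carrier ?A = Psi r ` GA n"
  proof (intro equalityI subsetI)
    fix f assume "f \<in> carrier ?A"
    then have "keys f \<subseteq> diag r ` Sym n" by (simp add: walled_brauer_def wb_diagrams_eq[unfolded One_nat_def])
    then show "f \<in> Psi r ` GA n" using Psi_surj[of f r] by blast
  next
    fix f assume "f \<in> Psi r ` GA n"
    then show "f \<in> carrier ?A" using keys_Psi by (auto simp: walled_brauer_def wb_diagrams_eq[unfolded One_nat_def])
  qed
  have mult: "Psi r a \<otimes>\<^bsub>?A\<^esub> Psi r b = Psi r (star n \<delta> a b)" for a b
    by (simp add: walled_brauer_def wb_mult_Psi)
  have comm: "Psi r a \<otimes>\<^bsub>?A\<^esub> Psi r b = Psi r b \<otimes>\<^bsub>?A\<^esub> Psi r a \<longleftrightarrow> star n \<delta> a b = star n \<delta> b a" for a b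
    unfolding mult using Psi_inj[OF star_GA star_GA] by auto
  have cen: "Psi r a \<in> centre ?A \<longleftrightarrow> (\<forall>\<pi>\<in>Sym n. star n \<delta> a (gel \<pi>) = star n \<delta> (gel \<pi>) a)" if a: "a \<in> GA n" for a
  proof
    assume "Psi r a \<in> centre ?A"
    then show "\<forall>\<pi>\<in>Sym n. star n \<delta> a (gel \<pi>) = star n \<delta> (gel \<pi>) a"
      using comm GA_gel unfolding centre_def car by blast
  next
    assume c: "\<forall>\<pi>\<in>Sym n. star n \<delta> a (gel \<pi>) = star n \<delta> (gel \<pi>) a"
    have "star n \<delta> a b = star n \<delta> b a" if "b \<in> GA n" for b
      unfolding star_expand_right[OF that] star_expand_left[OF that] using c by simp
    then show "Psi r a \<in> centre ?A" using a comm unfolding centre_def car by blast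
  qed
  show ?thesis
  proof (intro equalityI subsetI)
    fix g assume g: "g \<in> centre ?A"
    then have "g \<in> carrier ?A" by (simp add: centre_def)
    then obtain a where a: "a \<in> GA n" "g = Psi r a" unfolding car by blast
    have c: "star n \<delta> a (gel \<pi>) = star n \<delta> (gel \<pi>) a" if "\<pi> \<in> Sym n" for \<pi>
      using cen[OF a(1)] g a(2) that by blast
    have "cent r a"
      unfolding cent_def
    proof
      fix \<pi> assume p: "\<pi> \<in> Sym r"
      then have "\<pi> \<in> Sym n" using Sym_mono[of r n] by auto
      then show "gel \<pi> * a = a * gel \<pi>"
        using c[of \<pi>] star_upper[OF GA_gel[OF p] a(1), of \<delta>] star_lower[OF GA_gel[OF p] a(1), of \<delta>] by simp
    qed
    then obtain f where f: "fst f \<in> Zc r" "snd f \<in> Cc m" "a = Om f" using Om_decompose[OF a(1)] by blast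
    have vG: "rep (low f) \<in> GA r" and vc: "cent m (rep (low f))"
    proof -
      have "low f \<in> Cc m" unfolding low_def
        by (intro Z.subspace_add[OF Cc_subspace] Zc_Suc_Cc[OF f(1)] Cc_mult[OF f(2) x_Cc])
      then show "rep (low f) \<in> GA r" "cent m (rep (low f))" by (auto simp: Cc_def)
    qed
    have "arcg * rep (low f) = rep (low f) * arcg"
      using star_Om[OF f(1,2), of 1 1] c[of "arc r"] arc_Sym[of r] f(3) by simp
    \<comment> \<open>Conjugation by \<open>arc r\<close> exchanges the points \<open>r\<close> and
      \<open>n\<close>, so a permutation in the support fixes \<open>r\<close> because its conjugate
      fixes \<open>n\<close>.\<close>
    then have e: "arcg * rep (low f) * arcg = rep (low f)" by (simp add: mult.assoc flip: gel_mult)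
    have "rep (low f) \<in> GA m"
      unfolding GA_def
    proof clarify
      fix \<pi> assume p: "\<pi> \<in> keys (rep (low f))"
      have "lookup (rep (low f)) \<pi> = lookup (arcg * rep (low f) * arcg) \<pi>" by (simp only: e)
      also have "\<dots> = lookup (rep (low f)) (arc r * \<pi> * arc r)" by (simp add: mult.assoc)
      finally have "arc r * \<pi> * arc r \<in> keys (rep (low f))" using p by (simp add: in_keys_iff)
      then have "arc r * \<pi> * arc r \<in> Sym r" using vG by (auto simp: GA_def)
      then have "(arc r * \<pi> * arc r) \<langle>$\<rangle> n = n" by (auto intro: Sym_fix)
      then have "arc r \<langle>$\<rangle> (\<pi> \<langle>$\<rangle> r) = arc r \<langle>$\<rangle> r" by (simp add: apply_times)
      then have "\<pi> \<langle>$\<rangle> r = r" by (simp only: apply_inj)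
      moreover have "\<pi> \<in> Sym r" using vG p by (auto simp: GA_def)
      ultimately show "\<pi> \<in> Sym m" using Sym_Suc_fix by blast
    qed
    then have "f \<in> centre_pairs" using f vc by (simp add: centre_pairs_def Zc_def Zg_def)
    then show "g \<in> (\<lambda>f. Psi r (Om f)) ` centre_pairs" using a(2) f(3) by blast
  next
    fix g assume "g \<in> (\<lambda>f. Psi r (Om f)) ` centre_pairs"
    then obtain f where f: "f \<in> centre_pairs" "g = Psi r (Om f)" by blast
    then have f': "fst f \<in> Zc r" "snd f \<in> Cc m" "low f \<in> Zc m" by (auto simp: centre_pairs_def)
    have OG: "Om f \<in> GA n" by (rule Om_GA[OF f'(1,2)])
    have "star n \<delta> (Om f) (gel \<pi>) = star n \<delta> (gel \<pi>) (Om f)" if p: "\<pi> \<in> Sym n" for \<pi>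
    proof (cases "\<pi> \<in> Sym r")
      case True
      then show ?thesis using centD[OF Om_cent[OF f'(1,2)] True]
        by (simp add: star_upper[OF GA_gel[OF True] OG] star_lower[OF GA_gel[OF True] OG])
    next
      case False
      then obtain \<sigma> \<tau> where st: "\<sigma> \<in> Sym r" "\<tau> \<in> Sym r" "\<pi> = \<sigma> * arc r * \<tau>" using Sym_arc_cases[OF p] by blast
      have "arcg * rep (low f) = rep (low f) * arcg"
        using f'(3) by (intro arc_commute) (simp add: Zc_def Zg_def)
      then show ?thesis unfolding st(3) star_Om[OF f'(1,2) st(1,2)] by simp
    qed
    then show "g \<in> centre ?A" using cen[OF OG] f(2) by blast
  qed
qed

end

section \<open>Evaluation of polynomials\<close>

definition mev :: "(var \<Rightarrow> 'a::comm_ring_1) \<Rightarrow> (var \<Rightarrow>\<^sub>0 nat) \<Rightarrow> 'a" where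
  "mev \<sigma> k = (\<Prod>v\<in>keys k. \<sigma> v ^ lookup k v)"

text \<open>The coefficient map \<open>c\<close> is a parameter, so that substitution of polynomials
  and evaluation in \<open>gz\<close> are instances of the same map.\<close>

definition pev :: "(complex \<Rightarrow> 'a::comm_ring_1) \<Rightarrow> (var \<Rightarrow> 'a) \<Rightarrow> cpoly \<Rightarrow> 'a" where
  "pev c \<sigma> p = (\<Sum>k\<in>keys p. c (lookup p k) * mev \<sigma> k)"

lemma mev_superset: "finite A \<Longrightarrow> keys k \<subseteq> A \<Longrightarrow> mev \<sigma> k = (\<Prod>v\<in>A. \<sigma> v ^ lookup k v)"
  unfolding mev_def by (rule prod.mono_neutral_left) (auto simp: in_keys_iff)

lemma mev_add: "mev \<sigma> (k + l) = mev \<sigma> k * mev \<sigma> l"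
proof -
  let ?A = "keys k \<union> keys l"
  have "keys (k + l) \<subseteq> ?A" by (rule keys_add)
  then show ?thesis
    by (simp add: mev_superset[of ?A] lookup_add power_add prod.distrib)
qed

lemma mev_0 [simp]: "mev \<sigma> 0 = 1" by (simp add: mev_def)
lemma mev_single: "mev \<sigma> (Poly_Mapping.single v e) = \<sigma> v ^ e"
  by (subst mev_superset[of "{v}"]) auto

lemma cpoly_expand: "p = (\<Sum>k\<in>keys p. Poly_Mapping.single k (lookup p k))"
proof (rule poly_mapping_eqI)
  fix l
  have "(\<Sum>k\<in>keys p. lookup (Poly_Mapping.single k (lookup p k)) l) = (\<Sum>k\<in>keys p. if k = l then lookup p l else 0)"
    by (intro sum.cong refl) (auto simp: lookup_single when_def)
  also have "\<dots> = lookup p l" by (simp add: in_keys_iff)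
  finally show "lookup p l = lookup (\<Sum>k\<in>keys p. Poly_Mapping.single k (lookup p k)) l"
    by (simp add: lookup_sum)
qed

lemma Var_power: "Var v ^ e = Poly_Mapping.single (Poly_Mapping.single v e) 1"
  by (induction e) (simp_all add: Var_def mult_single single_add[symmetric])

locale coeff_hom =
  fixes c :: "complex \<Rightarrow> 'a::comm_ring_1"
  assumes c_0: "c 0 = 0" and c_1: "c 1 = 1" and c_add: "c (a + b) = c a + c b" and c_mult: "c (a * b) = c a * c b"
begin

lemma pev_superset: "finite A \<Longrightarrow> keys p \<subseteq> A \<Longrightarrow> pev c \<sigma> p = (\<Sum>k\<in>A. c (lookup p k) * mev \<sigma> k)"
  unfolding pev_def by (rule sum.mono_neutral_left) (auto simp: in_keys_iff c_0)

lemma pev_add: "pev c \<sigma> (p + q) = pev c \<sigma> p + pev c \<sigma> q"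
proof -
  let ?A = "keys p \<union> keys q"
  have "keys (p + q) \<subseteq> ?A" by (rule keys_add)
  then show ?thesis
    by (simp add: pev_superset[of ?A] lookup_add c_add distrib_right sum.distrib)
qed

lemma pev_0 [simp]: "pev c \<sigma> 0 = 0" by (simp add: pev_def)

lemma pev_sum: "pev c \<sigma> (sum f A) = (\<Sum>i\<in>A. pev c \<sigma> (f i))"
  by (induction A rule: infinite_finite_induct) (simp_all add: pev_add)

lemma pev_single: "pev c \<sigma> (Poly_Mapping.single k a) = c a * mev \<sigma> k"
  by (subst pev_superset[of "{k}"]) auto

lemma pev_mult: "pev c \<sigma> (p * q) = pev c \<sigma> p * pev c \<sigma> q"
proof -
  have "pev c \<sigma> ((\<Sum>k\<in>keys p. Poly_Mapping.single k (lookup p k)) * (\<Sum>l\<in>keys q. Poly_Mapping.single l (lookup q l))) =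
      pev c \<sigma> (\<Sum>k\<in>keys p. Poly_Mapping.single k (lookup p k)) * pev c \<sigma> (\<Sum>l\<in>keys q. Poly_Mapping.single l (lookup q l))"
    unfolding sum_product pev_sum
    by (intro sum.cong refl) (simp add: mult_single pev_single mev_add c_mult mult_ac)
  then show ?thesis by (simp flip: cpoly_expand)
qed

lemma pev_1 [simp]: "pev c \<sigma> 1 = 1"
  using pev_single[of \<sigma> 0 1] by (simp add: c_1)

lemma pev_Var [simp]: "pev c \<sigma> (Var v) = \<sigma> v"
  by (simp add: Var_def pev_single mev_single c_1)

lemma pev_power: "pev c \<sigma> (p ^ k) = pev c \<sigma> p ^ k"
  by (induction k) (simp_all add: pev_mult)

lemma pev_uminus: "pev c \<sigma> (- p) = - pev c \<sigma> p"
  using pev_add[of \<sigma> p "- p"] by (simp add: eq_neg_iff_add_eq_0 add.commute)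

lemma pev_prod: "pev c \<sigma> (prod f A) = (\<Prod>i\<in>A. pev c \<sigma> (f i))"
  by (induction A rule: infinite_finite_induct) (simp_all add: pev_mult)

lemma pev_cong: "(\<And>v. v \<in> vars p \<Longrightarrow> \<sigma> v = \<tau> v) \<Longrightarrow> pev c \<sigma> p = pev c \<tau> p"
proof -
  assume e: "\<And>v. v \<in> vars p \<Longrightarrow> \<sigma> v = \<tau> v"
  have "mev \<sigma> k = mev \<tau> k" if "k \<in> keys p" for k
    unfolding mev_def
  proof (rule prod.cong[OF refl])
    fix v assume "v \<in> keys k"
    then have "v \<in> vars p" using that by (auto simp: vars_def)
    then show "\<sigma> v ^ lookup k v = \<tau> v ^ lookup k v" by (simp add: e)
  qed
  then show ?thesis by (simp add: pev_def)
qed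

lemma pev_subst: "pev c \<tau> (subst \<sigma> p) = pev c (\<lambda>v. pev c \<tau> (\<sigma> v)) p"
  unfolding subst_def pev_sum pev_mult pev_prod pev_power pev_single
  by (simp add: pev_def mev_def)

end

lemma coeff_hom_single: "coeff_hom (Poly_Mapping.single (0 :: var \<Rightarrow>\<^sub>0 nat) :: complex \<Rightarrow> cpoly)"
  by unfold_locales (simp_all add: single_add mult_single)

global_interpretation S: coeff_hom "Poly_Mapping.single (0 :: var \<Rightarrow>\<^sub>0 nat) :: complex \<Rightarrow> cpoly"
  by (rule coeff_hom_single)

global_interpretation ZH: coeff_hom cz
  by unfold_locales (simp_all add: cz_add cz_mult)

lemma subst_pev: "subst \<sigma> p = pev (Poly_Mapping.single 0) \<sigma> p"
  by (simp add: subst_def pev_def mev_def)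

lemma mev_Var: "mev (\<lambda>v. Var (f v)) k = Poly_Mapping.single (\<Sum>v\<in>keys k. Poly_Mapping.single (f v) (lookup k v)) 1"
proof -
  have "(\<Prod>v\<in>A. Var (f v) ^ lookup k v) = Poly_Mapping.single (\<Sum>v\<in>A. Poly_Mapping.single (f v) (lookup k v)) 1" if "finite A" for A
    using that by (induction A rule: finite_induct) (simp_all add: Var_power mult_single)
  then show ?thesis by (simp add: mev_def)
qed

section \<open>Renaming of variables\<close>

definition rename :: "(var \<Rightarrow> var) \<Rightarrow> (var \<Rightarrow>\<^sub>0 nat) \<Rightarrow> (var \<Rightarrow>\<^sub>0 nat)" where
  "rename f k = (\<Sum>v\<in>keys k. Poly_Mapping.single (f v) (lookup k v))"

lemma lookup_rename: assumes "\<And>v. f (f v) = v" shows "lookup (rename f k) v = lookup k (f v)"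
proof -
  have "lookup (rename f k) v = (\<Sum>u\<in>keys k. if u = f v then lookup k (f v) else 0)"
    unfolding rename_def lookup_sum using assms
    by (intro sum.cong refl) (auto simp: lookup_single when_def)
  then show ?thesis by (simp add: in_keys_iff)
qed

lemma rename_rename: assumes "\<And>v. f (f v) = v" shows "rename f (rename f k) = k"
  by (rule poly_mapping_eqI) (simp add: lookup_rename[OF assms] assms)

lemma lookup_subst_rename:
  assumes "\<And>v. f (f v) = v" shows "lookup (subst (\<lambda>v. Var (f v)) p) k = lookup p (rename f k)"
proof -
  have "subst (\<lambda>v. Var (f v)) p = (\<Sum>l\<in>keys p. Poly_Mapping.single (rename f l) (lookup p l))"
    unfolding subst_pev pev_def mev_Var rename_def[symmetric] by (simp add: mult_single)
  then have "lookup (subst (\<lambda>v. Var (f v)) p) k = (\<Sum>l\<in>keys p. if l = rename f k then lookup p (rename f k) else 0)"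
    using rename_rename[of f, OF assms]
    by (simp only: lookup_sum, intro sum.cong refl) (auto simp: lookup_single when_def)
  then show ?thesis by (simp add: in_keys_iff)
qed

section \<open>Closure properties and power sums of supersymmetric polynomials\<close>

lemma vars_add: "vars (p + q) \<subseteq> vars p \<union> vars q"
  using keys_add[of p q] by (auto simp: vars_def)

lemma vars_mult: "vars (p * q) \<subseteq> vars p \<union> vars q"
proof
  fix v assume "v \<in> vars (p * q)"
  then obtain k where k: "k \<in> keys (p * q)" "v \<in> keys k" by (auto simp: vars_def)
  then obtain a b where "a \<in> keys p" "b \<in> keys q" "k = a + b" using keys_mult[of p q] by blast
  then show "v \<in> vars p \<union> vars q" using k(2) keys_add[of a b] by (auto simp: vars_def)
qed

lemma vars_const [simp]: "vars (Poly_Mapping.single 0 a) = {}"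
  by (simp add: vars_def)

lemma vars_Var_power: "vars (Poly_Mapping.single (Poly_Mapping.single v e) a) \<subseteq> {v}"
  by (auto simp: vars_def split: if_splits)

lemma vars_sum: "vars (sum f A) \<subseteq> (\<Union>i\<in>A. vars (f i))"
proof (induction A rule: infinite_finite_induct)
  case (insert a A)
  then show ?case using vars_add[of "f a" "sum f A"] by auto
qed (simp_all add: vars_def)

text \<open>The signs are such that the two powers of \<open>t\<close> cancel under the substitution
  of \<open>t\<close> for \<open>X n\<close> and \<open>- t\<close> for \<open>Y 1\<close>.\<close>

definition super_power :: "nat \<Rightarrow> nat \<Rightarrow> cpoly" where
  "super_power n k = (\<Sum>i\<in>{1..n}. Var (X i) ^ k) + Poly_Mapping.single 0 (- 1) * (- Var (Y 1)) ^ k"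

lemma neg_Var_power: "(- Var v) ^ k = Poly_Mapping.single (Poly_Mapping.single v k) ((- 1) ^ k)"
  by (induction k) (simp_all add: Var_def mult_single single_add[symmetric] single_uminus[symmetric])

lemma super_power_eq:
  "super_power n k = (\<Sum>i\<in>{1..n}. Poly_Mapping.single (Poly_Mapping.single (X i) k) 1)
    + Poly_Mapping.single (Poly_Mapping.single (Y 1) k) (- ((- 1) ^ k))"
  by (simp add: super_power_def neg_Var_power Var_power mult_single)

lemma supersymmetric_add:
  assumes "p \<in> supersymmetric k l" "q \<in> supersymmetric k l" shows "p + q \<in> supersymmetric k l"
proof -
  have s: "subst \<sigma> (p + q) = subst \<sigma> p + subst \<sigma> q" for \<sigma> by (simp add: subst_pev S.pev_add)
  let ?\<sigma> = "Var(X k := Var T, Y 1 := - Var T)"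
  have p: "vars p \<subseteq> X ` {1..k} \<union> Y ` {1..l}" "1 \<le> k \<and> 1 \<le> l \<longrightarrow> T \<notin> vars (subst ?\<sigma> p)"
      "vars q \<subseteq> X ` {1..k} \<union> Y ` {1..l}" "1 \<le> k \<and> 1 \<le> l \<longrightarrow> T \<notin> vars (subst ?\<sigma> q)"
    using assms unfolding supersymmetric_def by blast+
  have "vars (p + q) \<subseteq> X ` {1..k} \<union> Y ` {1..l}" using vars_add[of p q] p(1,3) by blast
  moreover have "1 \<le> k \<and> 1 \<le> l \<longrightarrow> T \<notin> vars (subst ?\<sigma> p + subst ?\<sigma> q)"
    using vars_add[of "subst ?\<sigma> p" "subst ?\<sigma> q"] p(2,4) by blast
  ultimately show ?thesis using assms unfolding supersymmetric_def mem_Collect_eq s by simp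
qed

lemma supersymmetric_mult:
  assumes "p \<in> supersymmetric k l" "q \<in> supersymmetric k l" shows "p * q \<in> supersymmetric k l"
proof -
  have s: "subst \<sigma> (p * q) = subst \<sigma> p * subst \<sigma> q" for \<sigma> by (simp add: subst_pev S.pev_mult)
  let ?\<sigma> = "Var(X k := Var T, Y 1 := - Var T)"
  have p: "vars p \<subseteq> X ` {1..k} \<union> Y ` {1..l}" "1 \<le> k \<and> 1 \<le> l \<longrightarrow> T \<notin> vars (subst ?\<sigma> p)"
      "vars q \<subseteq> X ` {1..k} \<union> Y ` {1..l}" "1 \<le> k \<and> 1 \<le> l \<longrightarrow> T \<notin> vars (subst ?\<sigma> q)"
    using assms unfolding supersymmetric_def by blast+
  have "vars (p * q) \<subseteq> X ` {1..k} \<union> Y ` {1..l}" using vars_mult[of p q] p(1,3) by blast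
  moreover have "1 \<le> k \<and> 1 \<le> l \<longrightarrow> T \<notin> vars (subst ?\<sigma> p * subst ?\<sigma> q)"
    using vars_mult[of "subst ?\<sigma> p" "subst ?\<sigma> q"] p(2,4) by blast
  ultimately show ?thesis using assms unfolding supersymmetric_def mem_Collect_eq s by simp
qed

lemma supersymmetric_const: "Poly_Mapping.single 0 a \<in> supersymmetric k l"
  unfolding supersymmetric_def by (simp add: subst_pev S.pev_single)

lemma supersymmetric_super_power: "n \<ge> 1 \<Longrightarrow> super_power n k \<in> supersymmetric n 1"
proof -
  assume n: "n \<ge> 1"
  have v: "vars (super_power n k) \<subseteq> X ` {1..n} \<union> Y ` {1..1}"
  proof -
    have "vars (super_power n k) \<subseteq> (\<Union>i\<in>{1..n}. vars (Poly_Mapping.single (Poly_Mapping.single (X i) k) 1))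
        \<union> vars (Poly_Mapping.single (Poly_Mapping.single (Y 1) k) (- ((- 1) ^ k)))"
      unfolding super_power_eq by (rule order.trans[OF vars_add Un_mono[OF vars_sum order.refl]])
    moreover have "(\<Union>i\<in>{1..n}. vars (Poly_Mapping.single (Poly_Mapping.single (X i) k) 1)) \<subseteq> X ` {1..n}"
    proof (rule UN_least)
      fix i assume "i \<in> {1..n}"
      then show "vars (Poly_Mapping.single (Poly_Mapping.single (X i) k) 1) \<subseteq> X ` {1..n}"
        using vars_Var_power[of "X i" k 1] by blast
    qed
    moreover have "vars (Poly_Mapping.single (Poly_Mapping.single (Y 1) k) (- ((- 1) ^ k))) \<subseteq> Y ` {1..1}"
      using vars_Var_power[of "Y 1" k "- ((- 1) ^ k)"] by simp
    ultimately show ?thesis by blast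
  qed
  have a: "subst (\<lambda>v. case v of X i \<Rightarrow> Var (X (\<pi> i)) | _ \<Rightarrow> Var v) (super_power n k) = super_power n k"
    if p: "\<pi> permutes {1..n}" for \<pi>
  proof -
    have "(\<Sum>i\<in>{1..n}. Var (X (\<pi> i)) ^ k) = (\<Sum>i\<in>{1..n}. Var (X i) ^ k)"
      by (rule sum.reindex_bij_betw[OF permutes_imp_bij[OF p], of "\<lambda>i. Var (X i) ^ k"])
    then show ?thesis
      by (simp add: super_power_def subst_pev S.pev_add S.pev_sum S.pev_power S.pev_mult S.pev_single S.pev_uminus del: sum.cl_ivl_Suc)
  qed
  have b: "subst (\<lambda>v. case v of Y i \<Rightarrow> Var (Y (\<pi> i)) | _ \<Rightarrow> Var v) (super_power n k) = super_power n k"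
    if p: "\<pi> permutes {1..1}" for \<pi>
  proof -
    have "\<pi> 1 = 1" using permutes_in_image[OF p, of 1] by simp
    then show ?thesis
      by (simp add: super_power_def subst_pev S.pev_add S.pev_sum S.pev_power S.pev_mult S.pev_single S.pev_uminus del: sum.cl_ivl_Suc)
  qed
  have c: "T \<notin> vars (subst (Var(X n := Var T, Y 1 := - Var T)) (super_power n k))"
  proof -
    have s: "{1..n} = insert n {1..<n}" using n by auto
    have "subst (Var(X n := Var T, Y 1 := - Var T)) (super_power n k) =
        (\<Sum>i\<in>{1..<n}. Var (X i) ^ k) + Var T ^ k + Poly_Mapping.single 0 (- 1) * Var T ^ k"
      unfolding super_power_def s
      by (simp add: subst_pev S.pev_add S.pev_sum S.pev_power S.pev_mult S.pev_single S.pev_uminus add.commute)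
    also have "Poly_Mapping.single 0 (- 1) * Var T ^ k = - (Var T ^ k)" by (simp add: single_uminus)
    also have "(\<Sum>i\<in>{1..<n}. Var (X i) ^ k) + Var T ^ k + - (Var T ^ k) = (\<Sum>i\<in>{1..<n}. Var (X i) ^ k)"
      by (simp only: add.assoc right_minus add_0_right)
    finally have e: "subst (Var(X n := Var T, Y 1 := - Var T)) (super_power n k) = (\<Sum>i\<in>{1..<n}. Var (X i) ^ k)" .
    have "T \<notin> vars (Var (X i) ^ k)" for i
      unfolding Var_power using vars_Var_power[of "X i" k 1] by auto
    then show ?thesis unfolding e using vars_sum[of "\<lambda>i. Var (X i) ^ k" "{1..<n}"] by blast
  qed
  show ?thesis unfolding supersymmetric_def using v a b c by blast
qed

section \<open>Values of polynomials in the commutative model\<close>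

context shifted
begin

definition Lmon :: "(var \<Rightarrow>\<^sub>0 nat) \<Rightarrow> gz" where
  "Lmon k = (\<Prod>i\<in>{1..r}. Lz i ^ lookup k (X i))"

text \<open>Powers of the pair that stands for the last Jucys-Murphy element,
  \<open>\<delta>\<close> minus the sum of the arcs (\<open>jm_last\<close>).\<close>

primrec ypow :: "nat \<Rightarrow> pair" where
  "ypow 0 = (1, 0)"
| "ypow (Suc k) = pm (ypow k) (cz \<delta>, - 1)"

definition pmul :: "gz \<Rightarrow> pair \<Rightarrow> pair" where "pmul a f = (a * fst f, a * snd f)"

definition Ev :: "cpoly \<Rightarrow> pair" where
  "Ev p = (\<Sum>k\<in>keys p. pmul (cz (lookup p k) * Lmon k) (ypow (lookup k (Y 1))))"

lemma pm_assoc: "pm (pm f g) h = pm f (pm g h)"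
  by (simp add: pm_def prod_eq_iff algebra_simps)
lemma pm_commute: "pm f g = pm g f"
  by (simp add: pm_def prod_eq_iff algebra_simps)
lemma pm_pmul: "pm (pmul a f) (pmul b g) = pmul (a * b) (pm f g)"
  by (simp add: pm_def pmul_def prod_eq_iff algebra_simps)
lemma pm_add_left: "pm (f + f') g = pm f g + pm f' g"
  by (simp add: pm_def prod_eq_iff algebra_simps)
lemma pm_add_right: "pm f (g + g') = pm f g + pm f g'"
  by (simp add: pm_def prod_eq_iff algebra_simps)
lemma pm_sum_left: "pm (sum f A) g = (\<Sum>i\<in>A. pm (f i) g)"
  by (induction A rule: infinite_finite_induct) (simp_all add: pm_add_left, simp_all add: pm_def prod_eq_iff)
lemma pm_sum_right: "pm f (sum g A) = (\<Sum>i\<in>A. pm f (g i))"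
  by (induction A rule: infinite_finite_induct) (simp_all add: pm_add_right, simp_all add: pm_def prod_eq_iff)
lemma pmul_add: "pmul (a + b) f = pmul a f + pmul b f"
  by (simp add: pmul_def prod_eq_iff distrib_right)
lemma pmul_0 [simp]: "pmul 0 f = 0" by (simp add: pmul_def prod_eq_iff)
lemma pmul_sum: "pmul (sum a A) f = (\<Sum>i\<in>A. pmul (a i) f)"
  by (induction A rule: infinite_finite_induct) (simp_all add: pmul_add)
lemma pm_one: "pm (1, 0) f = f" by (simp add: pm_def prod_eq_iff)

lemma ypow_add: "ypow (j + k) = pm (ypow j) (ypow k)"
proof (induction k)
  case 0
  then show ?case by (simp add: pm_commute[of _ "(1, 0)"] pm_one)
qed (simp add: pm_assoc)

lemma Lmon_add: "Lmon (k + l) = Lmon k * Lmon l"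
  by (simp add: Lmon_def lookup_add power_add prod.distrib del: prod.cl_ivl_Suc)

lemma Ev_superset:
  "finite A \<Longrightarrow> keys p \<subseteq> A \<Longrightarrow> Ev p = (\<Sum>k\<in>A. pmul (cz (lookup p k) * Lmon k) (ypow (lookup k (Y 1))))"
  unfolding Ev_def by (rule sum.mono_neutral_left) (auto simp: in_keys_iff)

lemma Ev_add: "Ev (p + q) = Ev p + Ev q"
proof -
  let ?A = "keys p \<union> keys q"
  have "keys (p + q) \<subseteq> ?A" by (rule keys_add)
  then show ?thesis
    by (simp add: Ev_superset[of ?A] lookup_add cz_add distrib_right pmul_add sum.distrib)
qed

lemma Ev_0 [simp]: "Ev 0 = 0" by (simp add: Ev_def)
lemma Ev_sum: "Ev (sum f A) = (\<Sum>i\<in>A. Ev (f i))"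
  by (induction A rule: infinite_finite_induct) (simp_all add: Ev_add)
lemma Ev_single: "Ev (Poly_Mapping.single k a) = pmul (cz a * Lmon k) (ypow (lookup k (Y 1)))"
  by (subst Ev_superset[of "{k}"]) auto

lemma Ev_mult: "Ev (p * q) = pm (Ev p) (Ev q)"
proof -
  have "Ev ((\<Sum>k\<in>keys p. Poly_Mapping.single k (lookup p k)) * (\<Sum>l\<in>keys q. Poly_Mapping.single l (lookup q l))) =
      pm (Ev (\<Sum>k\<in>keys p. Poly_Mapping.single k (lookup p k))) (Ev (\<Sum>l\<in>keys q. Poly_Mapping.single l (lookup q l)))"
    unfolding sum_product Ev_sum pm_sum_left unfolding pm_sum_right
    by (intro sum.cong refl)
       (simp add: mult_single Ev_single pm_pmul Lmon_add lookup_add ypow_add cz_mult mult_ac)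
  then show ?thesis by (simp flip: cpoly_expand)
qed

lemma Lmon_single_X: "i \<in> {1..r} \<Longrightarrow> Lmon (Poly_Mapping.single (X i) k) = Lz i ^ k"
proof -
  assume i: "i \<in> {1..r}"
  have "Lmon (Poly_Mapping.single (X i) k) = (\<Prod>j\<in>{1..r}. if j = i then Lz i ^ k else 1)"
    unfolding Lmon_def by (intro prod.cong refl) (auto simp: lookup_single when_def)
  then show ?thesis using i by simp
qed

lemma Lmon_0 [simp]: "Lmon 0 = 1" by (simp add: Lmon_def)
lemma Lmon_single_Y: "Lmon (Poly_Mapping.single (Y i) k) = 1"
  by (simp add: Lmon_def lookup_single)

lemma fst_ypow: "fst (ypow k) = cz (\<delta> ^ k)"
  by (induction k) (simp_all add: cz_mult mult.commute)

lemma low_ypow: "low (ypow k) = (- Lz r) ^ k"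
proof (induction k)
  case (Suc k)
  have "low (cz \<delta>, - 1) = - Lz r" by (simp add: low_def x_def)
  then show ?case using Suc by (simp add: low_pm mult.commute)
qed (simp add: low_def)

lemma snd_ypow: "snd (ypow (Suc k)) = - cz (\<delta> ^ k) - Lz r * snd (ypow k)"
proof -
  have "low (cz \<delta>, - 1) = - Lz r" by (simp add: low_def x_def)
  then show ?thesis by (simp add: snd_pm fst_ypow mult.commute)
qed

lemma super_psum_snd:
  "cz ((- 1) ^ k) * snd (ypow k) = (\<Sum>i<k. Lz r ^ i * cz ((- \<delta>) ^ (k - Suc i)))"
proof (induction k)
  case (Suc k)
  have "cz ((- 1) ^ Suc k) * snd (ypow (Suc k)) = cz ((- 1) ^ k * \<delta> ^ k) + Lz r * (cz ((- 1) ^ k) * snd (ypow k))"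
    unfolding snd_ypow by (simp add: cz_mult cz_minus algebra_simps)
  also have "(- 1) ^ k * \<delta> ^ k = (- \<delta>) ^ k" by (simp flip: power_mult_distrib)
  also have "Lz r * (cz ((- 1) ^ k) * snd (ypow k)) = (\<Sum>i<k. Lz r ^ Suc i * cz ((- \<delta>) ^ (k - Suc i)))"
    unfolding Suc by (simp add: sum_distrib_left mult.assoc)
  finally show ?case unfolding sum.lessThan_Suc_shift by simp
qed simp

lemma Ev_super_power: assumes "k \<ge> 1" shows "Ev (super_power r k) = super_psum k"
proof -
  have y: "lookup (Poly_Mapping.single (X i) k) (Y 1) = 0" for i by (simp add: lookup_single)
  have "Ev (super_power r k) = (\<Sum>i\<in>{1..r}. (Lz i ^ k, 0)) + pmul (cz (- ((- 1) ^ k))) (ypow k)"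
    unfolding super_power_eq Ev_add Ev_sum Ev_single y
    by (intro arg_cong2[of _ _ _ _ "(+)"] sum.cong refl)
       (simp_all only: Lmon_single_X Lmon_single_Y, simp_all add: pmul_def)
  moreover have "fst (\<Sum>i\<in>{1..r}. (Lz i ^ k, 0 :: gz)) = psz r k" "snd (\<Sum>i\<in>{1..r}. (Lz i ^ k, 0 :: gz)) = 0"
    by (simp_all add: fst_sum snd_sum psz_def)
  moreover have "cz ((- 1) ^ k) * cz (\<delta> ^ k) = cz ((- \<delta>) ^ k)"
    by (simp flip: cz_mult power_mult_distrib)
  ultimately show ?thesis
    using super_psum_snd[of k] by (simp add: super_psum_def prod_eq_iff pmul_def fst_ypow cz_minus del: sum.cl_ivl_Suc)
qed

text \<open>Monomials are grouped by the exponent of \<open>Y 1\<close>: for a polynomial symmetric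
  in the \<open>X i\<close> these coefficients are central, which the value of a single monomial
  need not be.\<close>

definition ycoeff :: "cpoly \<Rightarrow> nat \<Rightarrow> gz" where
  "ycoeff p j = (\<Sum>k\<in>{k\<in>keys p. lookup k (Y 1) = j}. cz (lookup p k) * Lmon k)"

definition ydegs :: "cpoly \<Rightarrow> nat set" where "ydegs p = (\<lambda>k. lookup k (Y 1)) ` keys p"

lemma group_by_ydeg: "(\<Sum>j\<in>ydegs p. \<Sum>k\<in>{k\<in>keys p. lookup k (Y 1) = j}. g k) = (\<Sum>k\<in>keys p. g k)"
  unfolding ydegs_def by (rule sum.image_gen[symmetric]) simp

lemma Ev_ycoeff: "Ev p = (\<Sum>j\<in>ydegs p. pmul (ycoeff p j) (ypow j))"
  unfolding Ev_def group_by_ydeg[symmetric, of _ p] ycoeff_def pmul_sum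
  by (intro sum.cong refl) auto

text \<open>A monomial and its mirror image under the exchange of two neighbouring variables add up
  to the expression of \<open>s_commute_sym\<close> times factors that commute with the
  transposition.\<close>

lemma Lmon_swap_commute:
  assumes i: "1 \<le> i" "i < r"
    and f: "f = (\<lambda>v. case v of X j \<Rightarrow> X (Transposition.transpose i (Suc i) j) | _ \<Rightarrow> v)"
  shows "gel (swap i (Suc i)) * rep (Lmon k + Lmon (rename f k)) = rep (Lmon k + Lmon (rename f k)) * gel (swap i (Suc i))"
proof -
  let ?s = "gel (swap i (Suc i))"
  let ?R = "{1..r} - {i, Suc i}"
  have ff: "f (f v) = v" for v by (cases v) (simp_all add: f)
  have split: "{1..r} = insert i (insert (Suc i) ?R)" using i by auto
  have Lm: "Lmon l = Lz i ^ lookup l (X i) * Lz (Suc i) ^ lookup l (X (Suc i)) * (\<Prod>j\<in>?R. Lz j ^ lookup l (X j))" for l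
    unfolding Lmon_def by (subst split) (simp add: mult.assoc)
  have ren: "lookup (rename f k) (X i) = lookup k (X (Suc i))" "lookup (rename f k) (X (Suc i)) = lookup k (X i)"
    unfolding lookup_rename[of f, OF ff] by (simp_all add: f)
  have renR: "(\<Prod>j\<in>?R. Lz j ^ lookup (rename f k) (X j)) = (\<Prod>j\<in>?R. Lz j ^ lookup k (X j))"
    unfolding lookup_rename[of f, OF ff] by (intro prod.cong refl) (auto simp: f transpose_def)
  define a b where "a = lookup k (X i)" and "b = lookup k (X (Suc i))"
  define R where "R = (\<Prod>j\<in>?R. Lz j ^ lookup k (X j))"
  have e: "Lmon k + Lmon (rename f k) = (Lz i ^ a * Lz (Suc i) ^ b + Lz i ^ b * Lz (Suc i) ^ a) * R"
    unfolding Lm[of k] Lm[of "rename f k"] ren renR a_def[symmetric] b_def[symmetric] R_def[symmetric]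
    by (simp add: distrib_right)
  have "?s * (L i ^ a * L (Suc i) ^ b + L i ^ b * L (Suc i) ^ a) = (L i ^ a * L (Suc i) ^ b + L i ^ b * L (Suc i) ^ a) * ?s"
  proof (rule s_commute_sym)
    show "?s * L i = L (Suc i) * ?s - 1" by (rule s_L[OF i(1)])
    show "?s * L (Suc i) = L i * ?s + 1" using L_s[OF i(1)] by simp
  qed (rule L_commute)
  moreover have "?s * rep R = rep R * ?s"
  proof -
    have "?s * rep (\<Prod>j\<in>A. Lz j ^ lookup k (X j)) = rep (\<Prod>j\<in>A. Lz j ^ lookup k (X j)) * ?s"
      if "finite A" "A \<subseteq> ?R" for A
      using that
    proof (induction A rule: finite_induct)
      case (insert j A)
      have "?s * L j ^ lookup k (X j) = L j ^ lookup k (X j) * ?s"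
        using insert.prems i by (intro commute_power s_L_far) auto
      moreover have "?s * rep (\<Prod>j\<in>A. Lz j ^ lookup k (X j)) = rep (\<Prod>j\<in>A. Lz j ^ lookup k (X j)) * ?s"
        using insert by simp
      ultimately have "?s * (L j ^ lookup k (X j) * rep (\<Prod>j\<in>A. Lz j ^ lookup k (X j)))
          = L j ^ lookup k (X j) * rep (\<Prod>j\<in>A. Lz j ^ lookup k (X j)) * ?s"
        by (intro commute_mult[symmetric]) (simp_all only:)
      then show ?case using insert by simp
    qed simp
    then show ?thesis unfolding R_def by simp
  qed
  ultimately have "?s * ((L i ^ a * L (Suc i) ^ b + L i ^ b * L (Suc i) ^ a) * rep R)
      = (L i ^ a * L (Suc i) ^ b + L i ^ b * L (Suc i) ^ a) * rep R * ?s"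
    by (intro commute_mult[symmetric]) (simp_all only:)
  then show ?thesis unfolding e by simp
qed

lemma ycoeff_Zc:
  assumes sym: "\<And>\<pi>. \<pi> permutes {1..r} \<Longrightarrow> subst (\<lambda>v. case v of X i \<Rightarrow> Var (X (\<pi> i)) | _ \<Rightarrow> Var v) p = p"
  shows "ycoeff p j \<in> Zc r"
proof -
  have "cent r (rep (ycoeff p j))"
  proof (rule cent_generators)
    fix i assume i: "1 \<le> i" "i < r"
    let ?s = "gel (swap i (Suc i))"
    define f where "f = (\<lambda>v. case v of X j \<Rightarrow> X (Transposition.transpose i (Suc i) j) | _ \<Rightarrow> v)"
    have ff: "f (f v) = v" for v by (cases v) (simp_all add: f_def)
    have "Transposition.transpose i (Suc i) permutes {1..r}" using i by (intro permutes_swap_id) auto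
    note sym[OF this]
    moreover have "(\<lambda>v. case v of X j \<Rightarrow> Var (X (Transposition.transpose i (Suc i) j)) | _ \<Rightarrow> Var v) = (\<lambda>v. Var (f v))"
      by (rule ext) (simp add: f_def split: var.split)
    ultimately have "subst (\<lambda>v. Var (f v)) p = p" by simp
    then have pf: "lookup p (rename f k) = lookup p k" for k
      using lookup_subst_rename[of f p k, OF ff] by simp
    let ?K = "{k\<in>keys p. lookup k (Y 1) = j}"
    have b: "bij_betw (rename f) ?K ?K"
    proof (rule bij_betw_byWitness[where f' = "rename f"])
      have "f (Y 1) = Y 1" by (simp add: f_def)
      then show "rename f ` ?K \<subseteq> ?K"
        unfolding image_subset_iff mem_Collect_eq in_keys_iff pf lookup_rename[of f, OF ff] by simp
      then show "rename f ` ?K \<subseteq> ?K" .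
    qed (simp_all add: rename_rename[of f, OF ff])
    have "(\<Sum>k\<in>?K. cz (lookup p k) * Lmon (rename f k)) = (\<Sum>k\<in>?K. cz (lookup p (rename f k)) * Lmon (rename f k))"
      by (simp add: pf)
    also have "\<dots> = ycoeff p j"
      unfolding ycoeff_def by (rule sum.reindex_bij_betw[OF b, of "\<lambda>k. cz (lookup p k) * Lmon k"])
    finally have "ycoeff p j + ycoeff p j = (\<Sum>k\<in>?K. cz (lookup p k) * (Lmon k + Lmon (rename f k)))"
      by (simp add: ycoeff_def distrib_left sum.distrib)
    \<comment> \<open>Twice the coefficient pairs every monomial with its mirror image; the factor
      \<open>2\<close> is divided out at the end.\<close>
    then have two: "cz 2 * ycoeff p j = (\<Sum>k\<in>?K. cz (lookup p k) * (Lmon k + Lmon (rename f k)))"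
      using cz_add[of 1 1] by (simp add: distrib_right)
    have "?s * rep (cz 2 * ycoeff p j) = rep (cz 2 * ycoeff p j) * ?s"
      unfolding two rep_sum sum_distrib_left sum_distrib_right
    proof (rule sum.cong[OF refl])
      fix k
      have "?s * (gsc (lookup p k) * rep (Lmon k + Lmon (rename f k))) = gsc (lookup p k) * rep (Lmon k + Lmon (rename f k)) * ?s"
        unfolding gsc_left_commute[of ?s] Lmon_swap_commute[OF i f_def] by (simp only: mult.assoc)
      then show "?s * rep (cz (lookup p k) * (Lmon k + Lmon (rename f k))) = rep (cz (lookup p k) * (Lmon k + Lmon (rename f k))) * ?s"
        by simp
    qed
    then have "gsc (1 / 2) * (?s * (gsc 2 * rep (ycoeff p j))) = gsc (1 / 2) * (gsc 2 * rep (ycoeff p j) * ?s)" by simp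
    then show "?s * rep (ycoeff p j) = rep (ycoeff p j) * ?s"
      unfolding gsc_left_commute[of ?s] by (simp add: mult.assoc[symmetric] flip: gsc_mult)
  qed
  moreover have "rep (ycoeff p j) \<in> GA r"
  proof -
    have "rep (\<Prod>i\<in>A. Lz i ^ lookup k (X i)) \<in> GA r" if "finite A" "A \<subseteq> {1..r}" for A k
      using that
    proof (induction A rule: finite_induct)
      case (insert i A)
      have "L i ^ lookup k (X i) \<in> GA r" using insert.prems by (intro GA_power GA_mono[OF _ L_GA]) auto
      then show ?case using insert by (simp add: GA_mult)
    qed simp
    then show ?thesis unfolding ycoeff_def rep_sum Lmon_def
      by (intro GA_sum) (simp add: GA_mult del: prod.cl_ivl_Suc)
  qed
  ultimately show ?thesis by (simp add: Zc_def Zg_def)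
qed

lemma snd_ypow_Cc: "snd (ypow k) \<in> Cc m"
proof (induction k)
  case 0
  then show ?case using Z.subspace_0[OF Cc_subspace] by simp
next
  case (Suc k)
  show ?case unfolding snd_ypow
    by (intro Z.subspace_diff[OF Cc_subspace] Z.subspace_neg[OF Cc_subspace] Cc_mult[OF Lz_Cc Suc] Zc_Suc_Cc Zc_cz)
qed

lemma pev_Lmon:
  assumes "vars p \<subseteq> X ` {1..r} \<union> Y ` {1..1}"
  shows "pev cz (\<lambda>v. case v of X i \<Rightarrow> Lz i | Y i \<Rightarrow> w | T \<Rightarrow> t) p = (\<Sum>k\<in>keys p. cz (lookup p k) * Lmon k * w ^ lookup k (Y 1))"
  unfolding pev_def
proof (rule sum.cong[OF refl])
  let ?\<sigma> = "\<lambda>v. case v of X i \<Rightarrow> Lz i | Y i \<Rightarrow> w | T \<Rightarrow> t"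
  fix k assume "k \<in> keys p"
  then have "keys k \<subseteq> X ` {1..r} \<union> Y ` {1..1}" using assms by (auto simp: vars_def)
  moreover have "X ` {1..r} \<inter> Y ` {1..1} = {}" by auto
  ultimately have "mev ?\<sigma> k = (\<Prod>v\<in>X ` {1..r}. ?\<sigma> v ^ lookup k v) * (\<Prod>v\<in>Y ` {1..1}. ?\<sigma> v ^ lookup k v)"
    by (subst mev_superset[of "X ` {1..r} \<union> Y ` {1..1}"]) (simp_all only: prod.union_disjoint finite_imageI finite_atLeastAtMost finite_UnI)
  moreover have "(\<Prod>v\<in>X ` {1..r}. ?\<sigma> v ^ lookup k v) = Lmon k"
    unfolding Lmon_def by (subst prod.reindex) (auto intro: inj_onI simp del: prod.cl_ivl_Suc)
  ultimately have "mev ?\<sigma> k = Lmon k * w ^ lookup k (Y 1)" by simp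
  then show "cz (lookup p k) * mev (\<lambda>v. case v of X i \<Rightarrow> Lz i | Y i \<Rightarrow> w | T \<Rightarrow> t) k
      = cz (lookup p k) * Lmon k * w ^ lookup k (Y 1)" by (simp add: mult.assoc)
qed

lemma pev_GA:
  assumes "\<And>v. v \<in> vars p \<Longrightarrow> rep (\<sigma> v) \<in> GA a"
  shows "rep (pev cz \<sigma> p) \<in> GA a"
proof -
  have *: "rep (\<Prod>v\<in>A. \<sigma> v ^ lookup k v) \<in> GA a" if "finite A" "A \<subseteq> vars p" for A and k :: "var \<Rightarrow>\<^sub>0 nat"
    using that by (induction A rule: finite_induct) (auto intro!: GA_mult GA_power assms)
  have "rep (mev \<sigma> k) \<in> GA a" if "k \<in> keys p" for k
    unfolding mev_def by (rule *[OF finite_keys]) (use that in \<open>auto simp: vars_def\<close>)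
  then show ?thesis unfolding pev_def rep_sum by (intro GA_sum) (auto intro: GA_mult)
qed

lemma low_pmul: "low (pmul a f) = a * low f" by (simp add: low_def pmul_def algebra_simps)

lemma low_Ev: "low (Ev p) = (\<Sum>k\<in>keys p. cz (lookup p k) * Lmon k * (- Lz r) ^ lookup k (Y 1))"
  by (simp add: Ev_def low_sum low_pmul low_ypow)

text \<open>As \<open>T\<close> does not occur after the substitution, it may be replaced by \<open>Lz r\<close> as well as by
  \<open>0\<close>; the first choice gives \<open>low (Ev p)\<close>, the second one only involves the smaller group.\<close>

lemma low_Ev_GA:
  assumes p: "p \<in> supersymmetric r 1" shows "rep (low (Ev p)) \<in> GA m"
proof -
  define \<tau> :: "gz \<Rightarrow> var \<Rightarrow> gz" where "\<tau> t v = (case v of X i \<Rightarrow> Lz i | Y i \<Rightarrow> 0 | T \<Rightarrow> t)" for t v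
  let ?\<sigma> = "Var(X r := Var T, Y 1 := - Var T)"
  have v: "vars p \<subseteq> X ` {1..r} \<union> Y ` {1..1}" and T: "T \<notin> vars (subst ?\<sigma> p)"
    using p by (auto simp: supersymmetric_def)
  have "low (Ev p) = pev cz (\<lambda>v. case v of X i \<Rightarrow> Lz i | Y i \<Rightarrow> - Lz r | T \<Rightarrow> 0) p"
    by (simp add: low_Ev pev_Lmon[OF v])
  also have "\<dots> = pev cz (\<lambda>v. pev cz (\<tau> (Lz r)) (?\<sigma> v)) p"
    by (rule ZH.pev_cong) (use v in \<open>auto simp: \<tau>_def ZH.pev_uminus\<close>)
  also have "\<dots> = pev cz (\<tau> (Lz r)) (subst ?\<sigma> p)" by (rule ZH.pev_subst[symmetric])
  also have "\<dots> = pev cz (\<tau> 0) (subst ?\<sigma> p)"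
    by (rule ZH.pev_cong) (use T in \<open>auto simp: \<tau>_def split: var.splits\<close>)
  also have "\<dots> = pev cz (\<lambda>v. pev cz (\<tau> 0) (?\<sigma> v)) p" by (rule ZH.pev_subst)
  finally have "low (Ev p) = pev cz (\<lambda>v. pev cz (\<tau> 0) (?\<sigma> v)) p" .
  moreover have "rep (pev cz (\<tau> 0) (?\<sigma> v)) \<in> GA m" if "v \<in> vars p" for v
  proof -
    have small: "rep (Lz i) \<in> GA m" if "i \<in> {1..r}" "i \<noteq> r" for i
      using that by (auto intro: GA_mono[OF _ L_GA])
    from v that consider i where "v = X i" "i \<in> {1..r}" | "v = Y 1" by auto
    then show ?thesis
    proof cases
      case (1 i)
      then show ?thesis using small[of i]
        by (cases "i = r") (simp_all add: \<tau>_def)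
    next
      case 2
      then show ?thesis by (simp add: \<tau>_def ZH.pev_uminus)
    qed
  qed
  ultimately show ?thesis using pev_GA by simp
qed

lemma supersymmetric_sym:
  "p \<in> supersymmetric k l \<Longrightarrow> \<pi> permutes {1..k} \<Longrightarrow> subst (\<lambda>v. case v of X i \<Rightarrow> Var (X (\<pi> i)) | _ \<Rightarrow> Var v) p = p"
  by (simp add: supersymmetric_def)

lemma Ev_centre_pairs: assumes p: "p \<in> supersymmetric r 1" shows "Ev p \<in> centre_pairs"
proof -
  have y: "ycoeff p j \<in> Zc r" for j by (rule ycoeff_Zc) (rule supersymmetric_sym[OF p])
  have f: "fst (Ev p) \<in> Zc r"
    unfolding Ev_ycoeff fst_sum pmul_def fst_conv fst_ypow by (intro Zc_sum Zc_mult y Zc_cz)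
  have s: "snd (Ev p) \<in> Cc m"
    unfolding Ev_ycoeff snd_sum pmul_def snd_conv
    by (intro Z.subspace_sum[OF Cc_subspace] Cc_mult snd_ypow_Cc Zc_Suc_Cc y)
  have "low (Ev p) \<in> Cc m"
    unfolding low_def by (intro Z.subspace_add[OF Cc_subspace] Zc_Suc_Cc[OF f] Cc_mult[OF s x_Cc])
  then have "low (Ev p) \<in> Zc m" using low_Ev_GA[OF p] by (simp add: Cc_def Zc_def Zg_def)
  then show ?thesis using f s by (simp add: centre_pairs_def)
qed

lemma Ev_const: "Ev (Poly_Mapping.single 0 a) = pscale a (1, 0)"
  by (simp add: Ev_single pmul_def pscale_def)

lemma supersym_algebra: "supersym_algebra m \<delta> (Ev ` supersymmetric r 1)"
proof unfold_locales
  let ?V = "Ev ` supersymmetric r 1"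
  show "?V \<subseteq> centre_pairs" using Ev_centre_pairs by blast
  have add: "f + g \<in> ?V" if "f \<in> ?V" "g \<in> ?V" for f g
    using that supersymmetric_add by (auto simp flip: Ev_add)
  have mult: "pm f g \<in> ?V" if "f \<in> ?V" "g \<in> ?V" for f g
    using that supersymmetric_mult by (auto simp flip: Ev_mult)
  have const: "pscale a (1, 0) \<in> ?V" for a
    using supersymmetric_const[of a r 1] Ev_const by (metis image_eqI)
  show "P.subspace ?V"
  proof (rule P.subspaceI)
    show "0 \<in> ?V" using const[of 0] by (simp add: pscale_def prod_eq_iff zero_prod_def)
    show "pscale c f \<in> ?V" if "f \<in> ?V" for c f
    proof -
      have "pscale c f = pm (pscale c (1, 0)) f" by (simp add: pscale_def pm_def)
      then show ?thesis using mult[OF const that] by simp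
    qed
  qed (rule add)
  show "pm f g \<in> ?V" if "f \<in> ?V" "g \<in> ?V" for f g by (rule mult[OF that])
  show "(1, 0) \<in> ?V" using const[of 1] by (simp add: pscale_def)
  show "super_psum k \<in> ?V" if "1 \<le> k" for k
    using Ev_super_power[OF that] supersymmetric_super_power[of r k] by (metis image_eqI le_add1 plus_1_eq_Suc)
qed

section \<open>Evaluation at the Jucys-Murphy elements\<close>

lemma jm_small: "1 \<le> k \<Longrightarrow> k \<le> r \<Longrightarrow> jucys_murphy r \<delta> k = Psi r (L k)"
proof -
  assume k: "1 \<le> k" "k \<le> r"
  have "basis_elem (transposition_diagram (r + 1) j k) = Psi r (gel (swap j k))" if j: "j \<in> {1..<k}" for j
  proof -
    have S: "swap j k \<in> Sym n" using j k by (intro Sym_swap) auto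
    have "diag r (swap j k) = transposition_diagram (r + 1) j k"
    proof -
      have s: "{1..Suc r} = insert j (insert k ({1..Suc r} - {j, k}))" using j k by auto
      have a: "{{Top l, Bot l} | l. l \<in> {1..r + 1} - {j, k}} = (\<lambda>l. {Top l, Bot l}) ` ({1..Suc r} - {j, k})"
        by (auto simp: Setcompr_eq_image)
      have b: "(\<lambda>i. {btm r i, tp r (swap j k \<langle>$\<rangle> i)}) ` ({1..Suc r} - {j, k}) = (\<lambda>l. {Top l, Bot l}) ` ({1..Suc r} - {j, k})"
      proof (rule image_cong[OF refl])
        fix i assume "i \<in> {1..Suc r} - {j, k}"
        then have "swap j k \<langle>$\<rangle> i = i" by simp
        then show "{btm r i, tp r (swap j k \<langle>$\<rangle> i)} = {Top i, Bot i}" by (simp add: btm_def tp_def insert_commute)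
      qed
      have c: "btm r j = Bot j" "btm r k = Bot k" "tp r j = Top j" "tp r k = Top k"
        using j k by (simp_all add: btm_def tp_def)
      have d: "swap j k \<langle>$\<rangle> j = k" "swap j k \<langle>$\<rangle> k = j" by simp_all
      have "diag r (swap j k) = insert {btm r j, tp r (swap j k \<langle>$\<rangle> j)} (insert {btm r k, tp r (swap j k \<langle>$\<rangle> k)}
          ((\<lambda>i. {btm r i, tp r (swap j k \<langle>$\<rangle> i)}) ` ({1..Suc r} - {j, k})))"
        unfolding diag_def by (subst s) (simp only: image_insert)
      then show ?thesis unfolding transposition_diagram_def a b c d
        by (simp only: insert_commute[of "Bot j"] insert_commute[of "Bot k"] insert_commute[of "{Top k, Bot j}"] Un_insert_left Un_empty_left)
    qed
    then show ?thesis using Psi_gel[OF S] by simp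
  qed
  then show ?thesis using k(2) unfolding jucys_murphy_def L_def Psi_sum by (simp del: sum.op_ivl_Suc)
qed

lemma diag_arc: "j \<in> {1..r} \<Longrightarrow> diag r (swap j n) = arc_diagram (r + 1) j (r + 1)"
proof -
  assume j: "j \<in> {1..r}"
  have s: "{1..Suc r} = insert j (insert n ({1..r} - {j}))" using j by auto
  have a: "(\<lambda>i. {btm r i, tp r (swap j n \<langle>$\<rangle> i)}) ` ({1..r} - {j}) = {{Top l, Bot l} | l. l \<in> {1..r} - {j}}"
    using j by (auto simp: btm_def tp_def insert_commute image_iff)
  have b: "{1..r + 1} - {j, r + 1} = {1..r} - {j}" by auto
  have c: "btm r j = Bot j" "tp r j = Top j" "btm r n = Top n" "tp r n = Bot n" using j by (auto simp: btm_def tp_def)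
  show ?thesis unfolding diag_def arc_diagram_def b unfolding s image_insert a
    by (simp only: c apply_swap_simp) (auto simp: insert_commute)
qed

lemma diag_1: "diag r 1 = id_diagram (r + 1)"
proof -
  have "{btm r i, tp r i} = {Top i, Bot i}" for i by (auto simp: btm_def tp_def)
  then show ?thesis unfolding diag_def id_diagram_def by (auto simp: image_iff)
qed

lemma Tr_arc: "Tr r arcg = (\<Sum>j\<in>{1..r}. gel (swap j n))"
  unfolding Tr_def
proof (rule sum.cong[OF refl])
  fix j assume j: "j \<in> {1..r}"
  have "swap j r * arc r * inverse (swap j r) = swap (swap j r \<langle>$\<rangle> r) (swap j r \<langle>$\<rangle> n)"
    unfolding arc_def by (rule swap_conj)
  then have "swap j r * arc r * swap j r = swap j n" using j by simp
  then show "gel (swap j r) * arcg * gel (swap j r) = gel (swap j n)" by (simp flip: gel_mult)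
qed

lemma jm_last: "jucys_murphy r \<delta> (Suc r) = Psi r (Om (cz \<delta>, - 1))"
proof -
  have "basis_elem (arc_diagram (r + 1) j (r + 1)) = Psi r (gel (swap j n))" if j: "j \<in> {1..r}" for j
  proof -
    have "swap j n \<in> Sym n" using j by (intro Sym_swap) auto
    then show ?thesis using Psi_gel[of "swap j n" r] diag_arc[OF j] by simp
  qed
  then have "(\<Sum>j\<in>{1..r}. basis_elem (arc_diagram (r + 1) j (r + 1))) = Psi r (Tr r arcg)"
    unfolding Tr_arc Psi_sum by (intro sum.cong refl)
  moreover have "scale \<delta> (basis_elem (id_diagram (r + 1))) = Psi r (gsc \<delta>)"
    using Psi_gel[of 1 r] Psi_gsc[of r \<delta> 1] by (simp add: diag_1)
  moreover have "Om (cz \<delta>, - 1) = gsc \<delta> + - Tr r arcg" by (simp add: Om_def Tr_uminus)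
  ultimately show ?thesis
    by (simp only: jucys_murphy_def Psi_add Psi_uminus if_False Suc_n_not_le_n, simp)
qed

lemma walled_mult: "Psi r a \<otimes>\<^bsub>walled_brauer r 1 \<delta>\<^esub> Psi r b = Psi r (star n \<delta> a b)"
  by (simp add: walled_brauer_def wb_mult_Psi)

lemma walled_one: "\<one>\<^bsub>walled_brauer r 1 \<delta>\<^esub> = Psi r 1"
  using Psi_gel[of 1 r] by (simp add: walled_brauer_def diag_1)

lemma walled_pow: "y [^]\<^bsub>walled_brauer r 1 \<delta>\<^esub> (0::nat) = Psi r 1"
  "y [^]\<^bsub>walled_brauer r 1 \<delta>\<^esub> Suc k = (y [^]\<^bsub>walled_brauer r 1 \<delta>\<^esub> k) \<otimes>\<^bsub>walled_brauer r 1 \<delta>\<^esub> y"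
  unfolding walled_one[symmetric] by (simp_all add: nat_pow_def)

lemma pow_small: "a \<in> GA r \<Longrightarrow> Psi r a [^]\<^bsub>walled_brauer r 1 \<delta>\<^esub> (k::nat) = Psi r (a ^ k)"
proof (induction k)
  case (Suc k)
  then show ?case
    by (simp only: walled_pow walled_mult star_lower[OF Suc.prems GA_mono[OF le_SucI[OF order.refl] GA_power[OF Suc.prems]]] power_Suc2)
qed (simp only: walled_pow power_0)

lemma ypow_Cc: "fst (ypow k) \<in> Zc r" "snd (ypow k) \<in> Cc m"
  by (simp_all add: fst_ypow Zc_cz snd_ypow_Cc)

text \<open>The scalar part of the last element acts by \<open>\<delta>\<close>, its arc part
  through \<open>low f\<close> by \<open>star_Om\<close>; together this is the multiplication rule
  \<open>pm\<close>.\<close>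

lemma star_last:
  assumes f: "fst f \<in> Zc r" "snd f \<in> Cc m"
  shows "star n \<delta> (Om f) (Om (cz \<delta>, - 1)) = Om (pm f (cz \<delta>, - 1))"
proof -
  have OG: "Om f \<in> GA n" by (rule Om_GA[OF f])
  have lC: "low f \<in> Cc m"
    unfolding low_def by (intro Z.subspace_add[OF Cc_subspace] Zc_Suc_Cc[OF f(1)] Cc_mult[OF f(2) x_Cc])
  have "star n \<delta> (Om f) (gel (swap j n)) = gel (swap j r) * (rep (low f) * arcg) * gel (swap j r)" if j: "j \<in> {1..r}" for j
  proof -
    have "swap j r * arc r * inverse (swap j r) = swap (swap j r \<langle>$\<rangle> r) (swap j r \<langle>$\<rangle> n)"
      unfolding arc_def by (rule swap_conj)
    then have e: "swap j n = swap j r * arc r * swap j r" using j by simp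
    have S: "swap j r \<in> Sym r" using j by (intro Sym_swap) auto
    show ?thesis unfolding e by (rule star_Om(2)[OF f S S])
  qed
  then have "star n \<delta> (Om f) (Tr r arcg) = Tr r (rep (low f) * arcg)"
    unfolding Tr_arc star_sum_right unfolding Tr_def by (intro sum.cong refl)
  also have "\<dots> = Tr r (arcg * rep (low f))" using Tr_arc_JM[OF lC] by simp
  finally have 1: "star n \<delta> (Om f) (Tr r arcg) = Tr r (arcg * rep (low f))" .
  have "Om (cz \<delta>, - 1) = gsc \<delta> + gsc (- 1) * Tr r arcg" by (simp add: Om_def Tr_uminus gsc_minus)
  then have "star n \<delta> (Om f) (Om (cz \<delta>, - 1)) = Om f * gsc \<delta> + gsc (- 1) * Tr r (arcg * rep (low f))"
    by (simp only: star_add_right star_gsc_right 1 star_lower[OF GA_gsc OG])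
  also have "\<dots> = gsc \<delta> * Om f + Tr r (arcg * (- rep (low f)))"
    by (simp add: gsc_commute gsc_minus Tr_uminus)
  also have "\<dots> = Om (cz \<delta> * fst f, cz \<delta> * snd f - low f)"
    by (simp add: Om_def distrib_left right_diff_distrib gsc_left_commute[of arcg] Tr_gsc Tr_add[of r _ "- _", simplified] Tr_uminus)
  also have "(cz \<delta> * fst f, cz \<delta> * snd f - low f) = pm f (cz \<delta>, - 1)"
    by (simp add: pm_def low_def algebra_simps)
  finally show ?thesis .
qed

lemma pow_last: "Psi r (Om (cz \<delta>, - 1)) [^]\<^bsub>walled_brauer r 1 \<delta>\<^esub> (k::nat) = Psi r (Om (ypow k))"
proof (induction k)
  case 0
  have "Om (1, 0) = 1" by (simp add: Om_def)
  then show ?case by (simp only: walled_pow ypow.simps)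
next
  case (Suc k)
  then show ?case by (simp only: walled_pow walled_mult star_last[OF ypow_Cc] ypow.simps)
qed

lemma jm_monomial_eq: "jm_monomial r \<delta> k = Psi r (rep (Lmon k) * Om (ypow (lookup k (Y 1))))"
proof -
  let ?B = "walled_brauer r 1 \<delta>"
  let ?g = "\<lambda>i a. (jucys_murphy r \<delta> i [^]\<^bsub>?B\<^esub> lookup k (if i \<le> r then X i else Y 1)) \<otimes>\<^bsub>?B\<^esub> a"
  let ?y = "Om (ypow (lookup k (Y 1)))"
  have yG: "?y \<in> GA n" by (rule Om_GA[OF ypow_Cc])
  \<comment> \<open>The factor with index \<open>r + 1\<close> is split off first. It stands
    rightmost, and all other factors lie in \<open>GA r\<close> and multiply from the left by
    convolution.\<close>
  have "[1..<r + 2] = [1..<Suc r] @ [Suc r]" by (simp add: upt_Suc)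
  then have "jm_monomial r \<delta> k = foldr ?g [1..<Suc r] (?g (Suc r) \<one>\<^bsub>?B\<^esub>)"
    unfolding jm_monomial_def Let_def by (simp only: foldr_append foldr.simps comp_apply id_apply)
  also have "?g (Suc r) \<one>\<^bsub>?B\<^esub> = Psi r ?y"
    by (simp only: Suc_n_not_le_n if_False jm_last pow_last walled_one walled_mult star_lower[OF GA_1 yG] mult_1_right)
  also have fold: "foldr ?g xs (Psi r ?y) = Psi r (rep (prod_list (map (\<lambda>i. Lz i ^ lookup k (X i)) xs)) * ?y)"
    if "set xs \<subseteq> {1..r}" for xs
    using that
  proof (induction xs)
    case (Cons i xs)
    let ?p = "prod_list (map (\<lambda>i. Lz i ^ lookup k (X i)) xs)"
    have i: "1 \<le> i" "i \<le> r" using Cons.prems by auto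
    have LG: "L i \<in> GA r" using i by (auto intro: GA_mono[OF _ L_GA])
    have pG: "rep (prod_list (map (\<lambda>i. Lz i ^ lookup k (X i)) ys)) \<in> GA r" if "set ys \<subseteq> {1..r}" for ys
      using that by (induction ys) (auto intro!: GA_mult GA_power intro: GA_mono[OF _ L_GA])
    have G: "rep ?p * ?y \<in> GA n" using pG[of xs] Cons.prems yG by (intro GA_mult) (auto intro: GA_mono[of r n])
    have "foldr ?g (i # xs) (Psi r ?y) = ?g i (Psi r (rep ?p * ?y))" using Cons by simp
    also have "\<dots> = Psi r (L i ^ lookup k (X i) * (rep ?p * ?y))"
      using i by (simp only: if_True jm_small pow_small[OF LG] walled_mult star_upper[OF GA_power[OF LG] G])
    finally show ?case by (simp add: mult.assoc)
  qed simp
  have "foldr ?g [1..<Suc r] (Psi r ?y) = Psi r (rep (prod_list (map (\<lambda>i. Lz i ^ lookup k (X i)) [1..<Suc r])) * ?y)"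
    by (rule fold) (simp only: set_upt atLeastLessThanSuc_atLeastAtMost order.refl)
  also have "prod_list (map (\<lambda>i. Lz i ^ lookup k (X i)) [1..<Suc r]) = Lmon k"
    unfolding Lmon_def by (simp add: prod.distinct_set_conv_list[symmetric] atLeastLessThanSuc_atLeastAtMost del: upt_Suc prod.cl_ivl_Suc)
  finally show ?thesis .
qed

text \<open>A central element passes through the transpositions of the relative trace. It is for
  this step that \<open>jm_eval_eq\<close> groups the monomials by powers of
  \<open>Y 1\<close>.\<close>

lemma Om_pmul:
  assumes a: "a \<in> Zc r" and f: "fst f \<in> Zc r" "snd f \<in> Cc m"
  shows "rep a * Om f = Om (pmul a f)"
proof -
  have ac: "cent r (rep a)" using a by (simp add: Zc_def Zg_def)
  have "rep a * Tr r (rep (snd f) * arcg) = Tr r (rep (a * snd f) * arcg)"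
    unfolding Tr_def sum_distrib_left
  proof (rule sum.cong[OF refl])
    fix i assume i: "i \<in> {1..r}"
    have "swap i r \<in> Sym r" using i by (intro Sym_swap) auto
    from centD[OF ac this] show "rep a * (gel (swap i r) * (rep (snd f) * arcg) * gel (swap i r)) =
        gel (swap i r) * (rep (a * snd f) * arcg) * gel (swap i r)"
      by (simp add: mult.assoc[symmetric])
  qed
  then show ?thesis
    unfolding Om_def using Tr_arc_JM[OF f(2)] Tr_arc_JM[OF Cc_mult[OF Zc_Suc_Cc[OF a] f(2)]]
    by (simp add: distrib_left pmul_def)
qed

lemma Om_sum: "Om (sum f A) = (\<Sum>i\<in>A. Om (f i))"
  by (induction A rule: infinite_finite_induct) (simp_all add: Om_add, simp_all add: Om_def)

lemma jm_eval_eq: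
  assumes p: "p \<in> supersymmetric r 1" shows "jm_eval r \<delta> p = Psi r (Om (Ev p))"
proof -
  have y: "ycoeff p j \<in> Zc r" for j by (rule ycoeff_Zc) (rule supersymmetric_sym[OF p])
  have "jm_eval r \<delta> p = (\<Sum>k\<in>keys p. Psi r (gsc (lookup p k) * (rep (Lmon k) * Om (ypow (lookup k (Y 1))))))"
    unfolding jm_eval_def jm_monomial_eq Psi_gsc ..
  also have "\<dots> = (\<Sum>j\<in>ydegs p. \<Sum>k\<in>{k\<in>keys p. lookup k (Y 1) = j}. Psi r (gsc (lookup p k) * (rep (Lmon k) * Om (ypow (lookup k (Y 1))))))"
    by (rule group_by_ydeg[symmetric])
  also have "\<dots> = (\<Sum>j\<in>ydegs p. Psi r (rep (ycoeff p j) * Om (ypow j)))"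
    by (intro sum.cong refl) (simp add: ycoeff_def sum_distrib_right Psi_sum mult.assoc)
  also have "\<dots> = Psi r (Om (Ev p))"
    unfolding Ev_ycoeff Om_sum Psi_sum Om_pmul[OF y ypow_Cc] ..
  finally show ?thesis .
qed

lemma image_eq_centre: "{jm_eval r \<delta> p | p. p \<in> supersymmetric r 1} = (\<lambda>f. Psi r (Om f)) ` centre_pairs"
proof -
  interpret sa: supersym_algebra m \<delta> "Ev ` supersymmetric r 1" by (rule supersym_algebra)
  have "{jm_eval r \<delta> p | p. p \<in> supersymmetric r 1} = (\<lambda>f. Psi r (Om f)) ` Ev ` supersymmetric r 1"
    using jm_eval_eq by (auto simp: image_iff) metis
  then show ?thesis using sa.centre_pairs_structure(1) by simp
qed

lemma dim_centre: "vector_space.dim scale ((\<lambda>f. Psi r (Om f)) ` centre_pairs) = card (Iz r) + card (Iz m)"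
proof -
  interpret W: vector_space scale by (rule vector_space_scale)
  interpret sa: supersym_algebra m \<delta> "Ev ` supersymmetric r 1" by (rule supersym_algebra)
  interpret li: Vector_Spaces.linear pscale scale "\<lambda>f. Psi r (Om f)"
    by unfold_locales (simp_all add: Om_add Psi_add Om_pscale Psi_gsc)
  obtain B where B: "finite B" "B \<subseteq> centre_pairs" "P.independent B" "centre_pairs \<subseteq> P.span B" "card B = card (Iz r) + card (Iz m)"
    using sa.centre_pairs_structure(2) by blast
  have sp: "P.span B = centre_pairs" using B(2,4) P.span_minimal[OF B(2) centre_pairs_subspace] by blast
  have inj: "inj_on (\<lambda>f. Psi r (Om f)) centre_pairs"
  proof (rule inj_onI)
    fix f g assume fg: "f \<in> centre_pairs" "g \<in> centre_pairs" "Psi r (Om f) = Psi r (Om g)"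
    have d: "f - g \<in> centre_pairs" using P.subspace_diff[OF centre_pairs_subspace fg(1,2)] .
    have "Om f \<in> GA n" "Om g \<in> GA n" using fg by (auto simp: centre_pairs_def intro: Om_GA)
    then have e: "Om f = Om g" using Psi_inj fg(3) by blast
    have "Om f = Om (f - g) + Om g" by (simp flip: Om_add)
    then have "Om (f - g) = 0" using e by simp
    moreover have "fst (f - g) \<in> Zc r" "snd (f - g) \<in> Cc m" using d unfolding centre_pairs_def by blast+
    ultimately have "f - g = 0" by (intro Om_zero)
    then show "f = g" by simp
  qed
  have "W.independent ((\<lambda>f. Psi r (Om f)) ` B)"
    using li.independent_inj_on_image[OF B(3)] inj sp by simp
  moreover have "(\<lambda>f. Psi r (Om f)) ` centre_pairs \<subseteq> W.span ((\<lambda>f. Psi r (Om f)) ` B)"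
    using li.span_image[of B] sp by simp
  moreover have "(\<lambda>f. Psi r (Om f)) ` B \<subseteq> (\<lambda>f. Psi r (Om f)) ` centre_pairs" using B(2) by blast
  ultimately have "card ((\<lambda>f. Psi r (Om f)) ` B) = W.dim ((\<lambda>f. Psi r (Om f)) ` centre_pairs)"
    by (intro W.basis_card_eq_dim)
  moreover have "card ((\<lambda>f. Psi r (Om f)) ` B) = card B"
    by (rule card_image) (rule inj_on_subset[OF inj B(2)])
  ultimately show ?thesis using B(5) by simp
qed

end

section \<open>The size of the index set\<close>

lemma partitions_0: "partitions 0 = {[]}"
proof (intro equalityI subsetI)
  fix xs assume "xs \<in> partitions 0"
  then show "xs \<in> {[]}" by (cases xs) (simp_all add: partitions_def)
qed (simp add: partitions_def)

lemma partitions_1: "partitions 1 = {[1]}"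
proof (intro equalityI subsetI)
  fix xs assume xs: "xs \<in> partitions 1"
  then obtain x ys where e: "xs = x # ys" by (cases xs) (auto simp: partitions_def)
  have s: "0 < x" "\<forall>y\<in>set ys. 0 < y" "x + sum_list ys = 1" using xs e by (auto simp: partitions_def)
  then have "x = 1" "sum_list ys = 0" by linarith+
  then have "ys = []" using s(2) by (cases ys) auto
  then show "xs \<in> {[1]}" using e \<open>x = 1\<close> by simp
qed (simp add: partitions_def)

text \<open>For \<open>k = 0\<close> the second partition is \<open>[1]\<close>, for
  \<open>k = 1\<close> it is empty; so the first one runs through the partitions of
  \<open>Suc m\<close> and of \<open>m\<close>.\<close>

lemma card_wb_index: "card (wb_index (Suc m) 1) = card (partitions (Suc m)) + card (partitions m)"
proof -
  have "{0..min (Suc m) 1} = {0, 1}" by auto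
  then have "wb_index (Suc m) 1 = (SIGMA k:{0, 1}. partitions (Suc m - k) \<times> partitions (1 - k))"
    by (simp add: wb_index_def)
  then have "card (wb_index (Suc m) 1) = (\<Sum>k\<in>{0, 1}. card (partitions (Suc m - k) \<times> partitions (1 - k)))"
    by (simp only:) (subst card_SigmaI, auto simp: finite_partitions)
  also have "\<dots> = card (partitions (Suc m) \<times> partitions 1) + card (partitions m \<times> partitions 0)" by simp
  finally show ?thesis by (simp only: partitions_0 partitions_1 card_cartesian_product) simp
qed

theorem theorem5p8:
  fixes r :: nat and \<delta> :: complex
  assumes "r \<ge> 1"
  shows "centre (walled_brauer r 1 \<delta>) = {jm_eval r \<delta> p | p. p \<in> supersymmetric r 1} \<and>
         vector_space.dim scale (centre (walled_brauer r 1 \<delta>)) = card (wb_index r 1)"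
proof -
  obtain m where r: "r = Suc m" using assms by (cases r) auto
  show ?thesis
    unfolding r shifted.image_eq_centre shifted.centre_eq shifted.dim_centre card_wb_index card_Iz by simp
qed

end
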